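(* Let $R$ be a commutative Noetherian ring, $\mathfrak a$ a proper ideal of $R$, and $M$ a finitely generated RCMF $R$-module with respect to $\mathfrak a$. Then $\widehat M$ is an RCMF $\widehat R$-module with respect to $\mathfrak a\widehat R$, where $\widehat{\ }$ denotes $\mathfrak a$-adic completion.
   Context: $H^i_{\mathfrak a}(-)$ denotes local cohomology with respect to $\mathfrak a$ and $\operatorname{cd}(\mathfrak a,M)=\sup\{i\in\mathbb Z\mid H^i_{\mathfrak a}(M)\neq0\}$ (so the zero module has $\operatorname{cd}=-\infty$). Cohomological dimension filtration (cd-filtration): for a finitely generated $R$-module $M$ with $c=\operatorname{cd}(\mathfrak a,M)$, it is the increasing filtration $\{M_i\}_{i=0}^c$ of submodules in which $M_i$ is the largest submodule of $M$ with $\operatorname{cd}(\mathfrak a,M_i)\le i$. Relative Cohen-Macaulay: a finitely generated $R$-module $N$ is relative Cohen-Macaulay with respect to $\mathfrak a$ if there is precisely one $i$ with $H^i_{\mathfrak a}(N)\ne0$ (equivalently $\operatorname{grade}(\mathfrak a,N)=\operatorname{cd}(\mathfrak a,N)$). RCMF (relative Cohen-Macaulay filtered): a finitely generated $R$-module $M$ with cd-filtration $\{M_i\}_{i=0}^c$, $c=\operatorname{cd}(\mathfrak a,M)$, is RCMF with respect to $\mathfrak a$ if for all $1\le i\le c$ the module $M_i/M_{i-1}$ is either zero or relative Cohen-Macaulay with respect to $\mathfrak a$ with $\operatorname{cd}(\mathfrak a,M_i/M_{i-1})=i$. *)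

theory Defs
  imports
    "HOL-Algebra.Ring_Divisibility"
    "HOL-Algebra.Ideal_Product"
    "HOL-Algebra.QuotRing"
    "HOL-Algebra.Module"
    "HOL-Library.Extended_Real"
begin

definition zero_module :: "('a, 'm, 's) module_scheme \<Rightarrow> bool" where
  "zero_module M \<longleftrightarrow> carrier M = {\<zero>\<^bsub>M\<^esub>}"

definition submodule_span ::
    "('a, 'r) ring_scheme \<Rightarrow> ('a, 'm, 's) module_scheme \<Rightarrow> 'm set \<Rightarrow> 'm set" where
  "submodule_span R M S = \<Inter> {N. submodule N R M \<and> S \<subseteq> N}"

definition fin_gen_module ::
    "('a, 'r) ring_scheme \<Rightarrow> ('a, 'm, 's) module_scheme \<Rightarrow> bool" where
  "fin_gen_module R M \<longleftrightarrow>
     module R M \<and> (\<exists>S. finite S \<and> S \<subseteq> carrier M \<and> submodule_span R M S = carrier M)"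

definition ring_as_module :: "('a, 'r) ring_scheme \<Rightarrow> ('a, 'a) module" where
  "ring_as_module R =
     \<lparr>carrier = carrier R, mult = mult R, one = one R, zero = zero R, add = add R,
      smult = mult R\<rparr>"

text \<open>A module record carries irrelevant fields \<^const>\<open>mult\<close> and \<^const>\<open>one\<close>, which the
  locale \<^locale>\<open>module\<close> ignores; they are left undefined below.\<close>

definition quot_module ::
    "('a, 'r) ring_scheme \<Rightarrow> ('a, 'm, 's) module_scheme \<Rightarrow> 'm set \<Rightarrow> ('a, 'm set) module" where
  "quot_module R M N =
     \<lparr>carrier = a_rcosets\<^bsub>M\<^esub> N, mult = undefined, one = undefined, zero = N, add = set_add M,
      smult = (\<lambda>r X. \<Union>x\<in>X. N +>\<^bsub>M\<^esub> (r \<odot>\<^bsub>M\<^esub> x))\<rparr>"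

text \<open>For submodules \<open>N' \<subseteq> N\<close> of \<open>M\<close>, the canonical map \<open>M/N' \<rightarrow> M/N\<close>.\<close>

definition quot_proj ::
    "('a, 'm, 's) module_scheme \<Rightarrow> 'm set \<Rightarrow> 'm set \<Rightarrow> 'm set \<Rightarrow> 'm set" where
  "quot_proj M N' N = (\<lambda>X\<in>a_rcosets\<^bsub>M\<^esub> N'. N <+>\<^bsub>M\<^esub> X)"

definition module_homs ::
    "('a, 'r) ring_scheme \<Rightarrow> ('a, 'm, 's) module_scheme \<Rightarrow> ('a, 'n, 't) module_scheme
      \<Rightarrow> ('m \<Rightarrow> 'n) set" where
  "module_homs R M N =
     {f \<in> carrier M \<rightarrow>\<^sub>E carrier N.
        (\<forall>x\<in>carrier M. \<forall>y\<in>carrier M. f (x \<oplus>\<^bsub>M\<^esub> y) = f x \<oplus>\<^bsub>N\<^esub> f y) \<and>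
        (\<forall>r\<in>carrier R. \<forall>x\<in>carrier M. f (r \<odot>\<^bsub>M\<^esub> x) = r \<odot>\<^bsub>N\<^esub> f x)}"

definition Hom_module ::
    "('a, 'r) ring_scheme \<Rightarrow> ('a, 'm, 's) module_scheme \<Rightarrow> ('a, 'n, 't) module_scheme
      \<Rightarrow> ('a, 'm \<Rightarrow> 'n) module" where
  "Hom_module R M N =
     \<lparr>carrier = module_homs R M N, mult = undefined, one = undefined,
      zero = (\<lambda>x\<in>carrier M. \<zero>\<^bsub>N\<^esub>),
      add = (\<lambda>f g. \<lambda>x\<in>carrier M. f x \<oplus>\<^bsub>N\<^esub> g x),
      smult = (\<lambda>r f. \<lambda>x\<in>carrier M. r \<odot>\<^bsub>N\<^esub> f x)\<rparr>"

definition free_module :: "('a, 'r) ring_scheme \<Rightarrow> nat \<Rightarrow> ('a, nat \<Rightarrow> 'a) module" where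
  "free_module R n =
     \<lparr>carrier = {..<n} \<rightarrow>\<^sub>E carrier R, mult = undefined, one = undefined,
      zero = (\<lambda>j\<in>{..<n}. \<zero>\<^bsub>R\<^esub>),
      add = (\<lambda>x y. \<lambda>j\<in>{..<n}. x j \<oplus>\<^bsub>R\<^esub> y j),
      smult = (\<lambda>r x. \<lambda>j\<in>{..<n}. r \<otimes>\<^bsub>R\<^esub> x j)\<rparr>"

text \<open>Over a Noetherian ring every finitely generated module has a resolution
  \<open>\<dots> \<rightarrow> F\<^sub>1 \<rightarrow> F\<^sub>0 \<rightarrow> N \<rightarrow> 0\<close> by free modules of finite rank. Restricting to such resolutions
  keeps all of them in one type; up to isomorphism Ext does not depend on the
  resolution chosen.\<close>

record ('a, 'n) free_res =
  res_rank :: "nat \<Rightarrow> nat"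
  res_diff :: "nat \<Rightarrow> (nat \<Rightarrow> 'a) \<Rightarrow> (nat \<Rightarrow> 'a)"  \<comment> \<open>\<open>F\<^sub>i\<^sub>+\<^sub>1 \<rightarrow> F\<^sub>i\<close> at index \<open>i\<close>\<close>
  res_aug :: "(nat \<Rightarrow> 'a) \<Rightarrow> 'n"

definition res_module ::
    "('a, 'r) ring_scheme \<Rightarrow> ('a, 'n) free_res \<Rightarrow> nat \<Rightarrow> ('a, nat \<Rightarrow> 'a) module" where
  "res_module R F i = free_module R (res_rank F i)"

definition is_free_resolution ::
    "('a, 'r) ring_scheme \<Rightarrow> ('a, 'n, 't) module_scheme \<Rightarrow> ('a, 'n) free_res \<Rightarrow> bool" where
  "is_free_resolution R N F \<longleftrightarrow>
     (\<forall>i. res_diff F i \<in> module_homs R (res_module R F (Suc i)) (res_module R F i)) \<and>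
     res_aug F \<in> module_homs R (res_module R F 0) N \<and>
     res_aug F ` carrier (res_module R F 0) = carrier N \<and>
     res_diff F 0 ` carrier (res_module R F 1) = a_kernel (res_module R F 0) N (res_aug F) \<and>
     (\<forall>i. res_diff F (Suc i) ` carrier (res_module R F (Suc (Suc i))) =
            a_kernel (res_module R F (Suc i)) (res_module R F i) (res_diff F i))"

definition free_resolution ::
    "('a, 'r) ring_scheme \<Rightarrow> ('a, 'n, 't) module_scheme \<Rightarrow> ('a, 'n) free_res" where
  "free_resolution R N = (SOME F. is_free_resolution R N F)"

definition cochain_module ::
    "('a, 'r) ring_scheme \<Rightarrow> ('a, 'n) free_res \<Rightarrow> ('a, 'm, 's) module_scheme \<Rightarrow> nat
      \<Rightarrow> ('a, (nat \<Rightarrow> 'a) \<Rightarrow> 'm) module" where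
  "cochain_module R F M i = Hom_module R (res_module R F i) M"

definition cochain_diff ::
    "('a, 'r) ring_scheme \<Rightarrow> ('a, 'n) free_res \<Rightarrow> nat
      \<Rightarrow> ((nat \<Rightarrow> 'a) \<Rightarrow> 'm) \<Rightarrow> ((nat \<Rightarrow> 'a) \<Rightarrow> 'm)" where
  "cochain_diff R F i f = compose (carrier (res_module R F (Suc i))) f (res_diff F i)"

definition cocycles ::
    "('a, 'r) ring_scheme \<Rightarrow> ('a, 'n) free_res \<Rightarrow> ('a, 'm, 's) module_scheme \<Rightarrow> nat
      \<Rightarrow> ((nat \<Rightarrow> 'a) \<Rightarrow> 'm) set" where
  "cocycles R F M i =
     a_kernel (cochain_module R F M i) (cochain_module R F M (Suc i)) (cochain_diff R F i)"

fun coboundaries ::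
    "('a, 'r) ring_scheme \<Rightarrow> ('a, 'n) free_res \<Rightarrow> ('a, 'm, 's) module_scheme \<Rightarrow> nat
      \<Rightarrow> ((nat \<Rightarrow> 'a) \<Rightarrow> 'm) set" where
  "coboundaries R F M 0 = {\<zero>\<^bsub>cochain_module R F M 0\<^esub>}"
| "coboundaries R F M (Suc i) = cochain_diff R F i ` carrier (cochain_module R F M i)"

definition Ext_module ::
    "('a, 'r) ring_scheme \<Rightarrow> nat \<Rightarrow> ('a, 'n, 't) module_scheme \<Rightarrow> ('a, 'm, 's) module_scheme
      \<Rightarrow> ('a, ((nat \<Rightarrow> 'a) \<Rightarrow> 'm) set) module" where
  "Ext_module R i N M =
     (let F = free_resolution R N
      in quot_module R ((cochain_module R F M i)\<lparr>carrier := cocycles R F M i\<rparr>)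
           (coboundaries R F M i))"

definition is_chain_lift ::
    "('a, 'r) ring_scheme \<Rightarrow> ('a, 'n') free_res \<Rightarrow> ('a, 'n) free_res \<Rightarrow> ('n' \<Rightarrow> 'n)
      \<Rightarrow> (nat \<Rightarrow> (nat \<Rightarrow> 'a) \<Rightarrow> (nat \<Rightarrow> 'a)) \<Rightarrow> bool" where
  "is_chain_lift R F' F g \<phi> \<longleftrightarrow>
     (\<forall>i. \<phi> i \<in> module_homs R (res_module R F' i) (res_module R F i)) \<and>
     (\<forall>x\<in>carrier (res_module R F' 0). res_aug F (\<phi> 0 x) = g (res_aug F' x)) \<and>
     (\<forall>i. \<forall>x\<in>carrier (res_module R F' (Suc i)).
        res_diff F i (\<phi> (Suc i) x) = \<phi> i (res_diff F' i x))"

text \<open>For a homomorphism \<open>g : N' \<rightarrow> N\<close>, the induced map \<open>Ext\<^sup>i(N, M) \<rightarrow> Ext\<^sup>i(N', M)\<close>; it does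
  not depend on the chain map chosen.\<close>

definition Ext_map ::
    "('a, 'r) ring_scheme \<Rightarrow> nat \<Rightarrow> ('a, 'n', 't') module_scheme \<Rightarrow> ('a, 'n, 't) module_scheme
      \<Rightarrow> ('n' \<Rightarrow> 'n) \<Rightarrow> ('a, 'm, 's) module_scheme
      \<Rightarrow> ((nat \<Rightarrow> 'a) \<Rightarrow> 'm) set \<Rightarrow> ((nat \<Rightarrow> 'a) \<Rightarrow> 'm) set" where
  "Ext_map R i N' N g M =
     (let F' = free_resolution R N'; F = free_resolution R N;
          \<phi> = (SOME \<phi>. is_chain_lift R F' F g \<phi>)
      in (\<lambda>X\<in>carrier (Ext_module R i N M).
            \<Union>f\<in>X. coboundaries R F' M i +>\<^bsub>cochain_module R F' M i\<^esub>
                     compose (carrier (res_module R F' i)) f (\<phi> i)))"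

text \<open>\<open>transition t n k\<close> is the composite \<open>A\<^sub>n \<rightarrow> A\<^sub>n\<^sub>+\<^sub>k\<close> of the maps \<open>t\<^sub>n : A\<^sub>n \<rightarrow> A\<^sub>n\<^sub>+\<^sub>1\<close>.\<close>

fun transition :: "(nat \<Rightarrow> 'x \<Rightarrow> 'x) \<Rightarrow> nat \<Rightarrow> nat \<Rightarrow> 'x \<Rightarrow> 'x" where
  "transition t n 0 x = x"
| "transition t n (Suc k) x = t (n + k) (transition t n k x)"

definition dirlim_rel ::
    "(nat \<Rightarrow> ('a, 'x) module) \<Rightarrow> (nat \<Rightarrow> 'x \<Rightarrow> 'x) \<Rightarrow> ((nat \<times> 'x) \<times> (nat \<times> 'x)) set" where
  "dirlim_rel A t =
     {((n, x), (m, y)). x \<in> carrier (A n) \<and> y \<in> carrier (A m) \<and>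
        (\<exists>k l. n + k = m + l \<and> transition t n k x = transition t m l y)}"

definition dirlim ::
    "(nat \<Rightarrow> ('a, 'x) module) \<Rightarrow> (nat \<Rightarrow> 'x \<Rightarrow> 'x) \<Rightarrow> ('a, (nat \<times> 'x) set) module" where
  "dirlim A t =
     \<lparr>carrier = (SIGMA n:UNIV. carrier (A n)) // dirlim_rel A t,
      mult = undefined, one = undefined,
      zero = dirlim_rel A t `` {(0, \<zero>\<^bsub>A 0\<^esub>)},
      add = (\<lambda>X Y. \<Union>(n, x)\<in>X. \<Union>(m, y)\<in>Y.
               dirlim_rel A t `` {(n + m, transition t n m x \<oplus>\<^bsub>A (n + m)\<^esub> transition t m n y)}),
      smult = (\<lambda>r X. \<Union>(n, x)\<in>X. dirlim_rel A t `` {(n, r \<odot>\<^bsub>A n\<^esub> x)})\<rparr>"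

abbreviation ideal_power :: "('a, 'r) ring_scheme \<Rightarrow> 'a set \<Rightarrow> nat \<Rightarrow> 'a set" where
  "ideal_power R I n \<equiv> I [^]\<^bsub>ideals_set R\<^esub> n"

definition quot_power :: "('a, 'r) ring_scheme \<Rightarrow> 'a set \<Rightarrow> nat \<Rightarrow> ('a, 'a set) module" where
  "quot_power R I n = quot_module R (ring_as_module R) (ideal_power R I n)"

text \<open>Grothendieck's formula: \<open>H\<^sup>i\<^sub>\<aa>(M)\<close> is the direct limit over \<open>n\<close> of \<open>Ext\<^sup>i(R/\<aa>\<^sup>n, M)\<close>,
  along the maps induced by the projections \<open>R/\<aa>\<^sup>n\<^sup>+\<^sup>1 \<rightarrow> R/\<aa>\<^sup>n\<close>.\<close>

definition local_cohomology ::
    "('a, 'r) ring_scheme \<Rightarrow> 'a set \<Rightarrow> nat \<Rightarrow> ('a, 'm, 's) module_scheme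
      \<Rightarrow> ('a, (nat \<times> ((nat \<Rightarrow> 'a) \<Rightarrow> 'm) set) set) module" where
  "local_cohomology R \<aa> i M =
     dirlim (\<lambda>n. Ext_module R i (quot_power R \<aa> n) M)
       (\<lambda>n. Ext_map R i (quot_power R \<aa> (Suc n)) (quot_power R \<aa> n)
          (quot_proj (ring_as_module R) (ideal_power R \<aa> (Suc n)) (ideal_power R \<aa> n)) M)"

text \<open>Local cohomology vanishes in negative degrees, so the supremum may be taken over natural
  numbers; in \<^typ>\<open>ereal\<close> the supremum of the empty set is \<open>-\<infinity>\<close>.\<close>

definition cd ::
    "('a, 'r) ring_scheme \<Rightarrow> 'a set \<Rightarrow> ('a, 'm, 's) module_scheme \<Rightarrow> ereal" where
  "cd R \<aa> M = (SUP i\<in>{i. \<not> zero_module (local_cohomology R \<aa> i M)}. ereal (real i))"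

definition relative_CM ::
    "('a, 'r) ring_scheme \<Rightarrow> 'a set \<Rightarrow> ('a, 'm, 's) module_scheme \<Rightarrow> bool" where
  "relative_CM R \<aa> N \<longleftrightarrow>
     fin_gen_module R N \<and> (\<exists>!i. \<not> zero_module (local_cohomology R \<aa> i N))"

definition is_cd_filtration ::
    "('a, 'r) ring_scheme \<Rightarrow> 'a set \<Rightarrow> ('a, 'm, 's) module_scheme \<Rightarrow> (nat \<Rightarrow> 'm set) \<Rightarrow> bool"
  where
  "is_cd_filtration R \<aa> M F \<longleftrightarrow>
     (\<forall>i. ereal (real i) \<le> cd R \<aa> M \<longrightarrow>
        submodule (F i) R M \<and> cd R \<aa> (M\<lparr>carrier := F i\<rparr>) \<le> ereal (real i) \<and>
        (\<forall>N. submodule N R M \<and> cd R \<aa> (M\<lparr>carrier := N\<rparr>) \<le> ereal (real i) \<longrightarrow> N \<subseteq> F i))"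

text \<open>The cd-filtration is uniquely determined on the indices \<open>0 \<le> i \<le> cd(\<aa>, M)\<close>, the only ones
  that matter.\<close>

definition rcmf ::
    "('a, 'r) ring_scheme \<Rightarrow> 'a set \<Rightarrow> ('a, 'm, 's) module_scheme \<Rightarrow> bool" where
  "rcmf R \<aa> M \<longleftrightarrow>
     fin_gen_module R M \<and>
     (\<exists>F. is_cd_filtration R \<aa> M F \<and>
        (\<forall>i\<ge>1. ereal (real i) \<le> cd R \<aa> M \<longrightarrow>
           (let Q = quot_module R (M\<lparr>carrier := F i\<rparr>) (F (i - 1))
            in zero_module Q \<or> relative_CM R \<aa> Q \<and> cd R \<aa> Q = ereal (real i))))"

definition ideal_smult ::
    "('a, 'r) ring_scheme \<Rightarrow> 'a set \<Rightarrow> ('a, 'm, 's) module_scheme \<Rightarrow> 'm set" where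
  "ideal_smult R I M = submodule_span R M {r \<odot>\<^bsub>M\<^esub> x | r x. r \<in> I \<and> x \<in> carrier M}"

text \<open>The inverse limit of the rings \<open>R/\<aa>\<^sup>n\<close>.\<close>

definition completion_ring ::
    "('a, 'r) ring_scheme \<Rightarrow> 'a set \<Rightarrow> (nat \<Rightarrow> 'a set) ring" where
  "completion_ring R \<aa> =
     (let Q = (\<lambda>n. R Quot (ideal_power R \<aa> n))
      in \<lparr>carrier = {x. \<forall>n. x n \<in> carrier (Q n) \<and>
                      quot_proj (ring_as_module R) (ideal_power R \<aa> (Suc n)) (ideal_power R \<aa> n)
                        (x (Suc n)) = x n},
          mult = (\<lambda>x y n. x n \<otimes>\<^bsub>Q n\<^esub> y n), one = (\<lambda>n. \<one>\<^bsub>Q n\<^esub>),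
          zero = (\<lambda>n. \<zero>\<^bsub>Q n\<^esub>), add = (\<lambda>x y n. x n \<oplus>\<^bsub>Q n\<^esub> y n)\<rparr>)"

definition completion_map :: "('a, 'r) ring_scheme \<Rightarrow> 'a set \<Rightarrow> 'a \<Rightarrow> (nat \<Rightarrow> 'a set)" where
  "completion_map R \<aa> r = (\<lambda>n. ideal_power R \<aa> n +>\<^bsub>R\<^esub> r)"

text \<open>The inverse limit of the modules \<open>M/\<aa>\<^sup>nM\<close>. A coset \<open>c \<in> R/\<aa>\<^sup>n\<close> acts on \<open>M/\<aa>\<^sup>nM\<close> through any
  of its representatives, so the union below is over equal sets.\<close>

definition completion_module ::
    "('a, 'r) ring_scheme \<Rightarrow> 'a set \<Rightarrow> ('a, 'm, 's) module_scheme
      \<Rightarrow> (nat \<Rightarrow> 'a set, nat \<Rightarrow> 'm set) module" where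
  "completion_module R \<aa> M =
     (let S = (\<lambda>n. ideal_smult R (ideal_power R \<aa> n) M); Q = (\<lambda>n. quot_module R M (S n))
      in \<lparr>carrier = {x. \<forall>n. x n \<in> carrier (Q n) \<and>
                      quot_proj M (S (Suc n)) (S n) (x (Suc n)) = x n},
          mult = undefined, one = undefined,
          zero = (\<lambda>n. \<zero>\<^bsub>Q n\<^esub>), add = (\<lambda>x y n. x n \<oplus>\<^bsub>Q n\<^esub> y n),
          smult = (\<lambda>c x n. \<Union>r\<in>c n. r \<odot>\<^bsub>Q n\<^esub> x n)\<rparr>)"

definition extended_ideal :: "('a, 'r) ring_scheme \<Rightarrow> 'a set \<Rightarrow> (nat \<Rightarrow> 'a set) set" where
  "extended_ideal R \<aa> = Idl\<^bsub>completion_ring R \<aa>\<^esub> (completion_map R \<aa> ` \<aa>)"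

end

theory Submission
  imports Defs
begin

text \<open>For submodules \<open>L \<subseteq> N\<close> of \<open>X\<close>, the vanishing of \<open>H\<^sup>k\<^sub>\<aa>(N/L)\<close> means that every cocycle on a free resolution of
  \<open>R/\<aa>\<^sup>n\<close> with values in \<open>N\<close>, modulo \<open>L\<close>, becomes a coboundary on resolutions of \<open>R/\<aa>\<^sup>m\<close> for \<open>m \<ge> n\<close>
  large. A resolution of \<open>R/\<aa>\<^sup>n\<close> stays one after tensoring with the completed ring, and by Artin--Rees a
  cocycle with values in the completion of \<open>M\<close> differs by a coboundary from one with values in
  \<open>M\<close>. So passing from submodules of \<open>M\<close> to their closures in the completion preserves the local
  cohomology of all subquotients, and the closures of the \<open>M\<^sub>i\<close> have the required quotients.

  It remains to see that the closure of \<open>M\<^sub>i\<close> contains every submodule \<open>N\<close> of the completion with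
  \<open>cd(N) \<le> i\<close>, even if \<open>N\<close> is not the closure of a submodule of \<open>M\<close>. If
  \<open>N\<close> lies in the closure \<open>C\<^sub>j\<close> of \<open>M\<^sub>j\<close> for some \<open>j > i\<close>, then \<open>H\<^sup>k(N) = 0\<close> for \<open>k > i\<close> while
  \<open>H\<^sup>k(C\<^sub>j / C\<^sub>j\<^sub>-\<^sub>1) = 0\<close> for \<open>k \<le> i\<close>. Climbing along a resolution with the first property and
  descending with the second gives \<open>N \<subseteq> \<aa>\<^sup>n C\<^sub>j + C\<^sub>j\<^sub>-\<^sub>1\<close> for all \<open>n\<close>, hence \<open>N \<subseteq> C\<^sub>j\<^sub>-\<^sub>1\<close> because the
  completion is separated.\<close>

subsection \<open>Linear maps and submodules\<close>

definition linear_map ::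
    "('a, 'r) ring_scheme => ('a, 'm, 's) module_scheme => ('a, 'n, 't) module_scheme
      => ('m => 'n) => bool" where
  "linear_map R M N f \<longleftrightarrow>
     module R M \<and> module R N \<and>
     (\<forall>x\<in>carrier M. f x \<in> carrier N) \<and>
     (\<forall>x\<in>carrier M. \<forall>y\<in>carrier M. f (x \<oplus>\<^bsub>M\<^esub> y) = f x \<oplus>\<^bsub>N\<^esub> f y) \<and>
     (\<forall>r\<in>carrier R. \<forall>x\<in>carrier M. f (r \<odot>\<^bsub>M\<^esub> x) = r \<odot>\<^bsub>N\<^esub> f x)"

lemma linear_map_module: "linear_map R M N f ==> module R M" "linear_map R M N f ==> module R N"
  and linear_map_closed: "linear_map R M N f ==> x \<in> carrier M ==> f x \<in> carrier N"
  and linear_map_add: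
    "linear_map R M N f ==> x \<in> carrier M ==> y \<in> carrier M ==> f (x \<oplus>\<^bsub>M\<^esub> y) = f x \<oplus>\<^bsub>N\<^esub> f y"
  and linear_map_smult:
    "linear_map R M N f ==> r \<in> carrier R ==> x \<in> carrier M ==> f (r \<odot>\<^bsub>M\<^esub> x) = r \<odot>\<^bsub>N\<^esub> f x"
  by (auto simp: linear_map_def)

lemma linear_map_zero:
  assumes f: "linear_map R M N f"
  shows "f \<zero>\<^bsub>M\<^esub> = \<zero>\<^bsub>N\<^esub>"
proof -
  interpret M: module R M by (rule linear_map_module[OF f])
  interpret N: module R N by (rule linear_map_module[OF f])
  have "f (\<zero>\<^bsub>R\<^esub> \<odot>\<^bsub>M\<^esub> \<zero>\<^bsub>M\<^esub>) = \<zero>\<^bsub>R\<^esub> \<odot>\<^bsub>N\<^esub> f \<zero>\<^bsub>M\<^esub>" by (rule linear_map_smult[OF f]) auto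
  then show ?thesis using linear_map_closed[OF f] by simp
qed

lemma linear_map_uminus:
  fixes R (structure)
  assumes f: "linear_map R M N f" and x: "x \<in> carrier M"
  shows "f (\<ominus>\<^bsub>M\<^esub> x) = \<ominus>\<^bsub>N\<^esub> f x"
proof -
  interpret M: module R M by (rule linear_map_module[OF f])
  interpret N: module R N by (rule linear_map_module[OF f])
  have "\<ominus>\<^bsub>M\<^esub> x = (\<ominus> \<one>) \<odot>\<^bsub>M\<^esub> x" using x by (simp add: M.smult_l_minus)
  also have "f \<dots> = (\<ominus> \<one>) \<odot>\<^bsub>N\<^esub> f x" by (rule linear_map_smult[OF f _ x]) simp
  finally show ?thesis using linear_map_closed[OF f x] by (simp add: N.smult_l_minus)
qed

lemma linear_map_minus:
  assumes f: "linear_map R M N f" and xy: "x \<in> carrier M" "y \<in> carrier M"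
  shows "f (x \<ominus>\<^bsub>M\<^esub> y) = f x \<ominus>\<^bsub>N\<^esub> f y"
proof -
  interpret M: module R M by (rule linear_map_module[OF f])
  show ?thesis using xy by (simp add: a_minus_def linear_map_add[OF f] linear_map_uminus[OF f])
qed

lemma linear_map_comp: "linear_map R A B f ==> linear_map R B C g ==> linear_map R A C (\<lambda>x. g (f x))"
  by (auto simp: linear_map_def)

lemma linear_map_const_zero:
  assumes "module R M" "module R N"
  shows "linear_map R M N (\<lambda>x. \<zero>\<^bsub>N\<^esub>)"
proof -
  interpret N: module R N by fact
  show ?thesis using assms by (simp add: linear_map_def)
qed

lemma linear_map_ident: "module R M ==> linear_map R M M (\<lambda>x. x)"
  by (auto simp: linear_map_def)

lemma linear_map_cong:
  assumes "linear_map R M N f" "\<And>x. x \<in> carrier M ==> f x = g x"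
  shows "linear_map R M N g"
proof -
  interpret M: module R M by (rule linear_map_module[OF assms(1)])
  show ?thesis using assms unfolding linear_map_def by simp
qed

lemma linear_map_fun_add:
  assumes "linear_map R M N f" "linear_map R M N g"
  shows "linear_map R M N (\<lambda>x. f x \<oplus>\<^bsub>N\<^esub> g x)"
proof -
  interpret N: module R N by (rule linear_map_module[OF assms(1)])
  show ?thesis using assms unfolding linear_map_def by (auto simp: N.smult_r_distr N.a_ac)
qed

lemma linear_map_fun_minus:
  assumes "linear_map R M N f" "linear_map R M N g"
  shows "linear_map R M N (\<lambda>x. f x \<ominus>\<^bsub>N\<^esub> g x)"
proof -
  interpret N: module R N by (rule linear_map_module[OF assms(1)])
  show ?thesis using assms unfolding linear_map_def
    by (auto simp: a_minus_def N.smult_r_distr N.smult_r_minus N.minus_add N.a_ac)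
qed

lemma linear_map_fun_smult:
  assumes "linear_map R M N f" "r \<in> carrier R"
  shows "linear_map R M N (\<lambda>x. r \<odot>\<^bsub>N\<^esub> f x)"
proof -
  interpret N: module R N by (rule linear_map_module[OF assms(1)])
  show ?thesis using assms unfolding linear_map_def
    by (auto simp: N.smult_r_distr N.smult_assoc1[symmetric] N.m_comm)
qed

lemma module_ring_as_module:
  assumes "cring R"
  shows "module R (ring_as_module R)"
proof -
  interpret cring R by fact
  have "abelian_group (ring_as_module R)"
    by (rule abelian_groupI) (auto simp: ring_as_module_def a_ac intro: l_neg)
  then show ?thesis
    by (intro moduleI[OF assms]) (auto simp: ring_as_module_def l_distr r_distr m_assoc)
qed

lemma ring_as_module_simps [simp]:
  "carrier (ring_as_module R) = carrier R" "zero (ring_as_module R) = zero R"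
  "add (ring_as_module R) = add R" "smult (ring_as_module R) = mult R"
  by (simp_all add: ring_as_module_def)

lemma a_inv_ring_as_module [simp]: "a_inv (ring_as_module R) = a_inv R"
  by (rule ext) (simp add: a_inv_def m_inv_def)

lemma a_minus_ring_as_module [simp]: "x \<ominus>\<^bsub>ring_as_module R\<^esub> y = x \<ominus>\<^bsub>R\<^esub> y"
  by (simp add: a_minus_def)

lemma linear_map_smult_const:
  assumes f: "linear_map R M (ring_as_module R) f" and N: "module R N" and y: "y \<in> carrier N"
  shows "linear_map R M N (\<lambda>x. f x \<odot>\<^bsub>N\<^esub> y)"
proof -
  interpret N: module R N by fact
  show ?thesis using f N y unfolding linear_map_def by (auto simp: N.smult_l_distr N.smult_assoc1)
qed

lemma submodule_mem_carrier: "submodule N R M ==> x \<in> N ==> x \<in> carrier M"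
  using submodule.axioms(1) subgroup.mem_carrier by fastforce

lemma submodule_zero_mem: "submodule N R M ==> \<zero>\<^bsub>M\<^esub> \<in> N"
  using submodule.axioms(1) subgroup.one_closed by fastforce

lemma submodule_add: "submodule N R M ==> x \<in> N ==> y \<in> N ==> x \<oplus>\<^bsub>M\<^esub> y \<in> N"
  using submodule.axioms(1) subgroup.m_closed by fastforce

lemma submodule_uminus: "submodule N R M ==> x \<in> N ==> \<ominus>\<^bsub>M\<^esub> x \<in> N"
  unfolding a_inv_def using submodule.axioms(1) subgroup.m_inv_closed by fastforce

lemma submodule_minus: "submodule N R M ==> x \<in> N ==> y \<in> N ==> x \<ominus>\<^bsub>M\<^esub> y \<in> N"
  by (simp add: a_minus_def submodule_add submodule_uminus)

lemmas submodule_smult = submodule.smult_closed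

lemma submoduleI_no_inverse:
  fixes M (structure)
  assumes "module R M" "N \<subseteq> carrier M" "\<zero> \<in> N"
    "\<And>x y. x \<in> N ==> y \<in> N ==> x \<oplus> y \<in> N"
    "\<And>r x. r \<in> carrier R ==> x \<in> N ==> r \<odot> x \<in> N"
  shows "submodule N R M"
proof -
  interpret module R M by fact
  have "\<ominus> x \<in> N" if "x \<in> N" for x
  proof -
    have "\<ominus> x = (\<ominus>\<^bsub>R\<^esub> \<one>\<^bsub>R\<^esub>) \<odot> x" using that assms(2) by (auto simp: smult_l_minus)
    then show ?thesis using assms(5) that by simp
  qed
  with assms show ?thesis by (intro submoduleI) auto
qed

lemma submodule_singleton_zero:
  assumes "module R M"
  shows "submodule {\<zero>\<^bsub>M\<^esub>} R M"
proof -
  interpret module R M by fact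
  show ?thesis by (rule submoduleI_no_inverse[OF assms]) auto
qed

lemma submodule_Int:
  "module R M ==> submodule A R M ==> submodule B R M ==> submodule (A \<inter> B) R M"
  by (rule submoduleI_no_inverse)
    (auto intro: submodule_add submodule_zero_mem submodule_smult dest: submodule_mem_carrier)

lemma ideal_iff_submodule:
  assumes "cring R"
  shows "ideal I R \<longleftrightarrow> submodule I R (ring_as_module R)"
proof
  interpret cring R by fact
  assume "ideal I R"
  then interpret I: ideal I R .
  show "submodule I R (ring_as_module R)"
    by (rule submoduleI_no_inverse[OF module_ring_as_module[OF assms]]) (auto intro: I.I_l_closed)
next
  interpret cring R by fact
  assume I: "submodule I R (ring_as_module R)"
  have "subgroup I (add_monoid R)"
    by (rule add.subgroupI) (use submodule_mem_carrier[OF I] submodule_zero_mem[OF I] submodule_add[OF I]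
        submodule_uminus[OF I] in \<open>auto simp: a_inv_def[symmetric]\<close>)
  moreover have "a \<otimes>\<^bsub>R\<^esub> x \<in> I" "x \<otimes>\<^bsub>R\<^esub> a \<in> I" if "a \<in> I" "x \<in> carrier R" for a x
    using submodule_smult[OF I that(2,1)] submodule_mem_carrier[OF I that(1)] m_comm[of a x] that(2) by auto
  ultimately show "ideal I R"
    by (intro idealI) (auto simp: ring_axioms)
qed

lemma submodule_vimage:
  assumes f: "linear_map R M N f" and A: "submodule A R M" and L: "submodule L R N"
  shows "submodule {x \<in> A. f x \<in> L} R M"
  by (rule submoduleI_no_inverse[OF linear_map_module(1)[OF f]])
    (auto simp: linear_map_zero[OF f] linear_map_add[OF f] linear_map_smult[OF f] submodule_mem_carrier[OF A]
      intro: submodule_zero_mem[OF A] submodule_zero_mem[OF L] submodule_add[OF A] submodule_add[OF L]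
        submodule_smult[OF A] submodule_smult[OF L])

lemma submodule_image:
  fixes N (structure)
  assumes f: "linear_map R M N f" and A: "submodule A R M"
  shows "submodule (f ` A) R N"
proof (rule submoduleI_no_inverse[OF linear_map_module(2)[OF f]])
  show "f ` A \<subseteq> carrier N" using linear_map_closed[OF f] submodule_mem_carrier[OF A] by blast
  show "\<zero> \<in> f ` A" using linear_map_zero[OF f] submodule_zero_mem[OF A] by force
  show "x \<oplus> y \<in> f ` A" if xy: "x \<in> f ` A" "y \<in> f ` A" for x y
  proof -
    obtain u v where "u \<in> A" "v \<in> A" "x = f u" "y = f v" using xy by blast
    then have "x \<oplus> y = f (u \<oplus>\<^bsub>M\<^esub> v)" "u \<oplus>\<^bsub>M\<^esub> v \<in> A"
      using linear_map_add[OF f] submodule_mem_carrier[OF A] submodule_add[OF A] by auto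
    then show ?thesis by blast
  qed
  show "r \<odot> x \<in> f ` A" if r: "r \<in> carrier R" and x: "x \<in> f ` A" for r x
  proof -
    obtain u where "u \<in> A" "x = f u" using x by auto
    then have "r \<odot> x = f (r \<odot>\<^bsub>M\<^esub> u)" "r \<odot>\<^bsub>M\<^esub> u \<in> A"
      using linear_map_smult[OF f r] submodule_mem_carrier[OF A] submodule_smult[OF A r] by auto
    then show ?thesis by blast
  qed
qed

lemma set_add_iff: "x \<in> A <+>\<^bsub>M\<^esub> B \<longleftrightarrow> (\<exists>a\<in>A. \<exists>b\<in>B. x = a \<oplus>\<^bsub>M\<^esub> b)"
  by (auto simp: set_add_def')

lemma set_add_mono: "A \<subseteq> A' ==> B \<subseteq> B' ==> A <+>\<^bsub>M\<^esub> B \<subseteq> A' <+>\<^bsub>M\<^esub> B'"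
  by (auto simp: set_add_def')

lemma set_add_subset: "submodule T R M ==> A \<subseteq> T ==> B \<subseteq> T ==> A <+>\<^bsub>M\<^esub> B \<subseteq> T"
  using submodule_add by (fastforce simp: set_add_iff)

lemma submodule_set_add:
  fixes M (structure)
  assumes M: "module R M" and A: "submodule A R M" and B: "submodule B R M"
  shows "submodule (A <+>\<^bsub>M\<^esub> B) R M" "A \<subseteq> A <+>\<^bsub>M\<^esub> B" "B \<subseteq> A <+>\<^bsub>M\<^esub> B"
proof -
  interpret module R M by fact
  note mem = submodule_mem_carrier[OF A] submodule_mem_carrier[OF B]
  show A_sub: "A \<subseteq> A <+>\<^bsub>M\<^esub> B"
  proof
    fix a assume a: "a \<in> A"
    then have "a = a \<oplus> \<zero>" using mem by simp
    then show "a \<in> A <+>\<^bsub>M\<^esub> B" using a submodule_zero_mem[OF B] unfolding set_add_iff by blast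
  qed
  show "B \<subseteq> A <+>\<^bsub>M\<^esub> B"
  proof
    fix b assume b: "b \<in> B"
    then have "b = \<zero> \<oplus> b" using mem by simp
    then show "b \<in> A <+>\<^bsub>M\<^esub> B" using b submodule_zero_mem[OF A] unfolding set_add_iff by blast
  qed
  show "submodule (A <+>\<^bsub>M\<^esub> B) R M"
  proof (rule submoduleI_no_inverse[OF M])
    show "A <+>\<^bsub>M\<^esub> B \<subseteq> carrier M" using mem by (auto simp: set_add_iff)
    show "\<zero> \<in> A <+>\<^bsub>M\<^esub> B" using A_sub submodule_zero_mem[OF A] by blast
  next
    fix x y assume "x \<in> A <+>\<^bsub>M\<^esub> B" "y \<in> A <+>\<^bsub>M\<^esub> B"
    then obtain a b c d where ab: "a \<in> A" "b \<in> B" "c \<in> A" "d \<in> B" "x = a \<oplus> b" "y = c \<oplus> d"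
      unfolding set_add_iff by blast
    then have "x \<oplus> y = (a \<oplus> c) \<oplus> (b \<oplus> d)" by (simp add: mem M.a_ac)
    then show "x \<oplus> y \<in> A <+>\<^bsub>M\<^esub> B" using submodule_add[OF A] submodule_add[OF B] ab unfolding set_add_iff by blast
  next
    fix r x assume r: "r \<in> carrier R" and "x \<in> A <+>\<^bsub>M\<^esub> B"
    then obtain a b where ab: "a \<in> A" "b \<in> B" "x = a \<oplus> b" unfolding set_add_iff by blast
    then have "r \<odot> x = r \<odot> a \<oplus> r \<odot> b" using r by (simp add: mem smult_r_distr)
    then show "r \<odot> x \<in> A <+>\<^bsub>M\<^esub> B" using submodule_smult[OF A r] submodule_smult[OF B r] ab unfolding set_add_iff by blast
  qed
qed

subsection \<open>Congruence modulo a submodule\<close>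

lemma minus_eq_zero_iff:
  assumes "module R M" "x \<in> carrier M" "y \<in> carrier M"
  shows "x \<ominus>\<^bsub>M\<^esub> y = \<zero>\<^bsub>M\<^esub> \<longleftrightarrow> x = y"
proof -
  interpret module R M by fact
  show ?thesis using assms(2,3)
    by (metis M.add.inv_closed M.add.inv_equality M.minus_minus M.r_neg a_minus_def)
qed

lemma minus_cancel:
  fixes M (structure)
  assumes "module R M" "x \<in> carrier M" "y \<in> carrier M"
  shows "(x \<ominus> y) \<oplus> y = x" "y \<oplus> (x \<ominus> y) = x" "x \<ominus> (x \<ominus> y) = y"
    "(x \<oplus> y) \<ominus> y = x" "(y \<oplus> x) \<ominus> y = x"
proof -
  interpret module R M by fact
  show "(x \<ominus> y) \<oplus> y = x" using assms(2,3) by (simp add: a_minus_def M.a_assoc M.l_neg)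
  then show "y \<oplus> (x \<ominus> y) = x" using assms(2,3) by (simp add: M.a_comm)
  show "x \<ominus> (x \<ominus> y) = y" using assms(2,3) by (simp add: a_minus_def M.minus_add M.r_neg2)
  show "(x \<oplus> y) \<ominus> y = x" using assms(2,3) by (simp add: a_minus_def M.a_assoc M.r_neg)
  then show "(y \<oplus> x) \<ominus> y = x" using assms(2,3) by (simp add: M.a_comm)
qed

lemma a_minus_zero:
  assumes "module R M" "x \<in> carrier M"
  shows "x \<ominus>\<^bsub>M\<^esub> \<zero>\<^bsub>M\<^esub> = x"
proof -
  interpret module R M by fact
  show ?thesis using minus_cancel(4)[OF assms M.zero_closed] assms(2) by simp
qed

lemma smult_minus:
  fixes M (structure)
  assumes "module R M" "r \<in> carrier R" "s \<in> carrier R" "x \<in> carrier M" "y \<in> carrier M"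
  shows "r \<odot> (x \<ominus> y) = r \<odot> x \<ominus> r \<odot> y" "(r \<ominus>\<^bsub>R\<^esub> s) \<odot> x = r \<odot> x \<ominus> s \<odot> x"
proof -
  interpret module R M by fact
  show "r \<odot> (x \<ominus> y) = r \<odot> x \<ominus> r \<odot> y" "(r \<ominus>\<^bsub>R\<^esub> s) \<odot> x = r \<odot> x \<ominus> s \<odot> x"
    using assms(2-) by (simp_all add: a_minus_def smult_r_distr smult_r_minus smult_l_distr smult_l_minus)
qed

context
  fixes R :: "('a, 'r) ring_scheme" and M :: "('a, 'm, 's) module_scheme" (structure) and T :: "'m set"
  assumes M: "module R M" and T: "submodule T R M"
begin

interpretation module R M by (rule M)

lemma diff_mem_refl: "x \<in> carrier M ==> x \<ominus> x \<in> T"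
  using minus_eq_zero_iff[OF M, of x x] submodule_zero_mem[OF T] by simp

lemma diff_mem_sym:
  assumes "x \<in> carrier M" "y \<in> carrier M" "x \<ominus> y \<in> T"
  shows "y \<ominus> x \<in> T"
proof -
  have "y \<ominus> x = \<ominus> (x \<ominus> y)" using assms(1,2) by (simp add: a_minus_def M.minus_add M.a_comm)
  then show ?thesis using submodule_uminus[OF T assms(3)] by simp
qed

lemma diff_mem_trans:
  assumes "x \<in> carrier M" "y \<in> carrier M" "z \<in> carrier M" "x \<ominus> y \<in> T" "y \<ominus> z \<in> T"
  shows "x \<ominus> z \<in> T"
proof -
  have "x \<ominus> z = (x \<ominus> y) \<oplus> (y \<ominus> z)" using assms(1-3)
    by (simp add: a_minus_def M.a_assoc M.r_neg1 M.r_neg2)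
  then show ?thesis using submodule_add[OF T assms(4,5)] by simp
qed

lemma diff_mem_add:
  assumes "x \<in> carrier M" "y \<in> carrier M" "x' \<in> carrier M" "y' \<in> carrier M" "x \<ominus> y \<in> T" "x' \<ominus> y' \<in> T"
  shows "(x \<oplus> x') \<ominus> (y \<oplus> y') \<in> T"
proof -
  have "(x \<oplus> x') \<ominus> (y \<oplus> y') = (x \<ominus> y) \<oplus> (x' \<ominus> y')" using assms(1-4)
    by (simp add: a_minus_def M.minus_add M.a_ac)
  then show ?thesis using submodule_add[OF T assms(5,6)] by simp
qed

lemma mem_if_diff_mem:
  assumes "x \<in> carrier M" "y \<in> T" "x \<ominus> y \<in> T"
  shows "x \<in> T"
  using submodule_add[OF T assms(3,2)] minus_cancel(1)[OF M assms(1) submodule_mem_carrier[OF T assms(2)]] by simp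

end

lemma mem_set_add_iff:
  fixes M (structure)
  assumes M: "module R M" and T: "submodule T R M" and L: "submodule L R M" and x: "x \<in> carrier M"
  shows "x \<in> T <+>\<^bsub>M\<^esub> L \<longleftrightarrow> (\<exists>l\<in>L. x \<ominus> l \<in> T)"
proof
  assume "x \<in> T <+>\<^bsub>M\<^esub> L"
  then obtain t l where "t \<in> T" "l \<in> L" "x = t \<oplus> l" unfolding set_add_iff by blast
  then show "\<exists>l\<in>L. x \<ominus> l \<in> T"
    using minus_cancel(4)[OF M submodule_mem_carrier[OF T] submodule_mem_carrier[OF L]] by (intro bexI[of _ l]) simp_all
next
  assume "\<exists>l\<in>L. x \<ominus> l \<in> T"
  then obtain l where l: "l \<in> L" "x \<ominus> l \<in> T" by blast
  have "x = (x \<ominus> l) \<oplus> l" using minus_cancel(1)[OF M x submodule_mem_carrier[OF L l(1)]] by simp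
  then show "x \<in> T <+>\<^bsub>M\<^esub> L" using l unfolding set_add_iff by blast
qed

subsection \<open>Linear combinations and Noetherian modules\<close>

primrec lincomb :: "('a, 'm, 's) module_scheme => (nat => 'm) => (nat => 'a) => nat => 'm" where
  "lincomb M g x 0 = \<zero>\<^bsub>M\<^esub>"
| "lincomb M g x (Suc k) = lincomb M g x k \<oplus>\<^bsub>M\<^esub> x k \<odot>\<^bsub>M\<^esub> g k"

definition lincombs ::
    "('a, 'r) ring_scheme => ('a, 'm, 's) module_scheme => (nat => 'm) => nat => 'm set" where
  "lincombs R M g k = {lincomb M g x k | x. \<forall>i<k. x i \<in> carrier R}"

definition generates ::
    "('a, 'r) ring_scheme => ('a, 'm, 's) module_scheme => 'm set => nat => (nat => 'm) => bool" where
  "generates R M N k g \<longleftrightarrow> (\<forall>i<k. g i \<in> N) \<and> N \<subseteq> lincombs R M g k"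

definition noetherian_module :: "('a, 'r) ring_scheme => ('a, 'm, 's) module_scheme => bool" where
  "noetherian_module R M \<longleftrightarrow> module R M \<and> (\<forall>N. submodule N R M --> (\<exists>k g. generates R M N k g))"

lemma lincomb_cong:
  "(\<And>i. i < k ==> g i = g' i) ==> (\<And>i. i < k ==> x i = x' i) ==> lincomb M g x k = lincomb M g' x' k"
  by (induction k) auto

lemma lincomb_mem:
  assumes N: "submodule N R M" and "\<And>i. i < k ==> g i \<in> N" "\<And>i. i < k ==> x i \<in> carrier R"
  shows "lincomb M g x k \<in> N"
  using assms(2,3)
  by (induction k) (auto intro: submodule_zero_mem[OF N] submodule_add[OF N] submodule_smult[OF N])

lemma lincomb_closed:
  assumes M: "module R M" and "\<And>i. i < k ==> g i \<in> carrier M" "\<And>i. i < k ==> x i \<in> carrier R"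
  shows "lincomb M g x k \<in> carrier M"
  by (rule lincomb_mem[OF module.carrier_is_submodule[OF M] assms(2,3)])

lemma generatesE:
  assumes "generates R M N k g" "y \<in> N"
  obtains x where "\<And>i. i < k ==> x i \<in> carrier R" "y = lincomb M g x k"
  using assms unfolding generates_def lincombs_def by blast

context
  fixes R :: "('a, 'r) ring_scheme" and M :: "('a, 'm, 's) module_scheme" (structure) and k :: nat and g :: "nat => 'm"
  assumes M: "module R M" and g: "\<And>i. i < k ==> g i \<in> carrier M"
begin

interpretation module R M by (rule M)

lemma lincomb_add_coeff:
  assumes "\<And>i. i < k ==> x i \<in> carrier R" "\<And>i. i < k ==> y i \<in> carrier R"
  shows "lincomb M g (\<lambda>i. x i \<oplus>\<^bsub>R\<^esub> y i) k = lincomb M g x k \<oplus> lincomb M g y k"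
  using g assms by (induction k) (simp_all add: smult_l_distr lincomb_closed[OF M] M.a_ac)

lemma lincomb_add_gens:
  assumes "\<And>i. i < k ==> h i \<in> carrier M" "\<And>i. i < k ==> x i \<in> carrier R"
  shows "lincomb M (\<lambda>i. g i \<oplus> h i) x k = lincomb M g x k \<oplus> lincomb M h x k"
  using g assms by (induction k) (simp_all add: smult_r_distr lincomb_closed[OF M] M.a_ac)

lemma lincomb_smult_coeff:
  assumes "\<And>i. i < k ==> x i \<in> carrier R" "r \<in> carrier R"
  shows "lincomb M g (\<lambda>i. r \<otimes>\<^bsub>R\<^esub> x i) k = r \<odot> lincomb M g x k"
  using g assms by (induction k) (simp_all add: smult_r_distr smult_assoc1 lincomb_closed[OF M])

lemma lincomb_zero_coeff: "lincomb M g (\<lambda>i. \<zero>\<^bsub>R\<^esub>) k = \<zero>"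
  using g by (induction k) simp_all

lemma lincomb_unit:
  assumes j: "j < k" and x: "\<And>i. i < k ==> x i = (if i = j then \<one>\<^bsub>R\<^esub> else \<zero>\<^bsub>R\<^esub>)"
  shows "lincomb M g x k = g j"
proof -
  have "lincomb M g (\<lambda>i. if i = j then \<one>\<^bsub>R\<^esub> else \<zero>\<^bsub>R\<^esub>) k = (if j < k then g j else \<zero>)"
    using g by (induction k) (auto simp: less_Suc_eq)
  then show ?thesis using j lincomb_cong[of k g g x "\<lambda>i. if i = j then \<one>\<^bsub>R\<^esub> else \<zero>\<^bsub>R\<^esub>" M] x by auto
qed

lemma lincomb_append:
  assumes x: "\<And>i. i < k ==> x i \<in> carrier R"
    and h: "\<And>i. i < l ==> h i \<in> carrier M" and y: "\<And>i. i < l ==> y i \<in> carrier R"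
  shows "lincomb M (\<lambda>i. if i < k then g i else h (i - k)) (\<lambda>i. if i < k then x i else y (i - k)) (k + l)
    = lincomb M g x k \<oplus> lincomb M h y l"
  using h y
proof (induction l)
  case 0
  show ?case using lincomb_closed[OF M g x] by (auto intro: trans[OF lincomb_cong])
next
  case (Suc l)
  then show ?case using lincomb_closed[OF M g x] lincomb_closed[OF M, of l h y]
    by (simp add: M.a_assoc)
qed

lemma generator_mem_lincombs: "j < k ==> g j \<in> lincombs R M g k"
  unfolding lincombs_def
  using lincomb_unit[of j "\<lambda>i. if i = j then \<one>\<^bsub>R\<^esub> else \<zero>\<^bsub>R\<^esub>"]
  by (auto intro!: exI[of _ "\<lambda>i. if i = j then \<one>\<^bsub>R\<^esub> else \<zero>\<^bsub>R\<^esub>"])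

lemma submodule_lincombs: "submodule (lincombs R M g k) R M"
  unfolding lincombs_def
proof (rule submoduleI_no_inverse[OF M])
  show "{lincomb M g x k | x. \<forall>i<k. x i \<in> carrier R} \<subseteq> carrier M" using lincomb_closed[OF M g] by auto
  show "\<zero> \<in> {lincomb M g x k | x. \<forall>i<k. x i \<in> carrier R}"
    using lincomb_zero_coeff by (auto intro!: exI[of _ "\<lambda>i. \<zero>\<^bsub>R\<^esub>"])
next
  fix u v assume "u \<in> {lincomb M g x k | x. \<forall>i<k. x i \<in> carrier R}" "v \<in> {lincomb M g x k | x. \<forall>i<k. x i \<in> carrier R}"
  then obtain x y where "\<forall>i<k. x i \<in> carrier R" "\<forall>i<k. y i \<in> carrier R" "u = lincomb M g x k" "v = lincomb M g y k"
    by auto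
  then show "u \<oplus> v \<in> {lincomb M g x k | x. \<forall>i<k. x i \<in> carrier R}"
    using lincomb_add_coeff[of x y] by (auto intro!: exI[of _ "\<lambda>i. x i \<oplus>\<^bsub>R\<^esub> y i"])
next
  fix r u assume r: "r \<in> carrier R" and "u \<in> {lincomb M g x k | x. \<forall>i<k. x i \<in> carrier R}"
  then obtain x where "\<forall>i<k. x i \<in> carrier R" "u = lincomb M g x k" by auto
  then show "r \<odot> u \<in> {lincomb M g x k | x. \<forall>i<k. x i \<in> carrier R}"
    using r lincomb_smult_coeff[of x r] by (auto intro!: exI[of _ "\<lambda>i. r \<otimes>\<^bsub>R\<^esub> x i"])
qed

end

lemma linear_map_image_lincomb:
  assumes f: "linear_map R M N f" and "\<And>i. i < k ==> g i \<in> carrier M" "\<And>i. i < k ==> x i \<in> carrier R"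
  shows "f (lincomb M g x k) = lincomb N (\<lambda>i. f (g i)) x k"
  using assms(2,3)
proof (induction k)
  case 0
  show ?case by (simp add: linear_map_zero[OF f])
next
  case (Suc k)
  interpret M: module R M by (rule linear_map_module[OF f])
  show ?case using Suc
    by (simp add: linear_map_add[OF f] linear_map_smult[OF f] lincomb_closed[OF linear_map_module(1)[OF f]])
qed

lemma lincomb_smult_right:
  assumes X: "module R X" and y: "y \<in> carrier X" and "\<And>i. i < k ==> a i \<in> carrier R" "\<And>i. i < k ==> c i \<in> carrier R"
  shows "lincomb (ring_as_module R) a c k \<odot>\<^bsub>X\<^esub> y = lincomb X (\<lambda>i. a i \<odot>\<^bsub>X\<^esub> y) c k"
proof -
  interpret module R X by fact
  note RR = module_ring_as_module[OF is_cring]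
  show ?thesis
    using linear_map_image_lincomb[OF linear_map_smult_const[OF linear_map_ident[OF RR] X y], of k a c] assms(3,4) by simp
qed

lemma fin_gen_moduleD: "fin_gen_module R M ==> module R M"
  by (simp add: fin_gen_module_def)

lemma fin_gen_module_iff:
  assumes M: "module R M"
  shows "fin_gen_module R M \<longleftrightarrow> (\<exists>k g. generates R M (carrier M) k g)"
proof
  assume "fin_gen_module R M"
  then obtain A where A: "finite A" "A \<subseteq> carrier M" "submodule_span R M A = carrier M"
    by (auto simp: fin_gen_module_def)
  obtain k and g :: "nat => 'c" where kg: "A = g ` {i. i < k}"
    using finite_imp_nat_seg_image_inj_on[OF A(1)] by auto
  have g: "g i \<in> carrier M" if "i < k" for i using kg that A by auto
  have "A \<subseteq> lincombs R M g k" using generator_mem_lincombs[OF M, of k g] g kg by blast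
  then have "carrier M \<subseteq> lincombs R M g k"
    using submodule_lincombs[OF M, of k g] g A(3) unfolding submodule_span_def by auto
  then show "\<exists>k g. generates R M (carrier M) k g" unfolding generates_def using g by blast
next
  interpret module R M by fact
  assume "\<exists>k g. generates R M (carrier M) k g"
  then obtain k g where kg: "generates R M (carrier M) k g" by auto
  then have g: "g ` {..<k} \<subseteq> carrier M" by (auto simp: generates_def)
  have "carrier M \<subseteq> N" if N: "submodule N R M" "g ` {..<k} \<subseteq> N" for N
  proof
    fix y assume "y \<in> carrier M"
    then obtain x where "\<And>i. i < k ==> x i \<in> carrier R" "y = lincomb M g x k" by (rule generatesE[OF kg]) blast
    then show "y \<in> N" using lincomb_mem[OF N(1), of k g x] N(2) by auto
  qed
  then have "submodule_span R M (g ` {..<k}) = carrier M"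
    using g carrier_is_submodule unfolding submodule_span_def by blast
  then show "fin_gen_module R M" using M g unfolding fin_gen_module_def by blast
qed

lemma noetherian_ring_ideal_generated:
  fixes R (structure)
  assumes R: "cring R" and "noetherian_ring R" "ideal I R"
  obtains k g where "generates R (ring_as_module R) I k g"
proof -
  interpret cring R by fact
  note RR = module_ring_as_module[OF R]
  obtain A where A: "A \<subseteq> carrier R" "finite A" "I = Idl A"
    using noetherian_ring.finetely_gen[OF assms(2,3)] by auto
  obtain k and g :: "nat => 'a" where kg: "A = g ` {i. i < k}"
    using finite_imp_nat_seg_image_inj_on[OF A(2)] by auto
  have g: "g i \<in> carrier (ring_as_module R)" if "i < k" for i using kg that A by auto
  have "A \<subseteq> lincombs R (ring_as_module R) g k" using generator_mem_lincombs[OF RR, of k g] g kg by blast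
  moreover have "ideal (lincombs R (ring_as_module R) g k) R"
    using submodule_lincombs[OF RR, of k g] g ideal_iff_submodule[OF R] by blast
  ultimately have "I \<subseteq> lincombs R (ring_as_module R) g k" using A(3) genideal_minimal by auto
  moreover have "\<forall>i<k. g i \<in> I" using A genideal_self kg by auto
  ultimately show ?thesis using that unfolding generates_def by blast
qed

lemma generates_extension:
  fixes M (structure)
  assumes M: "module R M" and N: "submodule N R M" and S: "submodule S R M"
    and h: "generates R M (N \<inter> S) m h" and n: "\<And>i. i < l ==> n i \<in> N"
    and n_gen: "\<And>y. y \<in> N ==> \<exists>c. (\<forall>i<l. c i \<in> carrier R) \<and> y \<ominus> lincomb M n c l \<in> S"
  shows "generates R M N (l + m) (\<lambda>i. if i < l then n i else h (i - l))"
  unfolding generates_def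
proof (intro conjI allI impI subsetI)
  have hN: "\<And>i. i < m ==> h i \<in> N" using h unfolding generates_def by blast
  show "(if i < l then n i else h (i - l)) \<in> N" if "i < l + m" for i using n hN that by auto
  fix y assume y: "y \<in> N"
  obtain c where c: "\<forall>i<l. c i \<in> carrier R" "y \<ominus> lincomb M n c l \<in> S" using n_gen[OF y] by blast
  have nN: "lincomb M n c l \<in> N" by (rule lincomb_mem[OF N n]) (use c in auto)
  then have "y \<ominus> lincomb M n c l \<in> N \<inter> S" using submodule_minus[OF N y] c by blast
  then obtain t where t: "\<And>i. i < m ==> t i \<in> carrier R" "y \<ominus> lincomb M n c l = lincomb M h t m"
    by (rule generatesE[OF h]) blast
  note mem = submodule_mem_carrier[OF N]
  have "y = lincomb M n c l \<oplus> lincomb M h t m"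
    using minus_cancel(2)[OF M mem[OF y] mem[OF nN]] t(2) by simp
  also have "\<dots> = lincomb M (\<lambda>i. if i < l then n i else h (i - l)) (\<lambda>i. if i < l then c i else t (i - l)) (l + m)"
    by (rule lincomb_append[OF M, symmetric]) (use c t mem n hN in auto)
  finally show "y \<in> lincombs R M (\<lambda>i. if i < l then n i else h (i - l)) (l + m)"
    unfolding lincombs_def using c t by (auto intro!: exI[of _ "\<lambda>i. if i < l then c i else t (i - l)"])
qed

lemma noetherian_submodule_lincombs_generated:
  fixes M (structure)
  assumes R: "cring R" and NR: "noetherian_ring R" and M: "module R M"
  shows "(\<And>i. i < k ==> g i \<in> carrier M) ==> submodule N R M ==> N \<subseteq> lincombs R M g k ==> \<exists>l h. generates R M N l h"
proof (induction k arbitrary: N)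
  case 0
  then show ?case by (intro exI[of _ 0]) (auto simp: generates_def lincombs_def)
next
  case (Suc k)
  interpret module R M by fact
  note RR = module_ring_as_module[OF R] and N = Suc.prems(2) and mem = submodule_mem_carrier
  have g: "\<And>i. i < k ==> g i \<in> carrier M" "g k \<in> carrier M" using Suc.prems by auto
  let ?S = "lincombs R M g k"
  have S: "submodule ?S R M" by (rule submodule_lincombs[OF M g(1)])
  obtain m h where h: "generates R M (N \<inter> ?S) m h"
    using Suc.IH[OF g(1) submodule_Int[OF M N S]] by blast
  define I where "I = {r \<in> carrier R. r \<odot> g k \<in> N <+>\<^bsub>M\<^esub> ?S}"
  have "submodule I R (ring_as_module R)"
    using submodule_vimage[OF linear_map_smult_const[OF linear_map_ident[OF RR] M g(2)]
        module.carrier_is_submodule[OF RR] submodule_set_add(1)[OF M N S]] by (simp add: I_def)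
  then obtain l \<rho> where \<rho>: "generates R (ring_as_module R) I l \<rho>"
    using noetherian_ring_ideal_generated[OF R NR] ideal_iff_submodule[OF R] by blast
  then have "\<forall>i<l. \<rho> i \<in> carrier R \<and> (\<exists>n\<in>N. \<exists>s\<in>?S. \<rho> i \<odot> g k = n \<oplus> s)"
    unfolding generates_def I_def set_add_iff by blast
  then obtain n s where \<rho>c: "\<And>i. i < l ==> \<rho> i \<in> carrier R" and n: "\<And>i. i < l ==> n i \<in> N"
    and s: "\<And>i. i < l ==> s i \<in> ?S" and ns: "\<And>i. i < l ==> \<rho> i \<odot> g k = n i \<oplus> s i" by metis
  have "\<exists>c. (\<forall>i<l. c i \<in> carrier R) \<and> y \<ominus> lincomb M n c l \<in> ?S" if y: "y \<in> N" for y
  proof -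
    obtain x where x: "\<forall>i<Suc k. x i \<in> carrier R" "y = lincomb M g x (Suc k)"
      using Suc.prems(3) y unfolding lincombs_def by blast
    let ?a = "lincomb M g x k"
    have a: "?a \<in> ?S" using x(1) unfolding lincombs_def by auto
    have "x k \<odot> g k = y \<ominus> ?a" using x g(2) minus_cancel(5)[OF M _ mem[OF S a]] by simp
    also have "\<dots> = y \<oplus> \<ominus> ?a" by (simp add: a_minus_def)
    finally have "x k \<in> I" using x(1) y submodule_uminus[OF S a] unfolding I_def set_add_iff by auto
    then obtain c where c: "\<And>i. i < l ==> c i \<in> carrier R" "x k = lincomb (ring_as_module R) \<rho> c l"
      by (rule generatesE[OF \<rho>]) blast
    have sS: "lincomb M s c l \<in> ?S" by (rule lincomb_mem[OF S s c(1)])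
    have nN: "lincomb M n c l \<in> N" by (rule lincomb_mem[OF N n c(1)])
    have "x k \<odot> g k = lincomb M (\<lambda>i. \<rho> i \<odot> g k) c l"
      unfolding c(2) by (rule lincomb_smult_right[OF M g(2) \<rho>c c(1)])
    also have "\<dots> = lincomb M (\<lambda>i. n i \<oplus> s i) c l" by (rule lincomb_cong) (simp_all add: ns)
    also have "\<dots> = lincomb M n c l \<oplus> lincomb M s c l"
      by (rule lincomb_add_gens[OF M mem[OF N n] mem[OF S s] c(1)])
    finally have "y = (?a \<oplus> lincomb M s c l) \<oplus> lincomb M n c l"
      using x(2) mem[OF S a] mem[OF S sS] mem[OF N nN] by (simp add: M.a_ac)
    then have "y \<ominus> lincomb M n c l = ?a \<oplus> lincomb M s c l"
      using minus_cancel(4)[OF M] mem[OF S a] mem[OF S sS] mem[OF N nN] by simp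
    then show ?thesis using c(1) submodule_add[OF S a sS] by (intro exI[of _ c]) simp
  qed
  from generates_extension[OF M N S h n this] show ?case by (intro exI)
qed

lemma fin_gen_noetherian_module:
  assumes "cring R" "noetherian_ring R" "fin_gen_module R M"
  shows "noetherian_module R M"
proof -
  note M = fin_gen_moduleD[OF assms(3)]
  obtain k g where g: "\<And>i. i < k ==> g i \<in> carrier M" "carrier M \<subseteq> lincombs R M g k"
    using assms(3) fin_gen_module_iff[OF M] unfolding generates_def by blast
  have "\<exists>l h. generates R M N l h" if N: "submodule N R M" for N
    by (rule noetherian_submodule_lincombs_generated[OF assms(1,2) M g(1) N])
      (use submodule_mem_carrier[OF N] g(2) in blast)+
  then show ?thesis using M unfolding noetherian_module_def by blast
qed

lemma noetherian_module_chain_stabilizes: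
  assumes M: "noetherian_module R M" and f: "\<And>n. submodule (f n) R M" and step: "\<And>n. f n \<subseteq> f (Suc n)"
  obtains n where "\<And>m. m \<ge> n ==> f m = f n"
proof -
  have mono: "f m \<subseteq> f n" if "m \<le> n" for m n using lift_Suc_mono_le[of f m n] step that by blast
  have "submodule (\<Union>n. f n) R M"
  proof (rule submoduleI_no_inverse)
    show "module R M" using M by (simp add: noetherian_module_def)
    fix x y assume "x \<in> (\<Union>n. f n)" "y \<in> (\<Union>n. f n)"
    then obtain m n where "x \<in> f m" "y \<in> f n" by blast
    then have "x \<in> f (max m n)" "y \<in> f (max m n)" using mono[of m "max m n"] mono[of n "max m n"] by auto
    then show "x \<oplus>\<^bsub>M\<^esub> y \<in> (\<Union>n. f n)" using submodule_add[OF f] by blast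
  next
    show "(\<Union>n. f n) \<subseteq> carrier M" using submodule_mem_carrier[OF f] by auto
    show "\<zero>\<^bsub>M\<^esub> \<in> (\<Union>n. f n)" using submodule_zero_mem[OF f] by auto
    show "r \<odot>\<^bsub>M\<^esub> x \<in> (\<Union>n. f n)" if "r \<in> carrier R" "x \<in> (\<Union>n. f n)" for r x
      using submodule_smult[OF f that(1)] that(2) by blast
  qed
  then obtain k g where kg: "generates R M (\<Union>n. f n) k g" using M by (auto simp: noetherian_module_def)
  then have "\<forall>i<k. \<exists>n. g i \<in> f n" by (auto simp: generates_def)
  then obtain n where n: "\<And>i. i < k ==> g i \<in> f (n i)" by metis
  define N where "N = (\<Sum>i<k. n i)"
  have g: "g i \<in> f N" if "i < k" for i
    using n[OF that] mono[of "n i" N] member_le_sum[of i "{..<k}" n] that unfolding N_def by auto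
  have "f m \<subseteq> f N" for m
  proof
    fix y assume "y \<in> f m"
    then have "y \<in> (\<Union>n. f n)" by blast
    then obtain x where "\<And>i. i < k ==> x i \<in> carrier R" "y = lincomb M g x k" by (rule generatesE[OF kg]) blast
    then show "y \<in> f N" using lincomb_mem[OF f g] by simp
  qed
  then show ?thesis using that[of N] mono by blast
qed

lemma noetherian_module_has_maximal:
  assumes M: "noetherian_module R M" and \<S>: "\<And>W. W \<in> \<S> ==> submodule W R M" "W0 \<in> \<S>"
  shows "\<exists>W\<in>\<S>. \<forall>V\<in>\<S>. W \<subseteq> V --> V = W"
proof (rule ccontr)
  assume "\<not> ?thesis"
  then have step: "\<forall>W\<in>\<S>. \<exists>V\<in>\<S>. W \<subset> V" by blast
  have "\<exists>f. \<forall>n. f n \<in> \<S> \<and> f n \<subset> f (Suc n)"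
    by (rule dependent_nat_choice) (use step \<S>(2) in auto)
  then obtain f where f: "\<And>n. f n \<in> \<S>" "\<And>n. f n \<subset> f (Suc n)" by blast
  have "f n \<subseteq> f (Suc n)" for n using f(2)[of n] by blast
  from noetherian_module_chain_stabilizes[where f=f, OF M \<S>(1)[OF f(1)] this]
  obtain n where "\<And>m. m \<ge> n ==> f m = f n" by blast
  from this[of "Suc n"] show False using f(2)[of n] by simp
qed

lemma noetherian_module_colon_stabilizes:
  fixes M (structure)
  assumes M: "noetherian_module R M" and W: "submodule W R M" and x: "x \<in> carrier R"
  obtains k where "\<forall>j. \<forall>y\<in>carrier M. x [^]\<^bsub>R\<^esub> (k + j) \<odot> y \<in> W --> x [^]\<^bsub>R\<^esub> (k::nat) \<odot> y \<in> W"
proof -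
  have MM: "module R M" using M by (simp add: noetherian_module_def)
  interpret module R M by (rule MM)
  define V where "V n = {y \<in> carrier M. x [^]\<^bsub>R\<^esub> n \<odot> y \<in> W}" for n :: nat
  have V: "submodule (V n) R M" for n
    unfolding V_def
    by (rule submodule_vimage[OF linear_map_fun_smult[OF linear_map_ident[OF MM]] carrier_is_submodule W]) (use x in simp)
  have "V n \<subseteq> V (Suc n)" for n
  proof
    fix y assume y: "y \<in> V n"
    have "x [^]\<^bsub>R\<^esub> Suc n \<odot> y = x \<odot> (x [^]\<^bsub>R\<^esub> n \<odot> y)"
      using y x by (simp add: V_def smult_assoc1[symmetric] m_comm)
    then show "y \<in> V (Suc n)" using y submodule_smult[OF W x] by (simp add: V_def)
  qed
  from noetherian_module_chain_stabilizes[where f=V, OF M V this]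
  obtain k where k: "\<And>m. m \<ge> k ==> V m = V k" by blast
  show ?thesis
  proof (rule that, intro allI ballI impI)
    show "x [^]\<^bsub>R\<^esub> k \<odot> y \<in> W" if "y \<in> carrier M" "x [^]\<^bsub>R\<^esub> (k + j) \<odot> y \<in> W" for j y
      using that k[of "k + j"] unfolding V_def by auto
  qed
qed

subsection \<open>Free modules\<close>

definition power_module :: "('a, 'm, 's) module_scheme => nat => ('a, nat => 'm) module" where
  "power_module M n =
     \<lparr>carrier = {..<n} \<rightarrow>\<^sub>E carrier M, mult = undefined, one = undefined,
      zero = (\<lambda>j\<in>{..<n}. \<zero>\<^bsub>M\<^esub>),
      add = (\<lambda>x y. \<lambda>j\<in>{..<n}. x j \<oplus>\<^bsub>M\<^esub> y j),
      smult = (\<lambda>r x. \<lambda>j\<in>{..<n}. r \<odot>\<^bsub>M\<^esub> x j)\<rparr>"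

definition power_inj :: "('a, 'm, 's) module_scheme => nat => nat => 'm => (nat => 'm)" where
  "power_inj M n j y = (\<lambda>i\<in>{..<n}. if i = j then y else \<zero>\<^bsub>M\<^esub>)"

definition std_basis :: "('a, 'r) ring_scheme => nat => nat => (nat => 'a)" where
  "std_basis R n j = power_inj (ring_as_module R) n j \<one>\<^bsub>R\<^esub>"

lemma power_module_eqI:
  "x \<in> carrier (power_module M n) ==> y \<in> carrier (power_module M n) ==> (\<And>j. j < n ==> x j = y j) ==> x = y"
  by (auto simp: power_module_def intro: PiE_ext)

lemma power_module_carrierI: "(\<And>j. j < n ==> v j \<in> carrier M) ==> (\<lambda>j\<in>{..<n}. v j) \<in> carrier (power_module M n)"
  by (auto simp: power_module_def)

lemma power_module_nth:
  "x \<in> carrier (power_module M n) ==> j < n ==> x j \<in> carrier M"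
  "j < n ==> \<zero>\<^bsub>power_module M n\<^esub> j = \<zero>\<^bsub>M\<^esub>"
  "j < n ==> (x \<oplus>\<^bsub>power_module M n\<^esub> y) j = x j \<oplus>\<^bsub>M\<^esub> y j"
  "j < n ==> (r \<odot>\<^bsub>power_module M n\<^esub> x) j = r \<odot>\<^bsub>M\<^esub> x j"
  by (auto simp: power_module_def)

lemma power_module_closed:
  assumes "module R M"
  shows "\<zero>\<^bsub>power_module M n\<^esub> \<in> carrier (power_module M n)"
    "x \<in> carrier (power_module M n) ==> y \<in> carrier (power_module M n) ==>
      x \<oplus>\<^bsub>power_module M n\<^esub> y \<in> carrier (power_module M n)"
    "r \<in> carrier R ==> x \<in> carrier (power_module M n) ==> r \<odot>\<^bsub>power_module M n\<^esub> x \<in> carrier (power_module M n)"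
proof -
  interpret module R M by fact
  have [simp]: "x \<in> {..<n} \<rightarrow>\<^sub>E carrier M ==> j < n ==> x j \<in> carrier M" for x j by auto
  show "\<zero>\<^bsub>power_module M n\<^esub> \<in> carrier (power_module M n)"
    "x \<in> carrier (power_module M n) ==> y \<in> carrier (power_module M n) ==>
      x \<oplus>\<^bsub>power_module M n\<^esub> y \<in> carrier (power_module M n)"
    "r \<in> carrier R ==> x \<in> carrier (power_module M n) ==> r \<odot>\<^bsub>power_module M n\<^esub> x \<in> carrier (power_module M n)"
    by (simp_all add: power_module_def)
qed

lemma module_power_module:
  assumes "module R M"
  shows "module R (power_module M n)" (is "module R ?P")
proof -
  interpret module R M by fact
  note [simp] = power_module_nth power_module_closed[OF assms]
  have abelian: "abelian_group ?P"
  proof (rule abelian_groupI)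
    fix x assume x: "x \<in> carrier ?P"
    have y: "(\<lambda>j\<in>{..<n}. \<ominus>\<^bsub>M\<^esub> x j) \<in> carrier ?P" using x by (intro power_module_carrierI) simp
    have "(\<lambda>j\<in>{..<n}. \<ominus>\<^bsub>M\<^esub> x j) \<oplus>\<^bsub>?P\<^esub> x = \<zero>\<^bsub>?P\<^esub>"
      by (rule power_module_eqI[of _ M n]) (use x y in \<open>simp_all add: M.l_neg\<close>)
    with y show "\<exists>y\<in>carrier ?P. y \<oplus>\<^bsub>?P\<^esub> x = \<zero>\<^bsub>?P\<^esub>" by blast
    show "\<zero>\<^bsub>?P\<^esub> \<oplus>\<^bsub>?P\<^esub> x = x" by (rule power_module_eqI[of _ M n]) (use x in simp_all)
    fix y assume y: "y \<in> carrier ?P"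
    show "x \<oplus>\<^bsub>?P\<^esub> y = y \<oplus>\<^bsub>?P\<^esub> x" by (rule power_module_eqI[of _ M n]) (use x y in \<open>simp_all add: M.a_comm\<close>)
    fix z assume z: "z \<in> carrier ?P"
    show "x \<oplus>\<^bsub>?P\<^esub> y \<oplus>\<^bsub>?P\<^esub> z = x \<oplus>\<^bsub>?P\<^esub> (y \<oplus>\<^bsub>?P\<^esub> z)"
      by (rule power_module_eqI[of _ M n]) (use x y z in \<open>simp_all add: M.a_assoc\<close>)
  qed simp_all
  show ?thesis
    by (intro moduleI[OF is_cring abelian]; (rule power_module_eqI[of _ M n])?)
      (auto simp: smult_l_distr smult_r_distr smult_assoc1)
qed

lemma linear_map_power_inj: "module R M ==> linear_map R M (power_module M n) (power_inj M n j)"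
proof -
  assume M: "module R M"
  then interpret module R M .
  show ?thesis using M module_power_module[OF M, of n]
    by (auto simp: linear_map_def power_module_def power_inj_def)
qed

lemma linear_map_power_nth: "module R M ==> j < n ==> linear_map R (power_module M n) M (\<lambda>x. x j)"
  using module_power_module[of R M n] by (auto simp: linear_map_def power_module_def)

lemma linear_map_into_power:
  assumes "module R A" "module R M" "\<And>j. j < n ==> linear_map R A M (f j)"
  shows "linear_map R A (power_module M n) (\<lambda>x. \<lambda>j\<in>{..<n}. f j x)"
  using assms module_power_module[OF assms(2), of n] by (auto simp: linear_map_def power_module_def)

lemma power_module_minus_nth:
  assumes "module R M" "x \<in> carrier (power_module M n)" "y \<in> carrier (power_module M n)" "j < n"
  shows "(x \<ominus>\<^bsub>power_module M n\<^esub> y) j = x j \<ominus>\<^bsub>M\<^esub> y j"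
  using linear_map_minus[OF linear_map_power_nth[OF assms(1,4)] assms(2,3)] .

lemma power_module_lincomb_nth:
  assumes "module R M" "\<And>i. i < k ==> g i \<in> carrier (power_module M n)" "\<And>i. i < k ==> c i \<in> carrier R" "j < n"
  shows "lincomb (power_module M n) g c k j = lincomb M (\<lambda>i. g i j) c k"
  using linear_map_image_lincomb[OF linear_map_power_nth[OF assms(1,4)] assms(2,3)] .

lemma power_module_mem_submodule:
  fixes M (structure)
  assumes M: "module R M" and T: "submodule T R (power_module M n)" and u: "u \<in> carrier (power_module M n)"
    and inj: "\<And>j. j < n ==> power_inj M n j (u j) \<in> T"
  shows "u \<in> T"
proof -
  interpret module R M by fact
  have [simp]: "j < n ==> u j \<in> carrier M" for j using u power_module_nth by blast
  have "(\<lambda>i\<in>{..<n}. if i < k then u i else \<zero>) \<in> T" if "k \<le> n" for k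
    using that
  proof (induction k)
    case 0
    then show ?case using submodule_zero_mem[OF T] by (simp add: power_module_def restrict_def)
  next
    case (Suc k)
    have "(\<lambda>i\<in>{..<n}. if i < Suc k then u i else \<zero>) =
        (\<lambda>i\<in>{..<n}. if i < k then u i else \<zero>) \<oplus>\<^bsub>power_module M n\<^esub> power_inj M n k (u k)"
      using Suc.prems by (auto simp: power_module_def power_inj_def)
    also have "\<dots> \<in> T" by (rule submodule_add[OF T Suc.IH inj]) (use Suc.prems in auto)
    finally show ?case .
  qed
  from this[of n] have "(\<lambda>i\<in>{..<n}. if i < n then u i else \<zero>) \<in> T" by simp
  also have "(\<lambda>i\<in>{..<n}. if i < n then u i else \<zero>) = u"
    using u by (auto simp: power_module_def PiE_def extensional_def)
  finally show ?thesis .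
qed

lemma submodule_power:
  assumes M: "module R M" and N: "submodule N R M"
  shows "submodule {u \<in> carrier (power_module M n). \<forall>j<n. u j \<in> N} R (power_module M n)"
  by (rule submoduleI_no_inverse[OF module_power_module[OF M]])
    (auto simp: power_module_nth power_module_closed[OF M]
      intro: submodule_zero_mem[OF N] submodule_add[OF N] submodule_smult[OF N])

lemma fin_gen_power_module:
  assumes fg: "fin_gen_module R M"
  shows "fin_gen_module R (power_module M n)"
proof -
  note M = fin_gen_moduleD[OF fg]
  interpret P: module R "power_module M n" by (rule module_power_module[OF M])
  note inj = linear_map_power_inj[OF M, of n]
  obtain k g where kg: "generates R M (carrier M) k g" using fg fin_gen_module_iff[OF M] by blast
  then have g: "\<And>i. i < k ==> g i \<in> carrier M" by (simp add: generates_def)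
  let ?A = "(\<lambda>(j, i). power_inj M n j (g i)) ` ({..<n} \<times> {..<k})"
  have A: "?A \<subseteq> carrier (power_module M n)" using g linear_map_closed[OF inj] by auto
  have "carrier (power_module M n) \<subseteq> N" if N: "submodule N R (power_module M n)" "?A \<subseteq> N" for N
  proof
    fix u assume u: "u \<in> carrier (power_module M n)"
    show "u \<in> N"
    proof (rule power_module_mem_submodule[OF M N(1) u])
      fix j assume j: "j < n"
      have "u j \<in> carrier M" using u j power_module_nth by blast
      then obtain x where x: "\<And>i. i < k ==> x i \<in> carrier R" "u j = lincomb M g x k" by (rule generatesE[OF kg]) blast
      have "power_inj M n j (u j) = lincomb (power_module M n) (\<lambda>i. power_inj M n j (g i)) x k"
        unfolding x(2) by (rule linear_map_image_lincomb[OF inj g x(1)])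
      also have "\<dots> \<in> N" by (rule lincomb_mem[OF N(1)]) (use x N(2) j in auto)
      finally show "power_inj M n j (u j) \<in> N" .
    qed
  qed
  then have "submodule_span R (power_module M n) ?A = carrier (power_module M n)"
    using A P.carrier_is_submodule unfolding submodule_span_def by blast
  then show ?thesis unfolding fin_gen_module_def using A P.module_axioms by (intro conjI exI[of _ ?A]) auto
qed

lemma fin_gen_ring_as_module:
  assumes "cring R"
  shows "fin_gen_module R (ring_as_module R)"
proof -
  interpret cring R by fact
  have "generates R (ring_as_module R) (carrier R) 1 (\<lambda>_. \<one>\<^bsub>R\<^esub>)"
    unfolding generates_def lincombs_def by (auto intro!: exI[of _ "\<lambda>_. _"])
  then show ?thesis using fin_gen_module_iff[OF module_ring_as_module[OF assms]] by auto
qed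

lemma free_module_eq_power: "free_module R n = power_module (ring_as_module R) n"
  by (simp add: free_module_def power_module_def)

lemma free_module_nth_closed: "x \<in> carrier (free_module R n) ==> i < n ==> x i \<in> carrier R"
  by (auto simp: free_module_def)

lemma module_free_module: "cring R ==> module R (free_module R n)"
  by (simp add: free_module_eq_power module_power_module module_ring_as_module)

lemma fin_gen_free_module: "cring R ==> fin_gen_module R (free_module R n)"
  by (simp add: free_module_eq_power fin_gen_power_module fin_gen_ring_as_module)

lemma std_basis_closed: "cring R ==> std_basis R n j \<in> carrier (free_module R n)"
  unfolding std_basis_def free_module_eq_power
  by (rule linear_map_closed[OF linear_map_power_inj[OF module_ring_as_module]]) (auto simp: cring.cring_simprules)

lemma free_module_mem_submodule:
  assumes "cring R" and T: "submodule T R (free_module R n)" and basis: "\<And>j. j < n ==> std_basis R n j \<in> T"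
    and x: "x \<in> carrier (free_module R n)"
  shows "x \<in> T"
proof (rule power_module_mem_submodule[OF module_ring_as_module[OF assms(1)]])
  interpret cring R by fact
  show "submodule T R (power_module (ring_as_module R) n)" "x \<in> carrier (power_module (ring_as_module R) n)"
    using T x by (auto simp: free_module_eq_power)
  fix j assume j: "j < n"
  note xj = free_module_nth_closed[OF x j]
  have "power_inj (ring_as_module R) n j (x j) = x j \<odot>\<^bsub>free_module R n\<^esub> std_basis R n j"
    using xj by (auto simp: power_inj_def std_basis_def free_module_def)
  then show "power_inj (ring_as_module R) n j (x j) \<in> T" using submodule_smult[OF T xj basis[OF j]] by simp
qed

lemma linear_map_mem_if_basis:
  assumes f: "linear_map R (free_module R n) M f" and L: "submodule L R M"
    and basis: "\<And>j. j < n ==> f (std_basis R n j) \<in> L" and x: "x \<in> carrier (free_module R n)"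
  shows "f x \<in> L"
proof -
  interpret F: module R "free_module R n" by (rule linear_map_module[OF f])
  have "x \<in> {x \<in> carrier (free_module R n). f x \<in> L}"
    by (rule free_module_mem_submodule[OF F.is_cring submodule_vimage[OF f F.carrier_is_submodule L] _ x])
      (simp add: basis std_basis_closed[OF F.is_cring])
  then show ?thesis by simp
qed

lemma linear_map_eq_if_basis:
  assumes f: "linear_map R (free_module R n) M f" and g: "linear_map R (free_module R n) M g"
    and basis: "\<And>j. j < n ==> f (std_basis R n j) = g (std_basis R n j)" and x: "x \<in> carrier (free_module R n)"
  shows "f x = g x"
proof -
  note M = linear_map_module(2)[OF f]
  interpret module R M by (rule M)
  have "f x \<ominus>\<^bsub>M\<^esub> g x \<in> {\<zero>\<^bsub>M\<^esub>}"
    by (rule linear_map_mem_if_basis[OF linear_map_fun_minus[OF f g] submodule_singleton_zero[OF M] _ x])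
      (use basis linear_map_closed[OF g std_basis_closed[OF is_cring]] in \<open>simp add: minus_eq_zero_iff[OF M]\<close>)
  then show ?thesis using linear_map_closed[OF f x] linear_map_closed[OF g x] by (simp add: minus_eq_zero_iff[OF M])
qed

lemma linear_map_lincomb:
  assumes M: "module R M" and u: "\<And>j. j < n ==> u j \<in> carrier M"
  shows "linear_map R (free_module R n) M (\<lambda>x. lincomb M u x n)"
proof -
  interpret module R M by fact
  have mem: "x \<in> carrier (free_module R n) ==> j < n ==> x j \<in> carrier R" for x j by (rule free_module_nth_closed)
  show ?thesis unfolding linear_map_def
  proof (intro conjI ballI M module_free_module[OF is_cring])
    fix x assume x: "x \<in> carrier (free_module R n)"
    show "lincomb M u x n \<in> carrier M" by (rule lincomb_closed[OF M u mem[OF x]])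
    fix y assume y: "y \<in> carrier (free_module R n)"
    have "lincomb M u (x \<oplus>\<^bsub>free_module R n\<^esub> y) n = lincomb M u (\<lambda>j. x j \<oplus>\<^bsub>R\<^esub> y j) n"
      by (rule lincomb_cong) (simp_all add: free_module_eq_power power_module_nth)
    also have "\<dots> = lincomb M u x n \<oplus>\<^bsub>M\<^esub> lincomb M u y n" by (rule lincomb_add_coeff[OF M u mem[OF x] mem[OF y]])
    finally show "lincomb M u (x \<oplus>\<^bsub>free_module R n\<^esub> y) n = lincomb M u x n \<oplus>\<^bsub>M\<^esub> lincomb M u y n" .
  next
    fix r x assume r: "r \<in> carrier R" and x: "x \<in> carrier (free_module R n)"
    have "lincomb M u (r \<odot>\<^bsub>free_module R n\<^esub> x) n = lincomb M u (\<lambda>j. r \<otimes>\<^bsub>R\<^esub> x j) n"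
      by (rule lincomb_cong) (simp_all add: free_module_eq_power power_module_nth)
    also have "\<dots> = r \<odot>\<^bsub>M\<^esub> lincomb M u x n" by (rule lincomb_smult_coeff[OF M u mem[OF x] r])
    finally show "lincomb M u (r \<odot>\<^bsub>free_module R n\<^esub> x) n = r \<odot>\<^bsub>M\<^esub> lincomb M u x n" .
  qed
qed

lemma lincomb_std_basis:
  assumes M: "module R M" and u: "\<And>j. j < n ==> u j \<in> carrier M" and j: "j < n"
  shows "lincomb M u (std_basis R n j) n = u j"
  by (rule lincomb_unit[OF M u j]) (auto simp: std_basis_def power_inj_def)

lemma linear_map_expand:
  assumes f: "linear_map R (free_module R n) M f" and x: "x \<in> carrier (free_module R n)"
  shows "f x = lincomb M (\<lambda>j. f (std_basis R n j)) x n"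
proof -
  note M = linear_map_module(2)[OF f]
  interpret module R M by (rule M)
  have closed: "f (std_basis R n j) \<in> carrier M" for j by (rule linear_map_closed[OF f std_basis_closed[OF is_cring]])
  show ?thesis
    by (rule linear_map_eq_if_basis[OF f linear_map_lincomb[OF M closed] _ x])
      (simp add: lincomb_std_basis[OF M closed])
qed

lemma linear_map_fun_lincomb:
  assumes M: "module R M" and X: "module R X"
    and "\<And>l. l < k ==> linear_map R M X (w l)" "\<And>l. l < k ==> c l \<in> carrier R"
  shows "linear_map R M X (\<lambda>x. lincomb X (\<lambda>l. w l x) c k)"
  using assms(3,4)
  by (induction k) (simp_all add: linear_map_const_zero[OF M X] linear_map_fun_add linear_map_fun_smult)

lemma linear_map_power_lincomb:
  assumes M: "module R M" and "\<And>j. j < n ==> x j \<in> carrier R"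
  shows "linear_map R (power_module M n) M (\<lambda>u. lincomb M u x n)"
  by (rule linear_map_fun_lincomb[where w="\<lambda>j u. u j", OF module_power_module[OF M] M linear_map_power_nth[OF M] assms(2)])

lemma linear_map_choice:
  assumes M: "module R M" and ex: "\<And>j. j < n ==> \<exists>y\<in>carrier M. P j y"
  obtains f where "linear_map R (free_module R n) M f" "\<And>j. j < n ==> P j (f (std_basis R n j))"
proof -
  obtain u where u: "\<And>j. j < n ==> u j \<in> carrier M" "\<And>j. j < n ==> P j (u j)" using ex by metis
  show ?thesis
    by (rule that[OF linear_map_lincomb[OF M u(1)]]) (use u lincomb_std_basis[OF M, of n u] in auto)
qed

lemma linear_map_lift_mod:
  assumes \<pi>: "linear_map R A B \<pi>" and f: "linear_map R (free_module R n) B f" and L: "submodule L R B"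
    and C: "submodule C R A" and ex: "\<And>x. x \<in> carrier (free_module R n) ==> \<exists>y\<in>C. f x \<ominus>\<^bsub>B\<^esub> \<pi> y \<in> L"
  obtains g where "linear_map R (free_module R n) A g" "\<And>x. x \<in> carrier (free_module R n) ==> f x \<ominus>\<^bsub>B\<^esub> \<pi> (g x) \<in> L"
    "\<And>x. x \<in> carrier (free_module R n) ==> g x \<in> C"
proof -
  note A = linear_map_module(1)[OF \<pi>]
  interpret A: module R A by (rule A)
  have "\<exists>y\<in>carrier A. y \<in> C \<and> f (std_basis R n j) \<ominus>\<^bsub>B\<^esub> \<pi> y \<in> L" for j
    using ex[OF std_basis_closed[OF A.is_cring]] submodule_mem_carrier[OF C] by blast
  then obtain g where g: "linear_map R (free_module R n) A g"
    "\<And>j. j < n ==> g (std_basis R n j) \<in> C \<and> f (std_basis R n j) \<ominus>\<^bsub>B\<^esub> \<pi> (g (std_basis R n j)) \<in> L"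
    using linear_map_choice[OF A, of n "\<lambda>j y. y \<in> C \<and> f (std_basis R n j) \<ominus>\<^bsub>B\<^esub> \<pi> y \<in> L"] by blast
  show ?thesis
  proof (rule that[OF g(1)])
    fix x assume x: "x \<in> carrier (free_module R n)"
    show "f x \<ominus>\<^bsub>B\<^esub> \<pi> (g x) \<in> L"
      by (rule linear_map_mem_if_basis[OF linear_map_fun_minus[OF f linear_map_comp[OF g(1) \<pi>]] L _ x]) (use g in auto)
    show "g x \<in> C" by (rule linear_map_mem_if_basis[OF g(1) C _ x]) (use g in auto)
  qed
qed

lemma linear_map_lift:
  assumes \<pi>: "linear_map R A B \<pi>" and f: "linear_map R (free_module R n) B f"
    and ex: "\<And>x. x \<in> carrier (free_module R n) ==> \<exists>y\<in>carrier A. f x = \<pi> y"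
  obtains g where "linear_map R (free_module R n) A g" "\<And>x. x \<in> carrier (free_module R n) ==> f x = \<pi> (g x)"
proof -
  note eq_iff = minus_eq_zero_iff[OF linear_map_module(2)[OF \<pi>]]
  have "\<exists>y\<in>carrier A. f x \<ominus>\<^bsub>B\<^esub> \<pi> y \<in> {\<zero>\<^bsub>B\<^esub>}" if "x \<in> carrier (free_module R n)" for x
    using ex[OF that] eq_iff linear_map_closed[OF \<pi>] linear_map_closed[OF f that] by (metis singletonI)
  then obtain g where g: "linear_map R (free_module R n) A g"
    "\<And>x. x \<in> carrier (free_module R n) ==> f x \<ominus>\<^bsub>B\<^esub> \<pi> (g x) \<in> {\<zero>\<^bsub>B\<^esub>}"
    using linear_map_lift_mod[OF \<pi> f submodule_singleton_zero[OF linear_map_module(2)[OF \<pi>]]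
        module.carrier_is_submodule[OF linear_map_module(1)[OF \<pi>]]] by blast
  show ?thesis
    by (rule that[OF g(1)])
      (use g(2) eq_iff linear_map_closed[OF \<pi>] linear_map_closed[OF f] linear_map_closed[OF g(1)] in auto)
qed

lemma submodule_is_image_of_free:
  assumes R: "cring R" and "noetherian_ring R" "submodule K R (free_module R n)"
  obtains m D where "linear_map R (free_module R m) (free_module R n) D" "D ` carrier (free_module R m) = K"
proof -
  let ?F = "free_module R n"
  obtain k g where kg: "generates R ?F K k g"
    using fin_gen_noetherian_module[OF R assms(2) fin_gen_free_module[OF R]] assms(3)
    unfolding noetherian_module_def by blast
  have g: "\<And>i. i < k ==> g i \<in> K" using kg by (simp add: generates_def)
  have image: "(\<lambda>x. lincomb ?F g x k) ` carrier (free_module R k) = K"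
  proof (intro equalityI subsetI)
    fix y assume "y \<in> (\<lambda>x. lincomb ?F g x k) ` carrier (free_module R k)"
    then obtain x where x: "x \<in> carrier (free_module R k)" "y = lincomb ?F g x k" by blast
    show "y \<in> K" unfolding x(2) by (rule lincomb_mem[OF assms(3) g free_module_nth_closed[OF x(1)]])
  next
    fix y assume "y \<in> K"
    then obtain x where x: "\<And>i. i < k ==> x i \<in> carrier R" "y = lincomb ?F g x k" by (rule generatesE[OF kg]) blast
    have "y = lincomb ?F g (restrict x {..<k}) k" unfolding x(2) by (rule lincomb_cong) auto
    moreover have "restrict x {..<k} \<in> carrier (free_module R k)" using x(1) by (auto simp: free_module_def)
    ultimately show "y \<in> (\<lambda>x. lincomb ?F g x k) ` carrier (free_module R k)" by blast
  qed
  show ?thesis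
    by (rule that[OF linear_map_lincomb[OF module_free_module[OF R] submodule_mem_carrier[OF assms(3) g]] image])
qed

lemma power_module_mem_set_add:
  fixes M (structure)
  assumes M: "module R M" and T: "submodule T R M" and L: "submodule L R M" and u: "u \<in> carrier (power_module M n)"
    and nth: "\<And>j. j < n ==> u j \<in> T <+>\<^bsub>M\<^esub> L"
  shows "u \<in> {v \<in> carrier (power_module M n). \<forall>j<n. v j \<in> T} <+>\<^bsub>power_module M n\<^esub> {v \<in> carrier (power_module M n). \<forall>j<n. v j \<in> L}"
proof -
  have "\<forall>j. \<exists>t l. j < n --> t \<in> T \<and> l \<in> L \<and> u j = t \<oplus> l" using nth unfolding set_add_iff by blast
  then obtain t l where tl: "\<And>j. j < n ==> t j \<in> T" "\<And>j. j < n ==> l j \<in> L" "\<And>j. j < n ==> u j = t j \<oplus> l j" by metis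
  let ?t = "\<lambda>j\<in>{..<n}. t j" and ?l = "\<lambda>j\<in>{..<n}. l j"
  have closed: "?t \<in> carrier (power_module M n)" "?l \<in> carrier (power_module M n)"
    by (rule power_module_carrierI; use tl submodule_mem_carrier[OF T] submodule_mem_carrier[OF L] in blast)+
  have "u = ?t \<oplus>\<^bsub>power_module M n\<^esub> ?l"
    by (rule power_module_eqI[OF u power_module_closed(2)[OF M closed]]) (use tl in \<open>simp add: power_module_nth\<close>)
  with closed tl(1,2) show ?thesis unfolding set_add_iff by (intro bexI[of _ ?t] bexI[of _ ?l]) simp_all
qed

lemma submodule_cochain_tuples:
  fixes X (structure)
  assumes X: "module R X" and zero: "Q (\<lambda>x. \<zero>)" and add: "\<And>f g. Q f ==> Q g ==> Q (\<lambda>x. f x \<oplus> g x)"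
    and smult: "\<And>r f. r \<in> carrier R ==> Q f ==> Q (\<lambda>x. r \<odot> f x)"
    and cong: "\<And>f g. Q f ==> (\<And>x. x \<in> carrier (free_module R p) ==> f x = g x) ==> Q g"
  shows "submodule {u \<in> carrier (power_module X p). Q (\<lambda>x. lincomb X u x p)} R (power_module X p)"
proof (rule submoduleI_no_inverse[OF module_power_module[OF X]])
  let ?T = "{u \<in> carrier (power_module X p). Q (\<lambda>x. lincomb X u x p)}" and ?P = "power_module X p"
  note closed = power_module_closed[OF X, where n=p]
  have lin: "linear_map R ?P X (\<lambda>u. lincomb X u x p)" if "x \<in> carrier (free_module R p)" for x
    by (rule linear_map_power_lincomb[OF X free_module_nth_closed[OF that]])
  show "\<zero>\<^bsub>?P\<^esub> \<in> ?T" using cong[OF zero linear_map_zero[OF lin, symmetric]] closed(1) by simp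
  show "u \<oplus>\<^bsub>?P\<^esub> v \<in> ?T" if u: "u \<in> ?T" and v: "v \<in> ?T" for u v
  proof -
    have uv: "Q (\<lambda>x. lincomb X u x p \<oplus> lincomb X v x p)" using u v by (intro add) auto
    have "Q (\<lambda>x. lincomb X (u \<oplus>\<^bsub>?P\<^esub> v) x p)" by (rule cong[OF uv]) (use linear_map_add[OF lin] u v in auto)
    then show ?thesis using closed(2) u v by simp
  qed
  show "r \<odot>\<^bsub>?P\<^esub> u \<in> ?T" if r: "r \<in> carrier R" and u: "u \<in> ?T" for r u
  proof -
    have ru: "Q (\<lambda>x. r \<odot> lincomb X u x p)" using r u by (intro smult) auto
    have "Q (\<lambda>x. lincomb X (r \<odot>\<^bsub>?P\<^esub> u) x p)" by (rule cong[OF ru]) (use linear_map_smult[OF lin] r u in auto)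
    then show ?thesis using closed(3) r u by simp
  qed
qed auto

subsection \<open>Ideal powers\<close>

lemma ideal_prod_subsetI:
  assumes "ideal K R" and prod: "\<And>i j. i \<in> I ==> j \<in> I' ==> i \<otimes>\<^bsub>R\<^esub> j \<in> K"
  shows "ideal_prod R I I' \<subseteq> K"
proof
  interpret K: ideal K R by fact
  show "x \<in> K" if "x \<in> ideal_prod R I I'" for x
    using that by induction (simp_all add: prod K.a_closed)
qed

context
  fixes R :: "('a, 'r) ring_scheme" (structure) and \<aa> :: "'a set"
  assumes R: "cring R" and \<aa>: "ideal \<aa> R"
begin

interpretation cring R by (rule R)
interpretation ideals: comm_monoid "ideals_set R" by (rule ideals_set_is_comm_monoid)

lemma ideal_power_ideal: "ideal (ideal_power R \<aa> n) R"
  using ideals.nat_pow_closed[of \<aa> n] \<aa> by (simp add: ideals_set_def)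

lemma submodule_ideal_power: "submodule (ideal_power R \<aa> n) R (ring_as_module R)"
  using ideal_power_ideal ideal_iff_submodule[OF R] by blast

lemma ideal_power_closed: "x \<in> ideal_power R \<aa> n ==> x \<in> carrier R"
  using ideal.Icarr[OF ideal_power_ideal] .

lemma ideal_power_0: "ideal_power R \<aa> 0 = carrier R"
  by (simp add: ideals_set_def)

lemma ideal_power_Suc: "ideal_power R \<aa> (Suc n) = ideal_prod R (ideal_power R \<aa> n) \<aa>"
  by (simp add: ideals_set_def)

lemma ideal_power_1: "ideal_power R \<aa> (Suc 0) = \<aa>"
  using ideal_power_Suc[of 0] ideal_prod_commute[OF oneideal \<aa>] ideal_prod_one[OF \<aa>] ideal_power_0 by simp

lemma ideal_power_antimono: "m \<le> n ==> ideal_power R \<aa> n \<subseteq> ideal_power R \<aa> m"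
proof (induction rule: dec_induct)
  case (step n)
  then show ?case using ideal_prod_inter[OF ideal_power_ideal \<aa>, of n] ideal_power_Suc by blast
qed simp

lemma ideal_power_mult: "ideal_power R (ideal_power R \<aa> n) m = ideal_power R \<aa> (n * m)"
  using ideals.nat_pow_pow[of \<aa> n m] \<aa> by (simp add: ideals_set_def)

lemma elem_power_in_ideal_power: "x \<in> \<aa> ==> x [^] n \<in> ideal_power R \<aa> n"
proof (induction n)
  case 0
  show ?case unfolding ideal_power_0 by simp
next
  case (Suc n)
  then show ?case unfolding ideal_power_Suc by (simp add: ideal_prod.prod)
qed

end

lemma ideal_power_mono:
  assumes R: "cring R" and "ideal \<bb> R" "ideal \<aa> R" "\<bb> \<subseteq> \<aa>"
  shows "ideal_power R \<bb> n \<subseteq> ideal_power R \<aa> n"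
proof (induction n)
  case 0
  show ?case by (simp add: ideals_set_def)
next
  case (Suc n)
  have "ideal_prod R (ideal_power R \<bb> n) \<bb> \<subseteq> ideal_power R \<aa> (Suc n)"
    by (rule ideal_prod_subsetI[OF ideal_power_ideal[OF R assms(3)]])
      (use Suc assms(4) ideal_power_Suc[OF R assms(3)] ideal_prod.prod[of _ "ideal_power R \<aa> n" _ \<aa>] in blast)
  then show ?case unfolding ideal_power_Suc[OF R assms(2)] .
qed

lemma set_add_ring_as_module: "set_add (ring_as_module R) = set_add R"
  by (intro ext) (simp add: set_add_def')

lemma ideal_subset_set_add:
  assumes R: "cring R" and "ideal I R" "ideal J R"
  shows "I \<subseteq> I <+>\<^bsub>R\<^esub> J" "J \<subseteq> I <+>\<^bsub>R\<^esub> J"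
  using submodule_set_add(2,3)[OF module_ring_as_module[OF R], of I J] assms(2,3) ideal_iff_submodule[OF R]
  by (simp_all add: set_add_ring_as_module)

lemma mult_mem_set_add_ideal_power:
  fixes R (structure) and n :: nat
  assumes R: "cring R" and \<bb>: "ideal \<bb> R" and x: "x \<in> carrier R" and iR: "i \<in> carrier R"
    and i: "i \<in> ideal_power R \<bb> m <+>\<^bsub>R\<^esub> PIdl (x [^] Suc n)" and i': "i \<in> ideal_power R \<bb> (Suc m) <+>\<^bsub>R\<^esub> PIdl (x [^] n)"
    and j: "j \<in> \<bb> <+>\<^bsub>R\<^esub> PIdl x"
  shows "i \<otimes> j \<in> ideal_power R \<bb> (Suc m) <+>\<^bsub>R\<^esub> PIdl (x [^] Suc n)"
proof -
  interpret cring R by (rule R)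
  note \<bb>I = ideal_power_ideal[OF R \<bb>]
  have principal: "ideal (PIdl (x [^] (n::nat))) R" for n by (rule cgenideal_ideal) (simp add: x)
  let ?B = "ideal_power R \<bb> (Suc m)" and ?X = "PIdl (x [^] Suc n)"
  interpret K: ideal "?B <+>\<^bsub>R\<^esub> ?X" R by (rule add_ideals[OF \<bb>I principal])
  obtain u p where up: "u \<in> \<bb>" "p \<in> PIdl x" "j = u \<oplus> p" using j unfolding set_add_iff by blast
  then obtain t where t: "t \<in> carrier R" "p = t \<otimes> x" unfolding cgenideal_def by blast
  obtain b c where bc: "b \<in> ideal_power R \<bb> m" "c \<in> ?X" "i = b \<oplus> c"
    using i unfolding set_add_iff by blast
  obtain b' c' where bc': "b' \<in> ?B" "c' \<in> PIdl (x [^] n)" "i = b' \<oplus> c'"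
    using i' unfolding set_add_iff by blast
  note mem = iR ideal.Icarr[OF \<bb> up(1)] ideal.Icarr[OF \<bb>I bc(1)] ideal.Icarr[OF principal bc(2)] ideal.Icarr[OF \<bb>I bc'(1)]
    ideal.Icarr[OF principal bc'(2)]
  have "b \<otimes> u \<in> ?B" unfolding ideal_power_Suc[OF R \<bb>] by (rule ideal_prod.prod[OF bc(1) up(1)])
  moreover have "c \<otimes> u \<in> ?X" by (rule ideal.I_r_closed[OF principal bc(2) mem(2)])
  moreover have "i \<otimes> u = b \<otimes> u \<oplus> c \<otimes> u" unfolding bc(3) by (rule l_distr) (use mem in auto)
  ultimately have iu: "i \<otimes> u \<in> ?B <+>\<^bsub>R\<^esub> ?X" unfolding set_add_iff by blast
  obtain s where s: "s \<in> carrier R" "c' = s \<otimes> x [^] n" using bc'(2) unfolding cgenideal_def by blast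
  have p: "p \<in> carrier R" unfolding t(2) by (rule m_closed[OF t(1) x])
  have "c' \<otimes> p = (s \<otimes> t) \<otimes> (x [^] n \<otimes> x)"
    unfolding s(2) t(2) using s(1) t(1) x by (simp add: m_assoc m_lcomm[of "x [^] n" t x])
  then have "c' \<otimes> p \<in> ?X" using s(1) t(1) unfolding cgenideal_def nat_pow_Suc by blast
  moreover have "b' \<otimes> p \<in> ?B" by (rule ideal.I_r_closed[OF \<bb>I bc'(1) p])
  moreover have "i \<otimes> p = b' \<otimes> p \<oplus> c' \<otimes> p" unfolding bc'(3) by (rule l_distr) (use mem p in auto)
  ultimately have "i \<otimes> p \<in> ?B <+>\<^bsub>R\<^esub> ?X" unfolding set_add_iff by blast
  with iu have "i \<otimes> u \<oplus> i \<otimes> p \<in> ?B <+>\<^bsub>R\<^esub> ?X" by (rule K.a_closed)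
  then show ?thesis using up(3) mem p by (simp add: r_distr)
qed

lemma ideal_power_add_subset:
  fixes R (structure)
  assumes R: "cring R" and \<aa>: "ideal \<aa> R" and \<bb>: "ideal \<bb> R" and x: "x \<in> carrier R"
    and cover: "\<aa> \<subseteq> \<bb> <+>\<^bsub>R\<^esub> PIdl x"
  shows "ideal_power R \<aa> (m + n) \<subseteq> ideal_power R \<bb> m <+>\<^bsub>R\<^esub> PIdl (x [^] (n::nat))"
proof -
  interpret cring R by (rule R)
  note \<bb>I = ideal_power_ideal[OF R \<bb>]
  have principal: "ideal (PIdl (x [^] (n::nat))) R" for n by (rule cgenideal_ideal) (simp add: x)
  have full: "ideal_power R \<aa> k \<subseteq> ideal_power R \<bb> m <+>\<^bsub>R\<^esub> PIdl (x [^] n)" if "m = 0 \<or> n = 0" for k m and n :: nat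
  proof -
    have "PIdl (x [^] (0::nat)) = carrier R" using cgenideal_self[OF one_closed] principal[of 0]
      by (simp add: ideal.one_imp_carrier)
    then show ?thesis
      using that ideal_subset_set_add[OF R \<bb>I[of m] principal[of n]] ideal_power_closed[OF R \<aa>] ideal_power_0[OF R \<bb>]
      by blast
  qed
  show ?thesis
  proof (induction m arbitrary: n)
    case 0
    show ?case by (rule full) simp
  next
    case (Suc m)
    note IH_m = Suc
    show ?case
    proof (induction n)
      case 0
      show ?case by (rule full) simp
    next
      case (Suc n)
      let ?B = "ideal_power R \<bb> (Suc m)" and ?X = "PIdl (x [^] Suc n)"
      interpret K: ideal "?B <+>\<^bsub>R\<^esub> ?X" R by (rule add_ideals[OF \<bb>I principal])
      have "i \<otimes> j \<in> ?B <+>\<^bsub>R\<^esub> ?X" if i: "i \<in> ideal_power R \<aa> (Suc (m + n))" and j: "j \<in> \<aa>" for i j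
        by (rule mult_mem_set_add_ideal_power[OF R \<bb> x ideal_power_closed[OF R \<aa> i] subsetD[OF IH_m[of "Suc n", unfolded add_Suc_right] i]
              subsetD[OF Suc[unfolded add_Suc] i] subsetD[OF cover j]])
      from ideal_prod_subsetI[OF K.ideal_axioms this] show ?case
        using ideal_power_Suc[OF R \<aa>, of "Suc (m + n)"] by (simp only: add_Suc add_Suc_right)
    qed
  qed
qed

lemma genideal_insert_subset:
  fixes R (structure)
  assumes R: "cring R" and A: "insert x A \<subseteq> carrier R"
  shows "Idl (insert x A) \<subseteq> Idl A <+>\<^bsub>R\<^esub> PIdl x"
proof -
  interpret cring R by (rule R)
  have I: "ideal (Idl A) R" "ideal (PIdl x) R" using A by (simp_all add: genideal_ideal cgenideal_ideal)
  show ?thesis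
    by (rule genideal_minimal[OF add_ideals[OF I]])
      (use ideal_subset_set_add[OF R I] genideal_self[of A] cgenideal_self[of x] A in blast)
qed

lemma ideal_power_subset_if_generators_nilpotent:
  fixes R (structure)
  assumes R: "cring R" and K: "ideal K R"
  shows "finite A ==> A \<subseteq> carrier R ==> (\<And>a. a \<in> A ==> \<exists>n. a [^] (n::nat) \<in> K) ==> \<exists>m. ideal_power R (Idl A) m \<subseteq> K"
proof (induction rule: finite_induct)
  case empty
  interpret cring R by (rule R)
  interpret K: ideal K R by (rule K)
  have "ideal_power R (Idl {}) (Suc 0) \<subseteq> Idl {}" using ideal_power_1[OF R genideal_ideal[of "{}"]] by simp
  also have "Idl {} \<subseteq> K" by (rule genideal_minimal[OF K]) simp
  finally show ?case by blast
next
  case (insert x A)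
  interpret cring R by (rule R)
  interpret K: ideal K R by (rule K)
  have x: "x \<in> carrier R" and I: "ideal (Idl A) R" "ideal (Idl (insert x A)) R" using insert.prems by (simp_all add: genideal_ideal)
  obtain m n where m: "ideal_power R (Idl A) m \<subseteq> K" and n: "x [^] (n::nat) \<in> K" using insert by (metis insert_iff insert_subset)
  have "ideal_power R (Idl (insert x A)) (m + n) \<subseteq> ideal_power R (Idl A) m <+>\<^bsub>R\<^esub> PIdl (x [^] n)"
    by (rule ideal_power_add_subset[OF R I(2,1) x genideal_insert_subset[OF R insert.prems(1)]])
  also have "\<dots> \<subseteq> K" using m cgenideal_minimal[OF K n] by (auto simp: set_add_iff intro!: K.a_closed)
  finally show ?case by blast
qed

subsection \<open>The Artin--Rees property\<close>

inductive_set smult_span :: "('a, 'm, 's) module_scheme => 'a set => 'm set => 'm set" for M I N where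
  zero: "\<zero>\<^bsub>M\<^esub> \<in> smult_span M I N"
| step: "y \<in> smult_span M I N ==> r \<in> I ==> x \<in> N ==> y \<oplus>\<^bsub>M\<^esub> r \<odot>\<^bsub>M\<^esub> x \<in> smult_span M I N"

lemma smult_span_mono: "I \<subseteq> I' ==> N \<subseteq> N' ==> smult_span M I N \<subseteq> smult_span M I' N'"
proof
  fix x assume "I \<subseteq> I'" "N \<subseteq> N'" "x \<in> smult_span M I N"
  from this(3,1,2) show "x \<in> smult_span M I' N'" by (induction) (auto intro: smult_span.intros)
qed

lemma smult_span_subsetI:
  assumes T: "submodule T R M" and smult: "\<And>r x. r \<in> I ==> x \<in> N ==> r \<odot>\<^bsub>M\<^esub> x \<in> T"
  shows "smult_span M I N \<subseteq> T"
proof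
  show "y \<in> T" if "y \<in> smult_span M I N" for y
    using that by induction (auto intro: submodule_zero_mem[OF T] submodule_add[OF T] smult)
qed

lemma smult_span_subset:
  assumes "submodule N R M" "I \<subseteq> carrier R"
  shows "smult_span M I N \<subseteq> N"
  by (rule smult_span_subsetI[OF assms(1)]) (use submodule_smult[OF assms(1)] assms(2) in blast)

context
  fixes R :: "('a, 'r) ring_scheme" and M :: "('a, 'm, 's) module_scheme" (structure) and I :: "'a set" and N :: "'m set"
  assumes M: "module R M" and I: "ideal I R" and N: "submodule N R M"
begin

interpretation module R M by (rule M)
interpretation I: ideal I R by (rule I)

lemma submodule_smult_span: "submodule (smult_span M I N) R M"
proof -
  have mem: "x \<in> carrier M" if "x \<in> smult_span M I N" for x
    using smult_span_subset[OF N, of I] I.Icarr submodule_mem_carrier[OF N] that by blast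
  note [simp] = submodule_mem_carrier[OF N]
  show ?thesis
  proof (rule submoduleI_no_inverse[OF M])
    show "smult_span M I N \<subseteq> carrier M" using mem by blast
    show "\<zero> \<in> smult_span M I N" by (rule smult_span.zero)
    fix y assume y: "y \<in> smult_span M I N"
    show "x \<oplus> y \<in> smult_span M I N" if "x \<in> smult_span M I N" for x using y
    proof induction
      case zero
      then show ?case using mem[OF that] that by simp
    next
      case (step y r z)
      then show ?case using smult_span.step[OF step.IH step(2,3)] mem[OF that] mem by (simp add: M.a_assoc)
    qed
    show "s \<odot> y \<in> smult_span M I N" if "s \<in> carrier R" for s using y
    proof induction
      case zero
      then show ?case using that by (simp add: smult_span.zero)
    next
      case (step y r z)
      then show ?case using smult_span.step[OF step.IH I.I_l_closed[OF step(2) that] step(3)] mem that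
        by (simp add: smult_r_distr smult_assoc1)
    qed
  qed
qed

lemma smult_mem_smult_span: "r \<in> I ==> x \<in> N ==> r \<odot> x \<in> smult_span M I N"
  using smult_span.step[OF smult_span.zero, of r I x N M] submodule_mem_carrier[OF N, of x] I.Icarr[of r] by simp

lemma smult_span_lincomb:
  assumes g: "generates R M N k g" and y: "y \<in> smult_span M I N"
  obtains c where "\<And>i. i < k ==> c i \<in> I" "y = lincomb M g c k"
proof -
  have gM: "\<And>i. i < k ==> g i \<in> carrier M" using g submodule_mem_carrier[OF N] by (auto simp: generates_def)
  from y have "\<exists>c. (\<forall>i<k. c i \<in> I) \<and> y = lincomb M g c k"
  proof induction
    case zero
    then show ?case using lincomb_zero_coeff[OF M gM] by (intro exI[of _ "\<lambda>_. \<zero>\<^bsub>R\<^esub>"]) auto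
  next
    case (step y r x)
    then obtain c where c: "\<forall>i<k. c i \<in> I" "y = lincomb M g c k" by blast
    obtain d where d: "\<And>i. i < k ==> d i \<in> carrier R" "x = lincomb M g d k" by (rule generatesE[OF g step(3)]) blast
    have r: "r \<in> carrier R" using step I.Icarr by blast
    have "y \<oplus> r \<odot> x = lincomb M g c k \<oplus> lincomb M g (\<lambda>i. r \<otimes>\<^bsub>R\<^esub> d i) k"
      using c d lincomb_smult_coeff[OF M gM d(1) r] by simp
    also have "\<dots> = lincomb M g (\<lambda>i. c i \<oplus>\<^bsub>R\<^esub> r \<otimes>\<^bsub>R\<^esub> d i) k"
      by (rule lincomb_add_coeff[OF M gM, symmetric]) (use c d r I.Icarr in auto)
    finally show ?case using c d step(2) I.I_r_closed by (intro exI[of _ "\<lambda>i. c i \<oplus>\<^bsub>R\<^esub> r \<otimes>\<^bsub>R\<^esub> d i"]) auto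
  qed
  then show ?thesis using that by blast
qed

end

lemma lincomb_mem_smult_span:
  "(\<And>i. i < k ==> c i \<in> I) ==> (\<And>i. i < k ==> g i \<in> N) ==> lincomb M g c k \<in> smult_span M I N"
  by (induction k) (auto intro: smult_span.intros)

lemma ideal_smult_eq_smult_span:
  assumes M: "module R M" and I: "ideal I R"
  shows "ideal_smult R I M = smult_span M I (carrier M)"
proof -
  note carr = module.carrier_is_submodule[OF M]
  have "smult_span M I (carrier M) \<subseteq> N"
    if "submodule N R M" "{r \<odot>\<^bsub>M\<^esub> x | r x. r \<in> I \<and> x \<in> carrier M} \<subseteq> N" for N
    by (rule smult_span_subsetI[OF that(1)]) (use that(2) in blast)
  then show ?thesis unfolding ideal_smult_def submodule_span_def
    using submodule_smult_span[OF M I carr] smult_mem_smult_span[OF M I carr] by auto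
qed

lemma linear_map_smult_span:
  assumes f: "linear_map R M N f" and "I \<subseteq> carrier R" "A \<subseteq> carrier M" "f ` A \<subseteq> B" "y \<in> smult_span M I A"
  shows "f y \<in> smult_span N I B"
proof -
  interpret M: module R M by (rule linear_map_module[OF f])
  from assms(5) have "y \<in> carrier M \<and> f y \<in> smult_span N I B"
  proof induction
    case zero
    then show ?case by (simp add: linear_map_zero[OF f] smult_span.zero)
  next
    case (step y r x)
    then have "x \<in> carrier M" "r \<in> carrier R" "f x \<in> B" using assms by auto
    then show ?case using step smult_span.step[of "f y" N I B r "f x"]
      by (simp add: linear_map_add[OF f] linear_map_smult[OF f])
  qed
  then show ?thesis by simp
qed

lemma smult_span_power_module_iff:
  assumes M: "module R M" and I: "ideal I R" and u: "u \<in> carrier (power_module M n)"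
  shows "u \<in> smult_span (power_module M n) I (carrier (power_module M n)) \<longleftrightarrow>
    (\<forall>j<n. u j \<in> smult_span M I (carrier M))"
proof
  interpret I: ideal I R by (rule I)
  let ?P = "power_module M n"
  note P = module_power_module[OF M]
  show "\<forall>j<n. u j \<in> smult_span M I (carrier M)" if "u \<in> smult_span ?P I (carrier ?P)"
    using linear_map_smult_span[OF linear_map_power_nth[OF M] _ _ _ that] power_module_nth(1) I.Icarr by blast
  assume mem: "\<forall>j<n. u j \<in> smult_span M I (carrier M)"
  show "u \<in> smult_span ?P I (carrier ?P)"
  proof (rule power_module_mem_submodule[OF M submodule_smult_span[OF P I module.carrier_is_submodule[OF P]] u])
    fix j assume "j < n"
    then show "power_inj M n j (u j) \<in> smult_span ?P I (carrier ?P)"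
      using linear_map_smult_span[OF linear_map_power_inj[OF M]] mem linear_map_closed[OF linear_map_power_inj[OF M]] I.Icarr
      by (metis image_subsetI subsetI)
  qed
qed

context
  fixes R :: "('a, 'r) ring_scheme" and M :: "('a, 'm, 's) module_scheme" (structure) and \<bb> :: "'a set" and N L :: "'m set"
  assumes NR: "noetherian_ring R" and M: "noetherian_module R M" and \<bb>: "ideal \<bb> R"
    and N: "submodule N R M" and L: "submodule L R M" and LN: "L \<subseteq> N"
begin

private lemmas MM = M[unfolded noetherian_module_def, THEN conjunct1]

interpretation module R M by (rule MM)

lemma power_smult_mem_maximal:
  assumes W: "submodule W R M" "smult_span M \<bb> N \<subseteq> W"
    and max: "\<And>V. submodule V R M ==> W \<subseteq> V ==> V \<inter> N \<subseteq> W ==> V = W"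
    and x: "x \<in> \<bb>"
  obtains k :: nat where "\<And>y. y \<in> carrier M ==> x [^]\<^bsub>R\<^esub> k \<odot> y \<in> W"
proof -
  interpret \<bb>: ideal \<bb> R by (rule \<bb>)
  have xR: "x \<in> carrier R" using x \<bb>.Icarr by blast
  obtain k where k: "\<forall>j. \<forall>y\<in>carrier M. x [^]\<^bsub>R\<^esub> (k + j) \<odot> y \<in> W --> x [^]\<^bsub>R\<^esub> (k::nat) \<odot> y \<in> W"
    using noetherian_module_colon_stabilizes[OF M W(1) xR] by blast
  let ?xM = "(\<lambda>y. x [^]\<^bsub>R\<^esub> k \<odot> y) ` carrier M"
  have xM: "submodule ?xM R M"
    by (rule submodule_image[OF linear_map_fun_smult[OF linear_map_ident[OF MM]] carrier_is_submodule]) (simp add: xR)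
  note sum = submodule_set_add[OF MM xM W(1)]
  have "(?xM <+>\<^bsub>M\<^esub> W) \<inter> N \<subseteq> W"
  proof
    fix u assume "u \<in> (?xM <+>\<^bsub>M\<^esub> W) \<inter> N"
    then obtain y w where u: "u \<in> N" "y \<in> carrier M" "w \<in> W" "u = x [^]\<^bsub>R\<^esub> k \<odot> y \<oplus> w" by (auto simp: set_add_iff)
    have w: "w \<in> carrier M" using u submodule_mem_carrier[OF W(1)] by blast
    have "x \<odot> u \<in> W" using smult_mem_smult_span[OF MM \<bb> N x u(1)] W(2) by blast
    moreover have "x [^]\<^bsub>R\<^esub> (k + 1) \<odot> y = x \<odot> u \<ominus> x \<odot> w"
      using u w xR minus_cancel(4)[OF MM, of "x \<odot> (x [^]\<^bsub>R\<^esub> k \<odot> y)" "x \<odot> w"]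
      by (simp add: smult_r_distr smult_assoc1[symmetric] m_comm)
    ultimately have "x [^]\<^bsub>R\<^esub> (k + 1) \<odot> y \<in> W" using submodule_minus[OF W(1)] submodule_smult[OF W(1) xR u(3)] by simp
    then have "x [^]\<^bsub>R\<^esub> k \<odot> y \<in> W" using k u(2) by blast
    then show "u \<in> W" using u submodule_add[OF W(1)] by simp
  qed
  then have "?xM <+>\<^bsub>M\<^esub> W = W" by (rule max[OF sum(1,3)])
  then show ?thesis using that[of k] sum(2) by blast
qed

text \<open>Take \<open>W\<close> maximal with \<open>W \<inter> N = \<bb>N + L\<close>; maximality forces a power of every element of \<open>\<bb>\<close>
  to map \<open>M\<close> into \<open>W\<close>.\<close>

lemma weak_artin_rees_first_power:
  obtains m where "N \<inter> (smult_span M (ideal_power R \<bb> m) (carrier M) <+>\<^bsub>M\<^esub> L) \<subseteq> smult_span M \<bb> N <+>\<^bsub>M\<^esub> L"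
proof -
  note sum = submodule_set_add[OF MM submodule_smult_span[OF MM \<bb> N] L]
  let ?B = "smult_span M \<bb> N <+>\<^bsub>M\<^esub> L" and ?\<S> = "{W. submodule W R M \<and> smult_span M \<bb> N <+>\<^bsub>M\<^esub> L \<subseteq> W \<and> W \<inter> N \<subseteq> smult_span M \<bb> N <+>\<^bsub>M\<^esub> L}"
  obtain W where W: "submodule W R M" "?B \<subseteq> W" "W \<inter> N \<subseteq> ?B" and max: "\<forall>V\<in>?\<S>. W \<subseteq> V --> V = W"
    using noetherian_module_has_maximal[OF M, of ?\<S> ?B] sum(1) by auto
  have "V = W" if V: "submodule V R M" "W \<subseteq> V" "V \<inter> N \<subseteq> W" for V
  proof -
    have "V \<inter> N \<subseteq> ?B" using V(3) W(3) by blast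
    then show ?thesis using V(1,2) W(2) max by blast
  qed
  note absorb = power_smult_mem_maximal[OF W(1) subset_trans[OF sum(2) W(2)] this]
  have pow: "\<exists>k::nat. \<forall>y\<in>carrier M. x [^]\<^bsub>R\<^esub> k \<odot> y \<in> W" if "x \<in> \<bb>" for x by (rule absorb[OF _ _ _ that]) blast+
  define K where "K = {r \<in> carrier R. \<forall>y\<in>carrier M. r \<odot> y \<in> W}"
  have "submodule K R (ring_as_module R)"
    by (rule submoduleI_no_inverse[OF module_ring_as_module[OF is_cring]])
      (auto simp: K_def smult_l_distr smult_assoc1 submodule_zero_mem[OF W(1)]
        intro: submodule_add[OF W(1)] submodule_smult[OF W(1)])
  then have K: "ideal K R" using ideal_iff_submodule[OF is_cring] by blast
  obtain A where A: "A \<subseteq> carrier R" "finite A" "\<bb> = Idl\<^bsub>R\<^esub> A" using noetherian_ring.finetely_gen[OF NR \<bb>] by auto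
  have "\<exists>n::nat. a [^]\<^bsub>R\<^esub> n \<in> K" if "a \<in> A" for a using that pow[of a] A genideal_self[OF A(1)] unfolding K_def by auto
  from ideal_power_subset_if_generators_nilpotent[OF is_cring K A(2,1) this]
  obtain m where "ideal_power R \<bb> m \<subseteq> K" using A(3) by blast
  then have "smult_span M (ideal_power R \<bb> m) (carrier M) \<subseteq> W"
    by (intro smult_span_subsetI[OF W(1)]) (auto simp: K_def)
  then have "smult_span M (ideal_power R \<bb> m) (carrier M) <+>\<^bsub>M\<^esub> L \<subseteq> W"
    using subset_trans[OF sum(3) W(2)] by (auto simp: set_add_iff subset_iff intro!: submodule_add[OF W(1)])
  then show ?thesis using that[of m] W(3) by blast
qed

end

lemma weak_artin_rees:
  assumes "noetherian_ring R" "noetherian_module R M" and \<aa>: "ideal \<aa> R"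
    and "submodule N R M" "submodule L R M" "L \<subseteq> N"
  obtains m where "N \<inter> (smult_span M (ideal_power R \<aa> m) (carrier M) <+>\<^bsub>M\<^esub> L)
    \<subseteq> smult_span M (ideal_power R \<aa> n) N <+>\<^bsub>M\<^esub> L"
proof -
  have R: "cring R" using assms(2) by (auto simp: noetherian_module_def module_def)
  from weak_artin_rees_first_power[OF assms(1,2) ideal_power_ideal[OF R \<aa>] assms(4-6)] obtain m where
    "N \<inter> (smult_span M (ideal_power R (ideal_power R \<aa> n) m) (carrier M) <+>\<^bsub>M\<^esub> L)
      \<subseteq> smult_span M (ideal_power R \<aa> n) N <+>\<^bsub>M\<^esub> L" by blast
  then show ?thesis using that[of "n * m"] unfolding ideal_power_mult[OF R \<aa>] by blast
qed

subsection \<open>Resolutions of cyclic modules\<close>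

abbreviation chain_mod :: "('a, 'r) ring_scheme => ('a, 'n) free_res => nat => ('a, nat => 'a) module" where
  "chain_mod R F i \<equiv> free_module R (res_rank F i)"

abbreviation chain_set :: "('a, 'r) ring_scheme => ('a, 'n) free_res => nat => (nat => 'a) set" where
  "chain_set R F i \<equiv> carrier (chain_mod R F i)"

text \<open>The augmentation takes values in \<open>R\<close> rather than \<open>R/J\<close>, so that the cycles of degree \<open>0\<close> are
  the chains with augmentation in \<open>J\<close>.\<close>

definition cycles :: "('a, 'r) ring_scheme => 'a set => ('a, 'a) free_res => nat => (nat => 'a) set" where
  "cycles R J F i = {x \<in> chain_set R F i.
     case i of 0 => res_aug F x \<in> J | Suc j => res_diff F j x = \<zero>\<^bsub>chain_mod R F j\<^esub>}"

definition resolves :: "('a, 'r) ring_scheme => 'a set => ('a, 'a) free_res => bool" where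
  "resolves R J F \<longleftrightarrow>
     (\<forall>i. linear_map R (chain_mod R F (Suc i)) (chain_mod R F i) (res_diff F i)) \<and>
     linear_map R (chain_mod R F 0) (ring_as_module R) (res_aug F) \<and>
     (\<exists>u\<in>chain_set R F 0. res_aug F u \<ominus>\<^bsub>R\<^esub> \<one>\<^bsub>R\<^esub> \<in> J) \<and>
     (\<forall>i. res_diff F i ` chain_set R F (Suc i) = cycles R J F i)"

definition chain_map ::
    "('a, 'r) ring_scheme => ('a, 'n) free_res => ('a, 'k) free_res => (nat => (nat => 'a) => (nat => 'a)) => bool" where
  "chain_map R F G \<phi> \<longleftrightarrow>
     (\<forall>i. linear_map R (chain_mod R F i) (chain_mod R G i) (\<phi> i)) \<and>
     (\<forall>i. \<forall>x\<in>chain_set R F (Suc i). res_diff G i (\<phi> (Suc i) x) = \<phi> i (res_diff F i x))"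

definition chain_lift ::
    "('a, 'r) ring_scheme => ('a, 'a) free_res => ('a, 'a) free_res => 'a set => (nat => (nat => 'a) => (nat => 'a)) => bool" where
  "chain_lift R F G J \<phi> \<longleftrightarrow>
     chain_map R F G \<phi> \<and> (\<forall>x\<in>chain_set R F 0. res_aug G (\<phi> 0 x) \<ominus>\<^bsub>R\<^esub> res_aug F x \<in> J)"

lemma chain_map_linear: "chain_map R F G \<phi> ==> linear_map R (chain_mod R F i) (chain_mod R G i) (\<phi> i)"
  and chain_map_commute:
    "chain_map R F G \<phi> ==> x \<in> chain_set R F (Suc i) ==> res_diff G i (\<phi> (Suc i) x) = \<phi> i (res_diff F i x)"
  by (auto simp: chain_map_def)

lemma chain_lift_chain_map: "chain_lift R F G J \<phi> ==> chain_map R F G \<phi>"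
  and chain_lift_linear: "chain_lift R F G J \<phi> ==> linear_map R (chain_mod R F i) (chain_mod R G i) (\<phi> i)"
  and chain_lift_aug: "chain_lift R F G J \<phi> ==> x \<in> chain_set R F 0 ==> res_aug G (\<phi> 0 x) \<ominus>\<^bsub>R\<^esub> res_aug F x \<in> J"
  by (auto simp: chain_map_def chain_lift_def)

lemma chain_map_comp:
  "chain_map R F G \<phi> ==> chain_map R G H \<psi> ==> chain_map R F H (\<lambda>i x. \<psi> i (\<phi> i x))"
  unfolding chain_map_def by (metis linear_map_comp linear_map_closed)

context
  fixes R :: "('a, 'r) ring_scheme" (structure) and J :: "'a set" and F :: "('a, 'a) free_res"
  assumes F: "resolves R J F"
begin

lemma resolves_diff: "linear_map R (chain_mod R F (Suc i)) (chain_mod R F i) (res_diff F i)"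
  and resolves_aug: "linear_map R (chain_mod R F 0) (ring_as_module R) (res_aug F)"
  using F by (auto simp: resolves_def)

lemma resolves_unit: obtains u where "u \<in> chain_set R F 0" "res_aug F u \<ominus> \<one> \<in> J"
  using F by (auto simp: resolves_def)

lemma resolves_image: "res_diff F i ` chain_set R F (Suc i) = cycles R J F i"
  using F by (auto simp: resolves_def)

lemma resolves_cring: "cring R"
  using linear_map_module(1)[OF resolves_aug] by (simp add: module_def)

interpretation cring R by (rule resolves_cring)

lemma resolves_aug_closed: "x \<in> chain_set R F 0 ==> res_aug F x \<in> carrier R"
  using linear_map_closed[OF resolves_aug] by simp

lemma resolves_diff_mem_cycles: "x \<in> chain_set R F (Suc i) ==> res_diff F i x \<in> cycles R J F i"
  using resolves_image by blast

lemma resolves_diff_diff: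
  "x \<in> chain_set R F (Suc (Suc i)) ==> res_diff F i (res_diff F (Suc i) x) = \<zero>\<^bsub>chain_mod R F i\<^esub>"
  using resolves_diff_mem_cycles[of x "Suc i"] by (simp add: cycles_def)

lemma resolves_aug_diff: "x \<in> chain_set R F (Suc 0) ==> res_aug F (res_diff F 0 x) \<in> J"
  using resolves_diff_mem_cycles[of x 0] by (simp add: cycles_def)

lemma resolves_lift_cycles:
  assumes f: "linear_map R (free_module R n) (chain_mod R F i) f"
    and "\<And>x. x \<in> carrier (free_module R n) ==> f x \<in> cycles R J F i"
  obtains g where "linear_map R (free_module R n) (chain_mod R F (Suc i)) g"
    "\<And>x. x \<in> carrier (free_module R n) ==> f x = res_diff F i (g x)"
proof (rule linear_map_lift[OF resolves_diff f _ that])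
  show "\<exists>y\<in>chain_set R F (Suc i). f x = res_diff F i y" if "x \<in> carrier (free_module R n)" for x
    using assms(2)[OF that] unfolding resolves_image[symmetric] by blast
qed

lemma resolves_unit_smult:
  assumes "ideal J R" "u \<in> chain_set R F 0" "res_aug F u \<ominus> \<one> \<in> J" "r \<in> carrier R"
  shows "res_aug F (r \<odot>\<^bsub>chain_mod R F 0\<^esub> u) \<ominus> r \<in> J"
proof -
  interpret J: ideal J R by fact
  have "res_aug F (r \<odot>\<^bsub>chain_mod R F 0\<^esub> u) \<ominus> r = r \<otimes> (res_aug F u \<ominus> \<one>)"
    using resolves_aug_closed[OF assms(2)] assms(4) linear_map_smult[OF resolves_aug assms(4,2)]
    by (simp add: a_minus_def r_distr r_minus)
  then show ?thesis using J.I_l_closed[OF assms(3,4)] by simp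
qed

lemma resolves_lift_aug:
  assumes J: "ideal J R" and f: "linear_map R (free_module R n) (ring_as_module R) f"
  obtains g where "linear_map R (free_module R n) (chain_mod R F 0) g"
    "\<And>x. x \<in> carrier (free_module R n) ==> res_aug F (g x) \<ominus> f x \<in> J"
proof -
  obtain u where u: "u \<in> chain_set R F 0" "res_aug F u \<ominus> \<one> \<in> J" by (rule resolves_unit)
  show ?thesis
    by (rule that[OF linear_map_smult_const[OF f module_free_module[OF resolves_cring] u(1)]])
      (use resolves_unit_smult[OF J u] linear_map_closed[OF f] in simp)
qed

end

lemma resolution_exists:
  fixes R (structure)
  assumes R: "cring R" and NR: "noetherian_ring R" and J: "ideal J R"
  obtains F where "resolves R J F"
proof -
  interpret cring R by (rule R)
  note FR = module_free_module[OF R] and carr = module.carrier_is_submodule[OF module_free_module[OF R]]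
  let ?e = "\<lambda>x::nat => 'a. x 0"
  let ?K0 = "{x \<in> carrier (free_module R 1). ?e x \<in> J}"
  have e: "linear_map R (free_module R 1) (ring_as_module R) ?e"
    unfolding free_module_eq_power by (rule linear_map_power_nth[OF module_ring_as_module[OF R]]) simp
  have K0: "submodule ?K0 R (free_module R 1)"
    by (rule submodule_vimage[OF e carr ideal_iff_submodule[OF R, THEN iffD1, OF J]])
  define K where "K a b D = {x \<in> carrier (free_module R b). D x \<in> {\<zero>\<^bsub>free_module R a\<^esub>}}" for a b and D :: "(nat => 'a) => (nat => 'a)"
  define P where "P i = (\<lambda>(a, b, D). linear_map R (free_module R b) (free_module R a) D \<and>
      (i = 0 --> a = 1 \<and> D ` carrier (free_module R b) = ?K0))" for i :: nat
  define Q where "Q = (\<lambda>(a, b, D) (a', b', D'). a' = b \<and> D' ` carrier (free_module R b') = K a b D)"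
  have "\<exists>s. \<forall>i. P i (s i) \<and> Q (s i) (s (Suc i))"
  proof (rule dependent_nat_choice)
    obtain b D where "linear_map R (free_module R b) (free_module R 1) D" "D ` carrier (free_module R b) = ?K0"
      by (rule submodule_is_image_of_free[OF R NR K0]) blast
    then show "\<exists>s. P 0 s" unfolding P_def by (intro exI[of _ "(1, b, D)"]) simp
  next
    fix s i assume "P i s"
    moreover obtain a b D where s: "s = (a, b, D)" by (cases s) auto
    ultimately have D: "linear_map R (free_module R b) (free_module R a) D" by (auto simp: P_def)
    obtain b' D' where "linear_map R (free_module R b') (free_module R b) D'" "D' ` carrier (free_module R b') = K a b D"
      unfolding K_def by (rule submodule_is_image_of_free[OF R NR submodule_vimage[OF D carr submodule_singleton_zero[OF FR]]]) blast
    then show "\<exists>s'. P (Suc i) s' \<and> Q s s'" unfolding P_def Q_def s by (intro exI[of _ "(b, b', D')"]) simp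
  qed
  then obtain s where s: "\<And>i. P i (s i)" "\<And>i. Q (s i) (s (Suc i))" by blast
  define F where "F = \<lparr>res_rank = \<lambda>i. fst (s i), res_diff = \<lambda>i. snd (snd (s i)), res_aug = ?e\<rparr>"
  have s_eq: "s i = (res_rank F i, res_rank F (Suc i), res_diff F i)" for i
    using s(2)[of i] unfolding Q_def F_def by (auto split: prod.splits)
  have diff: "linear_map R (chain_mod R F (Suc i)) (chain_mod R F i) (res_diff F i)" for i
    using s(1)[of i] unfolding P_def s_eq by simp
  have rank: "res_rank F 0 = 1" and image_0: "res_diff F 0 ` chain_set R F (Suc 0) = ?K0"
    using s(1)[of 0] unfolding P_def s_eq by auto
  have image: "res_diff F i ` chain_set R F (Suc i) = cycles R J F i" for i
  proof (cases i)
    case 0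
    then show ?thesis using image_0 rank by (simp add: cycles_def F_def)
  next
    case (Suc j)
    then show ?thesis using s(2)[of j] unfolding Q_def K_def s_eq by (simp add: cycles_def)
  qed
  have "std_basis R 1 0 0 \<ominus> \<one> \<in> J"
    using additive_subgroup.zero_closed[OF ideal.axioms(1)[OF J]] by (simp add: std_basis_def power_inj_def a_minus_def r_neg)
  then have "\<exists>u\<in>chain_set R F 0. res_aug F u \<ominus> \<one> \<in> J"
    unfolding rank using std_basis_closed[OF R, of 1 0] by (auto simp: F_def)
  moreover have "linear_map R (chain_mod R F 0) (ring_as_module R) (res_aug F)" unfolding rank using e by (simp add: F_def)
  ultimately show ?thesis using that[of F] diff image unfolding resolves_def by blast
qed

lemma chain_lift_exists:
  assumes F: "resolves R I F" and G: "resolves R J G" and IJ: "I \<subseteq> J" and J: "ideal J R"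
  obtains \<phi> where "chain_lift R F G J \<phi>"
proof -
  note R = resolves_cring[OF F] and dF = resolves_diff[OF F]
  have J': "submodule J R (ring_as_module R)" using J ideal_iff_submodule[OF R] by blast
  define P where "P i \<phi> \<longleftrightarrow> linear_map R (chain_mod R F i) (chain_mod R G i) \<phi> \<and>
      (\<forall>x\<in>chain_set R F (Suc i). \<phi> (res_diff F i x) \<in> cycles R J G i) \<and>
      (i = 0 --> (\<forall>x\<in>chain_set R F 0. res_aug G (\<phi> x) \<ominus>\<^bsub>R\<^esub> res_aug F x \<in> J))" for i \<phi>
  define Q where "Q i \<phi> \<psi> \<longleftrightarrow> (\<forall>x\<in>chain_set R F (Suc i). \<phi> (res_diff F i x) = res_diff G i (\<psi> x))" for i \<phi> \<psi>
  have "\<exists>\<phi>. \<forall>i. P i (\<phi> i) \<and> Q i (\<phi> i) (\<phi> (Suc i))"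
  proof (rule dependent_nat_choice)
    obtain \<phi> where \<phi>: "linear_map R (chain_mod R F 0) (chain_mod R G 0) \<phi>"
      "\<And>x. x \<in> chain_set R F 0 ==> res_aug G (\<phi> x) \<ominus>\<^bsub>R\<^esub> res_aug F x \<in> J"
      by (rule resolves_lift_aug[OF G J resolves_aug[OF F]]) blast
    have "\<phi> (res_diff F 0 x) \<in> cycles R J G 0" if x: "x \<in> chain_set R F (Suc 0)" for x
    proof -
      note dx = linear_map_closed[OF dF x]
      have "res_aug F (res_diff F 0 x) \<in> J" using resolves_aug_diff[OF F x] IJ by blast
      then have "res_aug G (\<phi> (res_diff F 0 x)) \<in> J"
        using mem_if_diff_mem[OF module_ring_as_module[OF R] J', of "res_aug G (\<phi> (res_diff F 0 x))"]
          \<phi>(2)[OF dx] resolves_aug_closed[OF G linear_map_closed[OF \<phi>(1) dx]] by simp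
      then show ?thesis using linear_map_closed[OF \<phi>(1) dx] by (simp add: cycles_def)
    qed
    then show "\<exists>\<phi>. P 0 \<phi>" unfolding P_def using \<phi> by blast
  next
    fix \<phi> i assume P: "P i \<phi>"
    then have \<phi>: "linear_map R (chain_mod R F i) (chain_mod R G i) \<phi>" by (simp add: P_def)
    have "\<phi> (res_diff F i x) \<in> cycles R J G i" if "x \<in> chain_set R F (Suc i)" for x
      using P that by (simp add: P_def)
    from resolves_lift_cycles[OF G linear_map_comp[OF dF \<phi>] this] obtain \<psi> where \<psi>: "linear_map R (chain_mod R F (Suc i)) (chain_mod R G (Suc i)) \<psi>"
      "\<And>x. x \<in> chain_set R F (Suc i) ==> \<phi> (res_diff F i x) = res_diff G i (\<psi> x)"
      by blast
    have "\<psi> (res_diff F (Suc i) x) \<in> cycles R J G (Suc i)" if x: "x \<in> chain_set R F (Suc (Suc i))" for x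
      using \<psi>(2)[OF linear_map_closed[OF dF x], symmetric] resolves_diff_diff[OF F x] linear_map_zero[OF \<phi>]
        linear_map_closed[OF \<psi>(1) linear_map_closed[OF dF x]] by (simp add: cycles_def)
    then show "\<exists>\<psi>. P (Suc i) \<psi> \<and> Q i \<phi> \<psi>" unfolding P_def Q_def using \<psi> by auto
  qed
  then obtain \<phi> where \<phi>: "\<And>i. P i (\<phi> i)" "\<And>i. Q i (\<phi> i) (\<phi> (Suc i))" by blast
  then show ?thesis using that[of \<phi>] unfolding chain_lift_def chain_map_def P_def Q_def by metis
qed

lemma null_homotopy_step:
  assumes F: "resolves R I F" and G: "resolves R J G" and \<phi>: "chain_map R F G \<phi>"
    and h: "linear_map R (chain_mod R F i) (chain_mod R G (Suc i)) h"
    and eq: "\<And>x. x \<in> chain_set R F (Suc i) ==> \<phi> i (res_diff F i x) = res_diff G i (h (res_diff F i x))"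
  obtains h' where "linear_map R (chain_mod R F (Suc i)) (chain_mod R G (Suc (Suc i))) h'"
    "\<And>x. x \<in> chain_set R F (Suc i) ==>
      \<phi> (Suc i) x = res_diff G (Suc i) (h' x) \<oplus>\<^bsub>chain_mod R G (Suc i)\<^esub> h (res_diff F i x)"
    "\<And>x. x \<in> chain_set R F (Suc (Suc i)) ==>
      \<phi> (Suc i) (res_diff F (Suc i) x) = res_diff G (Suc i) (h' (res_diff F (Suc i) x))"
proof -
  note FR = module_free_module[OF resolves_cring[OF F]] and dF = resolves_diff[OF F] and dG = resolves_diff[OF G]
    and \<phi>l = chain_map_linear[OF \<phi>]
  note hd = linear_map_comp[OF dF h]
  let ?f = "\<lambda>x. \<phi> (Suc i) x \<ominus>\<^bsub>chain_mod R G (Suc i)\<^esub> h (res_diff F i x)"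
  have f: "linear_map R (chain_mod R F (Suc i)) (chain_mod R G (Suc i)) ?f" by (rule linear_map_fun_minus[OF \<phi>l hd])
  have "?f x \<in> cycles R J G (Suc i)" if x: "x \<in> chain_set R F (Suc i)" for x
  proof -
    have "res_diff G i (?f x) = res_diff G i (\<phi> (Suc i) x) \<ominus>\<^bsub>chain_mod R G i\<^esub> res_diff G i (h (res_diff F i x))"
      by (rule linear_map_minus[OF dG linear_map_closed[OF \<phi>l x] linear_map_closed[OF hd x]])
    also have "\<dots> = \<zero>\<^bsub>chain_mod R G i\<^esub>"
      using eq x chain_map_commute[OF \<phi> x] minus_eq_zero_iff[OF FR] linear_map_closed[OF dG linear_map_closed[OF hd x]]
      by simp
    finally show ?thesis using linear_map_closed[OF f x] by (simp add: cycles_def)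
  qed
  from resolves_lift_cycles[OF G f this] obtain h' where h': "linear_map R (chain_mod R F (Suc i)) (chain_mod R G (Suc (Suc i))) h'"
    "\<And>x. x \<in> chain_set R F (Suc i) ==> ?f x = res_diff G (Suc i) (h' x)"
    by blast
  have decomp: "\<phi> (Suc i) x = res_diff G (Suc i) (h' x) \<oplus>\<^bsub>chain_mod R G (Suc i)\<^esub> h (res_diff F i x)"
    if x: "x \<in> chain_set R F (Suc i)" for x
    using h'(2)[OF x] minus_cancel(1)[OF FR linear_map_closed[OF \<phi>l x] linear_map_closed[OF hd x]] by simp
  have "\<phi> (Suc i) (res_diff F (Suc i) x) = res_diff G (Suc i) (h' (res_diff F (Suc i) x))"
    if x: "x \<in> chain_set R F (Suc (Suc i))" for x
  proof -
    interpret G: module R "chain_mod R G (Suc i)" by (rule FR)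
    note dx = linear_map_closed[OF dF x]
    show ?thesis
      using decomp[OF dx] resolves_diff_diff[OF F x] linear_map_zero[OF h] linear_map_closed[OF dG linear_map_closed[OF h'(1) dx]]
      by simp
  qed
  from that[OF h'(1) decomp this] show ?thesis .
qed

lemma null_homotopy:
  assumes F: "resolves R I F" and G: "resolves R J G" and \<phi>: "chain_map R F G \<phi>"
    and \<phi>0: "\<And>x. x \<in> chain_set R F 0 ==> res_aug G (\<phi> 0 x) \<in> J"
  obtains h where "\<And>i. linear_map R (chain_mod R F i) (chain_mod R G (Suc i)) (h i)"
    "\<And>x. x \<in> chain_set R F 0 ==> \<phi> 0 x = res_diff G 0 (h 0 x)"
    "\<And>i x. x \<in> chain_set R F (Suc i) ==>
      \<phi> (Suc i) x = res_diff G (Suc i) (h (Suc i) x) \<oplus>\<^bsub>chain_mod R G (Suc i)\<^esub> h i (res_diff F i x)"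
proof -
  note dF = resolves_diff[OF F] and \<phi>l = chain_map_linear[OF \<phi>]
  define P where "P i h \<longleftrightarrow> linear_map R (chain_mod R F i) (chain_mod R G (Suc i)) h \<and>
      (i = 0 --> (\<forall>x\<in>chain_set R F 0. \<phi> 0 x = res_diff G 0 (h x))) \<and>
      (\<forall>x\<in>chain_set R F (Suc i). \<phi> i (res_diff F i x) = res_diff G i (h (res_diff F i x)))" for i h
  define Q where "Q i h h' \<longleftrightarrow> (\<forall>x\<in>chain_set R F (Suc i).
      \<phi> (Suc i) x = res_diff G (Suc i) (h' x) \<oplus>\<^bsub>chain_mod R G (Suc i)\<^esub> h (res_diff F i x))" for i h h'
  have "\<exists>h. \<forall>i. P i (h i) \<and> Q i (h i) (h (Suc i))"
  proof (rule dependent_nat_choice)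
    have "\<phi> 0 x \<in> cycles R J G 0" if "x \<in> chain_set R F 0" for x
      using \<phi>0[OF that] linear_map_closed[OF \<phi>l that] by (simp add: cycles_def)
    from resolves_lift_cycles[OF G \<phi>l this] obtain h where "linear_map R (chain_mod R F 0) (chain_mod R G (Suc 0)) h"
      "\<And>x. x \<in> chain_set R F 0 ==> \<phi> 0 x = res_diff G 0 (h x)"
      by blast
    then show "\<exists>h. P 0 h" unfolding P_def using linear_map_closed[OF dF] by blast
  next
    fix h i assume P: "P i h"
    then have h: "linear_map R (chain_mod R F i) (chain_mod R G (Suc i)) h" by (simp add: P_def)
    from P have "\<And>x. x \<in> chain_set R F (Suc i) ==> \<phi> i (res_diff F i x) = res_diff G i (h (res_diff F i x))"
      by (simp add: P_def)
    from null_homotopy_step[OF F G \<phi> h this] show "\<exists>h'. P (Suc i) h' \<and> Q i h h'" unfolding P_def Q_def by auto metis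
  qed
  then obtain h where "\<And>i. P i (h i)" "\<And>i. Q i (h i) (h (Suc i))" by blast
  then show ?thesis using that[of h] unfolding P_def Q_def by blast
qed

lemma chain_lift_comp:
  assumes F: "resolves R I F" and G: "resolves R I' G" and H: "resolves R I'' H" and IJ: "K \<subseteq> J" and J: "ideal J R"
    and \<phi>: "chain_lift R F G K \<phi>" and \<psi>: "chain_lift R G H J \<psi>"
  shows "chain_lift R F H J (\<lambda>i x. \<psi> i (\<phi> i x))"
  unfolding chain_lift_def
proof (intro conjI ballI chain_map_comp[OF chain_lift_chain_map[OF \<phi>] chain_lift_chain_map[OF \<psi>]])
  note R = resolves_cring[OF F]
  have J': "submodule J R (ring_as_module R)" using J ideal_iff_submodule[OF R] by blast
  fix x assume x: "x \<in> chain_set R F 0"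
  note \<phi>x = linear_map_closed[OF chain_lift_linear[OF \<phi>] x] and \<psi>\<phi>x = linear_map_closed[OF linear_map_comp[OF chain_lift_linear[OF \<phi>] chain_lift_linear[OF \<psi>]] x]
  have "res_aug G (\<phi> 0 x) \<ominus>\<^bsub>R\<^esub> res_aug F x \<in> J" using chain_lift_aug[OF \<phi> x] IJ by blast
  then show "res_aug H (\<psi> 0 (\<phi> 0 x)) \<ominus>\<^bsub>R\<^esub> res_aug F x \<in> J"
    using diff_mem_trans[OF module_ring_as_module[OF R] J', of "res_aug H (\<psi> 0 (\<phi> 0 x))" "res_aug G (\<phi> 0 x)" "res_aug F x"]
      chain_lift_aug[OF \<psi> \<phi>x] resolves_aug_closed[OF F x] resolves_aug_closed[OF G \<phi>x] resolves_aug_closed[OF H \<psi>\<phi>x] by simp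
qed

subsection \<open>Cocycles relative to a submodule\<close>

definition rel_cocycle ::
    "('a, 'r) ring_scheme => ('a, 'n) free_res => ('a, 'm, 's) module_scheme => 'm set => 'm set => nat
      => ((nat => 'a) => 'm) => bool" where
  "rel_cocycle R F X N L k f \<longleftrightarrow>
     linear_map R (chain_mod R F k) X f \<and> (\<forall>x\<in>chain_set R F k. f x \<in> N) \<and>
     (\<forall>x\<in>chain_set R F (Suc k). f (res_diff F k x) \<in> L)"

definition rel_coboundary ::
    "('a, 'r) ring_scheme => ('a, 'n) free_res => ('a, 'm, 's) module_scheme => 'm set => 'm set => nat
      => ((nat => 'a) => 'm) => bool" where
  "rel_coboundary R F X N L k f \<longleftrightarrow>
     linear_map R (chain_mod R F k) X f \<and>
     (case k of 0 => \<forall>x\<in>chain_set R F 0. f x \<in> L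
      | Suc j => \<exists>g. linear_map R (chain_mod R F j) X g \<and> (\<forall>x\<in>chain_set R F j. g x \<in> N) \<and>
          (\<forall>x\<in>chain_set R F (Suc j). f x \<ominus>\<^bsub>X\<^esub> g (res_diff F j x) \<in> L))"

text \<open>\<open>vanishes R \<aa> X N L k\<close> expresses \<open>H\<^sup>k\<^sub>\<aa>(N/L) = 0\<close> for submodules \<open>L \<subseteq> N\<close> of \<open>X\<close>, without
  forming the quotient.\<close>

definition vanishes ::
    "('a, 'r) ring_scheme => 'a set => ('a, 'm, 's) module_scheme => 'm set => 'm set => nat => bool" where
  "vanishes R \<aa> X N L k \<longleftrightarrow>
     (\<forall>n F f. resolves R (ideal_power R \<aa> n) F --> rel_cocycle R F X N L k f -->
        (\<exists>m0\<ge>n. \<forall>m\<ge>m0. \<forall>G \<phi>. resolves R (ideal_power R \<aa> m) G -->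
           chain_lift R G F (ideal_power R \<aa> n) \<phi> --> rel_coboundary R G X N L k (\<lambda>x. f (\<phi> k x))))"

definition resolution_tower ::
    "('a, 'r) ring_scheme => 'a set => (nat => ('a, 'a) free_res)
      => (nat => nat => nat => (nat => 'a) => (nat => 'a)) => bool" where
  "resolution_tower R \<aa> F \<phi> \<longleftrightarrow>
     (\<forall>n. resolves R (ideal_power R \<aa> n) (F n)) \<and>
     (\<forall>m n. n \<le> m --> chain_lift R (F m) (F n) (ideal_power R \<aa> n) (\<phi> m n))"

lemma rel_cocycle_linear: "rel_cocycle R F X N L k f ==> linear_map R (chain_mod R F k) X f"
  and rel_cocycle_mem: "rel_cocycle R F X N L k f ==> x \<in> chain_set R F k ==> f x \<in> N"
  and rel_cocycle_diff: "rel_cocycle R F X N L k f ==> y \<in> chain_set R F (Suc k) ==> f (res_diff F k y) \<in> L"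
  by (auto simp: rel_cocycle_def)

lemma rel_coboundary_linear: "rel_coboundary R F X N L k f ==> linear_map R (chain_mod R F k) X f"
  by (auto simp: rel_coboundary_def)

lemma rel_coboundary_0:
  "rel_coboundary R F X N L 0 f \<longleftrightarrow>
     linear_map R (chain_mod R F 0) X f \<and> (\<forall>x\<in>chain_set R F 0. f x \<in> L)"
  by (simp add: rel_coboundary_def)

lemma rel_coboundary_SucI:
  assumes "linear_map R (chain_mod R F (Suc j)) X f" "linear_map R (chain_mod R F j) X g"
    "\<And>x. x \<in> chain_set R F j ==> g x \<in> N"
    "\<And>x. x \<in> chain_set R F (Suc j) ==> f x \<ominus>\<^bsub>X\<^esub> g (res_diff F j x) \<in> L"
  shows "rel_coboundary R F X N L (Suc j) f"
  using assms unfolding rel_coboundary_def by auto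

lemma rel_coboundary_SucE:
  assumes "rel_coboundary R F X N L (Suc j) f"
  obtains g where "linear_map R (chain_mod R F j) X g" "\<And>x. x \<in> chain_set R F j ==> g x \<in> N"
    "\<And>x. x \<in> chain_set R F (Suc j) ==> f x \<ominus>\<^bsub>X\<^esub> g (res_diff F j x) \<in> L"
  using assms unfolding rel_coboundary_def by auto

lemma rel_coboundary_cong:
  assumes "rel_coboundary R F X N L k f" "\<And>x. x \<in> chain_set R F k ==> f x = f' x"
  shows "rel_coboundary R F X N L k f'"
  using assms linear_map_cong[OF rel_coboundary_linear[OF assms(1)] assms(2)]
  by (cases k) (auto simp: rel_coboundary_def)

lemma rel_cocycle_comp:
  assumes f: "rel_cocycle R F X N L k f" and \<phi>: "chain_map R G F \<phi>"
  shows "rel_cocycle R G X N L k (\<lambda>x. f (\<phi> k x))"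
  using f linear_map_comp[OF chain_map_linear[OF \<phi>] rel_cocycle_linear[OF f]] linear_map_closed[OF chain_map_linear[OF \<phi>]]
    chain_map_commute[OF \<phi>, symmetric]
  unfolding rel_cocycle_def by auto

lemma rel_coboundary_comp:
  assumes f: "rel_coboundary R F X N L k f" and \<phi>: "chain_map R G F \<phi>"
  shows "rel_coboundary R G X N L k (\<lambda>x. f (\<phi> k x))"
proof -
  note \<phi>l = chain_map_linear[OF \<phi>] and f\<phi> = linear_map_comp[OF chain_map_linear[OF \<phi>] rel_coboundary_linear[OF f]]
  show ?thesis
  proof (cases k)
    case 0
    then show ?thesis using f f\<phi> linear_map_closed[OF \<phi>l] by (auto simp: rel_coboundary_0)
  next
    case (Suc j)
    obtain g where g: "linear_map R (chain_mod R F j) X g" "\<And>x. x \<in> chain_set R F j ==> g x \<in> N"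
      "\<And>x. x \<in> chain_set R F (Suc j) ==> f x \<ominus>\<^bsub>X\<^esub> g (res_diff F j x) \<in> L"
      using rel_coboundary_SucE[OF f[unfolded Suc]] by blast
    show ?thesis unfolding Suc
    proof (rule rel_coboundary_SucI[OF f\<phi>[unfolded Suc] linear_map_comp[OF \<phi>l g(1)]])
      show "g (\<phi> j x) \<in> N" if "x \<in> chain_set R G j" for x using g(2) linear_map_closed[OF \<phi>l that] by blast
      show "f (\<phi> (Suc j) x) \<ominus>\<^bsub>X\<^esub> g (\<phi> j (res_diff G j x)) \<in> L" if "x \<in> chain_set R G (Suc j)" for x
        using g(3)[OF linear_map_closed[OF \<phi>l that]] chain_map_commute[OF \<phi> that] by simp
    qed
  qed
qed

lemma rel_cocycle_map:
  assumes f: "rel_cocycle R F X N L k f" and h: "linear_map R X Y h" "h ` N \<subseteq> N'" "h ` L \<subseteq> L'"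
  shows "rel_cocycle R F Y N' L' k (\<lambda>x. h (f x))"
  using linear_map_comp[OF rel_cocycle_linear[OF f] h(1)] rel_cocycle_mem[OF f] rel_cocycle_diff[OF f] h(2,3)
  unfolding rel_cocycle_def by blast

lemma rel_coboundary_map:
  assumes f: "rel_coboundary R F X N L k f" and F: "resolves R J F"
    and h: "linear_map R X Y h" "h ` N \<subseteq> N'" "h ` L \<subseteq> L'"
  shows "rel_coboundary R F Y N' L' k (\<lambda>x. h (f x))"
proof (cases k)
  case 0
  then show ?thesis using f h(3) linear_map_comp[OF rel_coboundary_linear[OF f] h(1)] by (auto simp: rel_coboundary_0)
next
  case (Suc j)
  note fl = rel_coboundary_linear[OF f[unfolded Suc]]
  obtain g where g: "linear_map R (chain_mod R F j) X g" "\<And>x. x \<in> chain_set R F j ==> g x \<in> N"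
    "\<And>x. x \<in> chain_set R F (Suc j) ==> f x \<ominus>\<^bsub>X\<^esub> g (res_diff F j x) \<in> L"
    using rel_coboundary_SucE[OF f[unfolded Suc]] by blast
  show ?thesis unfolding Suc
  proof (rule rel_coboundary_SucI[OF linear_map_comp[OF fl h(1)] linear_map_comp[OF g(1) h(1)]])
    show "h (g x) \<in> N'" if "x \<in> chain_set R F j" for x using g(2)[OF that] h(2) by blast
    show "h (f x) \<ominus>\<^bsub>Y\<^esub> h (g (res_diff F j x)) \<in> L'" if x: "x \<in> chain_set R F (Suc j)" for x
      using linear_map_minus[OF h(1) linear_map_closed[OF fl x] linear_map_closed[OF g(1) linear_map_closed[OF resolves_diff[OF F] x]]]
        g(3)[OF x] h(3) by (metis image_subset_iff)
  qed
qed

context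
  fixes R :: "('a, 'r) ring_scheme" and X :: "('a, 'm, 's) module_scheme" (structure) and N L :: "'m set"
    and J :: "'a set" and F :: "('a, 'a) free_res"
  assumes X: "module R X" and N: "submodule N R X" and L: "submodule L R X" and F: "resolves R J F"
begin

interpretation module R X by (rule X)

private lemmas module_chain_mod = module_free_module[OF is_cring]
private lemmas diff_linear = resolves_diff[OF F]

lemma rel_coboundary_zero: "rel_coboundary R F X N L k (\<lambda>x. \<zero>)"
  using linear_map_const_zero[OF module_chain_mod X] submodule_zero_mem[OF L] submodule_zero_mem[OF N] diff_mem_refl[OF X L M.zero_closed]
  by (cases k) (auto simp: rel_coboundary_0 intro!: rel_coboundary_SucI[where g="\<lambda>_. \<zero>"])

lemma rel_coboundary_add:
  assumes f: "rel_coboundary R F X N L k f" and f': "rel_coboundary R F X N L k f'"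
  shows "rel_coboundary R F X N L k (\<lambda>x. f x \<oplus> f' x)"
proof -
  note fl = rel_coboundary_linear[OF f] and fl' = rel_coboundary_linear[OF f']
  note sum = linear_map_fun_add[OF fl fl']
  show ?thesis
  proof (cases k)
    case 0
    then show ?thesis using f f' sum submodule_add[OF L] by (simp add: rel_coboundary_0)
  next
    case (Suc j)
    obtain g where g: "linear_map R (chain_mod R F j) X g" "\<And>x. x \<in> chain_set R F j ==> g x \<in> N"
      "\<And>x. x \<in> chain_set R F (Suc j) ==> f x \<ominus> g (res_diff F j x) \<in> L"
      using rel_coboundary_SucE[OF f[unfolded Suc]] by blast
    obtain g' where g': "linear_map R (chain_mod R F j) X g'" "\<And>x. x \<in> chain_set R F j ==> g' x \<in> N"
      "\<And>x. x \<in> chain_set R F (Suc j) ==> f' x \<ominus> g' (res_diff F j x) \<in> L"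
      using rel_coboundary_SucE[OF f'[unfolded Suc]] by blast
    show ?thesis unfolding Suc
    proof (rule rel_coboundary_SucI[OF sum[unfolded Suc] linear_map_fun_add[OF g(1) g'(1)]])
      show "g x \<oplus> g' x \<in> N" if "x \<in> chain_set R F j" for x
        by (rule submodule_add[OF N g(2)[OF that] g'(2)[OF that]])
      show "(f x \<oplus> f' x) \<ominus> (g (res_diff F j x) \<oplus> g' (res_diff F j x)) \<in> L" if x: "x \<in> chain_set R F (Suc j)" for x
        by (rule diff_mem_add[OF X L]) (use x Suc g(3) g'(3) linear_map_closed[OF fl] linear_map_closed[OF fl']
            linear_map_closed[OF g(1) linear_map_closed[OF diff_linear]] linear_map_closed[OF g'(1) linear_map_closed[OF diff_linear]] in auto)
    qed
  qed
qed

lemma rel_coboundary_smult: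
  assumes f: "rel_coboundary R F X N L k f" and r: "r \<in> carrier R"
  shows "rel_coboundary R F X N L k (\<lambda>x. r \<odot> f x)"
proof (rule rel_coboundary_cong[OF rel_coboundary_comp[OF f]])
  show "chain_map R F F (\<lambda>i x. r \<odot>\<^bsub>chain_mod R F i\<^esub> x)"
    unfolding chain_map_def using linear_map_fun_smult[OF linear_map_ident[OF module_chain_mod] r] linear_map_smult[OF diff_linear r] by auto
  show "f (r \<odot>\<^bsub>chain_mod R F k\<^esub> x) = r \<odot> f x" if "x \<in> chain_set R F k" for x
    by (rule linear_map_smult[OF rel_coboundary_linear[OF f] r that])
qed

lemma rel_coboundary_imp_cocycle:
  assumes LN: "L \<subseteq> N" and f: "rel_coboundary R F X N L k f"
  shows "rel_cocycle R F X N L k f"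
  unfolding rel_cocycle_def
proof (intro conjI ballI)
  show fl: "linear_map R (chain_mod R F k) X f" by (rule rel_coboundary_linear[OF f])
  note d = linear_map_closed[OF diff_linear]
  show "f x \<in> N" if x: "x \<in> chain_set R F k" for x
  proof (cases k)
    case 0
    then show ?thesis using f x LN by (simp add: rel_coboundary_0 subset_iff)
  next
    case (Suc j)
    obtain g where "linear_map R (chain_mod R F j) X g" "\<And>x. x \<in> chain_set R F j ==> g x \<in> N"
      "\<And>x. x \<in> chain_set R F (Suc j) ==> f x \<ominus> g (res_diff F j x) \<in> L"
      using rel_coboundary_SucE[OF f[unfolded Suc]] by blast
    then have "g (res_diff F j x) \<in> N" "f x \<ominus> g (res_diff F j x) \<in> L" using d[OF x[unfolded Suc]] x[unfolded Suc] by blast+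
    then show ?thesis using mem_if_diff_mem[OF X N linear_map_closed[OF fl x] _ subsetD[OF LN]] by blast
  qed
  show "f (res_diff F k x) \<in> L" if x: "x \<in> chain_set R F (Suc k)" for x
  proof (cases k)
    case 0
    then show ?thesis using f d[OF x] by (simp add: rel_coboundary_0)
  next
    case (Suc j)
    obtain g where g: "linear_map R (chain_mod R F j) X g" "\<And>x. x \<in> chain_set R F j ==> g x \<in> N"
      "\<And>x. x \<in> chain_set R F (Suc j) ==> f x \<ominus> g (res_diff F j x) \<in> L"
      using rel_coboundary_SucE[OF f[unfolded Suc]] by blast
    have "g (res_diff F j (res_diff F k x)) \<in> L"
      using resolves_diff_diff[OF F x[unfolded Suc]] linear_map_zero[OF g(1)] submodule_zero_mem[OF L] Suc by simp
    then show ?thesis using mem_if_diff_mem[OF X L linear_map_closed[OF fl d[OF x]]] g(3)[OF d[OF x, unfolded Suc]] Suc by simp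
  qed
qed

lemma rel_coboundary_comp_null:
  assumes f: "rel_cocycle R F X N L k f" and G: "resolves R I G" and \<phi>: "chain_map R G F \<phi>"
    and \<phi>0: "\<And>x. x \<in> chain_set R G 0 ==> res_aug F (\<phi> 0 x) \<in> J"
  shows "rel_coboundary R G X N L k (\<lambda>x. f (\<phi> k x))"
proof -
  note fl = rel_cocycle_linear[OF f] and f\<phi> = linear_map_comp[OF chain_map_linear[OF \<phi>] rel_cocycle_linear[OF f]]
  obtain h where h: "\<And>i. linear_map R (chain_mod R G i) (chain_mod R F (Suc i)) (h i)"
    "\<And>x. x \<in> chain_set R G 0 ==> \<phi> 0 x = res_diff F 0 (h 0 x)"
    "\<And>i x. x \<in> chain_set R G (Suc i) ==>
      \<phi> (Suc i) x = res_diff F (Suc i) (h (Suc i) x) \<oplus>\<^bsub>chain_mod R F (Suc i)\<^esub> h i (res_diff G i x)"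
    using null_homotopy[OF G F \<phi> \<phi>0] by blast
  show ?thesis
  proof (cases k)
    case 0
    then show ?thesis using f\<phi> h(2) rel_cocycle_diff[OF f linear_map_closed[OF h(1)]] by (simp add: rel_coboundary_0)
  next
    case (Suc j)
    show ?thesis unfolding Suc
    proof (rule rel_coboundary_SucI[OF f\<phi>[unfolded Suc] linear_map_comp[OF h(1) fl[unfolded Suc]]])
      show "f (h j x) \<in> N" if "x \<in> chain_set R G j" for x
        using rel_cocycle_mem[OF f] linear_map_closed[OF h(1) that] Suc by simp
      show "f (\<phi> (Suc j) x) \<ominus> f (h j (res_diff G j x)) \<in> L" if x: "x \<in> chain_set R G (Suc j)" for x
      proof -
        let ?a = "res_diff F k (h k x)" and ?b = "h j (res_diff G j x)"
        have a: "?a \<in> chain_set R F k" "f ?a \<in> L"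
          using linear_map_closed[OF diff_linear linear_map_closed[OF h(1)]] rel_cocycle_diff[OF f linear_map_closed[OF h(1)]] x Suc by auto
        have b: "?b \<in> chain_set R F k"
          using linear_map_closed[OF h(1) linear_map_closed[OF resolves_diff[OF G] x]] Suc by simp
        have "f (\<phi> (Suc j) x) = f ?a \<oplus> f ?b" using h(3)[OF x] linear_map_add[OF fl a(1) b] Suc by simp
        then show ?thesis
          using a minus_cancel(4)[OF X linear_map_closed[OF fl a(1)] linear_map_closed[OF fl b]] by simp
      qed
    qed
  qed
qed

lemma rel_coboundary_smult_ideal:
  assumes f: "rel_cocycle R F X N L k f" and J: "ideal J R" and r: "r \<in> J"
  shows "rel_coboundary R F X N L k (\<lambda>x. r \<odot> f x)"
proof -
  interpret J: ideal J R by (rule J)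
  have rR: "r \<in> carrier R" using r J.Icarr by blast
  let ?\<phi> = "\<lambda>i x. r \<odot>\<^bsub>chain_mod R F i\<^esub> x"
  have \<phi>: "chain_map R F F ?\<phi>"
    unfolding chain_map_def using linear_map_fun_smult[OF linear_map_ident[OF module_chain_mod] rR] linear_map_smult[OF diff_linear rR] by auto
  have "res_aug F (?\<phi> 0 x) \<in> J" if "x \<in> chain_set R F 0" for x
    using linear_map_smult[OF resolves_aug[OF F] rR that] J.I_r_closed[OF r] resolves_aug_closed[OF F that] by simp
  note null = rel_coboundary_comp_null[OF f F \<phi> this]
  show ?thesis
    using rel_coboundary_cong[OF null] linear_map_smult[OF rel_cocycle_linear[OF f] rR] by simp
qed

end

lemma rel_coboundary_lift_unique:
  assumes X: "module R X" and N: "submodule N R X" and L: "submodule L R X" and F: "resolves R J F"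
    and f: "rel_cocycle R F X N L k f" and G: "resolves R I G" and J: "ideal J R"
    and \<phi>: "chain_lift R G F J \<phi>" and \<psi>: "chain_lift R G F J \<psi>" and f\<psi>: "rel_coboundary R G X N L k (\<lambda>x. f (\<psi> k x))"
  shows "rel_coboundary R G X N L k (\<lambda>x. f (\<phi> k x))"
proof -
  note RR = module_ring_as_module[OF resolves_cring[OF F]] and dF = resolves_diff[OF F]
    and \<phi>l = chain_lift_linear[OF \<phi>] and \<psi>l = chain_lift_linear[OF \<psi>] and fl = rel_cocycle_linear[OF f]
  have J': "submodule J R (ring_as_module R)" using ideal_iff_submodule[OF resolves_cring[OF F]] J by blast
  let ?\<delta> = "\<lambda>i x. \<phi> i x \<ominus>\<^bsub>chain_mod R F i\<^esub> \<psi> i x"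
  have \<delta>: "chain_map R G F ?\<delta>"
    unfolding chain_map_def
    using linear_map_fun_minus[OF \<phi>l \<psi>l] linear_map_minus[OF dF linear_map_closed[OF \<phi>l] linear_map_closed[OF \<psi>l]]
      chain_map_commute[OF chain_lift_chain_map[OF \<phi>]] chain_map_commute[OF chain_lift_chain_map[OF \<psi>]] by auto
  have "res_aug F (?\<delta> 0 x) \<in> J" if x: "x \<in> chain_set R G 0" for x
  proof -
    note closed = resolves_aug_closed[OF F linear_map_closed[OF \<phi>l x]] resolves_aug_closed[OF F linear_map_closed[OF \<psi>l x]]
      resolves_aug_closed[OF G x]
    have "res_aug G x \<ominus>\<^bsub>R\<^esub> res_aug F (\<psi> 0 x) \<in> J"
      using diff_mem_sym[OF RR J', of "res_aug F (\<psi> 0 x)" "res_aug G x"] chain_lift_aug[OF \<psi> x] closed by simp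
    then have "res_aug F (\<phi> 0 x) \<ominus>\<^bsub>R\<^esub> res_aug F (\<psi> 0 x) \<in> J"
      using diff_mem_trans[OF RR J', of "res_aug F (\<phi> 0 x)" "res_aug G x"] chain_lift_aug[OF \<phi> x] closed by simp
    then show ?thesis
      using linear_map_minus[OF resolves_aug[OF F] linear_map_closed[OF \<phi>l x] linear_map_closed[OF \<psi>l x]] by simp
  qed
  note f\<delta> = rel_coboundary_comp_null[OF X N L F f G \<delta> this]
  have "rel_coboundary R G X N L k (\<lambda>x. f (?\<delta> k x) \<oplus>\<^bsub>X\<^esub> f (\<psi> k x))"
    by (rule rel_coboundary_add[OF X N L G f\<delta> f\<psi>])
  then show ?thesis
  proof (rule rel_coboundary_cong)
    fix x assume x: "x \<in> chain_set R G k"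
    note closed = linear_map_closed[OF \<phi>l x] linear_map_closed[OF \<psi>l x]
    show "f (?\<delta> k x) \<oplus>\<^bsub>X\<^esub> f (\<psi> k x) = f (\<phi> k x)"
      using linear_map_minus[OF fl closed] minus_cancel(1)[OF X linear_map_closed[OF fl closed(1)] linear_map_closed[OF fl closed(2)]]
      by simp
  qed
qed

lemma resolution_tower_exists:
  assumes R: "cring R" and \<aa>: "ideal \<aa> R" and ex: "\<And>n. \<exists>F. resolves R (ideal_power R \<aa> n) F"
  obtains F \<phi> where "resolution_tower R \<aa> F \<phi>"
proof -
  obtain F where F: "\<And>n. resolves R (ideal_power R \<aa> n) (F n)" using ex by metis
  have "\<forall>m n. \<exists>\<phi>. n \<le> m --> chain_lift R (F m) (F n) (ideal_power R \<aa> n) \<phi>"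
    using chain_lift_exists[OF F F ideal_power_antimono[OF R \<aa>] ideal_power_ideal[OF R \<aa>]] by metis
  then obtain \<phi> where "\<forall>m n. n \<le> m --> chain_lift R (F m) (F n) (ideal_power R \<aa> n) (\<phi> m n)" by metis
  then show ?thesis using that[of F \<phi>] F unfolding resolution_tower_def by blast
qed

lemma noetherian_resolution_tower:
  assumes "cring R" "noetherian_ring R" "ideal \<aa> R"
  obtains F \<phi> where "resolution_tower R \<aa> F \<phi>"
  using resolution_tower_exists[OF assms(1,3)] resolution_exists[OF assms(1,2) ideal_power_ideal[OF assms(1,3)]] by metis

lemma resolution_towerD:
  assumes "resolution_tower R \<aa> F \<phi>"
  shows "resolves R (ideal_power R \<aa> n) (F n)"
    "n \<le> m ==> chain_lift R (F m) (F n) (ideal_power R \<aa> n) (\<phi> m n)"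
  using assms by (auto simp: resolution_tower_def)

lemma vanishes_iff_tower:
  assumes X: "module R X" and N: "submodule N R X" and L: "submodule L R X"
    and \<aa>: "ideal \<aa> R" and tower: "resolution_tower R \<aa> F \<phi>"
  shows "vanishes R \<aa> X N L k \<longleftrightarrow>
    (\<forall>n f. rel_cocycle R (F n) X N L k f --> (\<exists>m\<ge>n. rel_coboundary R (F m) X N L k (\<lambda>x. f (\<phi> m n k x))))"
proof
  note F = resolution_towerD(1)[OF tower] and \<phi> = resolution_towerD(2)[OF tower]
  assume vanishes: "vanishes R \<aa> X N L k"
  show "\<forall>n f. rel_cocycle R (F n) X N L k f --> (\<exists>m\<ge>n. rel_coboundary R (F m) X N L k (\<lambda>x. f (\<phi> m n k x)))"
  proof (intro allI impI)
    fix n f assume "rel_cocycle R (F n) X N L k f"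
    with vanishes F obtain m where "m \<ge> n" "\<forall>m'\<ge>m. \<forall>G \<phi>. resolves R (ideal_power R \<aa> m') G -->
        chain_lift R G (F n) (ideal_power R \<aa> n) \<phi> --> rel_coboundary R G X N L k (\<lambda>x. f (\<phi> k x))"
      unfolding vanishes_def by blast
    then show "\<exists>m\<ge>n. rel_coboundary R (F m) X N L k (\<lambda>x. f (\<phi> m n k x))" using F \<phi> by blast
  qed
next
  note F = resolution_towerD(1)[OF tower] and \<phi> = resolution_towerD(2)[OF tower]
  assume tower_vanishes: "\<forall>n f. rel_cocycle R (F n) X N L k f --> (\<exists>m\<ge>n. rel_coboundary R (F m) X N L k (\<lambda>x. f (\<phi> m n k x)))"
  note R = resolves_cring[OF F] and J = ideal_power_ideal[OF resolves_cring[OF F] \<aa>]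
  show "vanishes R \<aa> X N L k"
    unfolding vanishes_def
  proof (intro allI impI)
    fix n G f assume G: "resolves R (ideal_power R \<aa> n) G" and f: "rel_cocycle R G X N L k f"
    obtain \<beta> where \<beta>: "chain_lift R (F n) G (ideal_power R \<aa> n) \<beta>"
      using chain_lift_exists[OF F G subset_refl J] by blast
    from tower_vanishes rel_cocycle_comp[OF f chain_lift_chain_map[OF \<beta>]]
    obtain m where m: "m \<ge> n" "rel_coboundary R (F m) X N L k (\<lambda>x. f (\<beta> k (\<phi> m n k x)))" by blast
    show "\<exists>m0\<ge>n. \<forall>m\<ge>m0. \<forall>H \<theta>. resolves R (ideal_power R \<aa> m) H -->
      chain_lift R H G (ideal_power R \<aa> n) \<theta> --> rel_coboundary R H X N L k (\<lambda>x. f (\<theta> k x))"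
    proof (intro exI[of _ m] conjI allI impI m(1))
      fix m' H \<theta>
      assume m': "m' \<ge> m" and H: "resolves R (ideal_power R \<aa> m') H" and \<theta>: "chain_lift R H G (ideal_power R \<aa> n) \<theta>"
      obtain \<psi> where \<psi>: "chain_lift R H (F m) (ideal_power R \<aa> m) \<psi>"
        using chain_lift_exists[OF H F ideal_power_antimono[OF R \<aa> m'] J] by blast
      have "chain_lift R H (F n) (ideal_power R \<aa> n) (\<lambda>i x. \<phi> m n i (\<psi> i x))"
        by (rule chain_lift_comp[OF H F F ideal_power_antimono[OF R \<aa> m(1)] J \<psi> \<phi>[OF m(1)]])
      from chain_lift_comp[OF H F G subset_refl J this \<beta>]
      have lift: "chain_lift R H G (ideal_power R \<aa> n) (\<lambda>i x. \<beta> i (\<phi> m n i (\<psi> i x)))" .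
      show "rel_coboundary R H X N L k (\<lambda>x. f (\<theta> k x))"
        by (rule rel_coboundary_lift_unique[OF X N L G f H J \<theta> lift rel_coboundary_comp[OF m(2) chain_lift_chain_map[OF \<psi>]]])
    qed
  qed
qed

context
  fixes R :: "('a, 'r) ring_scheme" and X :: "('a, 'm, 's) module_scheme" (structure) and N L :: "'m set"
    and J :: "'a set" and F :: "('a, 'a) free_res" and k :: nat
  assumes X: "module R X" and N: "submodule N R X" and L: "submodule L R X" and F: "resolves R J F"
begin

lemma rel_cocycle_zero: "rel_cocycle R F X N L k (\<lambda>x. \<zero>)"
  using linear_map_const_zero[OF module_free_module[OF resolves_cring[OF F]] X] submodule_zero_mem[OF N] submodule_zero_mem[OF L]
  by (simp add: rel_cocycle_def)

lemma rel_cocycle_add: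
  "rel_cocycle R F X N L k f ==> rel_cocycle R F X N L k g ==> rel_cocycle R F X N L k (\<lambda>x. f x \<oplus> g x)"
  unfolding rel_cocycle_def by (blast intro: linear_map_fun_add submodule_add[OF N] submodule_add[OF L])

lemma rel_cocycle_smult: "r \<in> carrier R ==> rel_cocycle R F X N L k f ==> rel_cocycle R F X N L k (\<lambda>x. r \<odot> f x)"
  unfolding rel_cocycle_def by (blast intro: linear_map_fun_smult submodule_smult[OF N] submodule_smult[OF L])

lemma rel_cocycle_cong:
  assumes f: "rel_cocycle R F X N L k f" and eq: "\<And>x. x \<in> chain_set R F k ==> f x = g x"
  shows "rel_cocycle R F X N L k g"
  using f linear_map_cong[OF rel_cocycle_linear[OF f] eq] linear_map_closed[OF resolves_diff[OF F]] eq
  by (simp add: rel_cocycle_def)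

lemma submodule_cocycle_tuples:
  "submodule {u \<in> carrier (power_module X (res_rank F k)). rel_cocycle R F X N L k (\<lambda>x. lincomb X u x (res_rank F k))}
    R (power_module X (res_rank F k))"
  by (rule submodule_cochain_tuples[OF X rel_cocycle_zero rel_cocycle_add rel_cocycle_smult rel_cocycle_cong])

lemma submodule_coboundary_tuples:
  "submodule {u \<in> carrier (power_module X (res_rank F k)). rel_coboundary R F X N L k (\<lambda>x. lincomb X u x (res_rank F k))}
    R (power_module X (res_rank F k))"
  by (rule submodule_cochain_tuples[OF X rel_coboundary_zero[OF X N L F] rel_coboundary_add[OF X N L F]
        rel_coboundary_smult[OF X N L F] rel_coboundary_cong])

lemma rel_cocycle_lincomb:
  "(\<And>i. i < m ==> rel_cocycle R F X N L k (G i)) ==> (\<And>i. i < m ==> c i \<in> carrier R) ==>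
    rel_cocycle R F X N L k (\<lambda>x. lincomb X (\<lambda>i. G i x) c m)"
  by (induction m) (simp_all add: rel_cocycle_zero rel_cocycle_add rel_cocycle_smult)

end

subsection \<open>Chain lifts of bounded length\<close>

text \<open>Chain maps from \<open>F\<close> into the cone of multiplication by \<open>c\<close> on \<open>P\<close>.\<close>

definition cone_map ::
    "('a, 'r) ring_scheme => 'a => ('a, 'n) free_res => ('a, 'k) free_res => (nat => (nat => 'a) => (nat => 'a))
      => (nat => (nat => 'a) => (nat => 'a)) => bool" where
  "cone_map R c F P \<alpha> \<tau> \<longleftrightarrow>
     (\<forall>i. linear_map R (chain_mod R F i) (chain_mod R P i) (\<alpha> i)) \<and>
     (\<forall>i. linear_map R (chain_mod R F (Suc i)) (chain_mod R P i) (\<tau> i)) \<and>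
     (\<forall>i. \<forall>y\<in>chain_set R F (Suc i).
        \<alpha> i (res_diff F i y) = res_diff P i (\<alpha> (Suc i) y) \<oplus>\<^bsub>chain_mod R P i\<^esub> c \<odot>\<^bsub>chain_mod R P i\<^esub> \<tau> i y) \<and>
     (\<forall>i. \<forall>y\<in>chain_set R F (Suc (Suc i)).
        \<tau> i (res_diff F (Suc i) y) = \<ominus>\<^bsub>chain_mod R P i\<^esub> res_diff P i (\<tau> (Suc i) y))"

text \<open>A chain map into the cone that is constructed up to degree \<open>j + 1\<close> can be continued.\<close>

definition cone_stage ::
    "('a, 'r) ring_scheme => 'a set => 'a => ('a, 'n) free_res => ('a, 'a) free_res => nat
      => ((nat => 'a) => (nat => 'a)) => ((nat => 'a) => (nat => 'a)) => bool" where
  "cone_stage R J c F P j \<alpha> \<tau> \<longleftrightarrow>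
     linear_map R (chain_mod R F (Suc j)) (chain_mod R P (Suc j)) \<alpha> \<and>
     linear_map R (chain_mod R F (Suc j)) (chain_mod R P j) \<tau> \<and>
     (\<forall>y\<in>chain_set R F (Suc (Suc j)). \<tau> (res_diff F (Suc j) y) \<in> cycles R J P j \<and>
        res_diff P j (\<alpha> (res_diff F (Suc j) y)) \<oplus>\<^bsub>chain_mod R P j\<^esub> c \<odot>\<^bsub>chain_mod R P j\<^esub> \<tau> (res_diff F (Suc j) y) = \<zero>\<^bsub>chain_mod R P j\<^esub>)"

lemma cone_stageD:
  assumes "cone_stage R J c F P j \<alpha> \<tau>"
  shows "linear_map R (chain_mod R F (Suc j)) (chain_mod R P (Suc j)) \<alpha>"
    "linear_map R (chain_mod R F (Suc j)) (chain_mod R P j) \<tau>"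
    "y \<in> chain_set R F (Suc (Suc j)) ==> \<tau> (res_diff F (Suc j) y) \<in> cycles R J P j"
    "y \<in> chain_set R F (Suc (Suc j)) ==> res_diff P j (\<alpha> (res_diff F (Suc j) y))
      \<oplus>\<^bsub>chain_mod R P j\<^esub> c \<odot>\<^bsub>chain_mod R P j\<^esub> \<tau> (res_diff F (Suc j) y) = \<zero>\<^bsub>chain_mod R P j\<^esub>"
  using assms by (auto simp: cone_stage_def)

lemma cone_map_step:
  assumes F: "resolves R I F" and P: "resolves R J P" and c: "c \<in> carrier R"
    and stage: "cone_stage R J c F P j \<alpha> \<tau>"
  obtains \<alpha>' \<tau>' where "cone_stage R J c F P (Suc j) \<alpha>' \<tau>'"
    "\<And>y. y \<in> chain_set R F (Suc (Suc j)) ==> \<alpha> (res_diff F (Suc j) y) =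
      res_diff P (Suc j) (\<alpha>' y) \<oplus>\<^bsub>chain_mod R P (Suc j)\<^esub> c \<odot>\<^bsub>chain_mod R P (Suc j)\<^esub> \<tau>' y"
    "\<And>y. y \<in> chain_set R F (Suc (Suc j)) ==> \<tau> (res_diff F (Suc j) y) = \<ominus>\<^bsub>chain_mod R P j\<^esub> res_diff P j (\<tau>' y)"
proof -
  note FR = module_free_module[OF resolves_cring[OF F]] and dF = resolves_diff[OF F] and dP = resolves_diff[OF P]
  interpret Pj: module R "chain_mod R P j" by (rule FR)
  note \<alpha> = cone_stageD(1)[OF stage] and \<tau> = cone_stageD(2)[OF stage] and \<tau>_cycle = cone_stageD(3)[OF stage]
  note \<alpha>d = linear_map_comp[OF dF \<alpha>] and \<tau>d = linear_map_comp[OF dF \<tau>]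
  from resolves_lift_cycles[OF P \<tau>d \<tau>_cycle] obtain \<sigma>
    where \<sigma>: "linear_map R (chain_mod R F (Suc (Suc j))) (chain_mod R P (Suc j)) \<sigma>"
      "\<And>y. y \<in> chain_set R F (Suc (Suc j)) ==> \<tau> (res_diff F (Suc j) y) = res_diff P j (\<sigma> y)" by blast
  define \<tau>' where "\<tau>' y = (\<ominus>\<^bsub>R\<^esub> \<one>\<^bsub>R\<^esub>) \<odot>\<^bsub>chain_mod R P (Suc j)\<^esub> \<sigma> y" for y
  have \<tau>': "linear_map R (chain_mod R F (Suc (Suc j))) (chain_mod R P (Suc j)) \<tau>'"
    unfolding \<tau>'_def by (rule linear_map_fun_smult[OF \<sigma>(1)]) simp
  have \<tau>d_eq: "\<tau> (res_diff F (Suc j) y) = \<ominus>\<^bsub>chain_mod R P j\<^esub> res_diff P j (\<tau>' y)"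
    if y: "y \<in> chain_set R F (Suc (Suc j))" for y
    using \<sigma>(2)[OF y] linear_map_smult[OF dP _ linear_map_closed[OF \<sigma>(1) y], of "\<ominus>\<^bsub>R\<^esub> \<one>\<^bsub>R\<^esub>"]
      linear_map_closed[OF dP linear_map_closed[OF \<sigma>(1) y]] by (simp add: \<tau>'_def Pj.smult_l_minus)
  note c\<tau>' = linear_map_fun_smult[OF \<tau>' c]
  let ?f = "\<lambda>y. \<alpha> (res_diff F (Suc j) y) \<ominus>\<^bsub>chain_mod R P (Suc j)\<^esub> c \<odot>\<^bsub>chain_mod R P (Suc j)\<^esub> \<tau>' y"
  have f: "linear_map R (chain_mod R F (Suc (Suc j))) (chain_mod R P (Suc j)) ?f" by (rule linear_map_fun_minus[OF \<alpha>d c\<tau>'])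
  have "?f y \<in> cycles R J P (Suc j)" if y: "y \<in> chain_set R F (Suc (Suc j))" for y
  proof -
    have "res_diff P j (?f y) = res_diff P j (\<alpha> (res_diff F (Suc j) y)) \<ominus>\<^bsub>chain_mod R P j\<^esub> c \<odot>\<^bsub>chain_mod R P j\<^esub> res_diff P j (\<tau>' y)"
      using linear_map_minus[OF dP linear_map_closed[OF \<alpha>d y] linear_map_closed[OF c\<tau>' y]]
        linear_map_smult[OF dP c linear_map_closed[OF \<tau>' y]] by simp
    also have "\<dots> = res_diff P j (\<alpha> (res_diff F (Suc j) y)) \<oplus>\<^bsub>chain_mod R P j\<^esub> c \<odot>\<^bsub>chain_mod R P j\<^esub> \<tau> (res_diff F (Suc j) y)"
      unfolding \<tau>d_eq[OF y] a_minus_def using linear_map_closed[OF dP linear_map_closed[OF \<tau>' y]] c by (simp add: Pj.smult_r_minus)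
    finally show ?thesis using cone_stageD(4)[OF stage y] linear_map_closed[OF f y] by (simp add: cycles_def)
  qed
  from resolves_lift_cycles[OF P f this] obtain \<alpha>'
    where \<alpha>': "linear_map R (chain_mod R F (Suc (Suc j))) (chain_mod R P (Suc (Suc j))) \<alpha>'"
      "\<And>y. y \<in> chain_set R F (Suc (Suc j)) ==> ?f y = res_diff P (Suc j) (\<alpha>' y)" by blast
  have \<alpha>d_eq: "\<alpha> (res_diff F (Suc j) y) = res_diff P (Suc j) (\<alpha>' y) \<oplus>\<^bsub>chain_mod R P (Suc j)\<^esub> c \<odot>\<^bsub>chain_mod R P (Suc j)\<^esub> \<tau>' y"
    if y: "y \<in> chain_set R F (Suc (Suc j))" for y
    using \<alpha>'(2)[OF y] minus_cancel(1)[OF FR linear_map_closed[OF \<alpha>d y] linear_map_closed[OF c\<tau>' y]] by simp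
  have "cone_stage R J c F P (Suc j) \<alpha>' \<tau>'"
    unfolding cone_stage_def
  proof (intro conjI ballI \<alpha>'(1) \<tau>')
    fix y assume y: "y \<in> chain_set R F (Suc (Suc (Suc j)))"
    note dy = linear_map_closed[OF dF y] and d\<tau>' = linear_map_closed[OF dP linear_map_closed[OF \<tau>' linear_map_closed[OF dF y]]]
    show "res_diff P (Suc j) (\<alpha>' (res_diff F (Suc (Suc j)) y)) \<oplus>\<^bsub>chain_mod R P (Suc j)\<^esub>
        c \<odot>\<^bsub>chain_mod R P (Suc j)\<^esub> \<tau>' (res_diff F (Suc (Suc j)) y) = \<zero>\<^bsub>chain_mod R P (Suc j)\<^esub>"
      using \<alpha>d_eq[OF dy] resolves_diff_diff[OF F y] linear_map_zero[OF \<alpha>] by simp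
    have "\<ominus>\<^bsub>chain_mod R P j\<^esub> res_diff P j (\<tau>' (res_diff F (Suc (Suc j)) y)) = \<zero>\<^bsub>chain_mod R P j\<^esub>"
      using \<tau>d_eq[OF dy] resolves_diff_diff[OF F y] linear_map_zero[OF \<tau>] by simp
    then show "\<tau>' (res_diff F (Suc (Suc j)) y) \<in> cycles R J P (Suc j)"
      using linear_map_closed[OF \<tau>' dy] Pj.add.inv_eq_1_iff[OF d\<tau>'] by (simp add: cycles_def a_inv_def)
  qed
  then show ?thesis by (rule that[OF _ \<alpha>d_eq \<tau>d_eq])
qed

lemma cone_map_base:
  assumes F: "resolves R I F" and P: "resolves R J P" and c: "c \<in> carrier R"
    and \<alpha>0: "linear_map R (chain_mod R F 0) (chain_mod R P 0) \<alpha>0" and \<tau>0: "linear_map R (chain_mod R F (Suc 0)) (chain_mod R P 0) \<tau>0"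
    and base_cycle: "\<And>y. y \<in> chain_set R F (Suc 0) ==>
      \<alpha>0 (res_diff F 0 y) \<ominus>\<^bsub>chain_mod R P 0\<^esub> c \<odot>\<^bsub>chain_mod R P 0\<^esub> \<tau>0 y \<in> cycles R J P 0"
    and \<tau>0_cycle: "\<And>y. y \<in> chain_set R F (Suc (Suc 0)) ==> \<tau>0 (res_diff F (Suc 0) y) \<in> cycles R J P 0"
  obtains \<alpha> where "cone_stage R J c F P 0 \<alpha> \<tau>0" "\<And>y. y \<in> chain_set R F (Suc 0) ==>
    \<alpha>0 (res_diff F 0 y) = res_diff P 0 (\<alpha> y) \<oplus>\<^bsub>chain_mod R P 0\<^esub> c \<odot>\<^bsub>chain_mod R P 0\<^esub> \<tau>0 y"
proof -
  note dF = resolves_diff[OF F]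
  note \<alpha>d = linear_map_comp[OF dF \<alpha>0] and c\<tau> = linear_map_fun_smult[OF \<tau>0 c]
  from resolves_lift_cycles[OF P linear_map_fun_minus[OF \<alpha>d c\<tau>] base_cycle] obtain \<alpha>
    where \<alpha>: "linear_map R (chain_mod R F (Suc 0)) (chain_mod R P (Suc 0)) \<alpha>"
      "\<And>y. y \<in> chain_set R F (Suc 0) ==>
        \<alpha>0 (res_diff F 0 y) \<ominus>\<^bsub>chain_mod R P 0\<^esub> c \<odot>\<^bsub>chain_mod R P 0\<^esub> \<tau>0 y = res_diff P 0 (\<alpha> y)" by blast
  have eq: "\<alpha>0 (res_diff F 0 y) = res_diff P 0 (\<alpha> y) \<oplus>\<^bsub>chain_mod R P 0\<^esub> c \<odot>\<^bsub>chain_mod R P 0\<^esub> \<tau>0 y"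
    if y: "y \<in> chain_set R F (Suc 0)" for y
    using \<alpha>(2)[OF y] minus_cancel(1)[OF linear_map_module(2)[OF \<alpha>0] linear_map_closed[OF \<alpha>d y] linear_map_closed[OF c\<tau> y]] by simp
  have "res_diff P 0 (\<alpha> (res_diff F (Suc 0) y)) \<oplus>\<^bsub>chain_mod R P 0\<^esub> c \<odot>\<^bsub>chain_mod R P 0\<^esub> \<tau>0 (res_diff F (Suc 0) y) = \<zero>\<^bsub>chain_mod R P 0\<^esub>"
    if y: "y \<in> chain_set R F (Suc (Suc 0))" for y
    using eq[OF linear_map_closed[OF dF y]] resolves_diff_diff[OF F y] linear_map_zero[OF \<alpha>0] by simp
  then have "cone_stage R J c F P 0 \<alpha> \<tau>0" unfolding cone_stage_def using \<alpha>(1) \<tau>0 \<tau>0_cycle by blast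
  then show ?thesis by (rule that[OF _ eq])
qed

lemma cone_map_extend:
  assumes F: "resolves R I F" and P: "resolves R J P" and c: "c \<in> carrier R"
    and \<alpha>0: "linear_map R (chain_mod R F 0) (chain_mod R P 0) \<alpha>0" and \<tau>0: "linear_map R (chain_mod R F (Suc 0)) (chain_mod R P 0) \<tau>0"
    and base_cycle: "\<And>y. y \<in> chain_set R F (Suc 0) ==>
      \<alpha>0 (res_diff F 0 y) \<ominus>\<^bsub>chain_mod R P 0\<^esub> c \<odot>\<^bsub>chain_mod R P 0\<^esub> \<tau>0 y \<in> cycles R J P 0"
    and \<tau>0_cycle: "\<And>y. y \<in> chain_set R F (Suc (Suc 0)) ==> \<tau>0 (res_diff F (Suc 0) y) \<in> cycles R J P 0"
  obtains \<alpha> \<tau> where "cone_map R c F P \<alpha> \<tau>" "\<alpha> 0 = \<alpha>0"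
proof -
  define S where "S j = (\<lambda>(\<alpha>, \<tau>). cone_stage R J c F P j \<alpha> \<tau> \<and>
      (j = 0 --> (\<forall>y\<in>chain_set R F (Suc 0).
        \<alpha>0 (res_diff F 0 y) = res_diff P 0 (\<alpha> y) \<oplus>\<^bsub>chain_mod R P 0\<^esub> c \<odot>\<^bsub>chain_mod R P 0\<^esub> \<tau> y)))" for j
  define T where "T j = (\<lambda>(\<alpha>, \<tau>) (\<alpha>', \<tau>'). \<forall>y\<in>chain_set R F (Suc (Suc j)).
      \<tau> (res_diff F (Suc j) y) = \<ominus>\<^bsub>chain_mod R P j\<^esub> res_diff P j (\<tau>' y) \<and>
      \<alpha> (res_diff F (Suc j) y) = res_diff P (Suc j) (\<alpha>' y) \<oplus>\<^bsub>chain_mod R P (Suc j)\<^esub> c \<odot>\<^bsub>chain_mod R P (Suc j)\<^esub> \<tau>' y)"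
    for j :: nat
  have "\<exists>s. \<forall>j. S j (s j) \<and> T j (s j) (s (Suc j))"
  proof (rule dependent_nat_choice)
    from cone_map_base[OF F P c \<alpha>0 \<tau>0 base_cycle \<tau>0_cycle] obtain \<alpha> where "cone_stage R J c F P 0 \<alpha> \<tau>0"
      "\<And>y. y \<in> chain_set R F (Suc 0) ==>
        \<alpha>0 (res_diff F 0 y) = res_diff P 0 (\<alpha> y) \<oplus>\<^bsub>chain_mod R P 0\<^esub> c \<odot>\<^bsub>chain_mod R P 0\<^esub> \<tau>0 y" by blast
    then show "\<exists>s. S 0 s" unfolding S_def by (intro exI[of _ "(\<alpha>, \<tau>0)"]) simp
  next
    fix s j assume "S j s"
    moreover obtain \<alpha> \<tau> where s: "s = (\<alpha>, \<tau>)" by (cases s)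
    ultimately have "cone_stage R J c F P j \<alpha> \<tau>" by (simp add: S_def)
    from cone_map_step[OF F P c this] show "\<exists>s'. S (Suc j) s' \<and> T j s s'" unfolding S_def T_def s by auto metis
  qed
  then obtain s where s: "\<And>j. S j (s j)" "\<And>j. T j (s j) (s (Suc j))" by blast
  define \<alpha> where "\<alpha> i = (case i of 0 => \<alpha>0 | Suc j => fst (s j))" for i
  have s_eq: "s j = (\<alpha> (Suc j), snd (s j))" for j by (simp add: \<alpha>_def)
  have stage: "cone_stage R J c F P j (\<alpha> (Suc j)) (snd (s j))" for j
    using s(1)[of j] s_eq[of j] by (auto simp: S_def split: prod.splits)
  have lin: "linear_map R (chain_mod R F i) (chain_mod R P i) (\<alpha> i)" for i
    using \<alpha>0 cone_stageD(1)[OF stage] by (cases i) (simp_all add: \<alpha>_def)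
  have "\<alpha> i (res_diff F i y) = res_diff P i (\<alpha> (Suc i) y) \<oplus>\<^bsub>chain_mod R P i\<^esub> c \<odot>\<^bsub>chain_mod R P i\<^esub> snd (s i) y"
    if "y \<in> chain_set R F (Suc i)" for i y
  proof (cases i)
    case 0
    then show ?thesis using that s(1)[of 0] s_eq[of 0] by (auto simp: S_def \<alpha>_def split: prod.splits)
  next
    case (Suc j)
    then show ?thesis using that s(2)[of j] s_eq[of j] by (auto simp: T_def \<alpha>_def split: prod.splits)
  qed
  moreover have "snd (s i) (res_diff F (Suc i) y) = \<ominus>\<^bsub>chain_mod R P i\<^esub> res_diff P i (snd (s (Suc i)) y)"
    if "y \<in> chain_set R F (Suc (Suc i))" for i y
    using that s(2)[of i] by (auto simp: T_def split: prod.splits)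
  ultimately show ?thesis using that[of \<alpha> "\<lambda>i. snd (s i)"] lin cone_stageD(2)[OF stage] unfolding cone_map_def by (simp add: \<alpha>_def)
qed

lemma resolves_aug_boundary_multiple:
  fixes R (structure)
  assumes F: "resolves R I F" and J: "ideal J R" and x: "x \<in> carrier R" and I: "I \<subseteq> J <+>\<^bsub>R\<^esub> PIdl x"
  obtains t where "linear_map R (chain_mod R F (Suc 0)) (ring_as_module R) t"
    "\<And>y. y \<in> chain_set R F (Suc 0) ==> res_aug F (res_diff F 0 y) \<ominus> x \<otimes> t y \<in> J"
proof -
  interpret cring R by (rule resolves_cring[OF F])
  note RR = module_ring_as_module[OF is_cring]
  have J': "submodule J R (ring_as_module R)" using ideal_iff_submodule[OF is_cring] J by blast
  have mult: "linear_map R (ring_as_module R) (ring_as_module R) (\<lambda>t. x \<otimes> t)"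
    using linear_map_fun_smult[OF linear_map_ident[OF RR] x] by simp
  have ex: "\<exists>t\<in>carrier R. res_aug F (res_diff F 0 y) \<ominus> x \<otimes> t \<in> J" if y: "y \<in> chain_set R F (Suc 0)" for y
  proof -
    have "res_aug F (res_diff F 0 y) \<in> J <+> PIdl x" using resolves_aug_diff[OF F y] I by blast
    then obtain v t where v: "v \<in> J" and t: "t \<in> carrier R" "res_aug F (res_diff F 0 y) = v \<oplus> t \<otimes> x"
      unfolding set_add_iff cgenideal_def by blast
    then have "res_aug F (res_diff F 0 y) \<ominus> x \<otimes> t = v"
      using minus_cancel(4)[OF RR, of v "x \<otimes> t"] m_comm[OF t(1) x] ideal.Icarr[OF J v] x by simp
    then show ?thesis using t(1) v by auto
  qed
  show ?thesis
    by (rule linear_map_lift_mod[OF mult linear_map_comp[OF resolves_diff[OF F] resolves_aug[OF F]] J' module.carrier_is_submodule[OF RR],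
      unfolded ring_as_module_simps a_minus_ring_as_module, OF ex that])
qed

lemma cone_map_into_resolution:
  fixes R (structure)
  assumes J: "ideal J R" and F: "resolves R I F" and P: "resolves R J P"
    and x: "x \<in> carrier R" and I: "I \<subseteq> J <+>\<^bsub>R\<^esub> PIdl (x [^] (n + k :: nat))"
    and stable: "\<forall>j. \<forall>y\<in>carrier R. x [^] (k + j) \<otimes> y \<in> J --> x [^] k \<otimes> y \<in> J"
  obtains \<alpha> \<tau> where "cone_map R (x [^] n) F P \<alpha> \<tau>"
    "\<And>y. y \<in> chain_set R F 0 ==> res_aug P (\<alpha> 0 y) \<ominus> res_aug F y \<in> J"
proof -
  note R = resolves_cring[OF F] and dF = resolves_diff[OF F] and augF = resolves_aug_closed[OF F] and augP = resolves_aug_closed[OF P]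
  interpret cring R by (rule R)
  interpret J: ideal J R by (rule J)
  note RR = module_ring_as_module[OF R]
  have J': "submodule J R (ring_as_module R)" using ideal_iff_submodule[OF R] J by blast
  note trans = diff_mem_trans[OF RR J', unfolded ring_as_module_simps a_minus_ring_as_module]
    and sym = diff_mem_sym[OF RR J', unfolded ring_as_module_simps a_minus_ring_as_module]
    and mem = mem_if_diff_mem[OF RR J', unfolded ring_as_module_simps a_minus_ring_as_module]
  have xn: "x [^] n \<in> carrier R" and xk: "x [^] k \<in> carrier R" and xnk: "x [^] (n + k) = x [^] n \<otimes> x [^] k"
    using x by (simp_all add: nat_pow_mult)
  obtain t where t: "linear_map R (chain_mod R F (Suc 0)) (ring_as_module R) t"
    and td: "\<And>y. y \<in> chain_set R F (Suc 0) ==> res_aug F (res_diff F 0 y) \<ominus> x [^] (n + k) \<otimes> t y \<in> J"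
    using resolves_aug_boundary_multiple[OF F J nat_pow_closed[OF x] I] by blast
  have tR: "t y \<in> carrier R" if "y \<in> chain_set R F (Suc 0)" for y using linear_map_closed[OF t that] by simp
  obtain \<alpha>0 where \<alpha>0: "linear_map R (chain_mod R F 0) (chain_mod R P 0) \<alpha>0"
    and \<alpha>0_aug: "\<And>y. y \<in> chain_set R F 0 ==> res_aug P (\<alpha>0 y) \<ominus> res_aug F y \<in> J"
    using resolves_lift_aug[OF P J resolves_aug[OF F]] by blast
  have "linear_map R (chain_mod R F (Suc 0)) (ring_as_module R) (\<lambda>y. x [^] k \<otimes> t y)"
    using linear_map_fun_smult[OF t xk] by simp
  from resolves_lift_aug[OF P J this] obtain \<tau>0 where \<tau>0: "linear_map R (chain_mod R F (Suc 0)) (chain_mod R P 0) \<tau>0"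
    and \<tau>0_aug: "\<And>y. y \<in> chain_set R F (Suc 0) ==> res_aug P (\<tau>0 y) \<ominus> x [^] k \<otimes> t y \<in> J" by blast
  have base_cycle: "\<alpha>0 (res_diff F 0 y) \<ominus>\<^bsub>chain_mod R P 0\<^esub> x [^] n \<odot>\<^bsub>chain_mod R P 0\<^esub> \<tau>0 y \<in> cycles R J P 0"
    if y: "y \<in> chain_set R F (Suc 0)" for y
  proof -
    note dy = linear_map_closed[OF dF y]
    note \<alpha>0y = linear_map_closed[OF \<alpha>0 dy] and \<tau>0y = linear_map_closed[OF \<tau>0 y] and x\<tau>0y = linear_map_closed[OF linear_map_fun_smult[OF \<tau>0 xn] y]
    note closed = tR[OF y] augF[OF dy] augP[OF \<alpha>0y] augP[OF \<tau>0y]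
    have "x [^] n \<otimes> (res_aug P (\<tau>0 y) \<ominus> x [^] k \<otimes> t y) \<in> J" by (rule J.I_l_closed[OF \<tau>0_aug[OF y] xn])
    also have "x [^] n \<otimes> (res_aug P (\<tau>0 y) \<ominus> x [^] k \<otimes> t y) = x [^] n \<otimes> res_aug P (\<tau>0 y) \<ominus> x [^] (n + k) \<otimes> t y"
      unfolding xnk using tR[OF y] xn xk augP[OF \<tau>0y] by (simp add: a_minus_def r_distr r_minus m_assoc)
    finally have "x [^] (n + k) \<otimes> t y \<ominus> x [^] n \<otimes> res_aug P (\<tau>0 y) \<in> J" by (rule sym[rotated -1]) (simp_all add: closed x)
    then have "res_aug P (\<alpha>0 (res_diff F 0 y)) \<ominus> x [^] n \<otimes> res_aug P (\<tau>0 y) \<in> J"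
      using trans[OF _ _ _ trans[OF _ _ _ \<alpha>0_aug[OF dy] td[OF y]]] closed x by simp
    then show ?thesis
      using linear_map_minus[OF resolves_aug[OF P] \<alpha>0y x\<tau>0y] linear_map_smult[OF resolves_aug[OF P] xn \<tau>0y]
        module.carrier_is_submodule[OF linear_map_module(2)[OF \<alpha>0]] submodule_minus[OF _ \<alpha>0y x\<tau>0y]
      by (simp add: cycles_def)
  qed
  have "\<tau>0 (res_diff F (Suc 0) y) \<in> cycles R J P 0" if y: "y \<in> chain_set R F (Suc (Suc 0))" for y
  proof -
    note dy = linear_map_closed[OF dF y]
    have "res_aug F (res_diff F 0 (res_diff F (Suc 0) y)) = \<zero>"
      using resolves_diff_diff[OF F y] linear_map_zero[OF resolves_aug[OF F]] by simp
    then have "x [^] (n + k) \<otimes> t (res_diff F (Suc 0) y) \<in> J"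
      using td[OF dy] sym[of \<zero> "x [^] (n + k) \<otimes> t (res_diff F (Suc 0) y)"] tR[OF dy] x by (simp add: a_minus_def)
    then have "x [^] k \<otimes> t (res_diff F (Suc 0) y) \<in> J" using stable tR[OF dy] by (simp add: add.commute)
    then have "res_aug P (\<tau>0 (res_diff F (Suc 0) y)) \<in> J" by (rule mem[OF augP[OF linear_map_closed[OF \<tau>0 dy]] _ \<tau>0_aug[OF dy]])
    then show ?thesis using linear_map_closed[OF \<tau>0 dy] by (simp add: cycles_def)
  qed
  from cone_map_extend[OF F P xn \<alpha>0 \<tau>0 base_cycle this] obtain \<alpha> \<tau> where "cone_map R (x [^] n) F P \<alpha> \<tau>" "\<alpha> 0 = \<alpha>0" by blast
  then show ?thesis using that \<alpha>0_aug by blast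
qed

definition cone_fold ::
    "('a, 'r) ring_scheme => ('a, 'n) free_res => (nat => (nat => 'a) => (nat => 'a)) => (nat => (nat => 'a) => (nat => 'a))
      => (nat => (nat => 'a) => (nat => 'a)) => (nat => (nat => 'a) => (nat => 'a)) => nat => (nat => 'a) => (nat => 'a)" where
  "cone_fold R H \<zeta> h \<alpha> \<tau> i y =
     (case i of 0 => \<zeta> 0 (\<alpha> 0 y) | Suc j => \<zeta> i (\<alpha> i y) \<oplus>\<^bsub>chain_mod R H i\<^esub> h j (\<tau> j y))"

text \<open>A chain map \<open>\<zeta>\<close> and a null homotopy of \<open>c\<zeta>\<close> form a chain map out of the cone of \<open>c\<close>.\<close>

lemma chain_map_cone_fold:
  assumes F: "resolves R I F" and P: "resolves R J P" and H: "resolves R K H" and c: "c \<in> carrier R"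
    and \<alpha>\<tau>: "cone_map R c F P \<alpha> \<tau>" and \<zeta>: "chain_map R P H \<zeta>"
    and h: "\<And>i. linear_map R (chain_mod R P i) (chain_mod R H (Suc i)) (h i)"
    and h0: "\<And>y. y \<in> chain_set R P 0 ==> c \<odot>\<^bsub>chain_mod R H 0\<^esub> \<zeta> 0 y = res_diff H 0 (h 0 y)"
    and hSuc: "\<And>i y. y \<in> chain_set R P (Suc i) ==> c \<odot>\<^bsub>chain_mod R H (Suc i)\<^esub> \<zeta> (Suc i) y =
      res_diff H (Suc i) (h (Suc i) y) \<oplus>\<^bsub>chain_mod R H (Suc i)\<^esub> h i (res_diff P i y)"
  shows "chain_map R F H (cone_fold R H \<zeta> h \<alpha> \<tau>)"
  unfolding chain_map_def
proof (intro conjI allI ballI)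
  have \<alpha>: "linear_map R (chain_mod R F i) (chain_mod R P i) (\<alpha> i)"
    and \<tau>: "linear_map R (chain_mod R F (Suc i)) (chain_mod R P i) (\<tau> i)"
    and \<alpha>d: "y \<in> chain_set R F (Suc i) ==>
      \<alpha> i (res_diff F i y) = res_diff P i (\<alpha> (Suc i) y) \<oplus>\<^bsub>chain_mod R P i\<^esub> c \<odot>\<^bsub>chain_mod R P i\<^esub> \<tau> i y"
    and \<tau>d: "y \<in> chain_set R F (Suc (Suc i)) ==> \<tau> i (res_diff F (Suc i) y) = \<ominus>\<^bsub>chain_mod R P i\<^esub> res_diff P i (\<tau> (Suc i) y)"
    for i y using \<alpha>\<tau> by (auto simp: cone_map_def)
  note \<zeta>\<alpha> = linear_map_comp[OF \<alpha> chain_map_linear[OF \<zeta>]] and h\<tau> = linear_map_comp[OF \<tau> h] and dP = resolves_diff[OF P] and dH = resolves_diff[OF H]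
  show "linear_map R (chain_mod R F i) (chain_mod R H i) (cone_fold R H \<zeta> h \<alpha> \<tau> i)" for i
    using \<zeta>\<alpha> linear_map_fun_add[OF \<zeta>\<alpha> h\<tau>] unfolding cone_fold_def by (cases i) simp_all
  fix i y assume y: "y \<in> chain_set R F (Suc i)"
  interpret H: module R "chain_mod R H i" by (rule linear_map_module(2)[OF \<zeta>\<alpha>])
  note \<alpha>y = linear_map_closed[OF \<alpha> y] and \<tau>y = linear_map_closed[OF \<tau> y]
  note d\<alpha>y = linear_map_closed[OF dP \<alpha>y] and c\<tau>y = linear_map_closed[OF linear_map_fun_smult[OF \<tau> c] y] and dh\<tau>y = linear_map_closed[OF dH linear_map_closed[OF h\<tau> y]]
  have left: "res_diff H i (cone_fold R H \<zeta> h \<alpha> \<tau> (Suc i) y) = \<zeta> i (res_diff P i (\<alpha> (Suc i) y)) \<oplus>\<^bsub>chain_mod R H i\<^esub> res_diff H i (h i (\<tau> i y))"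
    using linear_map_add[OF dH linear_map_closed[OF \<zeta>\<alpha> y] linear_map_closed[OF h\<tau> y]] chain_map_commute[OF \<zeta> \<alpha>y] by (simp add: cone_fold_def)
  have \<zeta>\<alpha>d: "\<zeta> i (\<alpha> i (res_diff F i y)) = \<zeta> i (res_diff P i (\<alpha> (Suc i) y)) \<oplus>\<^bsub>chain_mod R H i\<^esub> c \<odot>\<^bsub>chain_mod R H i\<^esub> \<zeta> i (\<tau> i y)"
    using \<alpha>d[OF y] linear_map_add[OF chain_map_linear[OF \<zeta>] d\<alpha>y c\<tau>y] linear_map_smult[OF chain_map_linear[OF \<zeta>] c \<tau>y] by simp
  show "res_diff H i (cone_fold R H \<zeta> h \<alpha> \<tau> (Suc i) y) = cone_fold R H \<zeta> h \<alpha> \<tau> i (res_diff F i y)"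
  proof (cases i)
    case 0
    then show ?thesis using left \<zeta>\<alpha>d h0[of "\<tau> 0 y"] \<tau>y by (simp add: cone_fold_def)
  next
    case (Suc j)
    note y' = y[unfolded Suc]
    note d\<tau>y = linear_map_closed[OF dP linear_map_closed[OF \<tau> y']]
    have hd: "h j (res_diff P j (\<tau> (Suc j) y)) \<in> chain_set R H i"
      and h\<tau>d: "h j (\<tau> j (res_diff F i y)) = \<ominus>\<^bsub>chain_mod R H i\<^esub> h j (res_diff P j (\<tau> (Suc j) y))"
      using linear_map_closed[OF h d\<tau>y] \<tau>d[OF y'] linear_map_uminus[OF h d\<tau>y] Suc by simp_all
    have "c \<odot>\<^bsub>chain_mod R H i\<^esub> \<zeta> i (\<tau> i y) = res_diff H i (h i (\<tau> i y)) \<oplus>\<^bsub>chain_mod R H i\<^esub> h j (res_diff P j (\<tau> (Suc j) y))"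
      using hSuc[of "\<tau> (Suc j) y" j] \<tau>y Suc by simp
    moreover have "cone_fold R H \<zeta> h \<alpha> \<tau> i z = \<zeta> i (\<alpha> i z) \<oplus>\<^bsub>chain_mod R H i\<^esub> h j (\<tau> j z)" for z by (simp add: cone_fold_def Suc)
    ultimately show ?thesis
      using left \<zeta>\<alpha>d h\<tau>d hd dh\<tau>y linear_map_closed[OF chain_map_linear[OF \<zeta>] d\<alpha>y] by (simp add: H.a_assoc H.r_neg)
  qed
qed

definition bounded_lifts :: "('a, 'r) ring_scheme => 'a set => nat => bool" where
  "bounded_lifts R \<aa> r \<longleftrightarrow>
     (\<forall>n. \<exists>m\<ge>n. \<forall>F G. resolves R (ideal_power R \<aa> m) F --> resolves R (ideal_power R \<aa> n) G -->
        (\<exists>\<phi>. chain_lift R F G (ideal_power R \<aa> n) \<phi> \<and>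
          (\<forall>i>r. \<forall>x\<in>chain_set R F i. \<phi> i x = \<zero>\<^bsub>chain_mod R G i\<^esub>)))"

lemma bounded_lifts_zero_ideal:
  fixes R (structure)
  assumes R: "cring R"
  shows "bounded_lifts R {\<zero>} 0"
  unfolding bounded_lifts_def
proof (intro allI exI[of _ "Suc n" for n] conjI impI)
  interpret cring R by (rule R)
  note FR = module_free_module[OF R] and zero = zeroideal
  fix n F G assume F: "resolves R (ideal_power R {\<zero>} (Suc n)) F" and G: "resolves R (ideal_power R {\<zero>} n) G"
  note J = ideal_power_ideal[OF R zero]
  have power_zero: "ideal_power R {\<zero>} (Suc n) \<subseteq> {\<zero>}"
    using ideal_power_antimono[OF R zero, of "Suc 0" "Suc n"] ideal_power_1[OF R zero] by simp
  obtain u where u: "u \<in> chain_set R G 0" "res_aug G u \<ominus> \<one> \<in> ideal_power R {\<zero>} n" by (rule resolves_unit[OF G])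
  define \<phi> where "\<phi> i x = (if i = 0 then res_aug F x \<odot>\<^bsub>chain_mod R G 0\<^esub> u else \<zero>\<^bsub>chain_mod R G i\<^esub>)" for i :: nat and x
  have \<phi>0: "\<phi> 0 = (\<lambda>x. res_aug F x \<odot>\<^bsub>chain_mod R G 0\<^esub> u)" and \<phi>Suc: "\<phi> (Suc i) = (\<lambda>x. \<zero>\<^bsub>chain_mod R G (Suc i)\<^esub>)" for i
    by (simp_all add: \<phi>_def fun_eq_iff)
  have "linear_map R (chain_mod R F i) (chain_mod R G i) (\<phi> i)" for i
    by (cases i) (simp_all add: \<phi>0 \<phi>Suc linear_map_smult_const[OF resolves_aug[OF F] FR u(1)] linear_map_const_zero[OF FR FR])
  moreover have "res_diff G i (\<phi> (Suc i) x) = \<phi> i (res_diff F i x)" if x: "x \<in> chain_set R F (Suc i)" for i x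
  proof (cases i)
    case 0
    have "res_aug F (res_diff F 0 x) = \<zero>" using resolves_aug_diff[OF F] x 0 power_zero by blast
    then show ?thesis using 0 linear_map_zero[OF resolves_diff[OF G]] module.smult_l_null[OF FR u(1)] by (simp add: \<phi>0 \<phi>Suc)
  next
    case (Suc j)
    then show ?thesis using linear_map_zero[OF resolves_diff[OF G]] by (simp add: \<phi>Suc)
  qed
  moreover have "res_aug G (\<phi> 0 x) \<ominus> res_aug F x \<in> ideal_power R {\<zero>} n" if "x \<in> chain_set R F 0" for x
    using resolves_unit_smult[OF G J u resolves_aug_closed[OF F that]] by (simp add: \<phi>0)
  ultimately have "chain_lift R F G (ideal_power R {\<zero>} n) \<phi>" unfolding chain_lift_def chain_map_def by blast
  then show "\<exists>\<phi>. chain_lift R F G (ideal_power R {\<zero>} n) \<phi> \<and>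
      (\<forall>i>0. \<forall>x\<in>chain_set R F i. \<phi> i x = \<zero>\<^bsub>chain_mod R G i\<^esub>)"
    by (intro exI[of _ \<phi>]) (auto simp: \<phi>_def)
qed simp

lemma smult_null_homotopy:
  assumes Q: "resolves R I Q" and H: "resolves R K H" and K: "ideal K R" and c: "c \<in> K" and \<eta>: "chain_map R Q H \<eta>"
  obtains h where "\<And>i. linear_map R (chain_mod R Q i) (chain_mod R H (Suc i)) (h i)"
    "\<And>y. y \<in> chain_set R Q 0 ==> c \<odot>\<^bsub>chain_mod R H 0\<^esub> \<eta> 0 y = res_diff H 0 (h 0 y)"
    "\<And>i y. y \<in> chain_set R Q (Suc i) ==> c \<odot>\<^bsub>chain_mod R H (Suc i)\<^esub> \<eta> (Suc i) y =
      res_diff H (Suc i) (h (Suc i) y) \<oplus>\<^bsub>chain_mod R H (Suc i)\<^esub> h i (res_diff Q i y)"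
proof -
  interpret K: ideal K R by (rule K)
  have cR: "c \<in> carrier R" using K.Icarr[OF c] .
  note \<eta>l = chain_map_linear[OF \<eta>]
  let ?c\<eta> = "\<lambda>i y. c \<odot>\<^bsub>chain_mod R H i\<^esub> \<eta> i y"
  have c\<eta>: "chain_map R Q H ?c\<eta>"
    unfolding chain_map_def
    using linear_map_fun_smult[OF \<eta>l cR] linear_map_smult[OF resolves_diff[OF H] cR linear_map_closed[OF \<eta>l]]
      chain_map_commute[OF \<eta>] by auto
  have "res_aug H (?c\<eta> 0 y) \<in> K" if y: "y \<in> chain_set R Q 0" for y
    using linear_map_smult[OF resolves_aug[OF H] cR linear_map_closed[OF \<eta>l y]]
      K.I_r_closed[OF c resolves_aug_closed[OF H linear_map_closed[OF \<eta>l y]]] by simp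
  from null_homotopy[OF Q H c\<eta> this] that show ?thesis by blast
qed

lemma chain_lift_through_cone:
  fixes R (structure)
  assumes F: "resolves R I F" and P: "resolves R J P" and Q: "resolves R J' Q" and H: "resolves R K H"
    and K: "ideal K R" "J \<subseteq> K" "J' \<subseteq> K" and c: "c \<in> K"
    and \<beta>: "chain_lift R P Q J' \<beta>" and \<beta>_bounded: "\<And>i x. i > r ==> x \<in> chain_set R P i ==> \<beta> i x = \<zero>\<^bsub>chain_mod R Q i\<^esub>"
    and \<alpha>\<tau>: "cone_map R c F P \<alpha> \<tau>" and \<alpha>_aug: "\<And>y. y \<in> chain_set R F 0 ==> res_aug P (\<alpha> 0 y) \<ominus> res_aug F y \<in> J"
  obtains \<phi> where "chain_lift R F H K \<phi>"
    "\<And>i x. i > Suc r ==> x \<in> chain_set R F i ==> \<phi> i x = \<zero>\<^bsub>chain_mod R H i\<^esub>"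
proof -
  note R = resolves_cring[OF F]
  interpret cring R by (rule R)
  interpret K: ideal K R by (rule K)
  have cR: "c \<in> carrier R" using K.Icarr[OF c] .
  note RR = module_ring_as_module[OF R]
  have K': "submodule K R (ring_as_module R)" using ideal_iff_submodule[OF R] K(1) by blast
  obtain \<eta> where \<eta>: "chain_lift R Q H K \<eta>" using chain_lift_exists[OF Q H K(3,1)] by blast
  note \<eta>l = chain_lift_linear[OF \<eta>] and \<beta>l = chain_lift_linear[OF \<beta>]
  let ?c\<eta> = "\<lambda>i y. c \<odot>\<^bsub>chain_mod R H i\<^esub> \<eta> i y"
  from smult_null_homotopy[OF Q H K(1) c chain_lift_chain_map[OF \<eta>]] obtain h where h: "\<And>i. linear_map R (chain_mod R Q i) (chain_mod R H (Suc i)) (h i)"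
    "\<And>y. y \<in> chain_set R Q 0 ==> ?c\<eta> 0 y = res_diff H 0 (h 0 y)"
    "\<And>i y. y \<in> chain_set R Q (Suc i) ==>
      ?c\<eta> (Suc i) y = res_diff H (Suc i) (h (Suc i) y) \<oplus>\<^bsub>chain_mod R H (Suc i)\<^esub> h i (res_diff Q i y)" by blast
  let ?\<zeta> = "\<lambda>i y. \<eta> i (\<beta> i y)" and ?h = "\<lambda>i y. h i (\<beta> i y)"
  have \<zeta>: "chain_lift R P H K ?\<zeta>" by (rule chain_lift_comp[OF P Q H K(3,1) \<beta> \<eta>])
  let ?\<phi> = "cone_fold R H ?\<zeta> ?h \<alpha> \<tau>"
  have \<phi>: "chain_map R F H ?\<phi>"
    by (rule chain_map_cone_fold[OF F P H cR \<alpha>\<tau> chain_lift_chain_map[OF \<zeta>]])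
      (use h(2,3) linear_map_closed[OF \<beta>l] linear_map_comp[OF \<beta>l h(1)] chain_map_commute[OF chain_lift_chain_map[OF \<beta>]] in simp_all)
  have \<alpha>l: "linear_map R (chain_mod R F i) (chain_mod R P i) (\<alpha> i)"
    and \<tau>l: "linear_map R (chain_mod R F (Suc i)) (chain_mod R P i) (\<tau> i)" for i
    using \<alpha>\<tau> by (auto simp: cone_map_def)
  have "res_aug H (?\<phi> 0 y) \<ominus> res_aug F y \<in> K" if y: "y \<in> chain_set R F 0" for y
    using diff_mem_trans[OF RR K', of "res_aug H (?\<phi> 0 y)" "res_aug P (\<alpha> 0 y)" "res_aug F y"]
      chain_lift_aug[OF \<zeta> linear_map_closed[OF \<alpha>l y]] subsetD[OF K(2) \<alpha>_aug[OF y]] resolves_aug_closed[OF F y]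
      resolves_aug_closed[OF P linear_map_closed[OF \<alpha>l y]]
      resolves_aug_closed[OF H linear_map_closed[OF chain_lift_linear[OF \<zeta>] linear_map_closed[OF \<alpha>l y]]]
    by (simp add: cone_fold_def)
  then have "chain_lift R F H K ?\<phi>" using \<phi> unfolding chain_lift_def by blast
  moreover have "?\<phi> i y = \<zero>\<^bsub>chain_mod R H i\<^esub>" if i: "i > Suc r" and y: "y \<in> chain_set R F i" for i y
  proof -
    obtain j where j: "i = Suc j" "j > r" using i by (cases i) auto
    interpret Hi: module R "chain_mod R H i" by (rule linear_map_module(2)[OF \<eta>l])
    have "\<beta> (Suc j) (\<alpha> (Suc j) y) = \<zero>\<^bsub>chain_mod R Q (Suc j)\<^esub>" "\<beta> j (\<tau> j y) = \<zero>\<^bsub>chain_mod R Q j\<^esub>"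
      using \<beta>_bounded linear_map_closed[OF \<alpha>l] linear_map_closed[OF \<tau>l] y j by auto
    then show ?thesis
      using j linear_map_zero[OF \<eta>l, of "Suc j"] linear_map_zero[OF h(1), of j] Hi.l_zero[OF Hi.zero_closed] by (simp add: cone_fold_def)
  qed
  ultimately show ?thesis by (rule that)
qed

lemma bounded_lifts_insert:
  fixes R (structure)
  assumes R: "cring R" and NR: "noetherian_ring R" and \<bb>: "ideal \<bb> R" and \<aa>: "ideal \<aa> R" and "\<bb> \<subseteq> \<aa>" "x \<in> \<aa>"
    and \<aa>_sub: "\<aa> \<subseteq> \<bb> <+>\<^bsub>R\<^esub> PIdl x" and lifts: "bounded_lifts R \<bb> r"
  shows "bounded_lifts R \<aa> (Suc r)"
  unfolding bounded_lifts_def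
proof
  fix n
  obtain m where m: "m \<ge> n" and \<beta>: "\<And>F G. resolves R (ideal_power R \<bb> m) F ==> resolves R (ideal_power R \<bb> n) G ==>
      \<exists>\<phi>. chain_lift R F G (ideal_power R \<bb> n) \<phi> \<and> (\<forall>i>r. \<forall>x\<in>chain_set R F i. \<phi> i x = \<zero>\<^bsub>chain_mod R G i\<^esub>)"
    using lifts unfolding bounded_lifts_def by blast
  have x: "x \<in> carrier R" using ideal.Icarr[OF \<aa> assms(6)] .
  obtain k where stable: "\<forall>j. \<forall>y\<in>carrier R. x [^] (k + j) \<otimes> y \<in> ideal_power R \<bb> m --> x [^] (k::nat) \<otimes> y \<in> ideal_power R \<bb> m"
    using noetherian_module_colon_stabilizes[OF fin_gen_noetherian_module[OF R NR fin_gen_ring_as_module[OF R]]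
      submodule_ideal_power[OF R \<bb>, of m] x, unfolded ring_as_module_simps] by blast
  have cover: "ideal_power R \<aa> (m + (n + k)) \<subseteq> ideal_power R \<bb> m <+> PIdl (x [^] (n + k))"
    by (rule ideal_power_add_subset[OF R \<aa> \<bb> x \<aa>_sub])
  have sub: "ideal_power R \<bb> n \<subseteq> ideal_power R \<aa> n" "ideal_power R \<bb> m \<subseteq> ideal_power R \<aa> n"
    using ideal_power_mono[OF R \<bb> \<aa> assms(5)] ideal_power_antimono[OF R \<bb> m] by blast+
  note J = ideal_power_ideal[OF R \<bb>] and K = ideal_power_ideal[OF R \<aa>]
  obtain P where P: "resolves R (ideal_power R \<bb> m) P" using resolution_exists[OF R NR J] by blast
  obtain Q where Q: "resolves R (ideal_power R \<bb> n) Q" using resolution_exists[OF R NR J] by blast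
  obtain \<beta> where \<beta>: "chain_lift R P Q (ideal_power R \<bb> n) \<beta>"
    "\<And>i y. i > r ==> y \<in> chain_set R P i ==> \<beta> i y = \<zero>\<^bsub>chain_mod R Q i\<^esub>" using \<beta>[OF P Q] by blast
  show "\<exists>m\<ge>n. \<forall>F G. resolves R (ideal_power R \<aa> m) F --> resolves R (ideal_power R \<aa> n) G -->
      (\<exists>\<phi>. chain_lift R F G (ideal_power R \<aa> n) \<phi> \<and> (\<forall>i>Suc r. \<forall>x\<in>chain_set R F i. \<phi> i x = \<zero>\<^bsub>chain_mod R G i\<^esub>))"
  proof (intro exI[of _ "m + (n + k)"] conjI allI impI)
    fix F H assume F: "resolves R (ideal_power R \<aa> (m + (n + k))) F" and H: "resolves R (ideal_power R \<aa> n) H"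
    show "\<exists>\<phi>. chain_lift R F H (ideal_power R \<aa> n) \<phi> \<and> (\<forall>i>Suc r. \<forall>x\<in>chain_set R F i. \<phi> i x = \<zero>\<^bsub>chain_mod R H i\<^esub>)"
    proof (rule cone_map_into_resolution[OF J F P x cover stable])
      fix \<alpha> \<tau>
      assume "cone_map R (x [^] n) F P \<alpha> \<tau>"
        "\<And>y. y \<in> chain_set R F 0 ==> res_aug P (\<alpha> 0 y) \<ominus> res_aug F y \<in> ideal_power R \<bb> m"
      from chain_lift_through_cone[OF F P Q H K sub(2,1) elem_power_in_ideal_power[OF R \<aa> assms(6)] \<beta> this]
      show ?thesis by metis
    qed
  qed simp
qed

lemma bounded_lifts_genideal:
  assumes R: "cring R" and NR: "noetherian_ring R" and "finite A" "A \<subseteq> carrier R"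
  shows "bounded_lifts R (Idl\<^bsub>R\<^esub> A) (card A)"
  using assms(3,4)
proof (induction rule: finite_induct)
  case empty
  have "Idl\<^bsub>R\<^esub> {} = {\<zero>\<^bsub>R\<^esub>}"
    using ring.genideal_minimal[OF cring.axioms(1)[OF R] ring.zeroideal[OF cring.axioms(1)[OF R]], of "{}"]
      additive_subgroup.zero_closed[OF ideal.axioms(1)[OF ring.genideal_ideal[OF cring.axioms(1)[OF R], of "{}"]]] by auto
  then show ?case using bounded_lifts_zero_ideal[OF R] by simp
next
  case (insert x A)
  interpret cring R by (rule R)
  have A: "insert x A \<subseteq> carrier R" "A \<subseteq> carrier R" using insert.prems by auto
  have "A \<subseteq> Idl\<^bsub>R\<^esub> (insert x A)" "x \<in> Idl\<^bsub>R\<^esub> (insert x A)" using genideal_self[OF A(1)] by auto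
  then have "bounded_lifts R (Idl\<^bsub>R\<^esub> (insert x A)) (Suc (card A))"
    using bounded_lifts_insert[OF R NR genideal_ideal[OF A(2)] genideal_ideal[OF A(1)] _ _ genideal_insert_subset[OF R A(1)] insert.IH[OF A(2)]]
      genideal_minimal[OF genideal_ideal[OF A(1)]] by blast
  then show ?case using insert.hyps by simp
qed

lemma vanishes_above_lift_bound:
  assumes NR: "noetherian_ring R" and \<aa>: "ideal \<aa> R" and lifts: "bounded_lifts R \<aa> r"
    and X: "module R X" and N: "submodule N R X" and L: "submodule L R X" and k: "k > r"
  shows "vanishes R \<aa> X N L k"
proof -
  interpret module R X by (rule X)
  obtain F \<phi> where tower: "resolution_tower R \<aa> F \<phi>" using noetherian_resolution_tower[OF is_cring NR \<aa>] by blast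
  note F = resolution_towerD(1)[OF tower] and \<phi> = resolution_towerD(2)[OF tower]
  show ?thesis
    unfolding vanishes_iff_tower[OF X N L \<aa> tower]
  proof (intro allI impI)
    fix n f assume f: "rel_cocycle R (F n) X N L k f"
    obtain m \<psi> where m: "m \<ge> n" and \<psi>: "chain_lift R (F m) (F n) (ideal_power R \<aa> n) \<psi>"
      "\<And>x. x \<in> chain_set R (F m) k ==> \<psi> k x = \<zero>\<^bsub>chain_mod R (F n) k\<^esub>"
      using lifts F k unfolding bounded_lifts_def by metis
    have "rel_coboundary R (F m) X N L k (\<lambda>x. f (\<psi> k x))"
      using rel_coboundary_cong[OF rel_coboundary_zero[OF X N L F]] \<psi>(2) linear_map_zero[OF rel_cocycle_linear[OF f]] by auto
    from rel_coboundary_lift_unique[OF X N L F f F ideal_power_ideal[OF is_cring \<aa>] \<phi>[OF m] \<psi>(1) this]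
    show "\<exists>m\<ge>n. rel_coboundary R (F m) X N L k (\<lambda>x. f (\<phi> m n k x))" using m by blast
  qed
qed

subsection \<open>Submodules of small cohomological dimension\<close>

abbreviation dot :: "('a, 'r) ring_scheme => nat => (nat => 'a) => (nat => 'a) => 'a" where
  "dot R n l x \<equiv> lincomb (ring_as_module R) l x n"

definition dual_diff :: "('a, 'r) ring_scheme => ('a, 'n) free_res => nat => (nat => 'a) => (nat => 'a)" where
  "dual_diff R F q l = (\<lambda>j\<in>{..<res_rank F (Suc q)}.
     dot R (res_rank F q) l (res_diff F q (std_basis R (res_rank F (Suc q)) j)))"

definition dual_aug :: "('a, 'r) ring_scheme => ('a, 'a) free_res => (nat => 'a)" where
  "dual_aug R F = (\<lambda>j\<in>{..<res_rank F 0}. res_aug F (std_basis R (res_rank F 0) j))"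

lemma linear_map_dot:
  assumes "cring R"
  shows "x \<in> carrier (free_module R n) ==> linear_map R (free_module R n) (ring_as_module R) (\<lambda>l. dot R n l x)"
    "l \<in> carrier (free_module R n) ==> linear_map R (free_module R n) (ring_as_module R) (\<lambda>x. dot R n l x)"
  using linear_map_power_lincomb[OF module_ring_as_module[OF assms]] linear_map_lincomb[OF module_ring_as_module[OF assms]]
    free_module_nth_closed[of _ R n]
  by (simp_all add: free_module_eq_power[symmetric])

context
  fixes R :: "('a, 'r) ring_scheme" (structure) and J :: "'a set" and F :: "('a, 'a) free_res"
  assumes F: "resolves R J F"
begin

interpretation cring R by (rule resolves_cring[OF F])

private lemmas ring_module = module_ring_as_module[OF is_cring]
private lemmas res_diff_linear = resolves_diff[OF F]

lemma linear_map_dual_diff: "linear_map R (chain_mod R F q) (chain_mod R F (Suc q)) (dual_diff R F q)"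
  using linear_map_into_power[OF module_free_module[OF is_cring] ring_module
      linear_map_dot(1)[OF is_cring linear_map_closed[OF res_diff_linear std_basis_closed[OF is_cring]]]]
  by (simp add: dual_diff_def[abs_def] free_module_eq_power)

lemma dot_dual_diff:
  assumes l: "l \<in> chain_set R F q" and x: "x \<in> chain_set R F (Suc q)"
  shows "dot R (res_rank F (Suc q)) (dual_diff R F q l) x = dot R (res_rank F q) l (res_diff F q x)"
proof (rule linear_map_eq_if_basis[OF linear_map_dot(2)[OF is_cring linear_map_closed[OF linear_map_dual_diff l]]
      linear_map_comp[OF res_diff_linear linear_map_dot(2)[OF is_cring l]] _ x])
  fix j assume j: "j < res_rank F (Suc q)"
  have "dot R (res_rank F (Suc q)) (dual_diff R F q l) (std_basis R (res_rank F (Suc q)) j) = dual_diff R F q l j"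
    by (rule lincomb_std_basis[OF ring_module _ j]) (use free_module_nth_closed[OF linear_map_closed[OF linear_map_dual_diff l]] in simp)
  then show "dot R (res_rank F (Suc q)) (dual_diff R F q l) (std_basis R (res_rank F (Suc q)) j) =
      dot R (res_rank F q) l (res_diff F q (std_basis R (res_rank F (Suc q)) j))"
    using j by (simp add: dual_diff_def)
qed

lemma dual_diff_dual_diff:
  assumes l: "l \<in> chain_set R F q"
  shows "dual_diff R F (Suc q) (dual_diff R F q l) = \<zero>\<^bsub>chain_mod R F (Suc (Suc q))\<^esub>"
proof -
  note basis = std_basis_closed[OF is_cring]
  have "dual_diff R F (Suc q) (dual_diff R F q l) j = \<zero>" if j: "j < res_rank F (Suc (Suc q))" for j
    using dot_dual_diff[OF l linear_map_closed[OF res_diff_linear basis]] resolves_diff_diff[OF F basis]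
      linear_map_zero[OF linear_map_dot(2)[OF is_cring l]] j
    by (simp add: dual_diff_def[of R F "Suc q"])
  then show ?thesis
    using power_module_eqI[OF linear_map_closed[OF linear_map_comp[OF linear_map_dual_diff linear_map_dual_diff] l, unfolded free_module_eq_power]
        power_module_closed(1)[OF ring_module]] by (simp add: free_module_eq_power power_module_nth)
qed

lemma dual_aug_closed: "dual_aug R F \<in> chain_set R F 0"
  using resolves_aug_closed[OF F std_basis_closed[OF is_cring]] by (simp add: free_module_def dual_aug_def)

lemma dot_dual_aug:
  assumes "x \<in> chain_set R F 0"
  shows "dot R (res_rank F 0) (dual_aug R F) x = res_aug F x"
  unfolding linear_map_expand[OF resolves_aug[OF F] assms] by (rule lincomb_cong) (auto simp: dual_aug_def)

lemma dual_diff_dual_aug_mem: "j < res_rank F (Suc 0) ==> dual_diff R F 0 (dual_aug R F) j \<in> J"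
  using dot_dual_aug[OF linear_map_closed[OF res_diff_linear std_basis_closed[OF is_cring]]] resolves_aug_diff[OF F std_basis_closed[OF is_cring]]
  by (simp add: dual_diff_def)

end

text \<open>Chain maps from \<open>G\<close> to \<open>N \<otimes> F\<close> modulo \<open>L\<close>. The argument \<open>l\<close> of \<open>z\<close> runs through the dual
  of \<open>F\<close>, which avoids the tensor product.\<close>

definition tensor_map ::
    "('a, 'r) ring_scheme => ('a, 'm, 's) module_scheme => 'm set => 'm set => ('a, 'n) free_res => ('a, 'k) free_res
      => (nat => (nat => 'a) => (nat => 'a) => 'm) => bool" where
  "tensor_map R X N L F G z \<longleftrightarrow>
     (\<forall>q. \<forall>l\<in>chain_set R F q. linear_map R (chain_mod R G q) X (z q l)) \<and>
     (\<forall>q. \<forall>x\<in>chain_set R G q. linear_map R (chain_mod R F q) X (\<lambda>l. z q l x)) \<and>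
     (\<forall>q. \<forall>l\<in>chain_set R F q. \<forall>x\<in>chain_set R G q. z q l x \<in> N) \<and>
     (\<forall>q. \<forall>l\<in>chain_set R F q. \<forall>x\<in>chain_set R G (Suc q).
        z q l (res_diff G q x) \<ominus>\<^bsub>X\<^esub> z (Suc q) (dual_diff R F q l) x \<in> L)"

definition vanishes_from ::
    "('a, 'r) ring_scheme => 'm set => ('a, 'n) free_res => ('a, 'k) free_res
      => (nat => (nat => 'a) => (nat => 'a) => 'm) => nat => bool" where
  "vanishes_from R L F G z k \<longleftrightarrow>
     (\<forall>q\<ge>k. \<forall>l\<in>chain_set R F q. \<forall>x\<in>chain_set R G q. z q l x \<in> L)"

definition tensor_primitive ::
    "('a, 'r) ring_scheme => ('a, 'm, 's) module_scheme => 'm set => 'm set => ('a, 'n) free_res => ('a, 'k) free_res => nat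
      => (nat => (nat => 'a) => (nat => 'a) => 'm) => ((nat => 'a) => (nat => 'a) => 'm) => bool" where
  "tensor_primitive R X N L F G k z W \<longleftrightarrow>
     (\<forall>l\<in>chain_set R F (Suc k). linear_map R (chain_mod R G k) X (W l)) \<and>
     (\<forall>x\<in>chain_set R G k. linear_map R (chain_mod R F (Suc k)) X (\<lambda>l. W l x)) \<and>
     (\<forall>l\<in>chain_set R F (Suc k). \<forall>x\<in>chain_set R G k. W l x \<in> N) \<and>
     (\<forall>l\<in>chain_set R F (Suc k). \<forall>x\<in>chain_set R G (Suc k).
        z (Suc k) l x \<ominus>\<^bsub>X\<^esub> W l (res_diff G k x) \<in> L)"

definition truncate_tensor ::
    "('a, 'r) ring_scheme => ('a, 'm, 's) module_scheme => ('a, 'n) free_res => nat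
      => (nat => (nat => 'a) => (nat => 'a) => 'm) => ((nat => 'a) => (nat => 'a) => 'm)
      => nat => (nat => 'a) => (nat => 'a) => 'm" where
  "truncate_tensor R X F k z W q l x =
     (if q < k then z q l x else if q = k then z q l x \<ominus>\<^bsub>X\<^esub> W (dual_diff R F q l) x else \<zero>\<^bsub>X\<^esub>)"

text \<open>Some resolution of \<open>R/\<aa>\<^sup>m\<close> has a chain map to \<open>N \<otimes> F\<close> modulo \<open>L\<close>, for \<open>F\<close> a resolution of
  \<open>R/\<aa>\<^sup>n\<close>, which is zero from degree \<open>k\<close> on and sends \<open>1\<close> to \<open>y\<close> modulo \<open>\<aa>\<^sup>n\<close>.\<close>

definition reaches ::
    "('a, 'r) ring_scheme => 'a set => ('a, 'm, 's) module_scheme => 'm set => 'm set => nat => ('a, 'a) free_res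
      => 'm => nat => bool" where
  "reaches R \<aa> X N L n F y k \<longleftrightarrow>
     (\<exists>m G u z. resolves R (ideal_power R \<aa> m) G \<and> u \<in> chain_set R G 0 \<and>
        res_aug G u \<ominus>\<^bsub>R\<^esub> \<one>\<^bsub>R\<^esub> \<in> ideal_power R \<aa> m \<and> tensor_map R X N L F G z \<and> vanishes_from R L F G z k \<and>
        z 0 (dual_aug R F) u \<ominus>\<^bsub>X\<^esub> y \<in> smult_span X (ideal_power R \<aa> n) N <+>\<^bsub>X\<^esub> L)"

lemma tensor_mapD:
  assumes "tensor_map R X N L F G z"
  shows "l \<in> chain_set R F q ==> linear_map R (chain_mod R G q) X (z q l)"
    "x \<in> chain_set R G q ==> linear_map R (chain_mod R F q) X (\<lambda>l. z q l x)"
    "l \<in> chain_set R F q ==> x \<in> chain_set R G q ==> z q l x \<in> N"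
    "l \<in> chain_set R F q ==> x' \<in> chain_set R G (Suc q) ==>
      z q l (res_diff G q x') \<ominus>\<^bsub>X\<^esub> z (Suc q) (dual_diff R F q l) x' \<in> L"
  using assms unfolding tensor_map_def by auto

lemma tensor_primitiveD:
  assumes "tensor_primitive R X N L F G k z W"
  shows "l \<in> chain_set R F (Suc k) ==> linear_map R (chain_mod R G k) X (W l)"
    "x \<in> chain_set R G k ==> linear_map R (chain_mod R F (Suc k)) X (\<lambda>l. W l x)"
    "l \<in> chain_set R F (Suc k) ==> x \<in> chain_set R G k ==> W l x \<in> N"
    "l \<in> chain_set R F (Suc k) ==> x' \<in> chain_set R G (Suc k) ==>
      z (Suc k) l x' \<ominus>\<^bsub>X\<^esub> W l (res_diff G k x') \<in> L"
  using assms unfolding tensor_primitive_def by auto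

lemma tensor_map_comp:
  assumes z: "tensor_map R X N L F G z" and \<phi>: "chain_map R H G \<phi>"
  shows "tensor_map R X N L F H (\<lambda>q l x. z q l (\<phi> q x))"
  using tensor_mapD[OF z] linear_map_comp[OF chain_map_linear[OF \<phi>] tensor_mapD(1)[OF z]] linear_map_closed[OF chain_map_linear[OF \<phi>]]
    chain_map_commute[OF \<phi>, symmetric]
  unfolding tensor_map_def by auto

lemma vanishes_from_comp:
  "vanishes_from R L F G z k ==> chain_map R H G \<phi> ==> vanishes_from R L F H (\<lambda>q l x. z q l (\<phi> q x)) k"
  using linear_map_closed[OF chain_map_linear] unfolding vanishes_from_def by blast

lemma reaches_mono:
  fixes R :: "('a, 'r) ring_scheme"
  assumes "N \<subseteq> N'" "L \<subseteq> L'" and reach: "reaches R \<aa> X N L n F y k"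
  shows "reaches R \<aa> X N' L' n F y k"
proof -
  have "smult_span X (ideal_power R \<aa> n) N <+>\<^bsub>X\<^esub> L \<subseteq> smult_span X (ideal_power R \<aa> n) N' <+>\<^bsub>X\<^esub> L'"
    by (rule set_add_mono[OF smult_span_mono[OF subset_refl assms(1)] assms(2)])
  moreover have "tensor_map R X N' L' F G z" if "tensor_map R X N L F G z" for G :: "('a, 'a) free_res" and z
    using that assms(1,2) unfolding tensor_map_def by blast
  moreover have "vanishes_from R L' F G z k" if "vanishes_from R L F G z k" for G :: "('a, 'a) free_res" and z
    using that assms(2) unfolding vanishes_from_def by blast
  ultimately show ?thesis using reach unfolding reaches_def by blast
qed

lemma vanishes_finite_family:
  fixes r :: nat
  assumes vanish: "vanishes R \<aa> X N L k" and F: "resolves R (ideal_power R \<aa> n) F"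
    and f: "\<And>j. j < r ==> rel_cocycle R F X N L k (f j)"
  obtains m where "m \<ge> n" "\<forall>G \<phi>. resolves R (ideal_power R \<aa> m) G --> chain_lift R G F (ideal_power R \<aa> n) \<phi> -->
    (\<forall>j<r. rel_coboundary R G X N L k (\<lambda>x. f j (\<phi> k x)))"
proof -
  have "\<forall>j. \<exists>m0\<ge>n. j < r --> (\<forall>m\<ge>m0. \<forall>G \<phi>. resolves R (ideal_power R \<aa> m) G --> chain_lift R G F (ideal_power R \<aa> n) \<phi> -->
      rel_coboundary R G X N L k (\<lambda>x. f j (\<phi> k x)))"
    using vanish F f unfolding vanishes_def by (metis order_refl)
  then obtain M where M: "\<And>j m G \<phi>. j < r ==> m \<ge> M j ==> resolves R (ideal_power R \<aa> m) G ==>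
      chain_lift R G F (ideal_power R \<aa> n) \<phi> ==> rel_coboundary R G X N L k (\<lambda>x. f j (\<phi> k x))" by metis
  have "M j \<le> n + (\<Sum>j<r. M j)" if "j < r" for j using member_le_sum[of j "{..<r}" M] that by simp
  then show ?thesis by (intro that[of "n + (\<Sum>j<r. M j)"]) (auto intro: M)
qed

context
  fixes R :: "('a, 'r) ring_scheme" and X :: "('a, 'm, 's) module_scheme" (structure) and N L :: "'m set" and \<aa> :: "'a set"
    and n :: nat and F :: "('a, 'a) free_res"
  assumes X: "module R X" and N: "submodule N R X" and L: "submodule L R X" and \<aa>: "ideal \<aa> R"
    and F: "resolves R (ideal_power R \<aa> n) F"
begin

interpretation module R X by (rule X)

private abbreviation "target \<equiv> smult_span X (ideal_power R \<aa> n) N <+>\<^bsub>X\<^esub> L"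

private lemmas base_module = module_ring_as_module[OF is_cring]
private lemmas free_modules = module_free_module[OF is_cring]
private lemmas submodule_target = submodule_set_add[OF X submodule_smult_span[OF X ideal_power_ideal[OF is_cring \<aa>] N] L]
private lemmas unit_closed = dual_aug_closed[OF F]
private lemmas linear_dual = linear_map_dual_diff[OF F]

lemma tensor_map_unit_cong:
  assumes z: "tensor_map R X N L F G z" and G: "resolves R J G"
    and u: "u \<in> chain_set R G 0" "u' \<in> chain_set R G 0" "res_aug G u \<ominus>\<^bsub>R\<^esub> res_aug G u' \<in> J"
  shows "z 0 (dual_aug R F) u \<ominus> z 0 (dual_aug R F) u' \<in> target"
proof -
  note z = tensor_mapD[OF z] and minus = submodule_minus[OF module.carrier_is_submodule[OF free_modules] u(1,2)]
  have "u \<ominus>\<^bsub>chain_mod R G 0\<^esub> u' \<in> cycles R J G 0"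
    using linear_map_minus[OF resolves_aug[OF G] u(1,2)] u(3) minus by (simp add: cycles_def)
  then obtain s where s: "s \<in> chain_set R G (Suc 0)" "u \<ominus>\<^bsub>chain_mod R G 0\<^esub> u' = res_diff G 0 s"
    unfolding resolves_image[OF G, symmetric] by blast
  note \<delta>\<epsilon> = linear_map_closed[OF linear_dual unit_closed]
  have "z (Suc 0) (dual_diff R F 0 (dual_aug R F)) s \<in> smult_span X (ideal_power R \<aa> n) N"
    unfolding linear_map_expand[OF z(2)[OF s(1)] \<delta>\<epsilon>]
    by (rule lincomb_mem_smult_span) (use dual_diff_dual_aug_mem[OF F] z(3) s(1) std_basis_closed[OF is_cring] in auto)
  then have "z 0 (dual_aug R F) (res_diff G 0 s) \<in> target"
    using mem_if_diff_mem[OF X submodule_target(1) linear_map_closed[OF z(1)[OF unit_closed] linear_map_closed[OF resolves_diff[OF G] s(1)]]]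
      z(4)[OF unit_closed s(1)] submodule_target(2,3) by blast
  then show ?thesis using linear_map_minus[OF z(1)[OF unit_closed] u(1,2)] s(2) by simp
qed

lemma reaches_refine:
  assumes NR: "noetherian_ring R" and z: "tensor_map R X N L F G z"
    and G: "resolves R (ideal_power R \<aa> m) G" and u: "u \<in> chain_set R G 0" "res_aug G u \<ominus>\<^bsub>R\<^esub> \<one>\<^bsub>R\<^esub> \<in> ideal_power R \<aa> m"
    and y: "y \<in> carrier X" "z 0 (dual_aug R F) u \<ominus> y \<in> target" and m: "m \<le> m'"
  obtains H \<phi> v where "resolves R (ideal_power R \<aa> m') H" "chain_lift R H G (ideal_power R \<aa> m) \<phi>"
    "v \<in> chain_set R H 0" "res_aug H v \<ominus>\<^bsub>R\<^esub> \<one>\<^bsub>R\<^esub> \<in> ideal_power R \<aa> m'" "z 0 (dual_aug R F) (\<phi> 0 v) \<ominus> y \<in> target"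
proof -
  obtain H where H: "resolves R (ideal_power R \<aa> m') H"
    using resolution_exists[OF is_cring NR ideal_power_ideal[OF is_cring \<aa>]] by blast
  obtain \<phi> where \<phi>: "chain_lift R H G (ideal_power R \<aa> m) \<phi>"
    using chain_lift_exists[OF H G ideal_power_antimono[OF is_cring \<aa> m] ideal_power_ideal[OF is_cring \<aa>]] by blast
  obtain v where v: "v \<in> chain_set R H 0" "res_aug H v \<ominus>\<^bsub>R\<^esub> \<one>\<^bsub>R\<^esub> \<in> ideal_power R \<aa> m'"
    by (rule resolves_unit[OF H])
  note \<phi>v = linear_map_closed[OF chain_lift_linear[OF \<phi>] v(1)]
  note J = submodule_ideal_power[OF is_cring \<aa>, of m]
  note trans = diff_mem_trans[OF base_module J] and sym = diff_mem_sym[OF base_module J] and closed = resolves_aug_closed[OF G u(1)]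
    resolves_aug_closed[OF G \<phi>v] resolves_aug_closed[OF H v(1)]
  have "res_aug H v \<ominus>\<^bsub>R\<^esub> \<one>\<^bsub>R\<^esub> \<in> ideal_power R \<aa> m" using v(2) ideal_power_antimono[OF is_cring \<aa> m] by blast
  then have "res_aug G (\<phi> 0 v) \<ominus>\<^bsub>R\<^esub> \<one>\<^bsub>R\<^esub> \<in> ideal_power R \<aa> m"
    using trans[of "res_aug G (\<phi> 0 v)" "res_aug H v" "\<one>\<^bsub>R\<^esub>"] chain_lift_aug[OF \<phi> v(1)] closed by simp
  then have "res_aug G (\<phi> 0 v) \<ominus>\<^bsub>R\<^esub> res_aug G u \<in> ideal_power R \<aa> m"
    using trans[of "res_aug G (\<phi> 0 v)" "\<one>\<^bsub>R\<^esub>" "res_aug G u"] sym[of "res_aug G u" "\<one>\<^bsub>R\<^esub>"] u(2) closed by simp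
  from tensor_map_unit_cong[OF z G \<phi>v u(1) this] have "z 0 (dual_aug R F) (\<phi> 0 v) \<ominus> y \<in> target"
    using diff_mem_trans[OF X submodule_target(1) _ _ y(1) _ y(2)] linear_map_closed[OF tensor_mapD(1)[OF z unit_closed]] \<phi>v u(1) by blast
  then show ?thesis by (rule that[OF H \<phi> v])
qed

lemma tensor_primitive_exists:
  assumes z: "tensor_map R X N L F G z" and G: "resolves R J G"
    and cob: "\<And>j. j < res_rank F (Suc k) ==>
      rel_coboundary R G X N L (Suc k) (z (Suc k) (std_basis R (res_rank F (Suc k)) j))"
  obtains W where "tensor_primitive R X N L F G k z W"
proof -
  let ?r = "res_rank F (Suc k)"
  have "\<forall>j. \<exists>w. j < ?r --> linear_map R (chain_mod R G k) X w \<and> (\<forall>x\<in>chain_set R G k. w x \<in> N) \<and>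
      (\<forall>x\<in>chain_set R G (Suc k). z (Suc k) (std_basis R ?r j) x \<ominus> w (res_diff G k x) \<in> L)"
    using cob unfolding rel_coboundary_def by simp
  then obtain w where w: "\<And>j. j < ?r ==> linear_map R (chain_mod R G k) X (w j)"
    and wN: "\<And>j x. j < ?r ==> x \<in> chain_set R G k ==> w j x \<in> N"
    and wL: "\<And>j x. j < ?r ==> x \<in> chain_set R G (Suc k) ==> z (Suc k) (std_basis R ?r j) x \<ominus> w j (res_diff G k x) \<in> L"
    by metis
  define W where "W l x = lincomb X (\<lambda>j. w j x) l ?r" for l x
  note coeff = free_module_nth_closed[of _ R ?r]
  have W_left: "linear_map R (chain_mod R G k) X (W l)" if "l \<in> chain_set R F (Suc k)" for l
    unfolding W_def by (rule linear_map_fun_lincomb[OF free_modules X w coeff[OF that]])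
  have W_right: "linear_map R (chain_mod R F (Suc k)) X (\<lambda>l. W l x)" if "x \<in> chain_set R G k" for x
    unfolding W_def by (rule linear_map_lincomb[OF X linear_map_closed[OF w that]])
  have WN: "W l x \<in> N" if "l \<in> chain_set R F (Suc k)" "x \<in> chain_set R G k" for l x
    unfolding W_def by (rule lincomb_mem[OF N]) (use wN that coeff in auto)
  have "z (Suc k) l x \<ominus> W l (res_diff G k x) \<in> L"
    if l: "l \<in> chain_set R F (Suc k)" and x: "x \<in> chain_set R G (Suc k)" for l x
  proof (rule linear_map_mem_if_basis[OF _ L _ l, where f="\<lambda>l. z (Suc k) l x \<ominus> W l (res_diff G k x)"])
    note dx = linear_map_closed[OF resolves_diff[OF G] x]
    show "linear_map R (chain_mod R F (Suc k)) X (\<lambda>l. z (Suc k) l x \<ominus> W l (res_diff G k x))"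
      by (rule linear_map_fun_minus[OF tensor_mapD(2)[OF z x] W_right[OF dx]])
    show "z (Suc k) (std_basis R ?r j) x \<ominus> W (std_basis R ?r j) (res_diff G k x) \<in> L" if "j < ?r" for j
      using wL[OF that x] lincomb_std_basis[OF X linear_map_closed[OF w dx] that] by (simp add: W_def)
  qed
  then show ?thesis using that W_left W_right WN unfolding tensor_primitive_def by blast
qed

lemma tensor_map_truncate:
  assumes z: "tensor_map R X N L F G z" and G: "resolves R J G"
    and W: "tensor_primitive R X N L F G k z W"
  shows "tensor_map R X N L F G (truncate_tensor R X F k z W)"
proof -
  note W_left = tensor_primitiveD(1)[OF W] and W_right = tensor_primitiveD(2)[OF W]
    and WN = tensor_primitiveD(3)[OF W] and zW = tensor_primitiveD(4)[OF W]
  let ?z = "truncate_tensor R X F k z W"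
  have eqs: "?z k = (\<lambda>l x. z k l x \<ominus> W (dual_diff R F k l) x)" "q < k ==> ?z q = z q" "k < q ==> ?z q = (\<lambda>l x. \<zero>)" for q
    by (auto simp: truncate_tensor_def fun_eq_iff)
  have z_left: "linear_map R (chain_mod R G q) X (?z q l)" if l: "l \<in> chain_set R F q" for q l
    using tensor_mapD(1)[OF z l] linear_map_const_zero[OF free_modules X]
      linear_map_fun_minus[OF tensor_mapD(1)[OF z] W_left[OF linear_map_closed[OF linear_dual]]] l eqs
    by (cases q k rule: linorder_cases) simp_all
  have z_right: "linear_map R (chain_mod R F q) X (\<lambda>l. ?z q l x)" if x: "x \<in> chain_set R G q" for q x
    using tensor_mapD(2)[OF z x] linear_map_const_zero[OF free_modules X]
      linear_map_fun_minus[OF tensor_mapD(2)[OF z] linear_map_comp[OF linear_dual W_right]] x eqs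
    by (cases q k rule: linorder_cases) simp_all
  have zN: "?z q l x \<in> N" if "l \<in> chain_set R F q" "x \<in> chain_set R G q" for q l x
    using tensor_mapD(3)[OF z that] WN[OF linear_map_closed[OF linear_dual]] that submodule_minus[OF N] submodule_zero_mem[OF N] eqs
    by (cases q k rule: linorder_cases) simp_all
  have "?z q l (res_diff G q x) \<ominus> ?z (Suc q) (dual_diff R F q l) x \<in> L"
    if l: "l \<in> chain_set R F q" and x: "x \<in> chain_set R G (Suc q)" for q l x
  proof -
    note \<delta>l = linear_map_closed[OF linear_dual l] and dx = linear_map_closed[OF resolves_diff[OF G] x] and comm = tensor_mapD(4)[OF z l x]
    note zl = linear_map_closed[OF tensor_mapD(1)[OF z l] dx] and z\<delta>l = linear_map_closed[OF tensor_mapD(1)[OF z \<delta>l] x]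
    consider (below) "Suc q < k" | (last) "Suc q = k" | (top) "q = k" | (above) "k < q" by linarith
    then show ?thesis
    proof cases
      case below
      then show ?thesis using comm eqs(2) by simp
    next
      case last
      then have "W (dual_diff R F k (dual_diff R F q l)) x = \<zero>"
        using dual_diff_dual_diff[OF F l] linear_map_zero[OF W_right] x by simp
      then show ?thesis using comm eqs(2)[of q] z\<delta>l last a_minus_zero[OF X z\<delta>l] by (auto simp: truncate_tensor_def)
    next
      case top
      have Wc: "W (dual_diff R F q l) (res_diff G q x) \<in> carrier X"
        using linear_map_closed[OF W_left] \<delta>l dx top by blast
      have "z q l (res_diff G q x) \<ominus> W (dual_diff R F q l) (res_diff G q x) \<in> L"
        by (rule diff_mem_trans[OF X L zl z\<delta>l Wc comm]) (use zW \<delta>l x top in simp)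
      then show ?thesis using top a_minus_zero[OF X] zl Wc by (simp add: truncate_tensor_def)
    next
      case above
      then show ?thesis using eqs(3) diff_mem_refl[OF X L M.zero_closed] by simp
    qed
  qed
  then show ?thesis using z_left z_right zN unfolding tensor_map_def by blast
qed

lemma truncate_tensor_unit:
  assumes z: "tensor_map R X N L F G z" and u: "u \<in> chain_set R G 0" and W: "tensor_primitive R X N L F G k z W"
    and y: "y \<in> carrier X" "z 0 (dual_aug R F) u \<ominus> y \<in> target"
  shows "truncate_tensor R X F k z W 0 (dual_aug R F) u \<ominus> y \<in> target"
proof (cases "k = 0")
  case True
  note W = tensor_primitiveD[OF W[unfolded True]]
  note zu = linear_map_closed[OF tensor_mapD(1)[OF z unit_closed] u]
  have "W (dual_diff R F 0 (dual_aug R F)) u \<in> smult_span X (ideal_power R \<aa> n) N"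
    unfolding linear_map_expand[OF W(2)[OF u] linear_map_closed[OF linear_dual unit_closed]]
    by (rule lincomb_mem_smult_span) (use dual_diff_dual_aug_mem[OF F] W(3) u std_basis_closed[OF is_cring] in auto)
  then have w: "W (dual_diff R F 0 (dual_aug R F)) u \<in> target" using submodule_target(2) by blast
  have "z 0 (dual_aug R F) u \<ominus> W (dual_diff R F 0 (dual_aug R F)) u \<ominus> z 0 (dual_aug R F) u \<in> target"
    using diff_mem_sym[OF X submodule_target(1) zu] minus_cancel(3)[OF X zu submodule_mem_carrier[OF submodule_target(1) w]] w
      submodule_minus[OF carrier_is_submodule zu submodule_mem_carrier[OF submodule_target(1) w]] by simp
  then show ?thesis
    using diff_mem_trans[OF X submodule_target(1) _ zu y(1) _ y(2)] submodule_minus[OF carrier_is_submodule zu submodule_mem_carrier[OF submodule_target(1) w]] True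
    by (simp add: truncate_tensor_def)
next
  case False
  then show ?thesis using y(2) by (simp add: truncate_tensor_def)
qed

lemma reaches_step:
  assumes NR: "noetherian_ring R" and y: "y \<in> carrier X"
    and reach: "reaches R \<aa> X N L n F y (Suc k)" and vanish: "vanishes R \<aa> X N L k"
  shows "reaches R \<aa> X N L n F y k"
proof -
  let ?e = "std_basis R (res_rank F k)"
  obtain m G u z where G: "resolves R (ideal_power R \<aa> m) G" and u: "u \<in> chain_set R G 0" "res_aug G u \<ominus>\<^bsub>R\<^esub> \<one>\<^bsub>R\<^esub> \<in> ideal_power R \<aa> m"
    and z: "tensor_map R X N L F G z" and z_from: "vanishes_from R L F G z (Suc k)" and zu: "z 0 (dual_aug R F) u \<ominus> y \<in> target"
    using reach unfolding reaches_def by blast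
  have "rel_cocycle R G X N L k (z k (?e j))" for j
  proof -
    note e = std_basis_closed[OF is_cring, of "res_rank F k" j] and z = tensor_mapD[OF z]
    have "z k (?e j) (res_diff G k x) \<in> L" if x: "x \<in> chain_set R G (Suc k)" for x
    proof (rule mem_if_diff_mem[OF X L linear_map_closed[OF z(1)[OF e] linear_map_closed[OF resolves_diff[OF G] x]] _ z(4)[OF e x]])
      show "z (Suc k) (dual_diff R F k (?e j)) x \<in> L"
        using z_from linear_map_closed[OF linear_dual e] x by (simp add: vanishes_from_def)
    qed
    then show ?thesis using z(1)[OF e] z(3)[OF e] by (simp add: rel_cocycle_def)
  qed
  from vanishes_finite_family[where f="\<lambda>j. z k (?e j)" and r="res_rank F k", OF vanish G this] obtain m' where m': "m' \<ge> m"
    and cob: "\<forall>H \<phi>. resolves R (ideal_power R \<aa> m') H --> chain_lift R H G (ideal_power R \<aa> m) \<phi> -->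
      (\<forall>j<res_rank F k. rel_coboundary R H X N L k (\<lambda>x. z k (?e j) (\<phi> k x)))" by blast
  obtain H \<phi> v where H: "resolves R (ideal_power R \<aa> m') H" and \<phi>: "chain_lift R H G (ideal_power R \<aa> m) \<phi>"
    and v: "v \<in> chain_set R H 0" "res_aug H v \<ominus>\<^bsub>R\<^esub> \<one>\<^bsub>R\<^esub> \<in> ideal_power R \<aa> m'"
    and zv: "z 0 (dual_aug R F) (\<phi> 0 v) \<ominus> y \<in> target" by (rule reaches_refine[OF NR z G u y zu m'])
  let ?z = "\<lambda>q l x. z q l (\<phi> q x)"
  have z\<phi>: "tensor_map R X N L F H ?z" by (rule tensor_map_comp[OF z chain_lift_chain_map[OF \<phi>]])
  have cob: "rel_coboundary R H X N L k (?z k (?e j))" if "j < res_rank F k" for j using cob H \<phi> that by blast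
  show ?thesis
  proof (cases k)
    case 0
    have "?z 0 l x \<in> L" if "l \<in> chain_set R F 0" and x: "x \<in> chain_set R H 0" for l x
      using linear_map_mem_if_basis[OF tensor_mapD(2)[OF z\<phi> x] L _ that(1)] cob x by (simp add: 0 rel_coboundary_0)
    then have "vanishes_from R L F H ?z 0"
      using vanishes_from_comp[OF z_from chain_lift_chain_map[OF \<phi>]] unfolding vanishes_from_def 0
      by (metis One_nat_def less_one not_le)
    then show ?thesis using H v z\<phi> zv unfolding reaches_def 0 by blast
  next
    case (Suc j)
    obtain W where W: "tensor_primitive R X N L F H j ?z W"
      by (rule tensor_primitive_exists[OF z\<phi> H]) (use cob Suc in simp_all)
    have "vanishes_from R L F H (truncate_tensor R X F j ?z W) k"
      using submodule_zero_mem[OF L] Suc by (auto simp: vanishes_from_def truncate_tensor_def)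
    then show ?thesis
      using H v tensor_map_truncate[OF z\<phi> H W] truncate_tensor_unit[OF z\<phi> v(1) W y zv] unfolding reaches_def by blast
  qed
qed

lemma reaches_descend:
  assumes "noetherian_ring R" "y \<in> carrier X" "c \<le> k" "reaches R \<aa> X N L n F y k"
    and "\<And>q. c \<le> q ==> q < k ==> vanishes R \<aa> X N L q"
  shows "reaches R \<aa> X N L n F y c"
  using assms(3-)
proof (induction k rule: dec_induct)
  case (step k)
  have "reaches R \<aa> X N L n F y k" by (rule reaches_step[OF assms(1,2) step.prems(1)]) (use step in simp)
  then show ?case using step.IH step.prems(2) by simp
qed

lemma reaches_zero_imp_mem:
  assumes y: "y \<in> carrier X" and reach: "reaches R \<aa> X N L n F y 0"
  shows "y \<in> target"
proof -
  obtain G :: "('a, 'a) free_res" and u z where u: "u \<in> chain_set R G 0" and z: "tensor_map R X N L F G z" "vanishes_from R L F G z 0"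
    and zu: "z 0 (dual_aug R F) u \<ominus> y \<in> target"
    using reach unfolding reaches_def by blast
  have "z 0 (dual_aug R F) u \<in> target" using z(2) u unit_closed by (intro subsetD[OF submodule_target(3)]) (simp add: vanishes_from_def)
  moreover have "y \<ominus> z 0 (dual_aug R F) u \<in> target"
    by (rule diff_mem_sym[OF X submodule_target(1) linear_map_closed[OF tensor_mapD(1)[OF z(1) unit_closed] u] y zu])
  ultimately show ?thesis by (rule mem_if_diff_mem[OF X submodule_target(1) y])
qed

lemma bounded_lifts_imp_reaches:
  assumes NR: "noetherian_ring R" and lifts: "bounded_lifts R \<aa> r" and y: "y \<in> N" and k: "k > r"
  shows "reaches R \<aa> X N L n F y k"
proof -
  have yX: "y \<in> carrier X" by (rule submodule_mem_carrier[OF N y])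
  obtain m where m: "m \<ge> n" "\<forall>G H. resolves R (ideal_power R \<aa> m) G --> resolves R (ideal_power R \<aa> n) H -->
      (\<exists>\<phi>. chain_lift R G H (ideal_power R \<aa> n) \<phi> \<and> (\<forall>i>r. \<forall>x\<in>chain_set R G i. \<phi> i x = \<zero>\<^bsub>chain_mod R H i\<^esub>))"
    using lifts unfolding bounded_lifts_def by blast
  obtain G where G: "resolves R (ideal_power R \<aa> m) G" using resolution_exists[OF is_cring NR ideal_power_ideal[OF is_cring \<aa>]] by blast
  obtain \<phi> where \<phi>: "chain_lift R G F (ideal_power R \<aa> n) \<phi>"
    "\<And>i x. i > r ==> x \<in> chain_set R G i ==> \<phi> i x = \<zero>\<^bsub>chain_mod R F i\<^esub>" using m(2) G F by blast
  note \<phi>l = chain_lift_linear[OF \<phi>(1)] and dot_left = linear_map_dot(1)[OF is_cring] and dot_right = linear_map_dot(2)[OF is_cring]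
  obtain u where u: "u \<in> chain_set R G 0" "res_aug G u \<ominus>\<^bsub>R\<^esub> \<one>\<^bsub>R\<^esub> \<in> ideal_power R \<aa> m" by (rule resolves_unit[OF G])
  define z where "z q l x = dot R (res_rank F q) l (\<phi> q x) \<odot> y" for q l x
  have z_left: "linear_map R (chain_mod R G q) X (z q l)" if "l \<in> chain_set R F q" for q l
    unfolding z_def by (rule linear_map_smult_const[OF linear_map_comp[OF \<phi>l dot_right[OF that]] X yX])
  have z_right: "linear_map R (chain_mod R F q) X (\<lambda>l. z q l x)" if "x \<in> chain_set R G q" for q x
    unfolding z_def by (rule linear_map_smult_const[OF dot_left[OF linear_map_closed[OF \<phi>l that]] X yX])
  have "z q l (res_diff G q x) = z (Suc q) (dual_diff R F q l) x"
    if "l \<in> chain_set R F q" "x \<in> chain_set R G (Suc q)" for q l x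
    using dot_dual_diff[OF F that(1) linear_map_closed[OF \<phi>l that(2)]] chain_map_commute[OF chain_lift_chain_map[OF \<phi>(1)] that(2)]
    by (simp add: z_def)
  then have "tensor_map R X N L F G z"
    unfolding tensor_map_def
    using z_left z_right submodule_smult[OF N _ y] linear_map_closed[OF linear_map_comp[OF \<phi>l dot_right]]
      diff_mem_refl[OF X L linear_map_closed[OF z_left linear_map_closed[OF resolves_diff[OF G]]]] by (auto simp: z_def)
  moreover have "vanishes_from R L F G z k"
    using \<phi>(2) k linear_map_zero[OF dot_right] yX submodule_zero_mem[OF L] by (simp add: vanishes_from_def z_def)
  moreover have "z 0 (dual_aug R F) u \<ominus> y \<in> target"
  proof -
    note J = submodule_ideal_power[OF is_cring \<aa>, of n] and \<phi>u = linear_map_closed[OF \<phi>l u(1)]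
    have "res_aug F (\<phi> 0 u) \<ominus>\<^bsub>R\<^esub> \<one>\<^bsub>R\<^esub> \<in> ideal_power R \<aa> n"
      using diff_mem_trans[OF base_module J, of "res_aug F (\<phi> 0 u)" "res_aug G u" "\<one>\<^bsub>R\<^esub>"] chain_lift_aug[OF \<phi>(1) u(1)]
        subsetD[OF ideal_power_antimono[OF is_cring \<aa> m(1)] u(2)] resolves_aug_closed[OF F \<phi>u] resolves_aug_closed[OF G u(1)] by simp
    from smult_mem_smult_span[OF X ideal_power_ideal[OF is_cring \<aa>] N this y]
    have "(res_aug F (\<phi> 0 u) \<ominus>\<^bsub>R\<^esub> \<one>\<^bsub>R\<^esub>) \<odot> y \<in> target" using submodule_target(2) by blast
    then show ?thesis
      using dot_dual_aug[OF F \<phi>u] smult_minus(2)[OF X _ _ yX yX, of "res_aug F (\<phi> 0 u)" "\<one>\<^bsub>R\<^esub>"] resolves_aug_closed[OF F \<phi>u] yX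
      by (simp add: z_def)
  qed
  ultimately show ?thesis using G u unfolding reaches_def by blast
qed

end

lemma vanishes_imp_subset_smult_span_add:
  fixes X (structure)
  assumes NR: "noetherian_ring R" and \<aa>: "ideal \<aa> R" and X: "module R X"
    and N0: "submodule N0 R X" and N: "submodule N R X" and L: "submodule L R X" and "N0 \<subseteq> N"
    and above: "\<And>k. c < k ==> vanishes R \<aa> X N0 {\<zero>} k" and below: "\<And>k. k \<le> c ==> vanishes R \<aa> X N L k"
  shows "N0 \<subseteq> smult_span X (ideal_power R \<aa> n) N <+>\<^bsub>X\<^esub> L"
proof
  fix y assume y: "y \<in> N0"
  interpret module R X by (rule X)
  have yX: "y \<in> carrier X" by (rule submodule_mem_carrier[OF N0 y])
  obtain A where A: "finite A" "A \<subseteq> carrier R" "\<aa> = Idl\<^bsub>R\<^esub> A"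
    using noetherian_ring.finetely_gen[OF NR \<aa>] by blast
  obtain F where F: "resolves R (ideal_power R \<aa> n) F" using resolution_exists[OF is_cring NR ideal_power_ideal[OF is_cring \<aa>]] by blast
  note zero = submodule_singleton_zero[OF X]
  have "reaches R \<aa> X N0 {\<zero>} n F y (Suc (max (card A) c))"
    by (rule bounded_lifts_imp_reaches[OF X N0 zero \<aa> F NR _ y])
      (use bounded_lifts_genideal[OF is_cring NR A(1,2)] A(3) in auto)
  from reaches_descend[OF X N0 zero \<aa> F NR yX _ this, of "Suc c"]
  have "reaches R \<aa> X N0 {\<zero>} n F y (Suc c)" using above by simp
  then have "reaches R \<aa> X N L n F y (Suc c)" using reaches_mono[OF assms(7), of "{\<zero>}" L] submodule_zero_mem[OF L] by blast
  from reaches_descend[OF X N L \<aa> F NR yX _ this, of 0] below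
  have "reaches R \<aa> X N L n F y 0" by simp
  then show "y \<in> smult_span X (ideal_power R \<aa> n) N <+>\<^bsub>X\<^esub> L" by (rule reaches_zero_imp_mem[OF X N L \<aa> F yX])
qed

subsection \<open>Quotients and inverse limits\<close>

lemma a_coset_ring_as_module: "T +>\<^bsub>ring_as_module R\<^esub> x = T +>\<^bsub>R\<^esub> x"
  by (simp add: a_r_coset_def')

lemma a_rcosets_iff: "c \<in> a_rcosets\<^bsub>X\<^esub> T \<longleftrightarrow> (\<exists>x\<in>carrier X. c = T +>\<^bsub>X\<^esub> x)"
  by (auto simp: A_RCOSETS_def' a_r_coset_def')

lemma quot_module_simps:
  "carrier (quot_module R X T) = a_rcosets\<^bsub>X\<^esub> T" "zero (quot_module R X T) = T" "add (quot_module R X T) = set_add X"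
  by (simp_all add: quot_module_def)

context
  fixes R :: "('a, 'r) ring_scheme" and X :: "('a, 'm, 's) module_scheme" (structure) and T :: "'m set"
  assumes X: "module R X" and T: "submodule T R X"
begin

interpretation module R X by (rule X)

lemma submodule_abelian_subgroup: "abelian_subgroup T X"
  using submodule.axioms(1)[OF T] M.abelian_group_axioms
  by (intro abelian_subgroupI3 additive_subgroup.intro) auto

interpretation T: abelian_subgroup T X by (rule submodule_abelian_subgroup)

lemma mem_a_coset_iff:
  assumes "x \<in> carrier X"
  shows "y \<in> T +> x \<longleftrightarrow> y \<in> carrier X \<and> y \<ominus> x \<in> T"
  using T.a_rcos_module[OF assms, of y] T.a_elemrcos_carrier[OF assms, of y] by (auto simp: a_minus_def)

lemma a_coset_eq_iff:
  assumes "x \<in> carrier X" "y \<in> carrier X"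
  shows "T +> x = T +> y \<longleftrightarrow> x \<ominus> y \<in> T"
proof -
  have "T +> x = T +> y \<longleftrightarrow> x \<in> T +> y"
    using T.a_repr_independence'[OF _ assms(2)] T.a_rcos_self[OF assms(1)] by metis
  then show ?thesis using mem_a_coset_iff[OF assms(2)] assms(1) by simp
qed

lemma a_coset_zero: "T +> \<zero> = T"
  using submodule_mem_carrier[OF T] by (intro M.a_coset_add_zero) auto

lemma a_coset_eq_self_iff: "x \<in> carrier X ==> T +> x = T \<longleftrightarrow> x \<in> T"
  using a_coset_eq_iff[of x \<zero>] a_coset_zero a_minus_zero[OF X] by simp

lemmas a_coset_add = T.a_rcos_sum

lemma set_add_a_coset:
  assumes T': "submodule T' R X" and sub: "T \<subseteq> T'" and x: "x \<in> carrier X"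
  shows "T' <+>\<^bsub>X\<^esub> (T +> x) = T' +> x"
proof -
  have carr: "T \<subseteq> carrier X" "T' \<subseteq> carrier X" using submodule_mem_carrier[OF T] submodule_mem_carrier[OF T'] by auto
  have "T' <+>\<^bsub>X\<^esub> T = T'" using set_add_subset[OF T' subset_refl sub] submodule_set_add(2)[OF X T' T] by blast
  then show ?thesis
    using M.add.setmult_rcos_assoc[OF carr(2,1) x] by (simp add: set_add_def a_r_coset_def)
qed

lemma smult_a_coset:
  assumes x: "x \<in> carrier X" and r: "r \<in> carrier R"
  shows "r \<odot>\<^bsub>quot_module R X T\<^esub> (T +> x) = T +> (r \<odot> x)"
proof -
  have "T +> (r \<odot> y) = T +> (r \<odot> x)" if "y \<in> T +> x" for y
  proof -
    have y: "y \<in> carrier X" "y \<ominus> x \<in> T" using that mem_a_coset_iff[OF x] by auto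
    have "r \<odot> y \<ominus> r \<odot> x \<in> T" unfolding smult_minus(1)[OF X r r y(1) x, symmetric] by (rule submodule_smult[OF T r y(2)])
    then show ?thesis using a_coset_eq_iff y(1) x r by simp
  qed
  moreover have "x \<in> T +> x" by (rule T.a_rcos_self[OF x])
  ultimately have "(\<Union>y\<in>T +> x. T +> (r \<odot> y)) = T +> (r \<odot> x)" by blast
  then show ?thesis by (simp add: quot_module_def)
qed

lemma module_quot_module: "module R (quot_module R X T)"
proof -
  interpret Q: comm_group "X A_Mod T" by (rule T.a_factorgroup_is_comm_group)
  have "abelian_group (quot_module R X T)"
    by (rule abelian_groupI)
      (use Q.m_closed Q.one_closed Q.m_assoc Q.m_comm Q.l_one Q.l_inv_ex in \<open>simp_all add: A_FactGroup_def' quot_module_def\<close>)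
  then show ?thesis
    by (rule moduleI[OF is_cring])
      (auto simp: quot_module_simps a_rcosets_iff a_coset_add smult_a_coset smult_l_distr smult_r_distr smult_assoc1)
qed

lemma linear_map_a_coset: "linear_map R X (quot_module R X T) (\<lambda>x. T +> x)"
  using X module_quot_module a_coset_add smult_a_coset by (auto simp: linear_map_def quot_module_simps a_rcosets_iff)

end

lemma inverse_limit_iff:
  fixes X (structure)
  assumes X: "module R X" and T: "\<And>n. submodule (T n) R X" and dec: "\<And>n. T (Suc n) \<subseteq> T n"
  shows "(\<forall>n. x n \<in> a_rcosets T n \<and> quot_proj X (T (Suc n)) (T n) (x (Suc n)) = x n) \<longleftrightarrow>
    (\<exists>v. (\<forall>n. v n \<in> carrier X \<and> v (Suc n) \<ominus> v n \<in> T n) \<and> x = (\<lambda>n. T n +> v n))"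
    (is "?cosets \<longleftrightarrow> ?sequence")
proof
  have proj: "quot_proj X (T (Suc n)) (T n) (T (Suc n) +> y) = T n +> y" if "y \<in> carrier X" for n y
    using set_add_a_coset[OF X T T dec that] that a_rcosets_iff[of "T (Suc n) +> y" X "T (Suc n)"] by (auto simp: quot_proj_def)
  show ?sequence if cosets: ?cosets
  proof -
    have "\<forall>n. \<exists>v. v \<in> carrier X \<and> x n = T n +> v" using cosets unfolding a_rcosets_iff by blast
    then obtain v where v: "\<And>n. v n \<in> carrier X" "\<And>n. x n = T n +> v n" by metis
    have "v (Suc n) \<ominus> v n \<in> T n" for n
      using cosets v(2)[of n] v(2)[of "Suc n"] proj[OF v(1), of n] a_coset_eq_iff[OF X T v(1) v(1)] by metis
    then show ?sequence using v by (intro exI[of _ v]) auto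
  qed
  show ?cosets if sequence: ?sequence
  proof -
    obtain v where v: "\<And>n. v n \<in> carrier X" "\<And>n. v (Suc n) \<ominus> v n \<in> T n" "x = (\<lambda>n. T n +> v n)" using sequence by blast
    have "T n +> v (Suc n) = T n +> v n" for n using a_coset_eq_iff[OF X T v(1) v(1)] v(2) by blast
    then show ?cosets using proj[OF v(1)] a_rcosets_iff[of _ X] v(1,3) by auto
  qed
qed

definition restrict_scalars :: "('a => 'b) => ('b, 'm, 's) module_scheme => ('a, 'm) module" where
  "restrict_scalars h X =
     \<lparr>carrier = carrier X, mult = undefined, one = undefined, zero = zero X, add = add X,
      smult = (\<lambda>r x. h r \<odot>\<^bsub>X\<^esub> x)\<rparr>"

lemma restrict_scalars_simps [simp]:
  "carrier (restrict_scalars h X) = carrier X" "zero (restrict_scalars h X) = zero X"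
  "add (restrict_scalars h X) = add X" "smult (restrict_scalars h X) = (\<lambda>r x. h r \<odot>\<^bsub>X\<^esub> x)"
  by (simp_all add: restrict_scalars_def)

lemma a_inv_restrict_scalars [simp]: "a_inv (restrict_scalars h X) = a_inv X"
  by (rule ext) (simp add: a_inv_def m_inv_def)

lemma a_minus_restrict_scalars [simp]: "x \<ominus>\<^bsub>restrict_scalars h X\<^esub> y = x \<ominus>\<^bsub>X\<^esub> y"
  by (simp add: a_minus_def)

lemma module_restrict_scalars:
  assumes "cring R" "h \<in> ring_hom R S" "module S X"
  shows "module R (restrict_scalars h X)"
proof -
  interpret X: module S X by fact
  have ag: "abelian_group (restrict_scalars h X)"
    by (rule abelian_groupI) (auto simp: X.a_ac intro: X.l_neg)
  show ?thesis
    by (rule moduleI[OF assms(1) ag])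
      (auto simp: ring_hom_closed[OF assms(2)] ring_hom_add[OF assms(2)] ring_hom_mult[OF assms(2)] ring_hom_one[OF assms(2)]
        X.smult_l_distr X.smult_r_distr X.smult_assoc1)
qed

lemma submodule_restrict_scalars:
  assumes "cring R" "h \<in> ring_hom R S" "module S X" and N: "submodule N S X"
  shows "submodule N R (restrict_scalars h X)"
  by (rule submoduleI_no_inverse[OF module_restrict_scalars[OF assms(1-3)]])
    (use submodule_mem_carrier[OF N] submodule_zero_mem[OF N] submodule_add[OF N] submodule_smult[OF N] ring_hom_closed[OF assms(2)] in auto)

lemma linear_map_restrict_scalars:
  assumes "cring R" "h \<in> ring_hom R S" "linear_map S X Y f"
  shows "linear_map R (restrict_scalars h X) (restrict_scalars h Y) f"
  using assms(3) module_restrict_scalars[OF assms(1,2) linear_map_module(1)[OF assms(3)]]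
    module_restrict_scalars[OF assms(1,2) linear_map_module(2)[OF assms(3)]]
  by (simp add: linear_map_def ring_hom_closed[OF assms(2)])

lemma lincomb_restrict_scalars: "lincomb (restrict_scalars h X) g c k = lincomb X g (\<lambda>i. h (c i)) k"
  by (induction k) simp_all

subsection \<open>Completion\<close>

locale adic =
  fixes R :: "('a, 'r) ring_scheme" and \<aa> :: "'a set"
  assumes R: "cring R" and NR: "noetherian_ring R" and \<aa>: "ideal \<aa> R"
begin

sublocale cring R by (rule R)

abbreviation "J \<equiv> ideal_power R \<aa>"
abbreviation "Rm \<equiv> ring_as_module R"
abbreviation "S \<equiv> completion_ring R \<aa>"
abbreviation "Mhat \<equiv> completion_module R \<aa>"
abbreviation "\<iota> \<equiv> completion_map R \<aa>"

lemmas module_Rm = module_ring_as_module[OF R]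
lemmas ideal_J = ideal_power_ideal[OF R \<aa>]
lemmas submodule_J = submodule_ideal_power[OF R \<aa>]
lemmas J_closed = ideal_power_closed[OF R \<aa>]
lemmas J_antimono = ideal_power_antimono[OF R \<aa>]

definition adic_sub :: "('a, 'm, 's) module_scheme => nat => 'm set" where
  "adic_sub M n = smult_span M (J n) (carrier M)"

definition coherent :: "('a, 'm, 's) module_scheme => (nat => 'm) => bool" where
  "coherent M v \<longleftrightarrow> (\<forall>n. v n \<in> carrier M \<and> v (Suc n) \<ominus>\<^bsub>M\<^esub> v n \<in> adic_sub M n)"

definition seq_class :: "('a, 'm, 's) module_scheme => (nat => 'm) => nat => 'm set" where
  "seq_class M v = (\<lambda>n. adic_sub M n +>\<^bsub>M\<^esub> v n)"

lemma coherent_closed: "coherent M v ==> v n \<in> carrier M"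
  and coherent_Suc: "coherent M v ==> v (Suc n) \<ominus>\<^bsub>M\<^esub> v n \<in> adic_sub M n"
  by (simp_all add: coherent_def)

context
  fixes M :: "('a, 'm, 's) module_scheme" (structure)
  assumes M: "module R M"
begin

interpretation M: module R M by (rule M)

lemma submodule_adic_sub: "submodule (adic_sub M n) R M"
  unfolding adic_sub_def by (rule submodule_smult_span[OF M ideal_J M.carrier_is_submodule])

lemma smult_mem_adic_sub: "r \<in> J n ==> y \<in> carrier M ==> r \<odot> y \<in> adic_sub M n"
  unfolding adic_sub_def by (rule smult_mem_smult_span[OF M ideal_J M.carrier_is_submodule])

lemma adic_sub_antimono: "m \<le> n ==> adic_sub M n \<subseteq> adic_sub M m"
  unfolding adic_sub_def by (rule smult_span_mono[OF J_antimono subset_refl])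

lemma coherent_const: "y \<in> carrier M ==> coherent M (\<lambda>n. y)"
  using diff_mem_refl[OF M submodule_adic_sub, of y] by (simp add: coherent_def)

lemma coherent_add: "coherent M v ==> coherent M w ==> coherent M (\<lambda>n. v n \<oplus> w n)"
  using diff_mem_add[OF M submodule_adic_sub] by (simp add: coherent_def)

lemma coherent_diff_mem:
  assumes v: "coherent M v" and "m \<le> n"
  shows "v n \<ominus> v m \<in> adic_sub M m"
  using assms(2)
proof (induction rule: dec_induct)
  case base
  show ?case by (rule diff_mem_refl[OF M submodule_adic_sub coherent_closed[OF v]])
next
  case (step n)
  have "v (Suc n) \<ominus> v n \<in> adic_sub M m" using adic_sub_antimono[OF step(1)] coherent_Suc[OF v] by blast
  then show ?case
    by (rule diff_mem_trans[OF M submodule_adic_sub coherent_closed[OF v] coherent_closed[OF v] coherent_closed[OF v] _ step(3)])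
qed

lemma carrier_completion_iff: "x \<in> carrier (Mhat M) \<longleftrightarrow> (\<exists>v. coherent M v \<and> x = seq_class M v)"
proof -
  have "x \<in> carrier (Mhat M) \<longleftrightarrow> (\<forall>n. x n \<in> a_rcosets adic_sub M n \<and>
      quot_proj M (adic_sub M (Suc n)) (adic_sub M n) (x (Suc n)) = x n)"
    by (simp add: completion_module_def Let_def quot_module_simps ideal_smult_eq_smult_span[OF M ideal_J] adic_sub_def)
  then show ?thesis
    unfolding coherent_def seq_class_def
    using inverse_limit_iff[OF M, where T="adic_sub M" and x=x, OF submodule_adic_sub adic_sub_antimono[OF le_SucI[OF le_refl]]]
    by simp
qed

lemma completionE:
  assumes "x \<in> carrier (Mhat M)"
  obtains v where "coherent M v" "x = seq_class M v"
  using assms carrier_completion_iff by blast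

lemma seq_class_closed: "coherent M v ==> seq_class M v \<in> carrier (Mhat M)"
  using carrier_completion_iff by blast

lemma seq_class_add: "coherent M v ==> coherent M w ==> seq_class M v \<oplus>\<^bsub>Mhat M\<^esub> seq_class M w = seq_class M (\<lambda>n. v n \<oplus> w n)"
  using a_coset_add[OF M submodule_adic_sub] coherent_closed[of M]
  by (simp add: completion_module_def Let_def quot_module_simps seq_class_def fun_eq_iff)

lemma seq_class_zero: "\<zero>\<^bsub>Mhat M\<^esub> = seq_class M (\<lambda>n. \<zero>)"
  using a_coset_zero[OF M submodule_adic_sub]
  by (simp add: completion_module_def Let_def quot_module_simps seq_class_def adic_sub_def ideal_smult_eq_smult_span[OF M ideal_J])

lemma coherent_uminus:
  assumes v: "coherent M v"
  shows "coherent M (\<lambda>n. \<ominus> v n)"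
  unfolding coherent_def
proof
  fix n
  note closed = coherent_closed[OF v, of n] coherent_closed[OF v, of "Suc n"]
  have "\<ominus> v (Suc n) \<ominus> \<ominus> v n = \<ominus> (v (Suc n) \<ominus> v n)" using closed by (simp add: a_minus_def M.minus_add)
  then show "\<ominus> v n \<in> carrier M \<and> \<ominus> v (Suc n) \<ominus> \<ominus> v n \<in> adic_sub M n"
    using submodule_uminus[OF submodule_adic_sub coherent_Suc[OF v, of n]] closed by simp
qed

lemma abelian_group_completion: "abelian_group (Mhat M)"
proof (rule abelian_groupI)
  have zero: "coherent M (\<lambda>n. \<zero>)" by (rule coherent_const[OF M.zero_closed])
  show "\<zero>\<^bsub>Mhat M\<^esub> \<in> carrier (Mhat M)" unfolding seq_class_zero by (rule seq_class_closed[OF zero])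
  fix x assume "x \<in> carrier (Mhat M)"
  then obtain u where u: "coherent M u" "x = seq_class M u" by (rule completionE)
  show "\<zero>\<^bsub>Mhat M\<^esub> \<oplus>\<^bsub>Mhat M\<^esub> x = x" using u seq_class_add[OF zero u(1)] coherent_closed[OF u(1)] by (simp add: seq_class_zero)
  show "\<exists>y\<in>carrier (Mhat M). y \<oplus>\<^bsub>Mhat M\<^esub> x = \<zero>\<^bsub>Mhat M\<^esub>"
    using seq_class_add[OF coherent_uminus u(1)] coherent_closed[OF u(1)] seq_class_closed[OF coherent_uminus[OF u(1)]] u
    by (intro bexI[of _ "seq_class M (\<lambda>n. \<ominus> u n)"]) (simp_all add: seq_class_zero M.l_neg)
  fix y assume "y \<in> carrier (Mhat M)"
  then obtain v where v: "coherent M v" "y = seq_class M v" by (rule completionE)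
  show "x \<oplus>\<^bsub>Mhat M\<^esub> y \<in> carrier (Mhat M)" using u v seq_class_add seq_class_closed[OF coherent_add] by simp
  show "x \<oplus>\<^bsub>Mhat M\<^esub> y = y \<oplus>\<^bsub>Mhat M\<^esub> x" using u v seq_class_add coherent_closed[of M] by (simp add: M.a_comm)
  fix z assume "z \<in> carrier (Mhat M)"
  then obtain w where w: "coherent M w" "z = seq_class M w" by (rule completionE)
  show "x \<oplus>\<^bsub>Mhat M\<^esub> y \<oplus>\<^bsub>Mhat M\<^esub> z = x \<oplus>\<^bsub>Mhat M\<^esub> (y \<oplus>\<^bsub>Mhat M\<^esub> z)"
    using u v w seq_class_add coherent_add coherent_closed[of M] by (simp add: M.a_assoc)
qed

end

lemma smult_span_ring:
  assumes I: "ideal I R"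
  shows "smult_span Rm I (carrier Rm) = I"
proof
  interpret I: ideal I R by (rule I)
  have I': "submodule I R Rm" using I ideal_iff_submodule[OF R] by blast
  show "smult_span Rm I (carrier Rm) \<subseteq> I" by (rule smult_span_subsetI[OF I']) (simp add: I.I_r_closed)
  show "I \<subseteq> smult_span Rm I (carrier Rm)"
  proof
    fix x assume x: "x \<in> I"
    then show "x \<in> smult_span Rm I (carrier Rm)"
      using smult_mem_smult_span[OF module_Rm I module.carrier_is_submodule[OF module_Rm] x, of "\<one>\<^bsub>R\<^esub>"] I.Icarr by simp
  qed
qed

lemma adic_sub_Rm [simp]: "adic_sub Rm n = J n"
  unfolding adic_sub_def by (rule smult_span_ring[OF ideal_J])

lemma coherent_Rm_closed: "coherent Rm r ==> r n \<in> carrier R"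
  using coherent_closed[of Rm] by simp

lemma seq_class_Rm: "seq_class Rm r = (\<lambda>n. J n +>\<^bsub>R\<^esub> r n)"
  by (simp add: seq_class_def a_coset_ring_as_module)

lemma completion_ring_group_eq:
  "carrier S = carrier (Mhat Rm)" "add S = add (Mhat Rm)" "zero S = zero (Mhat Rm)"
proof -
  have ideal_smult: "ideal_smult R (J n) Rm = J n" for n
    unfolding ideal_smult_eq_smult_span[OF module_Rm ideal_J] by (rule smult_span_ring[OF ideal_J])
  have "a_rcosets\<^bsub>Rm\<^esub> T = a_rcosets\<^bsub>R\<^esub> T" for T by (auto simp: a_rcosets_iff a_coset_ring_as_module)
  then show "carrier S = carrier (Mhat Rm)" "add S = add (Mhat Rm)" "zero S = zero (Mhat Rm)"
    unfolding completion_ring_def completion_module_def Let_def ideal_smult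
    by (simp_all add: FactRing_def quot_module_simps set_add_ring_as_module)
qed

lemma completion_ringE:
  assumes "x \<in> carrier S"
  obtains r where "coherent Rm r" "x = seq_class Rm r"
  using assms unfolding completion_ring_group_eq by (rule completionE[OF module_Rm])

lemma seq_class_Rm_closed: "coherent Rm r ==> seq_class Rm r \<in> carrier S"
  unfolding completion_ring_group_eq by (rule seq_class_closed[OF module_Rm])

lemma seq_class_mult:
  "coherent Rm r ==> coherent Rm s ==> seq_class Rm r \<otimes>\<^bsub>S\<^esub> seq_class Rm s = seq_class Rm (\<lambda>n. r n \<otimes>\<^bsub>R\<^esub> s n)"
  using ideal.rcoset_mult_add[OF ideal_J] coherent_Rm_closed
  by (simp add: completion_ring_def Let_def FactRing_def seq_class_Rm fun_eq_iff)

lemma seq_class_one: "\<one>\<^bsub>S\<^esub> = seq_class Rm (\<lambda>n. \<one>\<^bsub>R\<^esub>)"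
  by (simp add: completion_ring_def Let_def FactRing_def seq_class_Rm)

context
  fixes M :: "('a, 'm, 's) module_scheme" (structure)
  assumes M: "module R M"
begin

interpretation M: module R M by (rule M)

lemma smult_diff_mem_adic_sub:
  assumes "r \<in> carrier R" "s \<in> carrier R" "x \<in> carrier M" "y \<in> carrier M" "r \<ominus>\<^bsub>R\<^esub> s \<in> J n" "x \<ominus> y \<in> adic_sub M n"
  shows "r \<odot> x \<ominus> s \<odot> y \<in> adic_sub M n"
proof (rule diff_mem_trans[OF M submodule_adic_sub[OF M]])
  show "r \<odot> x \<ominus> r \<odot> y \<in> adic_sub M n"
    unfolding smult_minus(1)[OF M assms(1,2,3,4), symmetric] by (rule submodule_smult[OF submodule_adic_sub[OF M] assms(1,6)])
  show "r \<odot> y \<ominus> s \<odot> y \<in> adic_sub M n"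
    unfolding smult_minus(2)[OF M assms(1,2,4,4), symmetric] by (rule smult_mem_adic_sub[OF M assms(5,4)])
qed (use assms in simp_all)

lemma coherent_smult:
  assumes r: "coherent Rm r" and v: "coherent M v"
  shows "coherent M (\<lambda>n. r n \<odot> v n)"
  using smult_diff_mem_adic_sub[OF _ _ _ _ _ coherent_Suc[OF v]] coherent_Suc[OF r] coherent_Rm_closed[OF r] coherent_closed[OF v]
  by (simp add: coherent_def)

lemma completion_smult_at:
  assumes r: "r \<in> carrier R" and y: "y \<in> carrier M" and cn: "c n = J n +>\<^bsub>Rm\<^esub> r" and xn: "x n = adic_sub M n +> y"
  shows "(c \<odot>\<^bsub>Mhat M\<^esub> x) n = adic_sub M n +> (r \<odot> y)"
proof -
  have "s \<odot>\<^bsub>quot_module R M (adic_sub M n)\<^esub> (adic_sub M n +> y) = adic_sub M n +> (r \<odot> y)" if "s \<in> J n +>\<^bsub>Rm\<^esub> r" for s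
  proof -
    have s: "s \<in> carrier R" "s \<ominus>\<^bsub>R\<^esub> r \<in> J n" using that mem_a_coset_iff[OF module_Rm submodule_J, of r s n] r by auto
    have "s \<odot> y \<ominus> r \<odot> y \<in> adic_sub M n"
      by (rule smult_diff_mem_adic_sub[OF s(1) r y y s(2) diff_mem_refl[OF M submodule_adic_sub[OF M] y]])
    then show ?thesis using smult_a_coset[OF M submodule_adic_sub[OF M] y s(1)] a_coset_eq_iff[OF M submodule_adic_sub[OF M]] s r y by simp
  qed
  moreover have "r \<in> J n +>\<^bsub>Rm\<^esub> r"
    using mem_a_coset_iff[OF module_Rm submodule_J, of r r n] r diff_mem_refl[OF module_Rm submodule_J, of r n] by simp
  ultimately have "(\<Union>s\<in>J n +>\<^bsub>Rm\<^esub> r. s \<odot>\<^bsub>quot_module R M (adic_sub M n)\<^esub> (adic_sub M n +> y)) = adic_sub M n +> (r \<odot> y)" by blast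
  then show ?thesis
    by (simp add: completion_module_def Let_def ideal_smult_eq_smult_span[OF M ideal_J] adic_sub_def[symmetric] cn xn)
qed

lemma seq_class_smult:
  assumes "coherent Rm r" "coherent M v"
  shows "seq_class Rm r \<odot>\<^bsub>Mhat M\<^esub> seq_class M v = seq_class M (\<lambda>n. r n \<odot> v n)"
  using completion_smult_at[OF coherent_Rm_closed[OF assms(1)] coherent_closed[OF assms(2)]]
  by (simp add: seq_class_def fun_eq_iff)

end

lemma cring_completion: "cring S"
proof (rule cringI)
  interpret G: abelian_group "Mhat Rm" by (rule abelian_group_completion[OF module_Rm])
  note eq = completion_ring_group_eq
  show "abelian_group S"
    by (rule abelian_groupI) (use G.a_assoc G.a_comm G.l_neg G.a_inv_closed in \<open>auto simp: eq\<close>)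
  note add = seq_class_add[OF module_Rm, folded eq, unfolded ring_as_module_simps]
    and coh_add = coherent_add[OF module_Rm, unfolded ring_as_module_simps] and coh_mult = coherent_smult[OF module_Rm, unfolded ring_as_module_simps]
  have one: "coherent Rm (\<lambda>n. \<one>\<^bsub>R\<^esub>)" by (rule coherent_const[OF module_Rm]) simp
  show "comm_monoid S"
  proof (rule comm_monoidI)
    show "\<one>\<^bsub>S\<^esub> \<in> carrier S" unfolding seq_class_one by (rule seq_class_Rm_closed[OF one])
    fix x assume "x \<in> carrier S"
    then obtain r where r: "coherent Rm r" "x = seq_class Rm r" by (rule completion_ringE)
    show "\<one>\<^bsub>S\<^esub> \<otimes>\<^bsub>S\<^esub> x = x" using r seq_class_mult[OF one r(1)] coherent_Rm_closed[OF r(1)] by (simp add: seq_class_one)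
    fix y assume "y \<in> carrier S"
    then obtain s where s: "coherent Rm s" "y = seq_class Rm s" by (rule completion_ringE)
    show "x \<otimes>\<^bsub>S\<^esub> y \<in> carrier S" using r s seq_class_mult seq_class_Rm_closed[OF coh_mult] by simp
    show "x \<otimes>\<^bsub>S\<^esub> y = y \<otimes>\<^bsub>S\<^esub> x" using r s seq_class_mult coherent_Rm_closed by (simp add: m_comm)
    fix z assume "z \<in> carrier S"
    then obtain t where t: "coherent Rm t" "z = seq_class Rm t" by (rule completion_ringE)
    show "x \<otimes>\<^bsub>S\<^esub> y \<otimes>\<^bsub>S\<^esub> z = x \<otimes>\<^bsub>S\<^esub> (y \<otimes>\<^bsub>S\<^esub> z)"
      using r s t seq_class_mult coh_mult coherent_Rm_closed by (simp add: m_assoc)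
  qed
  fix x y z assume "x \<in> carrier S" "y \<in> carrier S" "z \<in> carrier S"
  then obtain r s t where "coherent Rm r" "x = seq_class Rm r" "coherent Rm s" "y = seq_class Rm s"
    "coherent Rm t" "z = seq_class Rm t" by (metis completion_ringE)
  then show "(x \<oplus>\<^bsub>S\<^esub> y) \<otimes>\<^bsub>S\<^esub> z = x \<otimes>\<^bsub>S\<^esub> z \<oplus>\<^bsub>S\<^esub> y \<otimes>\<^bsub>S\<^esub> z"
    using seq_class_mult add coh_mult coh_add coherent_Rm_closed by (simp add: l_distr)
qed

sublocale S: cring S by (rule cring_completion)

lemma module_completion:
  assumes M: "module R M"
  shows "module S (Mhat M)"
proof (rule moduleI[OF cring_completion abelian_group_completion[OF M]])
  interpret M: module R M by (rule M)
  note smult = seq_class_smult[OF M] and add = seq_class_add[OF M] and coh_smult = coherent_smult[OF M]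
    and add_S = seq_class_add[OF module_Rm, folded completion_ring_group_eq, unfolded ring_as_module_simps]
    and coh_S = coherent_add[OF module_Rm, unfolded ring_as_module_simps] coherent_smult[OF module_Rm, unfolded ring_as_module_simps]
  have one: "coherent Rm (\<lambda>n. \<one>\<^bsub>R\<^esub>)" by (rule coherent_const[OF module_Rm]) simp
  fix x assume "x \<in> carrier (Mhat M)"
  then obtain u where u: "coherent M u" "x = seq_class M u" by (rule completionE[OF M])
  show "\<one>\<^bsub>S\<^esub> \<odot>\<^bsub>Mhat M\<^esub> x = x" using u smult[OF one u(1)] coherent_closed[OF u(1)] by (simp add: seq_class_one)
  fix a assume "a \<in> carrier S"
  then obtain r where r: "coherent Rm r" "a = seq_class Rm r" by (rule completion_ringE)
  show "a \<odot>\<^bsub>Mhat M\<^esub> x \<in> carrier (Mhat M)" using r u smult seq_class_closed[OF M coh_smult] by simp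
  show "a \<odot>\<^bsub>Mhat M\<^esub> (x \<oplus>\<^bsub>Mhat M\<^esub> y) = a \<odot>\<^bsub>Mhat M\<^esub> x \<oplus>\<^bsub>Mhat M\<^esub> a \<odot>\<^bsub>Mhat M\<^esub> y" if "y \<in> carrier (Mhat M)" for y
  proof -
    obtain v where "coherent M v" "y = seq_class M v" using completionE[OF M \<open>y \<in> _\<close>] .
    then show ?thesis using r u smult add coh_smult coherent_add[OF M] coherent_Rm_closed coherent_closed[of M]
      by (simp add: M.smult_r_distr)
  qed
  fix b assume "b \<in> carrier S"
  then obtain s where s: "coherent Rm s" "b = seq_class Rm s" by (rule completion_ringE)
  note closed = coherent_Rm_closed coherent_closed[of M]
  show "(a \<oplus>\<^bsub>S\<^esub> b) \<odot>\<^bsub>Mhat M\<^esub> x = a \<odot>\<^bsub>Mhat M\<^esub> x \<oplus>\<^bsub>Mhat M\<^esub> b \<odot>\<^bsub>Mhat M\<^esub> x"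
    using r s u smult add_S add coh_smult coh_S closed by (simp add: M.smult_l_distr)
  show "a \<otimes>\<^bsub>S\<^esub> b \<odot>\<^bsub>Mhat M\<^esub> x = a \<odot>\<^bsub>Mhat M\<^esub> (b \<odot>\<^bsub>Mhat M\<^esub> x)"
    using r s u smult seq_class_mult coh_smult coh_S closed by (simp add: M.smult_assoc1)
qed

lemma completion_map_eq: "\<iota> r = seq_class Rm (\<lambda>n. r)"
  by (simp add: completion_map_def seq_class_Rm)

lemma completion_map_ring_hom: "\<iota> \<in> ring_hom R S"
proof (rule ring_hom_memI)
  note const = coherent_const[OF module_Rm, unfolded ring_as_module_simps]
  show "\<iota> r \<in> carrier S" if "r \<in> carrier R" for r unfolding completion_map_eq by (rule seq_class_Rm_closed[OF const[OF that]])
  show "\<iota> (r \<otimes>\<^bsub>R\<^esub> s) = \<iota> r \<otimes>\<^bsub>S\<^esub> \<iota> s" if "r \<in> carrier R" "s \<in> carrier R" for r s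
    using seq_class_mult[OF const const] that by (simp add: completion_map_eq)
  show "\<iota> (r \<oplus>\<^bsub>R\<^esub> s) = \<iota> r \<oplus>\<^bsub>S\<^esub> \<iota> s" if "r \<in> carrier R" "s \<in> carrier R" for r s
    using seq_class_add[OF module_Rm const const] that by (simp add: completion_map_eq completion_ring_group_eq)
qed (simp add: completion_map_eq seq_class_one)

lemmas completion_map_closed = ring_hom_closed[OF completion_map_ring_hom]

abbreviation "rs \<equiv> restrict_scalars \<iota>"

lemmas module_rs = module_restrict_scalars[OF R completion_map_ring_hom]
lemmas submodule_rs = submodule_restrict_scalars[OF R completion_map_ring_hom]
lemmas linear_map_rs = linear_map_restrict_scalars[OF R completion_map_ring_hom]

definition to_completion :: "('a, 'm, 's) module_scheme => 'm => nat => 'm set" where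
  "to_completion M y = seq_class M (\<lambda>n. y)"

definition represents :: "('a, 'm, 's) module_scheme => nat => (nat => 'm set) => 'm => bool" where
  "represents M n x y \<longleftrightarrow> x \<in> carrier (Mhat M) \<and> y \<in> carrier M \<and> x n = adic_sub M n +>\<^bsub>M\<^esub> y"

definition adic_closure :: "('a, 'm, 's) module_scheme => 'm set => (nat => 'm set) set" where
  "adic_closure M N = {x \<in> carrier (Mhat M). \<forall>n. \<exists>y\<in>N. represents M n x y}"

lemma completion_map_eq_to_completion: "\<iota> = to_completion Rm"
  by (simp add: fun_eq_iff completion_map_eq to_completion_def)

lemma represents_closed: "represents M n x y ==> y \<in> carrier M"
  by (simp add: represents_def)

lemma adic_closure_closed: "x \<in> adic_closure M N ==> x \<in> carrier (Mhat M)"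
  by (simp add: adic_closure_def)

lemma adic_closureE:
  assumes "x \<in> adic_closure M N"
  obtains y where "y \<in> N" "represents M n x y"
  using assms by (auto simp: adic_closure_def)

lemma adic_closure_mono: "N \<subseteq> N' ==> adic_closure M N \<subseteq> adic_closure M N'"
  unfolding adic_closure_def by blast

context
  fixes M :: "('a, 'm, 's) module_scheme" (structure)
  assumes M: "module R M"
begin

interpretation M: module R M by (rule M)

lemma linear_map_to_completion: "linear_map R M (rs (Mhat M)) (to_completion M)"
  unfolding linear_map_def to_completion_def
  using M module_rs[OF module_completion[OF M]] seq_class_closed[OF M coherent_const[OF M]]
    seq_class_add[OF M coherent_const[OF M] coherent_const[OF M]]
    seq_class_smult[OF M coherent_const[OF module_Rm] coherent_const[OF M]]
  by (auto simp: completion_map_eq)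

lemma represents_seq_class: "coherent M v ==> represents M n (seq_class M v) (v n)"
  using seq_class_closed[OF M] coherent_closed[of M] by (simp add: represents_def seq_class_def)

lemma represents_to_completion: "y \<in> carrier M ==> represents M n (to_completion M y) y"
  unfolding to_completion_def using represents_seq_class[OF coherent_const[OF M]] by blast

lemma represents_unique: "represents M n x y ==> represents M n x y' ==> y \<ominus> y' \<in> adic_sub M n"
  using a_coset_eq_iff[OF M submodule_adic_sub[OF M], of y y' n] by (simp add: represents_def)

lemma represents_cong: "represents M n x y ==> y' \<in> carrier M ==> y' \<ominus> y \<in> adic_sub M n ==> represents M n x y'"
  using a_coset_eq_iff[OF M submodule_adic_sub[OF M], of y' y n] by (simp add: represents_def)

lemma represents_antimono:
  assumes rep: "represents M n x y" and m: "m \<le> n"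
  shows "represents M m x y"
proof -
  obtain v where v: "coherent M v" "x = seq_class M v" using rep completionE[OF M] unfolding represents_def by blast
  note sub = submodule_adic_sub[OF M] and closed = represents_closed[OF rep] coherent_closed[OF v(1)] coherent_closed[OF v(1)]
  have "y \<ominus> v n \<in> adic_sub M m"
    using represents_unique[OF rep, of "v n"] represents_seq_class[OF v(1)] v(2) adic_sub_antimono[OF M m] by auto
  then have "y \<ominus> v m \<in> adic_sub M m" by (rule diff_mem_trans[OF M sub closed _ coherent_diff_mem[OF M v(1) m]])
  then show ?thesis unfolding v(2) by (rule represents_cong[OF represents_seq_class[OF v(1)] closed(1)])
qed

lemma represents_coherent:
  assumes y: "\<And>n. represents M n x (y n)"
  shows "coherent M y"
  using represents_unique[OF represents_antimono[OF y le_SucI[OF le_refl]] y] represents_closed[OF y] by (simp add: coherent_def)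

lemma represents_eqI:
  assumes "\<And>n. represents M n x (y n)" "\<And>n. represents M n x' (y n)"
  shows "x = x'"
  using assms by (auto simp: represents_def)

lemma represents_add:
  assumes "represents M n x y" "represents M n x' y'"
  shows "represents M n (x \<oplus>\<^bsub>Mhat M\<^esub> x') (y \<oplus> y')"
proof -
  interpret H: module S "Mhat M" by (rule module_completion[OF M])
  have "(x \<oplus>\<^bsub>Mhat M\<^esub> x') n = x n <+>\<^bsub>M\<^esub> x' n" by (simp add: completion_module_def Let_def quot_module_simps)
  then show ?thesis using assms a_coset_add[OF M submodule_adic_sub[OF M]] by (simp add: represents_def)
qed

lemma represents_smult:
  assumes "represents Rm n c r" "represents M n x y"
  shows "represents M n (c \<odot>\<^bsub>Mhat M\<^esub> x) (r \<odot> y)"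
proof -
  interpret H: module S "Mhat M" by (rule module_completion[OF M])
  show ?thesis
    using assms completion_smult_at[OF M, of r y c n x] by (simp add: represents_def completion_ring_group_eq)
qed

lemma represents_zero: "represents M n \<zero>\<^bsub>Mhat M\<^esub> \<zero>"
  unfolding seq_class_zero[OF M] by (rule represents_seq_class[OF coherent_const[OF M M.zero_closed]])

lemma represents_lincomb:
  "(\<And>i. i < k ==> represents M n (f i) (y i)) ==> (\<And>i. i < k ==> represents Rm n (c i) (r i)) ==>
    represents M n (lincomb (Mhat M) f c k) (lincomb M y r k)"
  by (induction k) (auto simp: represents_zero intro!: represents_add represents_smult)

lemma adic_closureI: "coherent M v ==> (\<And>n. v n \<in> N) ==> seq_class M v \<in> adic_closure M N"
  using represents_seq_class seq_class_closed[OF M] by (auto simp: adic_closure_def)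

lemma to_completion_mem_adic_closure: "submodule N R M ==> y \<in> N ==> to_completion M y \<in> adic_closure M N"
  unfolding to_completion_def by (rule adic_closureI[OF coherent_const[OF M submodule_mem_carrier]])

lemma adic_closure_coherent:
  assumes x: "x \<in> adic_closure M N"
  obtains v where "coherent M v" "x = seq_class M v" "\<And>n. v n \<in> N"
proof -
  have "\<forall>n. \<exists>y. y \<in> N \<and> represents M n x y" using x by (auto simp: adic_closure_def)
  then obtain v where v: "\<And>n. v n \<in> N" "\<And>n. represents M n x (v n)" by metis
  note coherent = represents_coherent[OF v(2)]
  show ?thesis by (rule that[OF coherent represents_eqI[OF v(2) represents_seq_class[OF coherent]] v(1)])
qed

lemma submodule_adic_closure:
  assumes N: "submodule N R M"
  shows "submodule (adic_closure M N) S (Mhat M)"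
proof (rule submoduleI_no_inverse[OF module_completion[OF M]])
  interpret H: module S "Mhat M" by (rule module_completion[OF M])
  show "adic_closure M N \<subseteq> carrier (Mhat M)" using adic_closure_closed by blast
  show "\<zero>\<^bsub>Mhat M\<^esub> \<in> adic_closure M N"
    using represents_zero submodule_zero_mem[OF N] by (auto simp: adic_closure_def)
  fix x assume x: "x \<in> adic_closure M N"
  show "x \<oplus>\<^bsub>Mhat M\<^esub> y \<in> adic_closure M N" if "y \<in> adic_closure M N" for y
    using x that represents_add submodule_add[OF N] unfolding adic_closure_def by simp blast
  show "c \<odot>\<^bsub>Mhat M\<^esub> x \<in> adic_closure M N" if c: "c \<in> carrier S" for c
  proof -
    obtain r where r: "coherent Rm r" "c = seq_class Rm r" using c by (rule completion_ringE)
    have "represents Rm n c (r n)" for n unfolding r(2) using r(1) seq_class_closed[OF module_Rm r(1)]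
      by (simp add: represents_def seq_class_def coherent_Rm_closed)
    then show ?thesis
      using x c represents_smult submodule_smult[OF N coherent_Rm_closed[OF r(1)]] unfolding adic_closure_def by simp blast
  qed
qed

lemma adic_closure_carrier: "adic_closure M (carrier M) = carrier (Mhat M)"
proof
  show "adic_closure M (carrier M) \<subseteq> carrier (Mhat M)" using adic_closure_closed by (rule subsetI)
  show "carrier (Mhat M) \<subseteq> adic_closure M (carrier M)"
  proof
    fix x assume "x \<in> carrier (Mhat M)"
    then obtain v where v: "coherent M v" "x = seq_class M v" by (rule completionE[OF M])
    show "x \<in> adic_closure M (carrier M)" unfolding v(2) by (rule adic_closureI[OF v(1) coherent_closed[OF v(1)]])
  qed
qed

lemma adic_closure_zero: "adic_closure M {\<zero>} = {\<zero>\<^bsub>Mhat M\<^esub>}"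
proof (intro equalityI subsetI)
  fix x assume "x \<in> adic_closure M {\<zero>}"
  then have "represents M n x \<zero>" for n by (simp add: adic_closure_def)
  then show "x \<in> {\<zero>\<^bsub>Mhat M\<^esub>}" using represents_eqI[OF _ represents_zero] by blast
qed (use submodule_zero_mem[OF submodule_adic_closure[OF submodule_singleton_zero[OF M]]] in simp)

lemma smult_span_completion_represents:
  assumes "x \<in> smult_span (rs (Mhat M)) (J n) (carrier (Mhat M))"
  shows "\<exists>y\<in>adic_sub M n. represents M n x y"
  using assms
proof induction
  case zero
  then show ?case using represents_zero submodule_zero_mem[OF submodule_adic_sub[OF M]] by auto
next
  case (step y r x)
  then obtain z where z: "z \<in> adic_sub M n" "represents M n y z" by blast
  obtain v where v: "coherent M v" "x = seq_class M v" using step(3) completionE[OF M] by blast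
  have "represents M n (\<iota> r \<odot>\<^bsub>Mhat M\<^esub> x) (r \<odot> v n)"
    unfolding v(2) by (rule represents_smult[OF _ represents_seq_class[OF v(1)]])
      (use J_closed[OF step(2)] in \<open>simp add: completion_map_eq_to_completion adic.represents_to_completion[OF adic_axioms module_Rm]\<close>)
  then show ?case
    using represents_add[OF z(2)] submodule_add[OF submodule_adic_sub[OF M] z(1) smult_mem_adic_sub[OF M step(2) coherent_closed[OF v(1)]]]
    by auto
qed

lemma mem_adic_closure_if_approx:
  assumes N: "submodule N R M" and "x \<in> carrier (Mhat M)"
    and approx: "\<And>n. x \<in> smult_span (rs (Mhat M)) (J n) (carrier (Mhat M)) <+>\<^bsub>Mhat M\<^esub> adic_closure M N"
  shows "x \<in> adic_closure M N"
proof -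
  have "\<exists>z\<in>N. represents M n x z" for n
  proof -
    obtain a b where ab: "a \<in> smult_span (rs (Mhat M)) (J n) (carrier (Mhat M))" "b \<in> adic_closure M N" "x = a \<oplus>\<^bsub>Mhat M\<^esub> b"
      using approx[of n] by (auto simp: set_add_iff)
    obtain y where y: "y \<in> adic_sub M n" "represents M n a y" using smult_span_completion_represents[OF ab(1)] by blast
    obtain z where z: "z \<in> N" "represents M n b z" using ab(2) by (rule adic_closureE)
    note closed = represents_closed[OF y(2)] represents_closed[OF z(2)]
    have "z \<ominus> (y \<oplus> z) \<in> adic_sub M n"
      by (rule diff_mem_sym[OF M submodule_adic_sub[OF M]]) (use closed y(1) minus_cancel(4)[OF M closed] in simp_all)
    then show ?thesis using represents_cong[OF represents_add[OF y(2) z(2)]] ab(3) z(1) closed by blast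
  qed
  then show ?thesis using assms(2) by (simp add: adic_closure_def)
qed

end

subsection \<open>Generators of the closure of a submodule\<close>

context
  fixes M :: "('a, 'm, 's) module_scheme" (structure)
  assumes M: "module R M"
begin

interpretation M: module R M by (rule M)

lemma coherent_coefficients:
  assumes g: "\<And>i. i < k ==> g i \<in> carrier M" and r0: "\<And>i. i < k ==> r0 i \<in> carrier R" "w 0 = lincomb M g r0 k"
    and w: "\<And>n. w n \<in> carrier M" and c: "\<And>n i. i < k ==> c n i \<in> J n" "\<And>n. w (Suc n) \<ominus> w n = lincomb M g (c n) k"
  obtains r where "\<And>i. i < k ==> coherent Rm (r i)" "\<And>n. w n = lincomb M g (\<lambda>i. r i n) k"
proof -
  define r where "r i n = rec_nat (r0 i) (\<lambda>n x. x \<oplus>\<^bsub>R\<^esub> c n i) n" for i n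
  have r_simps: "r i 0 = r0 i" "r i (Suc n) = r i n \<oplus>\<^bsub>R\<^esub> c n i" for i n by (simp_all add: r_def)
  have cR: "i < k ==> c n i \<in> carrier R" for n i using c(1) J_closed by blast
  have rR: "r i n \<in> carrier R" if "i < k" for i n by (induction n) (use r_simps r0 cR that in auto)
  have "coherent Rm (r i)" if i: "i < k" for i
    using minus_cancel(5)[OF module_Rm, of "c n i" "r i n" for n] cR[OF i] rR[OF i] c(1)[OF i] by (simp add: coherent_def r_simps)
  moreover have "w n = lincomb M g (\<lambda>i. r i n) k" for n
  proof (induction n)
    case 0
    then show ?case using r0(2) by (simp add: r_simps)
  next
    case (Suc n)
    have "w (Suc n) = w n \<oplus> (w (Suc n) \<ominus> w n)" by (rule minus_cancel(2)[OF M w w, symmetric])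
    also have "\<dots> = lincomb M g (\<lambda>i. r i n) k \<oplus> lincomb M g (c n) k" unfolding c(2) by (simp only: Suc)
    also have "\<dots> = lincomb M g (\<lambda>i. r i (Suc n)) k" unfolding r_simps by (rule lincomb_add_coeff[OF M g rR cR, symmetric])
    finally show ?case .
  qed
  ultimately show ?thesis by (rule that)
qed

text \<open>By Artin--Rees a coherent sequence in \<open>N\<close> has a subsequence whose differences lie in the
  submodules \<open>\<aa>\<^sup>nN\<close>.\<close>

lemma adic_closure_fast_sequence:
  assumes fg: "fin_gen_module R M" and N: "submodule N R M" and x: "x \<in> adic_closure M N"
  obtains w where "\<And>n. w n \<in> N" "\<And>n. w (Suc n) \<ominus> w n \<in> smult_span M (J n) N" "\<And>n. represents M n x (w n)"
proof -
  note zero = submodule_singleton_zero[OF M] and sub = submodule_adic_sub[OF M]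
  obtain u where u: "coherent M u" "x = seq_class M u" "\<And>n. u n \<in> N" using adic_closure_coherent[OF M x] by blast
  have uM: "u n \<in> carrier M" for n by (rule coherent_closed[OF u(1)])
  have "\<exists>m. N \<inter> adic_sub M m \<subseteq> smult_span M (J n) N" for n
  proof -
    obtain m where m: "N \<inter> (adic_sub M m <+>\<^bsub>M\<^esub> {\<zero>}) \<subseteq> smult_span M (J n) N <+>\<^bsub>M\<^esub> {\<zero>}"
      unfolding adic_sub_def
      by (rule weak_artin_rees[OF NR fin_gen_noetherian_module[OF R NR fg] \<aa> N zero]) (use submodule_zero_mem[OF N] in auto)
    have "T <+>\<^bsub>M\<^esub> {\<zero>} = T" if "submodule T R M" for T
      using set_add_subset[OF that subset_refl, of "{\<zero>}"] submodule_set_add(2)[OF M that zero] submodule_zero_mem[OF that] by blast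
    then show ?thesis using m sub submodule_smult_span[OF M ideal_J N] by metis
  qed
  then obtain s where s: "\<And>n. N \<inter> adic_sub M (s n) \<subseteq> smult_span M (J n) N" by metis
  define \<sigma> where "\<sigma> n = n + (\<Sum>i\<le>n. s i)" for n
  have \<sigma>: "n \<le> \<sigma> n" "s n \<le> \<sigma> n" "\<sigma> n \<le> \<sigma> (Suc n)" for n
    using member_le_sum[of n "{..n}" s] by (auto simp: \<sigma>_def)
  show ?thesis
  proof (rule that[of "\<lambda>n. u (\<sigma> n)"])
    show "u (\<sigma> n) \<in> N" for n by (rule u(3))
    show "u (\<sigma> (Suc n)) \<ominus> u (\<sigma> n) \<in> smult_span M (J n) N" for n
      using s[of n] submodule_minus[OF N u(3) u(3)] coherent_diff_mem[OF M u(1) \<sigma>(3)[of n]] adic_sub_antimono[OF M \<sigma>(2)[of n]] by blast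
    show "represents M n x (u (\<sigma> n))" for n
      unfolding u(2) by (rule represents_cong[OF M represents_seq_class[OF M u(1)] uM coherent_diff_mem[OF M u(1) \<sigma>(1)]])
  qed
qed

lemma adic_closure_generated:
  assumes fg: "fin_gen_module R M" and N: "submodule N R M" and gen: "generates R M N k g"
  shows "generates S (Mhat M) (adic_closure M N) k (\<lambda>i. to_completion M (g i))"
  unfolding generates_def
proof (intro conjI allI impI subsetI)
  have gN: "\<And>i. i < k ==> g i \<in> N" using gen by (auto simp: generates_def)
  then have gM: "\<And>i. i < k ==> g i \<in> carrier M" using submodule_mem_carrier[OF N] by blast
  show "to_completion M (g i) \<in> adic_closure M N" if "i < k" for i by (rule to_completion_mem_adic_closure[OF M N gN[OF that]])
  fix x assume "x \<in> adic_closure M N"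
  from adic_closure_fast_sequence[OF fg N this] obtain w where w: "\<And>n. w n \<in> N"
    "\<And>n. w (Suc n) \<ominus> w n \<in> smult_span M (J n) N" "\<And>n. represents M n x (w n)" by blast
  obtain r0 where r0: "\<And>i. i < k ==> r0 i \<in> carrier R" "w 0 = lincomb M g r0 k" using generatesE[OF gen w(1)] by blast
  have "\<forall>n. \<exists>c. (\<forall>i<k. c i \<in> J n) \<and> w (Suc n) \<ominus> w n = lincomb M g c k"
    using smult_span_lincomb[OF M ideal_J N gen w(2)] by metis
  then obtain c where c: "\<And>n i. i < k ==> c n i \<in> J n" "\<And>n. w (Suc n) \<ominus> w n = lincomb M g (c n) k" by metis
  obtain r where r: "\<And>i. i < k ==> coherent Rm (r i)" "\<And>n. w n = lincomb M g (\<lambda>i. r i n) k"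
    using coherent_coefficients[OF gM r0 submodule_mem_carrier[OF N w(1)] c] by blast
  have "x = lincomb (Mhat M) (\<lambda>i. to_completion M (g i)) (\<lambda>i. seq_class Rm (r i)) k"
  proof (rule represents_eqI[OF M w(3)])
    show "represents M n (lincomb (Mhat M) (\<lambda>i. to_completion M (g i)) (\<lambda>i. seq_class Rm (r i)) k) (w n)" for n
      unfolding r(2) by (rule represents_lincomb[OF M represents_to_completion[OF M gM] represents_seq_class[OF module_Rm r(1)]])
  qed
  then show "x \<in> lincombs S (Mhat M) (\<lambda>i. to_completion M (g i)) k"
    using seq_class_Rm_closed[OF r(1)] unfolding lincombs_def by blast
qed

end

lemma smult_span_image_add_subset:
  assumes \<delta>: "linear_map R A B \<delta>" and C: "submodule C R A" and L: "submodule L R B"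
  shows "smult_span B (J t) (\<delta> ` C <+>\<^bsub>B\<^esub> L) \<subseteq> \<delta> ` smult_span A (J t) C <+>\<^bsub>B\<^esub> L" (is "_ \<subseteq> ?T")
proof (rule smult_span_subsetI)
  note A = linear_map_module(1)[OF \<delta>] and B = linear_map_module(2)[OF \<delta>]
  interpret B: module R B by (rule B)
  show "submodule ?T R B" by (rule submodule_set_add(1)[OF B submodule_image[OF \<delta> submodule_smult_span[OF A ideal_J C]] L])
  fix r z assume r: "r \<in> J t" and "z \<in> \<delta> ` C <+>\<^bsub>B\<^esub> L"
  then obtain c l where z: "c \<in> C" "l \<in> L" "z = \<delta> c \<oplus>\<^bsub>B\<^esub> l" by (auto simp: set_add_iff)
  have rR: "r \<in> carrier R" by (rule J_closed[OF r])
  have "r \<odot>\<^bsub>B\<^esub> z = \<delta> (r \<odot>\<^bsub>A\<^esub> c) \<oplus>\<^bsub>B\<^esub> r \<odot>\<^bsub>B\<^esub> l"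
    using z rR submodule_mem_carrier[OF C z(1)] submodule_mem_carrier[OF L z(2)] linear_map_closed[OF \<delta>] linear_map_smult[OF \<delta>]
    by (simp add: B.smult_r_distr)
  then show "r \<odot>\<^bsub>B\<^esub> z \<in> ?T"
    using smult_mem_smult_span[OF A ideal_J C r z(1)] submodule_smult[OF L rR z(2)] unfolding set_add_iff by blast
qed

lemma adic_closure_vimage:
  fixes A :: "('a, 'm, 's) module_scheme" and B :: "('a, 'n, 't) module_scheme"
  assumes fgB: "fin_gen_module R B" and \<delta>: "linear_map R A B \<delta>" and C: "submodule C R A" and L: "submodule L R B"
    and x: "x \<in> carrier (Mhat A)" and y: "\<And>n. represents A n x (y n)" "\<And>n. y n \<in> C" "\<And>n. \<delta> (y n) \<in> adic_sub B n <+>\<^bsub>B\<^esub> L"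
  shows "x \<in> adic_closure A {u \<in> C. \<delta> u \<in> L}"
proof -
  note A = linear_map_module(1)[OF \<delta>] and B = linear_map_module(2)[OF \<delta>]
  interpret B: module R B by (rule B)
  have image: "submodule (\<delta> ` C <+>\<^bsub>B\<^esub> L) R B" "L \<subseteq> \<delta> ` C <+>\<^bsub>B\<^esub> L" "\<delta> ` C \<subseteq> \<delta> ` C <+>\<^bsub>B\<^esub> L"
    using submodule_set_add[OF B submodule_image[OF \<delta> C] L] by auto
  have "\<exists>u\<in>{u \<in> C. \<delta> u \<in> L}. represents A t x u" for t
  proof -
    note tC = submodule_smult_span[OF A ideal_J C, of t]
    obtain m where m: "(\<delta> ` C <+>\<^bsub>B\<^esub> L) \<inter> (adic_sub B m <+>\<^bsub>B\<^esub> L) \<subseteq> smult_span B (J t) (\<delta> ` C <+>\<^bsub>B\<^esub> L) <+>\<^bsub>B\<^esub> L"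
      unfolding adic_sub_def by (rule weak_artin_rees[OF NR fin_gen_noetherian_module[OF R NR fgB] \<aa> image(1) L image(2)])
    let ?n = "max m t" and ?T = "\<delta> ` smult_span A (J t) C <+>\<^bsub>B\<^esub> L"
    have T: "submodule ?T R B" "\<delta> ` smult_span A (J t) C \<subseteq> ?T" "L \<subseteq> ?T"
      using submodule_set_add[OF B submodule_image[OF \<delta> tC] L] by auto
    have "smult_span B (J t) (\<delta> ` C <+>\<^bsub>B\<^esub> L) \<subseteq> ?T" by (rule smult_span_image_add_subset[OF \<delta> C L])
    then have "smult_span B (J t) (\<delta> ` C <+>\<^bsub>B\<^esub> L) <+>\<^bsub>B\<^esub> L \<subseteq> ?T" by (rule set_add_subset[OF T(1) _ T(3)])
    moreover have "\<delta> (y ?n) \<in> adic_sub B m <+>\<^bsub>B\<^esub> L"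
      using y(3)[of ?n] set_add_mono[OF adic_sub_antimono[OF B, of m ?n] subset_refl[of L]] by auto
    ultimately have "\<delta> (y ?n) \<in> ?T" using m y(2)[of ?n] image(3) by blast
    then obtain w l where w: "w \<in> smult_span A (J t) C" "l \<in> L" "\<delta> (y ?n) = \<delta> w \<oplus>\<^bsub>B\<^esub> l" by (auto simp: set_add_iff)
    have wC: "w \<in> C" by (rule subsetD[OF smult_span_subset[OF C subsetI[OF J_closed]] w(1)])
    note closed = represents_closed[OF y(1)[of ?n]] submodule_mem_carrier[OF C wC]
    have "\<delta> (y ?n \<ominus>\<^bsub>A\<^esub> w) = l"
      using linear_map_minus[OF \<delta> closed] w(3) minus_cancel(5)[OF B _ linear_map_closed[OF \<delta> closed(2)], of l] submodule_mem_carrier[OF L w(2)] by simp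
    moreover have "represents A t x (y ?n \<ominus>\<^bsub>A\<^esub> w)"
    proof (rule represents_cong[OF A represents_antimono[OF A y(1)[of ?n]]])
      show yw: "y ?n \<ominus>\<^bsub>A\<^esub> w \<in> carrier A" by (rule submodule_minus[OF module.carrier_is_submodule[OF A] closed])
      have "w \<in> adic_sub A t" unfolding adic_sub_def
        by (rule subsetD[OF smult_span_mono[OF subset_refl subsetI[OF submodule_mem_carrier[OF C]]] w(1)])
      then show "(y ?n \<ominus>\<^bsub>A\<^esub> w) \<ominus>\<^bsub>A\<^esub> y ?n \<in> adic_sub A t"
        using diff_mem_sym[OF A submodule_adic_sub[OF A] closed(1) yw] minus_cancel(3)[OF A closed] by simp
    qed simp
    ultimately show ?thesis using submodule_minus[OF C y(2) wC] w(2) by blast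
  qed
  then show ?thesis using x by (simp add: adic_closure_def)
qed

lemma adic_sub_power_module:
  assumes M: "module R M"
  shows "adic_sub (power_module M p) n = {u \<in> carrier (power_module M p). \<forall>j<p. u j \<in> adic_sub M n}"
  using smult_span_power_module_iff[OF M ideal_J] submodule_mem_carrier[OF submodule_adic_sub[OF module_power_module[OF M]]]
  unfolding adic_sub_def by blast

lemma coherent_power_module:
  fixes M :: "('a, 'm, 's) module_scheme"
  assumes M: "module R M" and y: "\<And>n. y n \<in> carrier (power_module M p)" and coh: "\<And>j. j < p ==> coherent M (\<lambda>n. y n j)"
  shows "coherent (power_module M p) y"
  unfolding coherent_def
proof (intro allI conjI y)
  fix n
  have "y (Suc n) \<ominus>\<^bsub>power_module M p\<^esub> y n \<in> carrier (power_module M p)"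
    by (rule submodule_minus[OF module.carrier_is_submodule[OF module_power_module[OF M]] y y])
  then show "y (Suc n) \<ominus>\<^bsub>power_module M p\<^esub> y n \<in> adic_sub (power_module M p) n"
    unfolding adic_sub_power_module[OF M] using power_module_minus_nth[OF M y y] coherent_Suc[OF coh] by simp
qed

lemma completion_tuple_generated:
  fixes M :: "('a, 'm, 's) module_scheme" and B :: "('a, 'n, 't) module_scheme"
  assumes fg: "fin_gen_module R M" and fgB: "fin_gen_module R B" and \<delta>: "linear_map R (power_module M p) B \<delta>"
    and C: "submodule C R (power_module M p)" and L: "submodule L R B"
  obtains k g where "\<And>i. i < k ==> g i \<in> C" "\<And>i. i < k ==> \<delta> (g i) \<in> L"
    "\<forall>x y. (\<forall>n. \<forall>j<p. represents M n (x j) (y n j)) --> (\<forall>n. y n \<in> C \<and> \<delta> (y n) \<in> adic_sub B n <+>\<^bsub>B\<^esub> L) -->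
      (\<exists>c. (\<forall>i<k. c i \<in> carrier S) \<and> (\<forall>j<p. x j = lincomb (Mhat M) (\<lambda>i. to_completion M (g i j)) c k))"
proof -
  note M = fin_gen_moduleD[OF fg] and fgP = fin_gen_power_module[OF fg, of p]
  let ?P = "power_module M p" and ?Z = "{u \<in> C. \<delta> u \<in> L}"
  note P = module_power_module[OF M, of p] and Z = submodule_vimage[OF \<delta> C L]
  obtain k g where gen: "generates R ?P ?Z k g"
    using fin_gen_noetherian_module[OF R NR fgP] Z unfolding noetherian_module_def by blast
  then have gZ: "\<And>i. i < k ==> g i \<in> ?Z" by (auto simp: generates_def)
  have gP: "\<And>i. i < k ==> g i \<in> carrier ?P" using gZ submodule_mem_carrier[OF C] by blast
  have "\<exists>c. (\<forall>i<k. c i \<in> carrier S) \<and> (\<forall>j<p. x j = lincomb (Mhat M) (\<lambda>i. to_completion M (g i j)) c k)"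
    if x: "\<forall>n. \<forall>j<p. represents M n (x j) (y n j)" and y: "\<forall>n. y n \<in> C \<and> \<delta> (y n) \<in> adic_sub B n <+>\<^bsub>B\<^esub> L" for x y
  proof -
    have yP: "y n \<in> carrier ?P" for n using y submodule_mem_carrier[OF C] by blast
    have coh: "coherent ?P y" by (rule coherent_power_module[OF M yP represents_coherent[OF M]]) (use x in blast)
    have "seq_class ?P y \<in> adic_closure ?P ?Z"
      by (rule adic_closure_vimage[OF fgB \<delta> C L seq_class_closed[OF P coh] represents_seq_class[OF P coh]]) (use y in blast)+
    then obtain c where c: "\<And>i. i < k ==> c i \<in> carrier S" "seq_class ?P y = lincomb (Mhat ?P) (\<lambda>i. to_completion ?P (g i)) c k"
      using generatesE[OF adic_closure_generated[OF P fgP Z gen]] by blast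
    have "\<forall>i. \<exists>r. i < k --> coherent Rm r \<and> c i = seq_class Rm r" using c(1) completion_ringE by metis
    then obtain r where r: "\<And>i. i < k ==> coherent Rm (r i)" "\<And>i. i < k ==> c i = seq_class Rm (r i)" by metis
    have rep_c: "i < k ==> represents Rm n (c i) (r i n)" for i n using represents_seq_class[OF module_Rm r(1)] r(2) by simp
    have rR: "\<And>n i. i < k ==> r i n \<in> carrier R" using coherent_Rm_closed[OF r(1)] .
    have "x j = lincomb (Mhat M) (\<lambda>i. to_completion M (g i j)) c k" if j: "j < p" for j
    proof (rule represents_eqI[OF M])
      fix n
      let ?l = "lincomb ?P g (\<lambda>i. r i n) k"
      have l: "?l \<in> carrier ?P" by (rule lincomb_closed[OF P gP rR])
      have l_nth: "?l j = lincomb M (\<lambda>i. g i j) (\<lambda>i. r i n) k" by (rule power_module_lincomb_nth[OF M gP rR j])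
      have "represents ?P n (seq_class ?P y) ?l"
        unfolding c(2) by (rule represents_lincomb[OF P represents_to_completion[OF P gP] rep_c])
      then have diff: "?l \<ominus>\<^bsub>?P\<^esub> y n \<in> adic_sub ?P n" using represents_unique[OF P _ represents_seq_class[OF P coh]] by blast
      have "?l j \<ominus>\<^bsub>M\<^esub> y n j \<in> adic_sub M n"
        using diff j unfolding adic_sub_power_module[OF M] power_module_minus_nth[OF M l yP j, symmetric] by blast
      then show "represents M n (x j) (?l j)"
        using represents_cong[OF M _ power_module_nth(1)[OF l j]] x j by blast
      show "represents M n (lincomb (Mhat M) (\<lambda>i. to_completion M (g i j)) c k) (?l j)"
        unfolding l_nth
        by (rule represents_lincomb[OF M represents_to_completion[OF M power_module_nth(1)[OF gP j]] rep_c])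
    qed
    then show ?thesis using c(1) by blast
  qed
  then show ?thesis using that[of k g] gZ by blast
qed

subsection \<open>Powers of the extended ideal\<close>

definition adic_kernel :: "nat => (nat => 'a set) set" where
  "adic_kernel n = {x \<in> carrier S. x n = J n}"

lemma represents_Rm_mem_kernel_iff:
  assumes "represents Rm n x r"
  shows "x \<in> adic_kernel n \<longleftrightarrow> r \<in> J n"
  using assms a_coset_eq_self_iff[OF module_Rm submodule_J, of r n]
  by (simp add: represents_def adic_kernel_def completion_ring_group_eq)

lemma adic_kernel_eq_closure: "adic_kernel n = adic_closure Rm (J n)"
proof (intro equalityI subsetI)
  fix x assume x: "x \<in> adic_kernel n"
  then obtain r where r: "coherent Rm r" "x = seq_class Rm r" unfolding adic_kernel_def by (blast elim: completion_ringE)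
  note rep = represents_seq_class[OF module_Rm r(1), folded r(2)] and closed = coherent_closed[OF r(1)]
  have rn: "r n \<in> J n" using represents_Rm_mem_kernel_iff[OF rep] x by blast
  have "r (max m n) \<in> J n" for m
    using mem_if_diff_mem[OF module_Rm submodule_J closed rn] coherent_diff_mem[OF module_Rm r(1), of n "max m n"] by simp
  moreover have "represents Rm m x (r (max m n))" for m by (rule represents_antimono[OF module_Rm rep]) simp
  ultimately show "x \<in> adic_closure Rm (J n)" using x by (auto simp: adic_closure_def adic_kernel_def completion_ring_group_eq)
next
  fix x assume "x \<in> adic_closure Rm (J n)"
  then obtain r where "r \<in> J n" "represents Rm n x r" by (rule adic_closureE)
  then show "x \<in> adic_kernel n" using represents_Rm_mem_kernel_iff by blast
qed

lemma linear_map_completion_ring: "linear_map S (Mhat Rm) (ring_as_module S) (\<lambda>x. x)"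
proof -
  have "c \<odot>\<^bsub>Mhat Rm\<^esub> x = c \<otimes>\<^bsub>S\<^esub> x" if cx: "c \<in> carrier S" "x \<in> carrier S" for c x
  proof -
    obtain r where r: "coherent Rm r" "c = seq_class Rm r" using cx(1) by (rule completion_ringE)
    obtain s where s: "coherent Rm s" "x = seq_class Rm s" using cx(2) by (rule completion_ringE)
    show ?thesis using seq_class_smult[OF module_Rm r(1) s(1)] seq_class_mult[OF r(1) s(1)] r(2) s(2) by simp
  qed
  then show ?thesis
    using module_completion[OF module_Rm] module_ring_as_module[OF cring_completion]
    by (simp add: linear_map_def completion_ring_group_eq)
qed

lemma ideal_adic_kernel: "ideal (adic_kernel n) S"
  unfolding adic_kernel_eq_closure ideal_iff_submodule[OF cring_completion]
  using submodule_image[OF linear_map_completion_ring submodule_adic_closure[OF module_Rm submodule_J]] by simp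

lemma adic_kernel_lincomb:
  obtains k g where "\<And>i. i < k ==> g i \<in> J n"
    "\<forall>x\<in>adic_kernel n. \<exists>c. (\<forall>i<k. c i \<in> carrier S) \<and> x = lincomb (ring_as_module S) (\<lambda>i. \<iota> (g i)) c k"
proof -
  obtain k g where gen: "generates R Rm (J n) k g" by (rule noetherian_ring_ideal_generated[OF R NR ideal_J])
  then have g: "\<And>i. i < k ==> g i \<in> J n" by (auto simp: generates_def)
  have "\<exists>c. (\<forall>i<k. c i \<in> carrier S) \<and> x = lincomb (ring_as_module S) (\<lambda>i. \<iota> (g i)) c k" if x: "x \<in> adic_kernel n" for x
  proof -
    obtain c where c: "\<And>i. i < k ==> c i \<in> carrier S" "x = lincomb (Mhat Rm) (\<lambda>i. to_completion Rm (g i)) c k"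
      using generatesE[OF adic_closure_generated[OF module_Rm fin_gen_ring_as_module[OF R] submodule_J gen]
        x[unfolded adic_kernel_eq_closure]] by blast
    have "x = lincomb (ring_as_module S) (\<lambda>i. \<iota> (g i)) c k"
      using linear_map_image_lincomb[OF linear_map_completion_ring _ c(1), of k "\<lambda>i. to_completion Rm (g i)"] c(2)
        completion_map_closed[OF J_closed[OF g]]
      by (simp add: completion_map_eq_to_completion completion_ring_group_eq)
    then show ?thesis using c(1) by blast
  qed
  then show ?thesis using that g by blast
qed

lemma ideal_extended_ideal: "ideal (extended_ideal R \<aa>) S"
  unfolding extended_ideal_def by (rule S.genideal_ideal) (use completion_map_closed ideal.Icarr[OF \<aa>] in auto)

lemma completion_map_mem_kernel: "r \<in> J n ==> \<iota> r \<in> adic_kernel n"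
  using represents_Rm_mem_kernel_iff[OF represents_to_completion[OF module_Rm, of r n]] J_closed[of r n]
  by (simp add: completion_map_eq_to_completion)

lemma completion_map_mem_extended_power: "a \<in> J n ==> \<iota> a \<in> ideal_power S (extended_ideal R \<aa>) n"
proof (induction n arbitrary: a)
  case 0
  then show ?case unfolding ideal_power_0[OF R \<aa>] ideal_power_0[OF cring_completion ideal_extended_ideal] by (rule completion_map_closed)
next
  case (Suc n)
  have generator: "\<iota> a \<in> extended_ideal R \<aa>" if "a \<in> \<aa>" for a
    unfolding extended_ideal_def using S.genideal_self[of "\<iota> ` \<aa>"] completion_map_closed ideal.Icarr[OF \<aa>] that by blast
  from Suc.prems show ?case
    unfolding ideal_power_Suc[OF R \<aa>] ideal_power_Suc[OF cring_completion ideal_extended_ideal]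
  proof induction
    case (prod i j)
    then show ?case
      using ring_hom_mult[OF completion_map_ring_hom, of i j] J_closed ideal.Icarr[OF \<aa>] ideal_prod.prod[OF Suc.IH[OF prod(1)] generator[OF prod(2)]]
      by simp
  next
    case (sum a b)
    then have "a \<in> carrier R" "b \<in> carrier R" using ideal_prod_in_carrier[OF ideal_J \<aa>] by blast+
    then show ?case using ring_hom_add[OF completion_map_ring_hom] ideal_prod.sum[OF sum(3,4)] by simp
  qed
qed

lemma adic_kernel_prod_subset: "ideal_prod S (adic_kernel n) (adic_kernel (Suc 0)) \<subseteq> adic_kernel (Suc n)"
proof (rule ideal_prod_subsetI[OF ideal_adic_kernel])
  fix x y assume xy: "x \<in> adic_kernel n" "y \<in> adic_kernel (Suc 0)"
  obtain r where r: "r \<in> J n" "represents Rm (Suc n) x r" using xy(1) unfolding adic_kernel_eq_closure by (rule adic_closureE)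
  obtain s where s: "s \<in> J (Suc 0)" "represents Rm (Suc n) y s" using xy(2) unfolding adic_kernel_eq_closure by (rule adic_closureE)
  have "represents Rm (Suc n) (x \<otimes>\<^bsub>S\<^esub> y) (r \<otimes>\<^bsub>R\<^esub> s)"
    using represents_smult[OF module_Rm r(2) s(2)] linear_map_smult[OF linear_map_completion_ring, of x y] xy
    by (simp add: adic_kernel_def completion_ring_group_eq)
  moreover have "r \<otimes>\<^bsub>R\<^esub> s \<in> J (Suc n)"
    unfolding ideal_power_Suc[OF R \<aa>] by (rule ideal_prod.prod[OF r(1) s(1)[unfolded ideal_power_1[OF R \<aa>]]])
  ultimately show "x \<otimes>\<^bsub>S\<^esub> y \<in> adic_kernel (Suc n)" using represents_Rm_mem_kernel_iff by blast
qed

lemma extended_ideal_power: "ideal_power S (extended_ideal R \<aa>) n = adic_kernel n"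
proof
  note I = ideal_extended_ideal
  have subset: "extended_ideal R \<aa> \<subseteq> adic_kernel (Suc 0)"
    unfolding extended_ideal_def
    by (rule S.genideal_minimal[OF ideal_adic_kernel])
      (use completion_map_mem_kernel[of _ "Suc 0", unfolded ideal_power_1[OF R \<aa>]] in blast)
  show "ideal_power S (extended_ideal R \<aa>) n \<subseteq> adic_kernel n"
  proof (induction n)
    case 0
    have "x \<in> adic_kernel 0" if x: "x \<in> carrier S" for x
    proof -
      obtain r where r: "coherent Rm r" "x = seq_class Rm r" using x by (rule completion_ringE)
      show ?thesis using represents_Rm_mem_kernel_iff[OF represents_seq_class[OF module_Rm r(1), of 0]] coherent_Rm_closed[OF r(1)] r(2)
        unfolding ideal_power_0[OF R \<aa>] by blast
    qed
    then show ?case unfolding ideal_power_0[OF cring_completion I] by blast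
  next
    case (Suc n)
    have "ideal_prod S (ideal_power S (extended_ideal R \<aa>) n) (extended_ideal R \<aa>) \<subseteq> adic_kernel (Suc n)"
      by (rule ideal_prod_subsetI[OF ideal_adic_kernel])
        (rule subsetD[OF adic_kernel_prod_subset ideal_prod.prod[OF subsetD[OF Suc] subsetD[OF subset]]])
    then show ?case unfolding ideal_power_Suc[OF cring_completion I] .
  qed
  show "adic_kernel n \<subseteq> ideal_power S (extended_ideal R \<aa>) n"
  proof
    fix x assume x: "x \<in> adic_kernel n"
    obtain k g where g: "\<And>i. i < k ==> g i \<in> J n"
      and gen: "\<forall>x\<in>adic_kernel n. \<exists>c. (\<forall>i<k. c i \<in> carrier S) \<and> x = lincomb (ring_as_module S) (\<lambda>i. \<iota> (g i)) c k"
      using adic_kernel_lincomb[of n] by metis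
    obtain c where c: "\<forall>i<k. c i \<in> carrier S" "x = lincomb (ring_as_module S) (\<lambda>i. \<iota> (g i)) c k" using gen x by blast
    show "x \<in> ideal_power S (extended_ideal R \<aa>) n" unfolding c(2)
      by (rule lincomb_mem[OF submodule_ideal_power[OF cring_completion I]])
        (use completion_map_mem_extended_power[OF g] c(1) in auto)
  qed
qed

subsection \<open>Base change to the completed ring\<close>

abbreviation "Sm \<equiv> ring_as_module S"

lemmas module_Sm = module_ring_as_module[OF cring_completion]
lemmas module_free_S = module_free_module[OF cring_completion]

definition completion_tuple :: "nat => (nat => 'a) => nat => (nat => 'a set)" where
  "completion_tuple p x = (\<lambda>i\<in>{..<p}. \<iota> (x i))"

definition scalar_extension ::
    "(nat => 'a set, 'n, 't) module_scheme => nat => ((nat => 'a) => 'n) => (nat => nat => 'a set) => 'n" where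
  "scalar_extension X p f x = lincomb X (\<lambda>j. f (std_basis R p j)) x p"

definition matrix_extension :: "nat => nat => ((nat => 'a) => (nat => 'a)) => (nat => nat => 'a set) => (nat => nat => 'a set)" where
  "matrix_extension p q f = scalar_extension (free_module S q) p (\<lambda>x. completion_tuple q (f x))"

definition completed_res :: "('a, 'a) free_res => (nat => 'a set, nat => 'a set) free_res" where
  "completed_res F = \<lparr>res_rank = res_rank F,
     res_diff = (\<lambda>i. matrix_extension (res_rank F (Suc i)) (res_rank F i) (res_diff F i)),
     res_aug = scalar_extension Sm (res_rank F 0) (\<lambda>x. \<iota> (res_aug F x))\<rparr>"

definition completed_map ::
    "('a, 'a) free_res => ('a, 'a) free_res => (nat => (nat => 'a) => (nat => 'a))
      => nat => (nat => nat => 'a set) => (nat => nat => 'a set)" where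
  "completed_map F G \<phi> i = matrix_extension (res_rank F i) (res_rank G i) (\<phi> i)"

lemma linear_map_completion_map: "linear_map R Rm (rs Sm) \<iota>"
  using module_rs[OF module_Sm] module_Rm completion_map_closed
    ring_hom_add[OF completion_map_ring_hom] ring_hom_mult[OF completion_map_ring_hom]
  by (simp add: linear_map_def)

lemma linear_map_completion_tuple: "linear_map R (free_module R p) (rs (free_module S p)) (completion_tuple p)"
proof -
  have "linear_map R (power_module Rm p) (power_module (rs Sm) p) (\<lambda>x. \<lambda>i\<in>{..<p}. \<iota> (x i))"
    by (rule linear_map_into_power[OF module_power_module[OF module_Rm] module_rs[OF module_Sm]])
      (rule linear_map_comp[OF linear_map_power_nth[OF module_Rm] linear_map_completion_map])
  moreover have "rs (free_module S p) = power_module (rs Sm) p"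
    by (simp add: free_module_eq_power power_module_def restrict_scalars_def)
  ultimately show ?thesis by (simp add: completion_tuple_def[abs_def] free_module_eq_power)
qed

lemma completion_tuple_closed: "x \<in> carrier (free_module R p) ==> completion_tuple p x \<in> carrier (free_module S p)"
  using linear_map_closed[OF linear_map_completion_tuple] by simp

lemma completion_tuple_basis: "completion_tuple p (std_basis R p j) = std_basis S p j"
  using ring_hom_one[OF completion_map_ring_hom] linear_map_zero[OF linear_map_completion_map]
  by (auto simp: completion_tuple_def std_basis_def power_inj_def)

context
  fixes X :: "(nat => 'a set, 'n, 't) module_scheme" and p :: nat and f :: "(nat => 'a) => 'n"
  assumes X: "module S X" and f: "linear_map R (free_module R p) (rs X) f"
begin

lemma linear_map_scalar_extension: "linear_map S (free_module S p) X (scalar_extension X p f)"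
  unfolding scalar_extension_def[abs_def]
  by (rule linear_map_lincomb[OF X]) (use linear_map_closed[OF f std_basis_closed[OF R]] in simp)

lemma scalar_extension_basis: "j < p ==> scalar_extension X p f (std_basis S p j) = f (std_basis R p j)"
  unfolding scalar_extension_def using linear_map_closed[OF f std_basis_closed[OF R]] by (simp add: lincomb_std_basis[OF X])

lemma scalar_extension_tuple:
  assumes "x \<in> carrier (free_module R p)"
  shows "scalar_extension X p f (completion_tuple p x) = f x"
  by (rule linear_map_eq_if_basis[OF linear_map_comp[OF linear_map_completion_tuple linear_map_rs[OF linear_map_scalar_extension]] f _ assms])
    (simp add: completion_tuple_basis scalar_extension_basis)

end

context
  fixes p q :: nat and f :: "(nat => 'a) => (nat => 'a)"
  assumes f: "linear_map R (free_module R p) (free_module R q) f"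
begin

private lemmas tuple_f = linear_map_comp[OF f linear_map_completion_tuple]

lemma linear_map_matrix_extension: "linear_map S (free_module S p) (free_module S q) (matrix_extension p q f)"
  unfolding matrix_extension_def by (rule linear_map_scalar_extension[OF module_free_S tuple_f])

lemma matrix_extension_basis: "j < p ==> matrix_extension p q f (std_basis S p j) = completion_tuple q (f (std_basis R p j))"
  unfolding matrix_extension_def by (rule scalar_extension_basis[OF module_free_S tuple_f])

lemma matrix_extension_tuple: "x \<in> carrier (free_module R p) ==> matrix_extension p q f (completion_tuple p x) = completion_tuple q (f x)"
  unfolding matrix_extension_def by (rule scalar_extension_tuple[OF module_free_S tuple_f])

lemma matrix_extension_nth:
  assumes l: "l < q" and x: "x \<in> carrier (free_module S p)"
  shows "matrix_extension p q f x l = scalar_extension Sm p (\<lambda>y. \<iota> (f y l)) x"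
proof -
  have "matrix_extension p q f x l = lincomb Sm (\<lambda>j. completion_tuple q (f (std_basis R p j)) l) x p"
    unfolding matrix_extension_def scalar_extension_def free_module_eq_power
    by (rule power_module_lincomb_nth[OF module_Sm _ _ l])
      (use completion_tuple_closed[OF linear_map_closed[OF f std_basis_closed[OF R]]] free_module_nth_closed[OF x]
        in \<open>simp_all add: free_module_eq_power\<close>)
  then show ?thesis using l by (simp add: scalar_extension_def completion_tuple_def)
qed

end

lemma scalar_extension_represents:
  assumes e: "linear_map R (free_module R p) Rm e" and x: "x \<in> carrier (free_module S p)" and y: "y \<in> carrier (free_module R p)"
    and rep: "\<And>j. j < p ==> represents Rm n (x j) (y j)"
  shows "represents Rm n (scalar_extension Sm p (\<lambda>x. \<iota> (e x)) x) (e y)"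
proof -
  have eR: "e (std_basis R p j) \<in> carrier R" for j using linear_map_closed[OF e std_basis_closed[OF R]] by simp
  have "scalar_extension Sm p (\<lambda>x. \<iota> (e x)) x = lincomb (Mhat Rm) (\<lambda>j. to_completion Rm (e (std_basis R p j))) x p"
    using linear_map_image_lincomb[OF linear_map_completion_ring, of p "\<lambda>j. \<iota> (e (std_basis R p j))" x]
      completion_map_closed[OF eR] free_module_nth_closed[OF x]
    by (simp add: scalar_extension_def completion_ring_group_eq completion_map_eq_to_completion)
  then show ?thesis
    unfolding linear_map_expand[OF e y]
    using represents_lincomb[OF module_Rm represents_to_completion[OF module_Rm] rep, of p "\<lambda>j. e (std_basis R p j)"] eR by simp
qed

lemma free_module_completion_represents:
  assumes x: "x \<in> carrier (free_module S p)"
  obtains y where "\<And>n. y n \<in> carrier (free_module R p)" "\<forall>n. \<forall>j<p. represents Rm n (x j) (y n j)"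
proof -
  have "\<exists>r. coherent Rm r \<and> x j = seq_class Rm r" if "j < p" for j
    using free_module_nth_closed[OF x that] by (rule completion_ringE) blast
  then obtain r where r: "\<And>j. j < p ==> coherent Rm (r j)" "\<And>j. j < p ==> x j = seq_class Rm (r j)" by metis
  show ?thesis
    by (rule that[of "\<lambda>n. \<lambda>j\<in>{..<p}. r j n"])
      (use coherent_Rm_closed[OF r(1)] represents_seq_class[OF module_Rm r(1)] r(2) in \<open>auto simp: free_module_def\<close>)
qed

lemma free_module_completion_mem:
  assumes fgB: "fin_gen_module R B" and \<delta>: "linear_map R (free_module R p) B \<delta>" and L: "submodule L R B"
    and x: "x \<in> carrier (free_module S p)" and y: "\<And>n. y n \<in> carrier (free_module R p)"
    and rep: "\<forall>n. \<forall>j<p. represents Rm n (x j) (y n j)" and \<delta>y: "\<And>n. \<delta> (y n) \<in> adic_sub B n <+>\<^bsub>B\<^esub> L"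
    and T: "submodule T S (free_module S p)"
    and mem: "\<And>u. u \<in> carrier (free_module R p) ==> \<delta> u \<in> L ==> completion_tuple p u \<in> T"
  shows "x \<in> T"
proof -
  have carr: "submodule (carrier (power_module Rm p)) R (power_module Rm p)"
    by (rule module.carrier_is_submodule[OF module_power_module[OF module_Rm]])
  obtain k g where g: "\<And>i. i < k ==> g i \<in> carrier (free_module R p)" "\<And>i. i < k ==> \<delta> (g i) \<in> L"
    and gen: "\<forall>x y. (\<forall>n. \<forall>j<p. represents Rm n (x j) (y n j)) -->
      (\<forall>n. y n \<in> carrier (power_module Rm p) \<and> \<delta> (y n) \<in> adic_sub B n <+>\<^bsub>B\<^esub> L) -->
      (\<exists>c. (\<forall>i<k. c i \<in> carrier S) \<and> (\<forall>j<p. x j = lincomb (Mhat Rm) (\<lambda>i. to_completion Rm (g i j)) c k))"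
    using completion_tuple_generated[OF fin_gen_ring_as_module[OF R] fgB \<delta>[unfolded free_module_eq_power] carr L]
    unfolding free_module_eq_power by blast
  obtain c where c: "\<And>i. i < k ==> c i \<in> carrier S"
    "\<And>j. j < p ==> x j = lincomb (Mhat Rm) (\<lambda>i. to_completion Rm (g i j)) c k"
    using gen rep y \<delta>y unfolding free_module_eq_power by blast
  note tuples = completion_tuple_closed[OF g(1)]
  have nth: "x j = lincomb (free_module S p) (\<lambda>i. completion_tuple p (g i)) c k j" if j: "j < p" for j
  proof -
    have "lincomb (free_module S p) (\<lambda>i. completion_tuple p (g i)) c k j = lincomb Sm (\<lambda>i. completion_tuple p (g i) j) c k"
      unfolding free_module_eq_power by (rule power_module_lincomb_nth[OF module_Sm tuples[unfolded free_module_eq_power] c(1) j])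
    also have "\<dots> = x j"
      using linear_map_image_lincomb[OF linear_map_completion_ring _ c(1), of k "\<lambda>i. to_completion Rm (g i j)"]
        completion_map_closed[OF free_module_nth_closed[OF g(1) j]] j c(2)[OF j]
      by (simp add: completion_tuple_def completion_map_eq_to_completion completion_ring_group_eq)
    finally show ?thesis by simp
  qed
  have "x = lincomb (free_module S p) (\<lambda>i. completion_tuple p (g i)) c k"
    using power_module_eqI[OF x[unfolded free_module_eq_power] lincomb_closed[OF module_free_S tuples c(1), unfolded free_module_eq_power]]
      nth by (simp add: free_module_eq_power)
  then show ?thesis using lincomb_mem[OF T mem[OF g] c(1)] by (simp add: free_module_eq_power)
qed

context
  fixes F :: "('a, 'a) free_res" and n :: nat
  assumes F: "resolves R (J n) F"
begin

private abbreviation "Fhat \<equiv> completed_res F"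

private lemmas diff_R = resolves_diff[OF F]
private lemmas basis_R = std_basis_closed[OF R]

lemma linear_map_completed_diff: "linear_map S (chain_mod S Fhat (Suc i)) (chain_mod S Fhat i) (res_diff Fhat i)"
  using linear_map_matrix_extension[OF diff_R] by (simp add: completed_res_def)

lemma completed_diff_tuple:
  "x \<in> chain_set R F (Suc i) ==>
    res_diff Fhat i (completion_tuple (res_rank F (Suc i)) x) = completion_tuple (res_rank F i) (res_diff F i x)"
  using matrix_extension_tuple[OF diff_R] by (simp add: completed_res_def)

lemma completed_diff_basis:
  "j < res_rank F (Suc i) ==> res_diff Fhat i (std_basis S (res_rank F (Suc i)) j) =
    completion_tuple (res_rank F i) (res_diff F i (std_basis R (res_rank F (Suc i)) j))"
  using matrix_extension_basis[OF diff_R] by (simp add: completed_res_def)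

private lemmas aug_R = linear_map_comp[OF resolves_aug[OF F] linear_map_completion_map]

lemma linear_map_completed_aug: "linear_map S (chain_mod S Fhat 0) Sm (res_aug Fhat)"
  using linear_map_scalar_extension[OF module_Sm aug_R] by (simp add: completed_res_def)

lemma completed_aug_tuple:
  "x \<in> chain_set R F 0 ==> res_aug Fhat (completion_tuple (res_rank F 0) x) = \<iota> (res_aug F x)"
  using scalar_extension_tuple[OF module_Sm aug_R] by (simp add: completed_res_def)

lemma completed_aug_basis:
  "j < res_rank F 0 ==> res_aug Fhat (std_basis S (res_rank F 0) j) = \<iota> (res_aug F (std_basis R (res_rank F 0) j))"
  using scalar_extension_basis[OF module_Sm aug_R] by (simp add: completed_res_def)

lemma completed_diff_mem_cycles:
  assumes y: "y \<in> chain_set S Fhat (Suc i)"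
  shows "res_diff Fhat i y \<in> cycles S (adic_kernel n) Fhat i"
proof (cases i)
  case 0
  have K: "submodule (adic_kernel n) S Sm" using ideal_adic_kernel ideal_iff_submodule[OF cring_completion] by blast
  have "res_aug Fhat (res_diff Fhat 0 y) \<in> adic_kernel n"
  proof (rule linear_map_mem_if_basis[OF linear_map_comp[OF linear_map_completed_diff linear_map_completed_aug] K])
    show "res_aug Fhat (res_diff Fhat 0 (std_basis S (res_rank Fhat (Suc 0)) j)) \<in> adic_kernel n"
      if "j < res_rank Fhat (Suc 0)" for j
      using that completed_diff_basis[of j 0] completed_aug_tuple[OF linear_map_closed[OF diff_R basis_R]]
        completion_map_mem_kernel[OF resolves_aug_diff[OF F basis_R]] by (simp add: completed_res_def)
  qed (use y 0 in simp)
  then show ?thesis using linear_map_closed[OF linear_map_completed_diff y] 0 by (simp add: cycles_def)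
next
  case (Suc l)
  have "res_diff Fhat l (res_diff Fhat (Suc l) y) = \<zero>\<^bsub>chain_mod S Fhat l\<^esub>"
  proof (rule linear_map_eq_if_basis[OF linear_map_comp[OF linear_map_completed_diff linear_map_completed_diff]
        linear_map_const_zero[OF module_free_S module_free_S]])
    show "res_diff Fhat l (res_diff Fhat (Suc l) (std_basis S (res_rank Fhat (Suc (Suc l))) j)) = \<zero>\<^bsub>chain_mod S Fhat l\<^esub>"
      if "j < res_rank Fhat (Suc (Suc l))" for j
      using that completed_diff_basis[of j "Suc l"] completed_diff_tuple[OF linear_map_closed[OF diff_R basis_R]]
        resolves_diff_diff[OF F basis_R] linear_map_zero[OF linear_map_completion_tuple] by (simp add: completed_res_def)
  qed (use y Suc in simp)
  then show ?thesis using linear_map_closed[OF linear_map_completed_diff y] Suc by (simp add: cycles_def)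
qed

lemma completed_aug_approx:
  assumes x: "x \<in> cycles S (adic_kernel n) Fhat 0" and y: "y \<in> chain_set R F 0"
    and rep: "\<And>j. j < res_rank F 0 ==> represents Rm t (x j) (y j)"
  shows "res_aug F y \<in> adic_sub Rm t <+>\<^bsub>Rm\<^esub> J n"
proof -
  have y': "represents Rm t (res_aug Fhat x) (res_aug F y)"
    using scalar_extension_represents[OF resolves_aug[OF F], of x y t] x y rep by (simp add: completed_res_def cycles_def)
  have "res_aug Fhat x \<in> adic_closure Rm (J n)" using x unfolding cycles_def adic_kernel_eq_closure by simp
  then obtain z where z: "z \<in> J n" "represents Rm t (res_aug Fhat x) z" by (rule adic_closureE)
  show ?thesis
    unfolding mem_set_add_iff[OF module_Rm submodule_adic_sub[OF module_Rm] submodule_J represents_closed[OF y']]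
    using represents_unique[OF module_Rm y' z(2)] z(1) by (rule bexI)
qed

lemma completed_diff_approx:
  assumes x: "x \<in> cycles S (adic_kernel n) Fhat (Suc l)" and y: "y \<in> chain_set R F (Suc l)"
    and rep: "\<And>j. j < res_rank F (Suc l) ==> represents Rm t (x j) (y j)"
  shows "res_diff F l y \<in> adic_sub (chain_mod R F l) t"
proof -
  have "res_diff F l y j \<in> J t" if j: "j < res_rank F l" for j
  proof -
    have nth: "linear_map R (chain_mod R F (Suc l)) Rm (\<lambda>y. res_diff F l y j)"
      using linear_map_comp[OF diff_R[unfolded free_module_eq_power] linear_map_power_nth[OF module_Rm j]] by (simp add: free_module_eq_power)
    have "res_diff Fhat l x j = \<zero>\<^bsub>S\<^esub>"
      using x j by (simp add: cycles_def completed_res_def free_module_eq_power power_module_nth)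
    then have "represents Rm t \<zero>\<^bsub>S\<^esub> (res_diff F l y j)"
      using scalar_extension_represents[OF nth, of x y t] matrix_extension_nth[OF diff_R j, of x] x y rep
      by (simp add: completed_res_def cycles_def)
    then show ?thesis
      using represents_Rm_mem_kernel_iff additive_subgroup.zero_closed[OF ideal.axioms(1)[OF ideal_adic_kernel]] by blast
  qed
  then show ?thesis
    using linear_map_closed[OF diff_R y] unfolding free_module_eq_power adic_sub_power_module[OF module_Rm] by simp
qed

lemma completed_cycles_subset_image:
  assumes x: "x \<in> cycles S (adic_kernel n) Fhat i"
  shows "x \<in> res_diff Fhat i ` chain_set S Fhat (Suc i)" (is "x \<in> ?T")
proof -
  let ?p = "res_rank F i"
  have xS: "x \<in> carrier (free_module S ?p)" using x by (simp add: cycles_def completed_res_def)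
  have T: "submodule ?T S (free_module S ?p)"
    using submodule_image[OF linear_map_completed_diff module.carrier_is_submodule[OF module_free_S]] by (simp add: completed_res_def)
  have mem: "completion_tuple ?p u \<in> ?T" if u: "u \<in> cycles R (J n) F i" for u
  proof -
    obtain v where v: "v \<in> chain_set R F (Suc i)" "u = res_diff F i v"
      using u unfolding resolves_image[OF F, symmetric] by blast
    show ?thesis unfolding v(2) completed_diff_tuple[OF v(1), symmetric]
      using completion_tuple_closed[OF v(1)] by (intro imageI) (simp add: completed_res_def)
  qed
  obtain y where y: "\<And>t. y t \<in> carrier (free_module R ?p)" and rep: "\<forall>t. \<forall>j<?p. represents Rm t (x j) (y t j)"
    using free_module_completion_represents[OF xS] by blast
  show ?thesis
  proof (cases i)
    case 0
    have "res_aug F (y t) \<in> adic_sub Rm t <+>\<^bsub>Rm\<^esub> J n" for t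
      by (rule completed_aug_approx[OF x[unfolded 0]]) (use y rep 0 in auto)
    then show ?thesis
      by (rule free_module_completion_mem[OF fin_gen_ring_as_module[OF R] resolves_aug[OF F, folded 0] submodule_J xS y rep _ T])
        (use mem 0 in \<open>simp add: cycles_def\<close>)
  next
    case (Suc l)
    note free = module_free_module[OF R, of "res_rank F l"] and zero = submodule_singleton_zero[OF module_free_module[OF R]]
    have "res_diff F l (y t) \<in> adic_sub (chain_mod R F l) t" for t
      by (rule completed_diff_approx[OF x[unfolded Suc]]) (use y rep Suc in auto)
    then have "res_diff F l (y t) \<in> adic_sub (chain_mod R F l) t <+>\<^bsub>chain_mod R F l\<^esub> {\<zero>\<^bsub>chain_mod R F l\<^esub>}" for t
      using submodule_set_add(2)[OF free submodule_adic_sub[OF free] zero] by blast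
    then show ?thesis
      by (rule free_module_completion_mem[OF fin_gen_free_module[OF R] diff_R[of l, folded Suc] zero xS y rep _ T])
        (use mem Suc in \<open>simp add: cycles_def\<close>)
  qed
qed

lemma resolves_completed_res: "resolves S (adic_kernel n) Fhat"
  unfolding resolves_def
proof (intro conjI allI linear_map_completed_diff linear_map_completed_aug)
  obtain u where u: "u \<in> chain_set R F 0" "res_aug F u \<ominus>\<^bsub>R\<^esub> \<one>\<^bsub>R\<^esub> \<in> J n" by (rule resolves_unit[OF F])
  have "res_aug Fhat (completion_tuple (res_rank F 0) u) \<ominus>\<^bsub>S\<^esub> \<one>\<^bsub>S\<^esub> = \<iota> (res_aug F u \<ominus>\<^bsub>R\<^esub> \<one>\<^bsub>R\<^esub>)"
    using completed_aug_tuple[OF u(1)] ring_hom_one[OF completion_map_ring_hom]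
      linear_map_minus[OF linear_map_completion_map, of "res_aug F u" "\<one>\<^bsub>R\<^esub>"] resolves_aug_closed[OF F u(1)] by simp
  then show "\<exists>u\<in>chain_set S Fhat 0. res_aug Fhat u \<ominus>\<^bsub>S\<^esub> \<one>\<^bsub>S\<^esub> \<in> adic_kernel n"
    using completion_tuple_closed[OF u(1)] u(2) completion_map_mem_kernel[OF u(2)]
    by (intro bexI[of _ "completion_tuple (res_rank F 0) u"]) (simp_all add: completed_res_def)
  show "res_diff Fhat i ` chain_set S Fhat (Suc i) = cycles S (adic_kernel n) Fhat i" for i
    using completed_diff_mem_cycles completed_cycles_subset_image by blast
qed

context
  fixes X :: "(nat => 'a set, 'n, 't) module_scheme" and N L :: "'n set" and k :: nat
  assumes X: "module S X" and N: "submodule N S X" and L: "submodule L S X"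
begin

lemma rel_cocycle_restrict:
  assumes f: "rel_cocycle S Fhat X N L k f"
  shows "rel_cocycle R F (rs X) N L k (\<lambda>x. f (completion_tuple (res_rank F k) x))"
  unfolding rel_cocycle_def
proof (intro conjI ballI)
  show "linear_map R (chain_mod R F k) (rs X) (\<lambda>x. f (completion_tuple (res_rank F k) x))"
    using linear_map_comp[OF linear_map_completion_tuple linear_map_rs[OF rel_cocycle_linear[OF f]]] by (simp add: completed_res_def)
  show "f (completion_tuple (res_rank F k) x) \<in> N" if "x \<in> chain_set R F k" for x
    using rel_cocycle_mem[OF f] completion_tuple_closed[OF that] by (simp add: completed_res_def)
  show "f (completion_tuple (res_rank F k) (res_diff F k x)) \<in> L" if x: "x \<in> chain_set R F (Suc k)" for x
    using rel_cocycle_diff[OF f] completion_tuple_closed[OF x] completed_diff_tuple[OF x, symmetric] by (simp add: completed_res_def)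
qed

lemma rel_coboundary_restrict:
  assumes f: "rel_coboundary S Fhat X N L k f"
  shows "rel_coboundary R F (rs X) N L k (\<lambda>x. f (completion_tuple (res_rank F k) x))"
proof -
  have fl: "linear_map R (chain_mod R F k) (rs X) (\<lambda>x. f (completion_tuple (res_rank F k) x))"
    using linear_map_comp[OF linear_map_completion_tuple linear_map_rs[OF rel_coboundary_linear[OF f]]] by (simp add: completed_res_def)
  show ?thesis
  proof (cases k)
    case 0
    then show ?thesis using f fl completion_tuple_closed by (simp add: rel_coboundary_0 completed_res_def)
  next
    case (Suc j)
    obtain g where g: "linear_map S (chain_mod S Fhat j) X g" "\<And>x. x \<in> chain_set S Fhat j ==> g x \<in> N"
      "\<And>x. x \<in> chain_set S Fhat (Suc j) ==> f x \<ominus>\<^bsub>X\<^esub> g (res_diff Fhat j x) \<in> L"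
      using rel_coboundary_SucE[OF f[unfolded Suc]] by blast
    show ?thesis unfolding Suc
    proof (rule rel_coboundary_SucI[OF fl[unfolded Suc]])
      show "linear_map R (chain_mod R F j) (rs X) (\<lambda>x. g (completion_tuple (res_rank F j) x))"
        using linear_map_comp[OF linear_map_completion_tuple linear_map_rs[OF g(1)]] by (simp add: completed_res_def)
      show "g (completion_tuple (res_rank F j) x) \<in> N" if "x \<in> chain_set R F j" for x
        using g(2) completion_tuple_closed[OF that] by (simp add: completed_res_def)
      show "f (completion_tuple (res_rank F (Suc j)) x) \<ominus>\<^bsub>rs X\<^esub> g (completion_tuple (res_rank F j) (res_diff F j x)) \<in> L"
        if x: "x \<in> chain_set R F (Suc j)" for x
        using g(3) completion_tuple_closed[OF x] completed_diff_tuple[OF x, symmetric] by (simp add: completed_res_def)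
    qed
  qed
qed

private lemma scalar_extension_mem:
  assumes "linear_map R (chain_mod R F i) (rs X) f" "submodule U S X" "\<And>x. x \<in> chain_set R F i ==> f x \<in> U"
    and x: "x \<in> chain_set S Fhat i"
  shows "scalar_extension X (res_rank F i) f x \<in> U"
  by (rule linear_map_mem_if_basis[OF linear_map_scalar_extension[OF X assms(1)] assms(2) _ x[unfolded completed_res_def free_res.select_convs]])
    (use assms(3)[OF basis_R] scalar_extension_basis[OF X assms(1)] in simp)

private lemma scalar_extension_diff:
  assumes f: "linear_map R (chain_mod R F i) (rs X) f" and x: "x \<in> chain_set S Fhat (Suc i)"
  shows "scalar_extension X (res_rank F i) f (res_diff Fhat i x) = scalar_extension X (res_rank F (Suc i)) (\<lambda>x. f (res_diff F i x)) x"
proof (rule linear_map_eq_if_basis[OF _ _ _ x])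
  note f' = linear_map_comp[OF diff_R f]
  show "linear_map S (chain_mod S Fhat (Suc i)) X (\<lambda>x. scalar_extension X (res_rank F i) f (res_diff Fhat i x))"
    using linear_map_comp[OF linear_map_completed_diff] linear_map_scalar_extension[OF X f] by (simp add: completed_res_def)
  show "linear_map S (chain_mod S Fhat (Suc i)) X (scalar_extension X (res_rank F (Suc i)) (\<lambda>x. f (res_diff F i x)))"
    using linear_map_scalar_extension[OF X f'] by (simp add: completed_res_def)
  show "scalar_extension X (res_rank F i) f (res_diff Fhat i (std_basis S (res_rank Fhat (Suc i)) j)) =
      scalar_extension X (res_rank F (Suc i)) (\<lambda>x. f (res_diff F i x)) (std_basis S (res_rank Fhat (Suc i)) j)"
    if "j < res_rank Fhat (Suc i)" for j
    using that completed_diff_basis scalar_extension_tuple[OF X f linear_map_closed[OF diff_R basis_R]] scalar_extension_basis[OF X f']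
    by (simp add: completed_res_def)
qed

lemma rel_cocycle_scalar_extension:
  assumes f: "rel_cocycle R F (rs X) N L k f"
  shows "rel_cocycle S Fhat X N L k (scalar_extension X (res_rank F k) f)"
  unfolding rel_cocycle_def
proof (intro conjI ballI)
  note fl = rel_cocycle_linear[OF f]
  show "linear_map S (chain_mod S Fhat k) X (scalar_extension X (res_rank F k) f)"
    using linear_map_scalar_extension[OF X fl] by (simp add: completed_res_def)
  show "scalar_extension X (res_rank F k) f x \<in> N" if "x \<in> chain_set S Fhat k" for x
    by (rule scalar_extension_mem[OF fl N rel_cocycle_mem[OF f] that])
  show "scalar_extension X (res_rank F k) f (res_diff Fhat k x) \<in> L" if "x \<in> chain_set S Fhat (Suc k)" for x
    unfolding scalar_extension_diff[OF fl that]
    by (rule scalar_extension_mem[OF linear_map_comp[OF diff_R fl] L rel_cocycle_diff[OF f] that])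
qed

lemma rel_coboundary_scalar_extension:
  assumes f: "rel_coboundary R F (rs X) N L k f"
  shows "rel_coboundary S Fhat X N L k (scalar_extension X (res_rank F k) f)"
proof -
  note fl = rel_coboundary_linear[OF f]
  have ext: "linear_map S (chain_mod S Fhat i) X (scalar_extension X (res_rank F i) g)"
    if "linear_map R (chain_mod R F i) (rs X) g" for i g
    using linear_map_scalar_extension[OF X that] by (simp add: completed_res_def)
  show ?thesis
  proof (cases k)
    case 0
    then show ?thesis using f ext[OF fl] scalar_extension_mem[OF fl L] by (simp add: rel_coboundary_0)
  next
    case (Suc j)
    obtain g where g: "linear_map R (chain_mod R F j) (rs X) g" "\<And>x. x \<in> chain_set R F j ==> g x \<in> N"
      "\<And>x. x \<in> chain_set R F (Suc j) ==> f x \<ominus>\<^bsub>rs X\<^esub> g (res_diff F j x) \<in> L"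
      using rel_coboundary_SucE[OF f[unfolded Suc]] by blast
    note gd = linear_map_comp[OF diff_R g(1)] and fl = fl[unfolded Suc]
    show ?thesis unfolding Suc
    proof (rule rel_coboundary_SucI[OF ext[OF fl] ext[OF g(1)]])
      show "scalar_extension X (res_rank F j) g x \<in> N" if "x \<in> chain_set S Fhat j" for x
        by (rule scalar_extension_mem[OF g(1) N g(2) that])
      show "scalar_extension X (res_rank F (Suc j)) f x \<ominus>\<^bsub>X\<^esub> scalar_extension X (res_rank F j) g (res_diff Fhat j x) \<in> L"
        if x: "x \<in> chain_set S Fhat (Suc j)" for x
        unfolding scalar_extension_diff[OF g(1) x]
        by (rule linear_map_mem_if_basis[OF linear_map_fun_minus[OF ext[OF fl] ext[OF gd]] L _ x])
          (use g(3)[OF basis_R] scalar_extension_basis[OF X fl] scalar_extension_basis[OF X gd] in \<open>simp add: completed_res_def\<close>)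
    qed
  qed
qed

end

end

lemma chain_lift_completed:
  assumes F: "resolves R (J m) F" and G: "resolves R (J n) G" and \<phi>: "chain_lift R F G (J n) \<phi>"
  shows "chain_lift S (completed_res F) (completed_res G) (adic_kernel n) (completed_map F G \<phi>)"
  unfolding chain_lift_def chain_map_def
proof (intro conjI allI ballI)
  note \<phi>l = chain_lift_linear[OF \<phi>] and basis = std_basis_closed[OF R]
  have lin: "linear_map S (chain_mod S (completed_res F) i) (chain_mod S (completed_res G) i) (completed_map F G \<phi> i)" for i
    using linear_map_matrix_extension[OF \<phi>l] by (simp add: completed_res_def completed_map_def[abs_def])
  then show "linear_map S (chain_mod S (completed_res F) i) (chain_mod S (completed_res G) i) (completed_map F G \<phi> i)" for i .
  have map_basis: "completed_map F G \<phi> i (std_basis S (res_rank F i) j) = completion_tuple (res_rank G i) (\<phi> i (std_basis R (res_rank F i) j))"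
    if "j < res_rank F i" for i j
    using matrix_extension_basis[OF \<phi>l that] by (simp add: completed_map_def)
  have map_tuple: "completed_map F G \<phi> i (completion_tuple (res_rank F i) x) = completion_tuple (res_rank G i) (\<phi> i x)"
    if "x \<in> chain_set R F i" for i x
    using matrix_extension_tuple[OF \<phi>l that] by (simp add: completed_map_def)
  show "res_diff (completed_res G) i (completed_map F G \<phi> (Suc i) x) = completed_map F G \<phi> i (res_diff (completed_res F) i x)"
    if x: "x \<in> chain_set S (completed_res F) (Suc i)" for i x
  proof (rule linear_map_eq_if_basis[OF linear_map_comp[OF lin linear_map_completed_diff[OF G]]
        linear_map_comp[OF linear_map_completed_diff[OF F] lin] _ x])
    fix j assume "j < res_rank (completed_res F) (Suc i)"
    then have j: "j < res_rank F (Suc i)" by (simp add: completed_res_def)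
    show "res_diff (completed_res G) i (completed_map F G \<phi> (Suc i) (std_basis S (res_rank (completed_res F) (Suc i)) j)) =
        completed_map F G \<phi> i (res_diff (completed_res F) i (std_basis S (res_rank (completed_res F) (Suc i)) j))"
      using map_basis[OF j] completed_diff_basis[OF F j] completed_diff_tuple[OF G linear_map_closed[OF \<phi>l basis]]
        map_tuple[OF linear_map_closed[OF resolves_diff[OF F] basis]] chain_map_commute[OF chain_lift_chain_map[OF \<phi>] basis]
      by (simp add: completed_res_def[of F])
  qed
  show "res_aug (completed_res G) (completed_map F G \<phi> 0 x) \<ominus>\<^bsub>S\<^esub> res_aug (completed_res F) x \<in> adic_kernel n"
    if x: "x \<in> chain_set S (completed_res F) 0" for x
  proof -
    have K: "submodule (adic_kernel n) S Sm" using ideal_adic_kernel ideal_iff_submodule[OF cring_completion] by blast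
    note diff = linear_map_fun_minus[OF linear_map_comp[OF lin linear_map_completed_aug[OF G]] linear_map_completed_aug[OF F]]
    have "res_aug (completed_res G) (completed_map F G \<phi> 0 x) \<ominus>\<^bsub>Sm\<^esub> res_aug (completed_res F) x \<in> adic_kernel n"
    proof (rule linear_map_mem_if_basis[OF diff K _ x])
      fix j assume "j < res_rank (completed_res F) 0"
      then have j: "j < res_rank F 0" by (simp add: completed_res_def)
      let ?b = "std_basis R (res_rank F 0) j"
      have "\<iota> (res_aug G (\<phi> 0 ?b)) \<ominus>\<^bsub>S\<^esub> \<iota> (res_aug F ?b) = \<iota> (res_aug G (\<phi> 0 ?b) \<ominus>\<^bsub>R\<^esub> res_aug F ?b)"
        using linear_map_minus[OF linear_map_completion_map, of "res_aug G (\<phi> 0 ?b)" "res_aug F ?b"]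
          resolves_aug_closed[OF G linear_map_closed[OF \<phi>l basis]] resolves_aug_closed[OF F basis] by simp
      then show "res_aug (completed_res G) (completed_map F G \<phi> 0 (std_basis S (res_rank (completed_res F) 0) j))
          \<ominus>\<^bsub>Sm\<^esub> res_aug (completed_res F) (std_basis S (res_rank (completed_res F) 0) j) \<in> adic_kernel n"
        using map_basis[OF j] completed_aug_basis[OF F j] completed_aug_tuple[OF G linear_map_closed[OF \<phi>l basis]]
          completion_map_mem_kernel[OF chain_lift_aug[OF \<phi> basis]] by (simp add: completed_res_def[of F])
    qed
    then show ?thesis by simp
  qed
qed

lemma vanishes_base_change:
  assumes X: "module S X" and N: "submodule N S X" and L: "submodule L S X"
  shows "vanishes S (extended_ideal R \<aa>) X N L k \<longleftrightarrow> vanishes R \<aa> (rs X) N L k"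
proof -
  obtain F \<phi> where tower: "resolution_tower R \<aa> F \<phi>" by (rule noetherian_resolution_tower[OF R NR \<aa>])
  note F = resolution_towerD(1)[OF tower] and \<phi> = resolution_towerD(2)[OF tower]
  let ?F = "\<lambda>n. completed_res (F n)" and ?\<phi> = "\<lambda>m n. completed_map (F m) (F n) (\<phi> m n)"
  have towerS: "resolution_tower S (extended_ideal R \<aa>) ?F ?\<phi>"
    unfolding resolution_tower_def extended_ideal_power
    using resolves_completed_res[OF F] chain_lift_completed[OF F F \<phi>] by blast
  note \<phi>' = resolution_towerD(2)[OF towerS]
  note iffS = vanishes_iff_tower[OF X N L ideal_extended_ideal towerS]
    and iffR = vanishes_iff_tower[OF module_rs[OF X] submodule_rs[OF X N] submodule_rs[OF X L] \<aa> tower]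
  have restrict_map: "?\<phi> m n k (completion_tuple (res_rank (F m) k) x) = completion_tuple (res_rank (F n) k) (\<phi> m n k x)"
    if "n \<le> m" "x \<in> chain_set R (F m) k" for m n x
    using matrix_extension_tuple[OF chain_lift_linear[OF \<phi>[OF that(1)]] that(2)] by (simp add: completed_map_def)
  show ?thesis
    unfolding iffS iffR
  proof (intro iffI allI impI)
    fix n f
    assume vanishS: "\<forall>n f. rel_cocycle S (?F n) X N L k f --> (\<exists>m\<ge>n. rel_coboundary S (?F m) X N L k (\<lambda>x. f (?\<phi> m n k x)))"
      and f: "rel_cocycle R (F n) (rs X) N L k f"
    obtain m where m: "m \<ge> n" "rel_coboundary S (?F m) X N L k (\<lambda>x. scalar_extension X (res_rank (F n) k) f (?\<phi> m n k x))"
      using vanishS rel_cocycle_scalar_extension[OF F X N L f] by blast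
    have "rel_coboundary R (F m) (rs X) N L k (\<lambda>x. f (\<phi> m n k x))"
      by (rule rel_coboundary_cong[OF rel_coboundary_restrict[OF F X N L m(2)]])
        (simp add: restrict_map[OF m(1)] scalar_extension_tuple[OF X rel_cocycle_linear[OF f]] linear_map_closed[OF chain_lift_linear[OF \<phi>[OF m(1)]]])
    then show "\<exists>m\<ge>n. rel_coboundary R (F m) (rs X) N L k (\<lambda>x. f (\<phi> m n k x))" using m(1) by blast
  next
    fix n f
    assume vanishR: "\<forall>n f. rel_cocycle R (F n) (rs X) N L k f --> (\<exists>m\<ge>n. rel_coboundary R (F m) (rs X) N L k (\<lambda>x. f (\<phi> m n k x)))"
      and f: "rel_cocycle S (?F n) X N L k f"
    obtain m where m: "m \<ge> n" "rel_coboundary R (F m) (rs X) N L k (\<lambda>x. f (completion_tuple (res_rank (F n) k) (\<phi> m n k x)))"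
      using vanishR rel_cocycle_restrict[OF F X N L f] by blast
    note lin = linear_map_comp[OF chain_lift_linear[OF \<phi>'[OF m(1)]] rel_cocycle_linear[OF f]]
    have "rel_coboundary S (?F m) X N L k (\<lambda>x. f (?\<phi> m n k x))"
    proof (rule rel_coboundary_cong[OF rel_coboundary_scalar_extension[OF F X N L m(2)]])
      fix x assume x: "x \<in> chain_set S (?F m) k"
      note mlin = rel_coboundary_linear[OF m(2)]
      show "scalar_extension X (res_rank (F m) k) (\<lambda>x. f (completion_tuple (res_rank (F n) k) (\<phi> m n k x))) x = f (?\<phi> m n k x)"
      proof (rule linear_map_eq_if_basis[OF _ lin _ x])
        show "linear_map S (chain_mod S (?F m) k) X (scalar_extension X (res_rank (F m) k) (\<lambda>x. f (completion_tuple (res_rank (F n) k) (\<phi> m n k x))))"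
          using linear_map_scalar_extension[OF X mlin] by (simp add: completed_res_def)
      qed (use scalar_extension_basis[OF X mlin] matrix_extension_basis[OF chain_lift_linear[OF \<phi>[OF m(1)]]]
          in \<open>simp add: completed_res_def completed_map_def\<close>)
    qed
    then show "\<exists>m\<ge>n. rel_coboundary S (?F m) X N L k (\<lambda>x. f (?\<phi> m n k x))" using m(1) by blast
  qed
qed

subsection \<open>Cocycles with values in the completion\<close>

lemma rel_coboundary_lincomb:
  assumes X: "module S X" and N: "submodule N S X" and L: "submodule L S X" and F: "resolves R I F"
    and "\<And>i. i < m ==> rel_coboundary R F (rs X) N L k (\<lambda>x. c i \<odot>\<^bsub>X\<^esub> g i x)"
  shows "rel_coboundary R F (rs X) N L k (\<lambda>x. lincomb X (\<lambda>i. g i x) c m)"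
  using assms(5)
proof (induction m)
  case 0
  show ?case using rel_coboundary_zero[OF module_rs[OF X] submodule_rs[OF X N] submodule_rs[OF X L] F] by simp
next
  case (Suc m)
  then show ?case using rel_coboundary_add[OF module_rs[OF X] submodule_rs[OF X N] submodule_rs[OF X L] F] by simp
qed

lemma linear_map_lincomb_restrict_scalars:
  assumes A: "module R A" and X: "module S X"
    and "\<And>i. i < m ==> linear_map R A (rs X) (g i)" "\<And>i. i < m ==> c i \<in> carrier S"
  shows "linear_map R A (rs X) (\<lambda>x. lincomb X (\<lambda>i. g i x) c m)"
  using assms(3,4)
proof (induction m)
  case 0
  show ?case using linear_map_const_zero[OF A module_rs[OF X]] by simp
next
  case (Suc m)
  have "linear_map R A (rs X) (\<lambda>x. c m \<odot>\<^bsub>X\<^esub> g m x)"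
    by (rule linear_map_comp[OF _ linear_map_rs[OF linear_map_fun_smult[OF linear_map_ident[OF X]]]]) (use Suc.prems in auto)
  from linear_map_fun_add[OF Suc.IH this] Suc.prems show ?case by simp
qed

lemma completion_ring_split:
  assumes "c \<in> carrier S"
  obtains r \<rho> where "r \<in> carrier R" "\<rho> \<in> adic_kernel n" "c = \<iota> r \<oplus>\<^bsub>S\<^esub> \<rho>"
proof -
  obtain s where s: "coherent Rm s" "c = seq_class Rm s" using assms by (rule completion_ringE)
  let ?r = "s n"
  have r: "?r \<in> carrier R" "\<ominus>\<^bsub>R\<^esub> ?r \<in> carrier R"
    using coherent_Rm_closed[OF s(1)] submodule_uminus[OF module.carrier_is_submodule[OF module_Rm], of ?r] by simp_all
  have "represents Rm n (c \<oplus>\<^bsub>Mhat Rm\<^esub> \<iota> (\<ominus>\<^bsub>R\<^esub> ?r)) (?r \<oplus>\<^bsub>R\<^esub> (\<ominus>\<^bsub>R\<^esub> ?r))"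
    using represents_add[OF module_Rm represents_seq_class[OF module_Rm s(1)] represents_to_completion[OF module_Rm], of "\<ominus>\<^bsub>R\<^esub> ?r" n] r s(2)
    by (simp add: completion_map_eq_to_completion)
  then have "c \<oplus>\<^bsub>S\<^esub> \<iota> (\<ominus>\<^bsub>R\<^esub> ?r) \<in> adic_kernel n"
    using represents_Rm_mem_kernel_iff diff_mem_refl[OF module_Rm submodule_J, of ?r n] r by (simp add: completion_ring_group_eq a_minus_def)
  moreover have "c = \<iota> ?r \<oplus>\<^bsub>S\<^esub> (c \<oplus>\<^bsub>S\<^esub> \<iota> (\<ominus>\<^bsub>R\<^esub> ?r))"
    using linear_map_uminus[OF linear_map_completion_map, of ?r] minus_cancel(2)[OF module_Sm, of c "\<iota> ?r"] completion_map_closed[OF r(1)] r assms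
    by (simp add: a_minus_def)
  ultimately show ?thesis using that[OF r(1)] by blast
qed

lemma rel_coboundary_smult_kernel:
  assumes X: "module S X" and N: "submodule N S X" and L: "submodule L S X" and F: "resolves R (J n) F"
    and f: "rel_cocycle R F (rs X) N L k f" and \<rho>: "\<rho> \<in> adic_kernel n"
  shows "rel_coboundary R F (rs X) N L k (\<lambda>x. \<rho> \<odot>\<^bsub>X\<^esub> f x)"
proof -
  have "rel_coboundary S (completed_res F) X N L k (\<lambda>x. \<rho> \<odot>\<^bsub>X\<^esub> scalar_extension X (res_rank F k) f x)"
    by (rule rel_coboundary_smult_ideal[OF X N L resolves_completed_res[OF F] rel_cocycle_scalar_extension[OF F X N L f] ideal_adic_kernel \<rho>])
  from rel_coboundary_restrict[OF F X N L this] show ?thesis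
    by (rule rel_coboundary_cong) (simp add: scalar_extension_tuple[OF X rel_cocycle_linear[OF f]])
qed

context
  fixes M :: "('a, 'm, 's) module_scheme" (structure)
  assumes M: "module R M"
begin

interpretation M: module R M by (rule M)

lemma represents_linear_map:
  assumes f: "linear_map R (free_module R p) (rs (Mhat M)) f" and g: "linear_map R (free_module R p) M g"
    and basis: "\<And>j. j < p ==> represents M t (f (std_basis R p j)) (g (std_basis R p j))" and x: "x \<in> carrier (free_module R p)"
  shows "represents M t (f x) (g x)"
  unfolding linear_map_expand[OF f x] linear_map_expand[OF g x] lincomb_restrict_scalars
  by (rule represents_lincomb[OF M basis])
    (simp_all add: completion_map_eq_to_completion represents_to_completion[OF module_Rm] free_module_nth_closed[OF x])

lemma linear_map_completion_approx:
  assumes f: "linear_map R (free_module R p) (rs (Mhat M)) f" and U: "submodule U R M"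
    and fU: "\<And>x. x \<in> carrier (free_module R p) ==> f x \<in> adic_closure M U"
  obtains g where "linear_map R (free_module R p) M g" "\<And>x. x \<in> carrier (free_module R p) ==> g x \<in> U"
    "\<And>x. x \<in> carrier (free_module R p) ==> represents M t (f x) (g x)"
proof -
  have "\<exists>y\<in>carrier M. y \<in> U \<and> represents M t (f (std_basis R p j)) y" for j
    using fU[OF std_basis_closed[OF R]] submodule_mem_carrier[OF U] by (fastforce simp: adic_closure_def)
  then obtain g where g: "linear_map R (free_module R p) M g"
    "\<And>j. j < p ==> g (std_basis R p j) \<in> U \<and> represents M t (f (std_basis R p j)) (g (std_basis R p j))"
    using linear_map_choice[OF M, of p "\<lambda>j y. y \<in> U \<and> represents M t (f (std_basis R p j)) y"] by blast
  show ?thesis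
    by (rule that[OF g(1) linear_map_mem_if_basis[OF g(1) U] represents_linear_map[OF f g(1)]]) (use g(2) in auto)
qed

end

context
  fixes M :: "('a, 'm, 's) module_scheme" (structure) and N L :: "'m set" and F :: "('a, 'a) free_res" and n k :: nat
  assumes fg: "fin_gen_module R M" and N: "submodule N R M" and L: "submodule L R M" and F: "resolves R (J n) F"
begin

private lemmas fg_module = fin_gen_moduleD[OF fg]

interpretation M: module R M by (rule fg_module)

private abbreviation "X \<equiv> Mhat M"
private abbreviation "N' \<equiv> adic_closure M N"
private abbreviation "L' \<equiv> adic_closure M L"
private abbreviation "p \<equiv> res_rank F k"

private lemmas X = module_completion[OF fg_module]
private lemmas N' = submodule_adic_closure[OF fg_module N]
private lemmas L' = submodule_adic_closure[OF fg_module L]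
private lemmas diff = resolves_diff[OF F]
private lemmas basis = std_basis_closed[OF R]

lemma rel_cocycle_to_completion: "rel_cocycle R F M N L k f ==> rel_cocycle R F (rs X) N' L' k (\<lambda>x. to_completion M (f x))"
  by (rule rel_cocycle_map[OF _ linear_map_to_completion[OF fg_module]])
    (auto intro: to_completion_mem_adic_closure[OF fg_module N] to_completion_mem_adic_closure[OF fg_module L])

lemma rel_coboundary_to_completion: "rel_coboundary R F M N L k f ==> rel_coboundary R F (rs X) N' L' k (\<lambda>x. to_completion M (f x))"
  by (rule rel_coboundary_map[OF _ F linear_map_to_completion[OF fg_module]])
    (auto intro: to_completion_mem_adic_closure[OF fg_module N] to_completion_mem_adic_closure[OF fg_module L])

private lemma approx_tuple_diff:
  assumes f: "rel_cocycle R F (rs X) N' L' k f" and g: "linear_map R (chain_mod R F k) M g"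
    and rep: "\<And>x. x \<in> chain_set R F k ==> represents M t (f x) (g x)"
  defines "q \<equiv> res_rank F (Suc k)"
  shows "(\<lambda>l\<in>{..<q}. lincomb M (\<lambda>j\<in>{..<p}. g (std_basis R p j)) (res_diff F k (std_basis R q l)) p)
    \<in> adic_sub (power_module M q) t <+>\<^bsub>power_module M q\<^esub> {u \<in> carrier (power_module M q). \<forall>l<q. u l \<in> L}" (is "?u \<in> _")
proof -
  have d: "res_diff F k (std_basis R q l) \<in> chain_set R F k" for l
    unfolding q_def by (rule linear_map_closed[OF diff basis])
  have nth: "?u l = g (res_diff F k (std_basis R q l))" if "l < q" for l
    unfolding linear_map_expand[OF g d] using that by (simp cong: lincomb_cong)
  have approx: "?u l \<in> adic_sub M t <+>\<^bsub>M\<^esub> L" if l: "l < q" for l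
  proof -
    have "f (res_diff F k (std_basis R q l)) \<in> L'" unfolding q_def by (rule rel_cocycle_diff[OF f basis])
    then obtain z where z: "z \<in> L" "represents M t (f (res_diff F k (std_basis R q l))) z" by (rule adic_closureE)
    show ?thesis
      unfolding nth[OF l] mem_set_add_iff[OF fg_module submodule_adic_sub[OF fg_module] L linear_map_closed[OF g d]]
      using represents_unique[OF fg_module rep[OF d] z(2)] z(1) by (rule bexI)
  qed
  have "?u \<in> carrier (power_module M q)" using linear_map_closed[OF g d] nth by (intro power_module_carrierI) simp
  from power_module_mem_set_add[OF fg_module submodule_adic_sub[OF fg_module] L this approx] show ?thesis
    unfolding adic_sub_power_module[OF fg_module] .
qed

text \<open>Through the values on the basis, cocycles with values in \<open>M\<close> are the tuples that satisfy a linear condition.\<close>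

lemma rel_cocycle_completion_generated:
  assumes f: "rel_cocycle R F (rs X) N' L' k f"
  obtains m G c where "\<And>i. i < m ==> rel_cocycle R F M N L k (G i)" "\<And>i. i < m ==> c i \<in> carrier S"
    "\<forall>x\<in>chain_set R F k. f x = lincomb X (\<lambda>i. to_completion M (G i x)) c m"
proof -
  let ?q = "res_rank F (Suc k)" and ?b = "std_basis R p"
  let ?d = "\<lambda>l. res_diff F k (std_basis R (res_rank F (Suc k)) l)" and ?P = "power_module M p" and ?Q = "power_module M (res_rank F (Suc k))"
  let ?\<delta> = "\<lambda>u. \<lambda>l\<in>{..<?q}. lincomb M u (?d l) p" and ?C = "{u \<in> carrier ?P. \<forall>j<p. u j \<in> N}" and ?L = "{u \<in> carrier ?Q. \<forall>l<?q. u l \<in> L}"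
  note fl = rel_cocycle_linear[OF f] and d = linear_map_closed[OF diff basis]
  have \<delta>: "linear_map R ?P ?Q ?\<delta>"
    by (rule linear_map_into_power[OF module_power_module[OF fg_module] fg_module
          linear_map_power_lincomb[OF fg_module free_module_nth_closed[OF d]]])
  note C = submodule_power[OF fg_module N, of p] and Lq = submodule_power[OF fg_module L, of ?q]
  obtain m u where u: "\<And>i. i < m ==> u i \<in> ?C" "\<And>i. i < m ==> ?\<delta> (u i) \<in> ?L"
    and gen: "\<forall>x y. (\<forall>n. \<forall>j<p. represents M n (x j) (y n j)) --> (\<forall>n. y n \<in> ?C \<and> ?\<delta> (y n) \<in> adic_sub ?Q n <+>\<^bsub>?Q\<^esub> ?L) -->
      (\<exists>c. (\<forall>i<m. c i \<in> carrier S) \<and> (\<forall>j<p. x j = lincomb X (\<lambda>i. to_completion M (u i j)) c m))"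
    using completion_tuple_generated[OF fg fin_gen_power_module[OF fg] \<delta> C Lq] by blast
  have "\<forall>t. \<exists>g. linear_map R (chain_mod R F k) M g \<and> (\<forall>x\<in>chain_set R F k. g x \<in> N \<and> represents M t (f x) (g x))"
    using linear_map_completion_approx[OF fg_module fl N rel_cocycle_mem[OF f]] by metis
  then obtain g where g: "\<And>t. linear_map R (chain_mod R F k) M (g t)" "\<And>t x. x \<in> chain_set R F k ==> g t x \<in> N"
    "\<And>t x. x \<in> chain_set R F k ==> represents M t (f x) (g t x)" by metis
  have "(\<lambda>j\<in>{..<p}. g t (?b j)) \<in> ?C \<and> ?\<delta> (\<lambda>j\<in>{..<p}. g t (?b j)) \<in> adic_sub ?Q t <+>\<^bsub>?Q\<^esub> ?L" for t
    using approx_tuple_diff[OF f g(1,3)] g(2)[OF basis] linear_map_closed[OF g(1) basis] by (auto intro: power_module_carrierI)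
  then obtain c where c: "\<And>i. i < m ==> c i \<in> carrier S" "\<And>j. j < p ==> f (?b j) = lincomb X (\<lambda>i. to_completion M (u i j)) c m"
    using gen[rule_format, of "\<lambda>j. f (?b j)" "\<lambda>t. \<lambda>j\<in>{..<p}. g t (?b j)"] g(3)[OF basis] by auto
  have uN: "u i j \<in> N" and uM: "u i j \<in> carrier M" if "i < m" "j < p" for i j
    using u(1)[OF that(1)] that(2) submodule_mem_carrier[OF N] by auto
  let ?G = "\<lambda>i x. lincomb M (u i) x p"
  have G: "rel_cocycle R F M N L k (?G i)" if i: "i < m" for i
    unfolding rel_cocycle_def
  proof (intro conjI ballI)
    show Gl: "linear_map R (chain_mod R F k) M (?G i)" by (rule linear_map_lincomb[OF fg_module uM[OF i]])
    show "?G i x \<in> N" if "x \<in> chain_set R F k" for x by (rule lincomb_mem[OF N uN[OF i] free_module_nth_closed[OF that]])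
    have "?\<delta> (u i) l \<in> L" if "l < ?q" for l using u(2)[OF i] that by blast
    then show "?G i (res_diff F k x) \<in> L" if "x \<in> chain_set R F (Suc k)" for x
      by (intro linear_map_mem_if_basis[OF linear_map_comp[OF diff Gl] L _ that]) simp
  qed
  have "f x = lincomb X (\<lambda>i. to_completion M (?G i x)) c m" if x: "x \<in> chain_set R F k" for x
  proof (rule linear_map_eq_if_basis[OF fl linear_map_lincomb_restrict_scalars[OF module_free_module[OF R] X] _ x])
    show "linear_map R (chain_mod R F k) (rs X) (\<lambda>x. to_completion M (?G i x))" if "i < m" for i
      by (rule linear_map_comp[OF rel_cocycle_linear[OF G[OF that]] linear_map_to_completion[OF fg_module]])
    show "f (?b j) = lincomb X (\<lambda>i. to_completion M (?G i (?b j))) c m" if j: "j < p" for j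
      unfolding c(2)[OF j] by (rule lincomb_cong) (simp_all add: lincomb_std_basis[OF fg_module uM j])
  qed (rule c(1))
  then show ?thesis using that[of m ?G c] G c(1) by blast
qed

lemma rel_cocycle_approximation:
  assumes f: "rel_cocycle R F (rs X) N' L' k f"
  obtains f0 where "rel_cocycle R F M N L k f0" "rel_coboundary R F (rs X) N' L' k (\<lambda>x. f x \<ominus>\<^bsub>X\<^esub> to_completion M (f0 x))"
proof -
  obtain m G c where G: "\<And>i. i < m ==> rel_cocycle R F M N L k (G i)" and c: "\<And>i. i < m ==> c i \<in> carrier S"
    and fG: "\<forall>x\<in>chain_set R F k. f x = lincomb X (\<lambda>i. to_completion M (G i x)) c m"
    using rel_cocycle_completion_generated[OF f] by metis
  have "\<forall>i. \<exists>r \<rho>. i < m --> r \<in> carrier R \<and> \<rho> \<in> adic_kernel n \<and> c i = \<iota> r \<oplus>\<^bsub>S\<^esub> \<rho>" using completion_ring_split c by metis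
  then obtain r \<rho> where r: "\<And>i. i < m ==> r i \<in> carrier R" and \<rho>: "\<And>i. i < m ==> \<rho> i \<in> adic_kernel n"
    and c_split: "\<And>i. i < m ==> c i = \<iota> (r i) \<oplus>\<^bsub>S\<^esub> \<rho> i" by metis
  let ?f = "\<lambda>x. lincomb M (\<lambda>i. G i x) r m"
  have remainder: "lincomb X (\<lambda>i. to_completion M (G i x)) \<rho> m = f x \<ominus>\<^bsub>X\<^esub> to_completion M (?f x)"
    if x: "x \<in> chain_set R F k" for x
  proof -
    let ?g = "\<lambda>i. to_completion M (G i x)"
    have GM: "i < m ==> G i x \<in> carrier M" for i by (rule linear_map_closed[OF rel_cocycle_linear[OF G] x])
    have closed: "i < m ==> ?g i \<in> carrier X" "i < m ==> \<iota> (r i) \<in> carrier S" "i < m ==> \<rho> i \<in> carrier S" for i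
      using linear_map_closed[OF linear_map_to_completion[OF fg_module] GM] completion_map_closed[OF r] \<rho> by (simp_all add: adic_kernel_def)
    have "f x = lincomb X ?g (\<lambda>i. \<iota> (r i) \<oplus>\<^bsub>S\<^esub> \<rho> i) m" using fG x c_split by (simp cong: lincomb_cong)
    also have "\<dots> = lincomb X ?g (\<lambda>i. \<iota> (r i)) m \<oplus>\<^bsub>X\<^esub> lincomb X ?g \<rho> m" by (rule lincomb_add_coeff[OF X closed])
    also have "lincomb X ?g (\<lambda>i. \<iota> (r i)) m = to_completion M (?f x)"
      using linear_map_image_lincomb[OF linear_map_to_completion[OF fg_module] GM r] by (simp add: lincomb_restrict_scalars)
    finally show ?thesis
      using minus_cancel(5)[OF X lincomb_closed[OF X closed(1,3)]
          linear_map_closed[OF linear_map_to_completion[OF fg_module] lincomb_closed[OF fg_module GM r], unfolded restrict_scalars_simps]]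
      by simp
  qed
  show ?thesis
  proof (rule that[OF rel_cocycle_lincomb[OF fg_module N L F G r]])
    show "rel_coboundary R F (rs X) N' L' k (\<lambda>x. f x \<ominus>\<^bsub>X\<^esub> to_completion M (?f x))"
      by (rule rel_coboundary_cong[OF rel_coboundary_lincomb[OF X N' L' F
            rel_coboundary_smult_kernel[OF X N' L' F rel_cocycle_to_completion[OF G] \<rho>]] remainder])
  qed
qed

lemma rel_coboundary_completion_approx:
  assumes f: "linear_map R (chain_mod R F k) M f" and fb: "rel_coboundary R F (rs X) N' L' k (\<lambda>x. to_completion M (f x))"
  obtains b where "rel_coboundary R F M N L k b" "\<And>x. x \<in> chain_set R F k ==> f x \<ominus> b x \<in> adic_sub M t"
proof (cases k)
  note rep_f = represents_to_completion[OF fg_module linear_map_closed[OF f]]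
  note fl = linear_map_comp[OF f linear_map_to_completion[OF fg_module]]
  case 0
  obtain b where b: "linear_map R (chain_mod R F k) M b" "\<And>x. x \<in> chain_set R F k ==> b x \<in> L"
    "\<And>x. x \<in> chain_set R F k ==> represents M t (to_completion M (f x)) (b x)"
    using linear_map_completion_approx[OF fg_module fl L] fb 0 by (metis rel_coboundary_0)
  show ?thesis
    by (rule that[of b]) (use b represents_unique[OF fg_module rep_f b(3)] 0 in \<open>simp_all add: rel_coboundary_0\<close>)
next
  note rep_f = represents_to_completion[OF fg_module linear_map_closed[OF f]]
  note fl = linear_map_comp[OF f linear_map_to_completion[OF fg_module]]
  case (Suc i)
  obtain g where g: "linear_map R (chain_mod R F i) (rs X) g" "\<And>x. x \<in> chain_set R F i ==> g x \<in> N'"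
    "\<And>x. x \<in> chain_set R F (Suc i) ==> to_completion M (f x) \<ominus>\<^bsub>rs X\<^esub> g (res_diff F i x) \<in> L'"
    using rel_coboundary_SucE[OF fb[unfolded Suc]] by blast
  obtain G where G: "linear_map R (chain_mod R F i) M G" "\<And>x. x \<in> chain_set R F i ==> G x \<in> N"
    "\<And>x. x \<in> chain_set R F i ==> represents M t (g x) (G x)"
    using linear_map_completion_approx[OF fg_module g(1) N g(2)] by blast
  note d = linear_map_closed[OF diff]
  have rem: "linear_map R (chain_mod R F (Suc i)) (rs X) (\<lambda>x. to_completion M (f x) \<ominus>\<^bsub>rs X\<^esub> g (res_diff F i x))"
    by (rule linear_map_fun_minus[OF fl[unfolded Suc] linear_map_comp[OF diff g(1)]])
  obtain Y where Y: "linear_map R (chain_mod R F (Suc i)) M Y" "\<And>x. x \<in> chain_set R F (Suc i) ==> Y x \<in> L"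
    "\<And>x. x \<in> chain_set R F (Suc i) ==> represents M t (to_completion M (f x) \<ominus>\<^bsub>rs X\<^esub> g (res_diff F i x)) (Y x)"
    using linear_map_completion_approx[OF fg_module rem L g(3)] by blast
  let ?b = "\<lambda>x. Y x \<oplus> G (res_diff F i x)"
  note bl = linear_map_fun_add[OF Y(1) linear_map_comp[OF diff G(1)]]
  have rep_b: "represents M t (to_completion M (f x)) (?b x)" if x: "x \<in> chain_set R F (Suc i)" for x
    using represents_add[OF fg_module Y(3)[OF x] G(3)[OF d[OF x]]] minus_cancel(1)[OF X, of "to_completion M (f x)" "g (res_diff F i x)"]
      linear_map_closed[OF fl[unfolded Suc] x] linear_map_closed[OF g(1) d[OF x]] by simp
  have cob: "?b x \<ominus> G (res_diff F i x) \<in> L" if x: "x \<in> chain_set R F (Suc i)" for x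
    using minus_cancel(4)[OF fg_module linear_map_closed[OF Y(1) x] linear_map_closed[OF G(1) d[OF x]]] Y(2)[OF x] by simp
  show ?thesis
    by (rule that[of ?b]) (use rel_coboundary_SucI[OF bl G(1,2) cob] represents_unique[OF fg_module rep_f rep_b] Suc in simp_all)
qed

text \<open>A cocycle that is adically close to a coboundary is, by Artin--Rees, the sum of a coboundary and of
  multiples of cocycles by elements of \<open>\<aa>\<^sup>n\<close>, and those are coboundaries too.\<close>

lemma rel_coboundary_descent:
  assumes LN: "L \<subseteq> N" and f: "rel_cocycle R F M N L k f" and fb: "rel_coboundary R F (rs X) N' L' k (\<lambda>x. to_completion M (f x))"
  shows "rel_coboundary R F M N L k f"
proof -
  let ?P = "power_module M p" and ?F = "\<lambda>u x. lincomb M u x p" and ?tuple = "\<lambda>f. \<lambda>j\<in>{..<p}. f (std_basis R p j)"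
  let ?Z = "{u \<in> carrier ?P. rel_cocycle R F M N L k (?F u)}" and ?B = "{u \<in> carrier ?P. rel_coboundary R F M N L k (?F u)}"
  note P = module_power_module[OF fg_module, of p] and fl = rel_cocycle_linear[OF f]
  note Z = submodule_cocycle_tuples[OF fg_module N L F, of k] and B = submodule_coboundary_tuples[OF fg_module N L F, of k]
  have tuple: "?tuple g \<in> carrier ?P" "x \<in> chain_set R F k ==> ?F (?tuple g) x = g x"
    if g: "linear_map R (chain_mod R F k) M g" for g x
    using linear_map_closed[OF g basis] linear_map_expand[OF g, of x] by (auto intro: power_module_carrierI cong: lincomb_cong)
  have BZ: "?B \<subseteq> ?Z" using rel_coboundary_imp_cocycle[OF fg_module N L F LN] by blast
  obtain t where t: "?Z \<inter> (adic_sub ?P t <+>\<^bsub>?P\<^esub> ?B) \<subseteq> smult_span ?P (J n) ?Z <+>\<^bsub>?P\<^esub> ?B"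
    unfolding adic_sub_def by (rule weak_artin_rees[OF NR fin_gen_noetherian_module[OF R NR fin_gen_power_module[OF fg]] \<aa> Z B BZ])
  obtain b where b: "rel_coboundary R F M N L k b" "\<And>x. x \<in> chain_set R F k ==> f x \<ominus> b x \<in> adic_sub M t"
    using rel_coboundary_completion_approx[OF fl fb] by blast
  note bl = rel_coboundary_linear[OF b(1)]
  have "?tuple f \<in> ?Z" using tuple[OF fl] rel_cocycle_cong[OF fg_module N L F f] by simp
  moreover have "?tuple b \<in> ?B" using tuple[OF bl] rel_coboundary_cong[OF b(1)] by simp
  moreover have "?tuple f \<ominus>\<^bsub>?P\<^esub> ?tuple b \<in> adic_sub ?P t"
    unfolding adic_sub_power_module[OF fg_module]
    using submodule_minus[OF module.carrier_is_submodule[OF P] tuple(1)[OF fl] tuple(1)[OF bl]]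
      power_module_minus_nth[OF fg_module tuple(1)[OF fl] tuple(1)[OF bl]] b(2)[OF basis] by simp
  ultimately have "?tuple f \<in> smult_span ?P (J n) ?Z <+>\<^bsub>?P\<^esub> ?B"
    using t mem_set_add_iff[OF P submodule_adic_sub[OF P] B tuple(1)[OF fl]] by blast
  moreover have "smult_span ?P (J n) ?Z \<subseteq> ?B"
  proof (rule smult_span_subsetI[OF B])
    fix r z assume r: "r \<in> J n" and z: "z \<in> ?Z"
    have rz: "rel_coboundary R F M N L k (\<lambda>x. r \<odot> ?F z x)"
      by (rule rel_coboundary_smult_ideal[OF fg_module N L F _ ideal_J r]) (use z in blast)
    have "rel_coboundary R F M N L k (?F (r \<odot>\<^bsub>?P\<^esub> z))"
      by (rule rel_coboundary_cong[OF rz], rule linear_map_smult[OF linear_map_power_lincomb[OF fg_module free_module_nth_closed], symmetric])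
        (use z J_closed[OF r] in auto)
    then show "r \<odot>\<^bsub>?P\<^esub> z \<in> ?B" using power_module_closed(3)[OF fg_module J_closed[OF r]] z by blast
  qed
  ultimately have "?tuple f \<in> ?B" using set_add_subset[OF B _ subset_refl] by blast
  then show ?thesis using rel_coboundary_cong[of R F M N L k "?F (?tuple f)" f] tuple(2)[OF fl] by blast
qed

end

theorem vanishes_completion:
  fixes M :: "('a, 'm, 's) module_scheme" (structure)
  assumes fg: "fin_gen_module R M" and N: "submodule N R M" and L: "submodule L R M" and LN: "L \<subseteq> N"
  shows "vanishes R \<aa> M N L k \<longleftrightarrow> vanishes R \<aa> (rs (Mhat M)) (adic_closure M N) (adic_closure M L) k"
proof -
  note M = fin_gen_moduleD[OF fg]
  let ?X = "Mhat M" and ?N = "adic_closure M N" and ?L = "adic_closure M L"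
  note X = module_completion[OF M] and N' = submodule_adic_closure[OF M N] and L' = submodule_adic_closure[OF M L]
  note rsX = module_rs[OF X] and rsN = submodule_rs[OF X N'] and rsL = submodule_rs[OF X L']
  obtain F \<phi> where tower: "resolution_tower R \<aa> F \<phi>" by (rule noetherian_resolution_tower[OF R NR \<aa>])
  note F = resolution_towerD(1)[OF tower] and \<phi> = chain_lift_chain_map[OF resolution_towerD(2)[OF tower]]
  show ?thesis
    unfolding vanishes_iff_tower[OF M N L \<aa> tower] vanishes_iff_tower[OF rsX rsN rsL \<aa> tower]
  proof (intro iffI allI impI)
    fix n f
    assume vanish: "\<forall>n f. rel_cocycle R (F n) M N L k f --> (\<exists>m\<ge>n. rel_coboundary R (F m) M N L k (\<lambda>x. f (\<phi> m n k x)))"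
      and f: "rel_cocycle R (F n) (rs ?X) ?N ?L k f"
    obtain g where g: "rel_cocycle R (F n) M N L k g" "rel_coboundary R (F n) (rs ?X) ?N ?L k (\<lambda>x. f x \<ominus>\<^bsub>?X\<^esub> to_completion M (g x))"
      by (rule rel_cocycle_approximation[OF fg N L F f])
    obtain m where m: "m \<ge> n" "rel_coboundary R (F m) M N L k (\<lambda>x. g (\<phi> m n k x))" using vanish g(1) by blast
    note sum = rel_coboundary_add[OF rsX rsN rsL F rel_coboundary_comp[OF g(2) \<phi>[OF m(1)]] rel_coboundary_to_completion[OF fg N L F m(2)]]
    have "rel_coboundary R (F m) (rs ?X) ?N ?L k (\<lambda>x. f (\<phi> m n k x))"
    proof (rule rel_coboundary_cong[OF sum])
      fix x assume "x \<in> chain_set R (F m) k"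
      then have x: "\<phi> m n k x \<in> chain_set R (F n) k" by (rule linear_map_closed[OF chain_map_linear[OF \<phi>[OF m(1)]]])
      show "(f (\<phi> m n k x) \<ominus>\<^bsub>?X\<^esub> to_completion M (g (\<phi> m n k x))) \<oplus>\<^bsub>rs ?X\<^esub> to_completion M (g (\<phi> m n k x)) = f (\<phi> m n k x)"
        using minus_cancel(1)[OF X, of "f (\<phi> m n k x)" "to_completion M (g (\<phi> m n k x))"] linear_map_closed[OF rel_cocycle_linear[OF f] x]
          linear_map_closed[OF linear_map_to_completion[OF M] linear_map_closed[OF rel_cocycle_linear[OF g(1)] x]] by simp
    qed
    then show "\<exists>m\<ge>n. rel_coboundary R (F m) (rs ?X) ?N ?L k (\<lambda>x. f (\<phi> m n k x))" using m(1) by blast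
  next
    fix n f
    assume vanish: "\<forall>n f. rel_cocycle R (F n) (rs ?X) ?N ?L k f --> (\<exists>m\<ge>n. rel_coboundary R (F m) (rs ?X) ?N ?L k (\<lambda>x. f (\<phi> m n k x)))"
      and f: "rel_cocycle R (F n) M N L k f"
    obtain m where m: "m \<ge> n" "rel_coboundary R (F m) (rs ?X) ?N ?L k (\<lambda>x. to_completion M (f (\<phi> m n k x)))"
      using vanish rel_cocycle_to_completion[OF fg N L F f] by blast
    have "rel_coboundary R (F m) M N L k (\<lambda>x. f (\<phi> m n k x))"
      by (rule rel_coboundary_descent[OF fg N L F LN rel_cocycle_comp[OF f \<phi>[OF m(1)]] m(2)])
    then show "\<exists>m\<ge>n. rel_coboundary R (F m) M N L k (\<lambda>x. f (\<phi> m n k x))" using m(1) by blast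
  qed
qed

end

subsection \<open>Ext and local cohomology\<close>

definition with_aug :: "('a, 'n) free_res => ((nat => 'a) => 'k) => ('a, 'k) free_res" where
  "with_aug F e = \<lparr>res_rank = res_rank F, res_diff = res_diff F, res_aug = e\<rparr>"

lemma with_aug_simps [simp]:
  "res_rank (with_aug F e) = res_rank F" "res_diff (with_aug F e) = res_diff F" "res_aug (with_aug F e) = e"
  by (simp_all add: with_aug_def)

lemma rel_cocycle_with_aug [simp]: "rel_cocycle R (with_aug F e) = rel_cocycle R F"
  and rel_coboundary_with_aug [simp]: "rel_coboundary R (with_aug F e) = rel_coboundary R F"
  and chain_map_with_aug [simp]: "chain_map R (with_aug F e) (with_aug G e') = chain_map R F G"
  by (simp_all add: fun_eq_iff rel_cocycle_def rel_coboundary_def chain_map_def split: nat.split)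

lemma module_homs_iff:
  "module R A ==> module R C ==> f \<in> module_homs R A C \<longleftrightarrow> linear_map R A C f \<and> f \<in> extensional (carrier A)"
  by (auto simp: module_homs_def linear_map_def PiE_def)

lemma restrict_mem_module_homs:
  assumes "linear_map R A C f"
  shows "restrict f (carrier A) \<in> module_homs R A C"
  using linear_map_cong[OF assms] module_homs_iff[OF linear_map_module[OF assms]] by simp

lemma module_homs_eqI:
  "f \<in> module_homs R A C ==> g \<in> module_homs R A C ==> (\<And>x. x \<in> carrier A ==> f x = g x) ==> f = g"
  by (auto simp: module_homs_def intro: PiE_ext)

lemma module_Hom_module:
  assumes A: "module R A" and X: "module R X"
  shows "module R (Hom_module R A X)" (is "module R ?H")
proof -
  interpret A: module R A by (rule A)
  interpret X: module R X by (rule X)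
  have linear: "linear_map R A X f" and closed: "x \<in> carrier A ==> f x \<in> carrier X" if "f \<in> carrier ?H" for f x
    using that module_homs_iff[OF A X] linear_map_closed by (auto simp: Hom_module_def)
  have eqI: "f = g" if "f \<in> carrier ?H" "g \<in> carrier ?H" "\<And>x. x \<in> carrier A ==> f x = g x" for f g
    using module_homs_eqI that by (simp add: Hom_module_def) blast
  have zero: "\<zero>\<^bsub>?H\<^esub> \<in> carrier ?H" using restrict_mem_module_homs[OF linear_map_const_zero[OF A X]] by (simp add: Hom_module_def)
  have add: "f \<oplus>\<^bsub>?H\<^esub> g \<in> carrier ?H" if "f \<in> carrier ?H" "g \<in> carrier ?H" for f g
    using restrict_mem_module_homs[OF linear_map_fun_add[OF linear linear]] that by (simp add: Hom_module_def)
  have smult: "r \<odot>\<^bsub>?H\<^esub> f \<in> carrier ?H" if "r \<in> carrier R" "f \<in> carrier ?H" for r f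
    using restrict_mem_module_homs[OF linear_map_fun_smult[OF linear]] that by (simp add: Hom_module_def)
  have nth: "x \<in> carrier A ==> \<zero>\<^bsub>?H\<^esub> x = \<zero>\<^bsub>X\<^esub>" "x \<in> carrier A ==> (f \<oplus>\<^bsub>?H\<^esub> g) x = f x \<oplus>\<^bsub>X\<^esub> g x"
    "x \<in> carrier A ==> (r \<odot>\<^bsub>?H\<^esub> f) x = r \<odot>\<^bsub>X\<^esub> f x" for f g r x by (simp_all add: Hom_module_def)
  have "abelian_group ?H"
  proof (rule abelian_groupI)
    fix f assume f: "f \<in> carrier ?H"
    have neg: "\<ominus>\<^bsub>R\<^esub> \<one>\<^bsub>R\<^esub> \<in> carrier R" by simp
    have "(\<ominus>\<^bsub>R\<^esub> \<one>\<^bsub>R\<^esub>) \<odot>\<^bsub>?H\<^esub> f \<oplus>\<^bsub>?H\<^esub> f = \<zero>\<^bsub>?H\<^esub>"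
      by (rule eqI[OF add[OF smult[OF neg f] f] zero]) (simp add: nth closed[OF f] X.smult_l_minus X.l_neg)
    then show "\<exists>g\<in>carrier ?H. g \<oplus>\<^bsub>?H\<^esub> f = \<zero>\<^bsub>?H\<^esub>" using smult[OF neg f] by blast
  qed (auto simp: nth closed zero add X.a_ac intro!: eqI)
  then show ?thesis
    by (intro moduleI[OF A.is_cring]) (auto simp: nth closed add smult X.smult_l_distr X.smult_r_distr X.smult_assoc1 intro!: eqI)
qed

lemma linear_map_Hom_compose:
  assumes h: "linear_map R A B h" and X: "module R X"
  shows "linear_map R (Hom_module R B X) (Hom_module R A X) (\<lambda>f. compose (carrier A) f h)"
proof -
  note A = linear_map_module(1)[OF h] and B = linear_map_module(2)[OF h]
  have "compose (carrier A) f h \<in> module_homs R A X" if "f \<in> module_homs R B X" for f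
    using restrict_mem_module_homs[OF linear_map_comp[OF h, of X f]] that module_homs_iff[OF B X] by (simp add: compose_def)
  then show ?thesis
    using module_Hom_module[OF A X] module_Hom_module[OF B X] linear_map_closed[OF h]
    by (auto simp: linear_map_def Hom_module_def compose_def intro!: restrict_ext)
qed

context
  fixes R :: "('a, 'r) ring_scheme" and X :: "('a, 'm, 's) module_scheme" (structure)
  assumes X: "module R X"
begin

interpretation X: module R X by (rule X)

private lemmas carrier_X = X.carrier_is_submodule
private lemmas zero_X = submodule_singleton_zero[OF X]

lemma cocycles_iff:
  assumes "\<And>i. linear_map R (chain_mod R F (Suc i)) (chain_mod R F i) (res_diff F i)"
  shows "f \<in> cocycles R F X k \<longleftrightarrow> f \<in> module_homs R (chain_mod R F k) X \<and> rel_cocycle R F X (carrier X) {\<zero>} k f"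
proof -
  have "compose A f g = (\<lambda>x\<in>A. \<zero>) \<longleftrightarrow> (\<forall>x\<in>A. f (g x) = \<zero>)" for A and g :: "(nat => 'a) => (nat => 'a)"
    by (auto simp: compose_def restrict_def fun_eq_iff)
  then show ?thesis
    using module_homs_iff[OF linear_map_module(2)[OF assms] X] linear_map_closed[of R "chain_mod R F k" X f]
    by (auto simp: cocycles_def a_kernel_def' cochain_module_def Hom_module_def cochain_diff_def res_module_def rel_cocycle_def)
qed

lemma coboundaries_iff:
  assumes d: "\<And>i. linear_map R (chain_mod R F (Suc i)) (chain_mod R F i) (res_diff F i)"
  shows "f \<in> coboundaries R F X k \<longleftrightarrow> f \<in> module_homs R (chain_mod R F k) X \<and> rel_coboundary R F X (carrier X) {\<zero>} k f"
proof (cases k)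
  case 0
  note zero = linear_map_const_zero[OF linear_map_module(2)[OF d] X]
  show ?thesis
    using 0 zero restrict_mem_module_homs[OF zero, of 0] linear_map_cong[OF zero, of 0 "\<lambda>x\<in>chain_set R F 0. \<zero>"]
      module_homs_eqI[of f R "chain_mod R F 0" X "\<lambda>x\<in>chain_set R F 0. \<zero>"]
    by (auto simp: rel_coboundary_0 cochain_module_def Hom_module_def res_module_def)
next
  case (Suc j)
  let ?A = "chain_mod R F (Suc j)" and ?B = "chain_mod R F j"
  note homs_iff = module_homs_iff[OF linear_map_module(2)[OF d] X]
  have coboundaries: "f \<in> coboundaries R F X k \<longleftrightarrow> (\<exists>g\<in>module_homs R ?B X. f = compose (carrier ?A) g (res_diff F j))"
    using Suc by (auto simp: cochain_module_def Hom_module_def res_module_def cochain_diff_def)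
  show ?thesis unfolding coboundaries unfolding Suc
  proof
    assume "\<exists>g\<in>module_homs R ?B X. f = compose (carrier ?A) g (res_diff F j)"
    then obtain g where g: "linear_map R ?B X g" and f: "f = (\<lambda>x\<in>carrier ?A. g (res_diff F j x))"
      using homs_iff by (auto simp: compose_def)
    note gd = linear_map_comp[OF d g]
    have "rel_coboundary R F X (carrier X) {\<zero>} (Suc j) (\<lambda>x. g (res_diff F j x))"
      by (rule rel_coboundary_SucI[OF gd g])
        (use linear_map_closed[OF g] linear_map_closed[OF gd] minus_eq_zero_iff[OF X] in auto)
    then have "rel_coboundary R F X (carrier X) {\<zero>} (Suc j) f" by (rule rel_coboundary_cong) (simp add: f)
    then show "f \<in> module_homs R ?A X \<and> rel_coboundary R F X (carrier X) {\<zero>} (Suc j) f"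
      using restrict_mem_module_homs[OF gd] f by simp
  next
    assume f: "f \<in> module_homs R ?A X \<and> rel_coboundary R F X (carrier X) {\<zero>} (Suc j) f"
    obtain g where g: "linear_map R ?B X g" "\<And>x. x \<in> carrier ?A ==> f x \<ominus> g (res_diff F j x) \<in> {\<zero>}"
      using rel_coboundary_SucE[OF conjunct2[OF f]] by blast
    have "f x = g (res_diff F j x)" if x: "x \<in> carrier ?A" for x
      using g(2)[OF x] f homs_iff minus_eq_zero_iff[OF X linear_map_closed[of R ?A X f] linear_map_closed[OF linear_map_comp[OF d g(1)] x]] x
      by blast
    then have "f = compose (carrier ?A) (restrict g (carrier ?B)) (res_diff F j)"
      using module_homs_eqI[of f R ?A X "\<lambda>x\<in>carrier ?A. g (res_diff F j x)"] f restrict_mem_module_homs[OF linear_map_comp[OF d g(1)]]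
        linear_map_closed[OF d, of _ j] by (simp add: compose_def cong: restrict_cong)
    then show "\<exists>g\<in>module_homs R ?B X. f = compose (carrier ?A) g (res_diff F j)" using restrict_mem_module_homs[OF g(1)] by blast
  qed
qed

context
  fixes F :: "('a, 'n) free_res" and e :: "(nat => 'a) => 'a" and J :: "'a set" and k :: nat
  assumes F: "resolves R J (with_aug F e)"
begin

private lemmas diff = resolves_diff[OF F, unfolded with_aug_simps]
private lemmas Hom = module_Hom_module[OF linear_map_module(2)[OF diff] X]

lemma module_cochain_module: "module R (cochain_module R F X k)"
  using Hom by (simp add: cochain_module_def res_module_def)

lemma submodule_coboundaries: "submodule (coboundaries R F X k) R (cochain_module R F X k)"
proof (rule submoduleI_no_inverse[OF module_cochain_module])
  let ?C = "cochain_module R F X k" and ?cob = "rel_coboundary R F X (carrier X) {\<zero>} k"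
  note iff = coboundaries_iff[OF diff] and C = cochain_module_def res_module_def Hom_module_def
  note H = module_cochain_module
  have closed: "f \<in> carrier ?C" if "f \<in> coboundaries R F X k" for f using that by (simp add: iff C)
  then show "coboundaries R F X k \<subseteq> carrier ?C" by blast
  have cobI: "f \<in> coboundaries R F X k" if "f \<in> carrier ?C" "?cob g" "\<And>x. x \<in> chain_set R F k ==> g x = f x" for f g
    using that rel_coboundary_cong[OF that(2,3)] by (simp add: iff C)
  show "\<zero>\<^bsub>?C\<^esub> \<in> coboundaries R F X k"
    by (rule cobI[OF _ rel_coboundary_zero[OF X carrier_X zero_X F, unfolded rel_coboundary_with_aug]])
      (use submodule_zero_mem[OF module.carrier_is_submodule[OF H]] in \<open>simp_all add: C\<close>)
  fix f assume f: "f \<in> coboundaries R F X k"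
  show "f \<oplus>\<^bsub>?C\<^esub> g \<in> coboundaries R F X k" if g: "g \<in> coboundaries R F X k" for g
    by (rule cobI[OF _ rel_coboundary_add[OF X carrier_X zero_X F, unfolded rel_coboundary_with_aug, of k f g]])
      (use f g iff submodule_add[OF module.carrier_is_submodule[OF H] closed closed] in \<open>simp_all add: C\<close>)
  show "r \<odot>\<^bsub>?C\<^esub> f \<in> coboundaries R F X k" if r: "r \<in> carrier R" for r
    by (rule cobI[OF _ rel_coboundary_smult[OF X carrier_X zero_X F, unfolded rel_coboundary_with_aug, of k f r]])
      (use f r iff submodule_smult[OF module.carrier_is_submodule[OF H] r closed] in \<open>simp_all add: C\<close>)
qed

lemma restrict_mem_cocycles:
  assumes f: "rel_cocycle R F X (carrier X) {\<zero>} k f"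
  shows "restrict f (chain_set R F k) \<in> cocycles R F X k"
  using restrict_mem_module_homs[OF rel_cocycle_linear[OF f]]
    rel_cocycle_cong[OF X carrier_X zero_X F, of k f "restrict f (chain_set R F k)"] f
  by (simp add: cocycles_iff[OF diff])

lemma coboundaries_coset_eq_iff:
  assumes f: "f \<in> cocycles R F X k"
  shows "coboundaries R F X k +>\<^bsub>cochain_module R F X k\<^esub> f = coboundaries R F X k \<longleftrightarrow> rel_coboundary R F X (carrier X) {\<zero>} k f"
proof -
  have fH: "f \<in> module_homs R (chain_mod R F k) X" using f cocycles_iff[OF diff] by blast
  then have "f \<in> carrier (cochain_module R F X k)" by (simp add: cochain_module_def res_module_def Hom_module_def)
  from a_coset_eq_self_iff[OF module_cochain_module submodule_coboundaries this] fH show ?thesis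
    by (simp add: coboundaries_iff[OF diff])
qed

end

lemma Ext_module_simps:
  "carrier (Ext_module R k N X) = (\<lambda>f. coboundaries R (free_resolution R N) X k +>\<^bsub>cochain_module R (free_resolution R N) X k\<^esub> f)
    ` cocycles R (free_resolution R N) X k"
  "\<zero>\<^bsub>Ext_module R k N X\<^esub> = coboundaries R (free_resolution R N) X k"
  by (simp_all add: Ext_module_def Let_def quot_module_simps A_RCOSETS_def' a_r_coset_def' UNION_singleton_eq_range)

lemma Ext_map_coset:
  fixes N :: "('a, 'n, 't) module_scheme" and N' :: "('a, 'k, 'u) module_scheme" and g :: "'k => 'n"
  defines "F \<equiv> free_resolution R N" and "F' \<equiv> free_resolution R N'"
  defines "\<phi> \<equiv> SOME \<phi>. is_chain_lift R F' F g \<phi>"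
  assumes F: "resolves R J (with_aug F e)" and F': "resolves R J' (with_aug F' e')"
    and \<phi>: "chain_map R F' F \<phi>" and f: "f \<in> cocycles R F X k"
  shows "Ext_map R k N' N g X (coboundaries R F X k +>\<^bsub>cochain_module R F X k\<^esub> f) =
    coboundaries R F' X k +>\<^bsub>cochain_module R F' X k\<^esub> (\<lambda>x\<in>chain_set R F' k. f (\<phi> k x))"
proof -
  let ?C = "cochain_module R F X k" and ?C' = "cochain_module R F' X k"
  let ?B = "coboundaries R F X k" and ?B' = "coboundaries R F' X k" and ?pull = "\<lambda>f. compose (chain_set R F' k) f (\<phi> k)"
  note C = module_cochain_module[OF F, of k] and B = submodule_coboundaries[OF F, of k]
    and C' = module_cochain_module[OF F', of k] and B' = submodule_coboundaries[OF F', of k]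
  note iff = coboundaries_iff[OF resolves_diff[OF F, unfolded with_aug_simps]]
    and iff' = coboundaries_iff[OF resolves_diff[OF F', unfolded with_aug_simps]]
  have pull: "linear_map R ?C ?C' ?pull"
    using linear_map_Hom_compose[OF chain_map_linear[OF \<phi>, of k] X] by (simp add: cochain_module_def res_module_def)
  have pull_B: "?pull b \<in> ?B'" if b: "b \<in> ?B" for b
  proof -
    have "rel_coboundary R F' X (carrier X) {\<zero>} k (\<lambda>x. b (\<phi> k x))" by (rule rel_coboundary_comp[OF _ \<phi>]) (use b iff in blast)
    then have "rel_coboundary R F' X (carrier X) {\<zero>} k (?pull b)" by (rule rel_coboundary_cong) (simp add: compose_def)
    then show ?thesis
      using linear_map_closed[OF pull submodule_mem_carrier[OF B b]]
      by (simp add: iff' cochain_module_def res_module_def Hom_module_def)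
  qed
  have fC: "f \<in> carrier ?C"
    using f cocycles_iff[OF resolves_diff[OF F, unfolded with_aug_simps]] by (simp add: cochain_module_def res_module_def Hom_module_def)
  have "?B' +>\<^bsub>?C'\<^esub> ?pull h = ?B' +>\<^bsub>?C'\<^esub> ?pull f" if "h \<in> ?B +>\<^bsub>?C\<^esub> f" for h
  proof -
    have h: "h \<in> carrier ?C" "h \<ominus>\<^bsub>?C\<^esub> f \<in> ?B" using that mem_a_coset_iff[OF C B fC] by auto
    show ?thesis
      unfolding a_coset_eq_iff[OF C' B' linear_map_closed[OF pull h(1)] linear_map_closed[OF pull fC]]
        linear_map_minus[OF pull h(1) fC, symmetric] by (rule pull_B[OF h(2)])
  qed
  moreover have "f \<in> ?B +>\<^bsub>?C\<^esub> f" using mem_a_coset_iff[OF C B fC] fC diff_mem_refl[OF C B fC] by blast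
  ultimately have "(\<Union>h\<in>?B +>\<^bsub>?C\<^esub> f. ?B' +>\<^bsub>?C'\<^esub> ?pull h) = ?B' +>\<^bsub>?C'\<^esub> ?pull f" by blast
  then show ?thesis
    using Ext_module_simps(1)[of k N] f unfolding F_def F'_def \<phi>_def
    by (simp add: Ext_map_def Let_def res_module_def compose_def)
qed

end

context
  fixes R :: "('a, 'r) ring_scheme" and J :: "'a set"
  assumes R: "cring R" and J: "ideal J R"
begin

interpretation cring R by (rule R)

private abbreviation "Rm \<equiv> ring_as_module R"
private abbreviation "Q \<equiv> quot_module R (ring_as_module R) J"
private lemmas Rm = module_ring_as_module[OF R]
private lemmas J' = J[unfolded ideal_iff_submodule[OF R]]
private lemmas proj = linear_map_a_coset[OF Rm J']

lemma resolves_imp_free_resolution: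
  assumes F: "resolves R J F"
  shows "is_free_resolution R Q
    \<lparr>res_rank = res_rank F, res_diff = (\<lambda>i. restrict (res_diff F i) (chain_set R F (Suc i))),
     res_aug = (\<lambda>x\<in>chain_set R F 0. J +>\<^bsub>Rm\<^esub> res_aug F x)\<rparr>"
proof -
  let ?aug = "\<lambda>x\<in>chain_set R F 0. J +>\<^bsub>Rm\<^esub> res_aug F x"
  note aug = linear_map_comp[OF resolves_aug[OF F] proj]
  have surj: "?aug ` chain_set R F 0 = carrier Q"
  proof (intro equalityI subsetI)
    fix y assume "y \<in> carrier Q"
    then obtain r where r: "r \<in> carrier R" "y = J +>\<^bsub>Rm\<^esub> r" by (auto simp: quot_module_simps a_rcosets_iff)
    obtain u where u: "u \<in> chain_set R F 0" "res_aug F u \<ominus>\<^bsub>R\<^esub> \<one>\<^bsub>R\<^esub> \<in> J" by (rule resolves_unit[OF F])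
    have ru: "r \<odot>\<^bsub>chain_mod R F 0\<^esub> u \<in> chain_set R F 0" using module.smult_closed[OF module_free_module[OF R] r(1) u(1)] .
    have "y = ?aug (r \<odot>\<^bsub>chain_mod R F 0\<^esub> u)"
      unfolding r(2) using a_coset_eq_iff[OF Rm J', of "res_aug F (r \<odot>\<^bsub>chain_mod R F 0\<^esub> u)" r] ru r(1)
        resolves_aug_closed[OF F ru] resolves_unit_smult[OF F J u r(1)] by simp
    then show "y \<in> ?aug ` chain_set R F 0" using ru by blast
  qed (use linear_map_closed[OF aug] in auto)
  have "res_diff F 0 ` chain_set R F 1 = {x \<in> chain_set R F 0. ?aug x = \<zero>\<^bsub>Q\<^esub>}"
    using resolves_image[OF F, of 0] a_coset_eq_self_iff[OF Rm J'] resolves_aug_closed[OF F]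
    by (auto simp: cycles_def quot_module_simps)
  moreover have "res_diff F (Suc i) ` chain_set R F (Suc (Suc i)) =
      {x \<in> chain_set R F (Suc i). res_diff F i x = \<zero>\<^bsub>chain_mod R F i\<^esub>}" for i
    using resolves_image[OF F, of "Suc i"] by (simp add: cycles_def)
  ultimately show ?thesis
    using surj restrict_mem_module_homs[OF resolves_diff[OF F]] restrict_mem_module_homs[OF aug]
    by (auto simp: is_free_resolution_def res_module_def a_kernel_def')
qed

lemma free_resolution_imp_resolves:
  assumes F: "is_free_resolution R Q F"
  obtains e where "resolves R J (with_aug F e)" "\<And>x. x \<in> chain_set R F 0 ==> res_aug F x = J +>\<^bsub>Rm\<^esub> e x"
proof -
  note free = module_free_module[OF R] and Q = module_quot_module[OF Rm J']
  have diff: "linear_map R (chain_mod R F (Suc i)) (chain_mod R F i) (res_diff F i)" for i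
    using F module_homs_iff[OF free free] by (simp add: is_free_resolution_def res_module_def)
  have aug: "linear_map R (chain_mod R F 0) Q (res_aug F)" and surj: "res_aug F ` chain_set R F 0 = carrier Q"
    using F module_homs_iff[OF free Q] by (simp_all add: is_free_resolution_def res_module_def)
  have image_0: "res_diff F 0 ` chain_set R F (Suc 0) = {x \<in> chain_set R F 0. res_aug F x = J}"
    and image_Suc: "res_diff F (Suc i) ` chain_set R F (Suc (Suc i)) =
      {x \<in> chain_set R F (Suc i). res_diff F i x = \<zero>\<^bsub>chain_mod R F i\<^esub>}" for i
    using F by (simp_all add: is_free_resolution_def res_module_def a_kernel_def' quot_module_simps)
  have "\<exists>y\<in>carrier Rm. res_aug F x = J +>\<^bsub>Rm\<^esub> y" if "x \<in> chain_set R F 0" for x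
    using linear_map_closed[OF aug that] by (simp add: quot_module_simps a_rcosets_iff)
  then obtain e where e: "linear_map R (chain_mod R F 0) Rm e"
    and aug_e: "\<And>x. x \<in> chain_set R F 0 ==> res_aug F x = J +>\<^bsub>Rm\<^esub> e x"
    using linear_map_lift[OF proj aug] by blast
  have eR: "e x \<in> carrier Rm" if "x \<in> chain_set R F 0" for x by (rule linear_map_closed[OF e that])
  have "J +>\<^bsub>Rm\<^esub> \<one>\<^bsub>R\<^esub> \<in> carrier Q" by (auto simp: quot_module_simps a_rcosets_iff)
  then obtain u where u: "u \<in> chain_set R F 0" "res_aug F u = J +>\<^bsub>Rm\<^esub> \<one>\<^bsub>R\<^esub>" unfolding surj[symmetric] by (rule imageE) simp
  then have unit: "e u \<ominus>\<^bsub>R\<^esub> \<one>\<^bsub>R\<^esub> \<in> J"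
    using a_coset_eq_iff[OF Rm J' eR[OF u(1)], of "\<one>\<^bsub>R\<^esub>"] aug_e[OF u(1)] by simp
  have aug_zero_iff: "res_aug F x = J \<longleftrightarrow> e x \<in> J" if x: "x \<in> chain_set R F 0" for x
    unfolding aug_e[OF x] by (rule a_coset_eq_self_iff[OF Rm J' eR[OF x]])
  have "res_diff F i ` chain_set R F (Suc i) = cycles R J (with_aug F e) i" for i
  proof (cases i)
    case 0
    have "{x \<in> chain_set R F 0. res_aug F x = J} = {x \<in> chain_set R F 0. e x \<in> J}"
      using aug_zero_iff by (rule Collect_cong[OF conj_cong[OF refl]])
    then show ?thesis using image_0 0 by (simp add: cycles_def)
  qed (use image_Suc in \<open>simp add: cycles_def\<close>)
  then have "resolves R J (with_aug F e)" using diff e u(1) unit by (auto simp: resolves_def)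
  then show ?thesis using that aug_e by blast
qed

lemma free_resolution_quot_resolves:
  assumes "\<exists>F. resolves R J F"
  obtains e where "resolves R J (with_aug (free_resolution R Q) e)"
    "\<And>x. x \<in> chain_set R (free_resolution R Q) 0 ==> res_aug (free_resolution R Q) x = J +>\<^bsub>Rm\<^esub> e x"
proof (rule free_resolution_imp_resolves)
  show "is_free_resolution R Q (free_resolution R Q)"
    unfolding free_resolution_def using assms resolves_imp_free_resolution someI[where P="is_free_resolution R Q"] by blast
qed (rule that)

lemma quot_proj_chain_lift:
  assumes I: "ideal I R" and IJ: "I \<subseteq> J"
    and F: "resolves R J (with_aug F e)" "\<And>x. x \<in> chain_set R F 0 ==> res_aug F x = J +>\<^bsub>Rm\<^esub> e x"
    and F': "resolves R I (with_aug F' e')" "\<And>x. x \<in> chain_set R F' 0 ==> res_aug F' x = I +>\<^bsub>Rm\<^esub> e' x"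
  shows "chain_lift R (with_aug F' e') (with_aug F e) J (SOME \<phi>. is_chain_lift R F' F (quot_proj Rm I J) \<phi>)"
proof -
  have I': "submodule I R Rm" using I ideal_iff_submodule[OF R] by blast
  note free = module_free_module[OF R]
  have iff: "is_chain_lift R F' F (quot_proj Rm I J) \<phi> \<longleftrightarrow>
      (\<forall>i. \<phi> i \<in> extensional (chain_set R F' i)) \<and> chain_lift R (with_aug F' e') (with_aug F e) J \<phi>" (is "_ = ?rhs \<phi>") for \<phi>
  proof -
    have aug_iff: "res_aug F y = quot_proj Rm I J (res_aug F' x) \<longleftrightarrow> e y \<ominus>\<^bsub>R\<^esub> e' x \<in> J"
      if x: "x \<in> chain_set R F' 0" and y: "y \<in> chain_set R F 0" for x y
    proof -
      have closed: "e y \<in> carrier Rm" "e' x \<in> carrier Rm"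
        using linear_map_closed[OF resolves_aug[OF F(1)]] linear_map_closed[OF resolves_aug[OF F'(1)]] x y by simp_all
      have "quot_proj Rm I J (I +>\<^bsub>Rm\<^esub> e' x) = J +>\<^bsub>Rm\<^esub> e' x"
        using set_add_a_coset[OF Rm I' J' IJ closed(2)] closed(2) by (auto simp: quot_proj_def a_rcosets_iff)
      then show ?thesis using a_coset_eq_iff[OF Rm J' closed] F(2)[OF y] F'(2)[OF x] by simp
    qed
    have "(\<forall>x\<in>chain_set R F' 0. res_aug F (\<phi> 0 x) = quot_proj Rm I J (res_aug F' x)) \<longleftrightarrow>
        (\<forall>x\<in>chain_set R F' 0. e (\<phi> 0 x) \<ominus>\<^bsub>R\<^esub> e' x \<in> J)"
      if "linear_map R (chain_mod R F' 0) (chain_mod R F 0) (\<phi> 0)"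
      by (rule ball_cong[OF refl], rule aug_iff[OF _ linear_map_closed[OF that]])
    then show ?thesis
      unfolding is_chain_lift_def res_module_def module_homs_iff[OF free free] chain_lift_def chain_map_def with_aug_simps by blast
  qed
  obtain \<phi> where \<phi>: "chain_lift R (with_aug F' e') (with_aug F e) J \<phi>" by (rule chain_lift_exists[OF F'(1) F(1) IJ J])
  define \<psi> where "\<psi> i = restrict (\<phi> i) (chain_set R F' i)" for i
  have "linear_map R (chain_mod R F' i) (chain_mod R F i) (\<psi> i)" for i
    by (rule linear_map_cong[OF chain_lift_linear[OF \<phi>, unfolded with_aug_simps]]) (simp add: \<psi>_def)
  then have "chain_map R F' F \<psi>"
    using chain_map_commute[OF chain_lift_chain_map[OF \<phi>]] linear_map_closed[OF resolves_diff[OF F'(1)]]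
    by (simp add: chain_map_def \<psi>_def)
  moreover have "e (\<psi> 0 x) \<ominus>\<^bsub>R\<^esub> e' x \<in> J" if "x \<in> chain_set R F' 0" for x
    using chain_lift_aug[OF \<phi>, of x] that by (simp add: \<psi>_def)
  moreover have "\<psi> i \<in> extensional (chain_set R F' i)" for i unfolding \<psi>_def by (rule restrict_extensional)
  ultimately have "?rhs \<psi>" by (simp add: chain_lift_def)
  then show ?thesis unfolding iff using someI[where P="?rhs"] by blast
qed

end

primrec iterated_lift ::
    "(nat => nat => (nat => 'a) => (nat => 'a)) => nat => nat => nat => (nat => 'a) => (nat => 'a)" where
  "iterated_lift \<phi> n 0 i x = x"
| "iterated_lift \<phi> n (Suc j) i x = iterated_lift \<phi> n j i (\<phi> (n + j) i x)"

lemma resolution_tower_iterated_lift: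
  assumes \<aa>: "ideal \<aa> R" and F: "\<And>n. resolves R (ideal_power R \<aa> n) (F n)"
    and \<phi>: "\<And>n. chain_lift R (F (Suc n)) (F n) (ideal_power R \<aa> n) (\<phi> n)"
  shows "resolution_tower R \<aa> F (\<lambda>m n. iterated_lift \<phi> n (m - n))"
proof -
  note R = resolves_cring[OF F] and J = ideal_power_ideal[OF resolves_cring[OF F] \<aa>]
  have "chain_lift R (F (n + j)) (F n) (ideal_power R \<aa> n) (iterated_lift \<phi> n j)" for n j
  proof (induction j)
    case 0
    have "res_aug (F n) x \<ominus>\<^bsub>R\<^esub> res_aug (F n) x \<in> ideal_power R \<aa> n" if "x \<in> chain_set R (F n) 0" for x
      using diff_mem_refl[OF module_ring_as_module[OF R] submodule_ideal_power[OF R \<aa>]] resolves_aug_closed[OF F that] by simp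
    then show ?case
      by (simp add: chain_lift_def chain_map_def linear_map_ident[OF module_free_module[OF R]] iterated_lift.simps[abs_def])
  next
    case (Suc j)
    from chain_lift_comp[OF F F F ideal_power_antimono[OF R \<aa>] J \<phi> Suc] show ?case by simp
  qed
  then show ?thesis unfolding resolution_tower_def using F by (metis le_add_diff_inverse)
qed

lemma transition_add: "transition t n (j + i) c = transition t (n + j) i (transition t n j c)"
  by (induction i) (simp_all add: add.assoc)

lemma zero_module_dirlim_iff:
  assumes zero: "\<And>n. \<zero>\<^bsub>A n\<^esub> \<in> carrier (A n)" and t: "\<And>n. t n \<zero>\<^bsub>A n\<^esub> = \<zero>\<^bsub>A (Suc n)\<^esub>"
  shows "zero_module (dirlim A t) \<longleftrightarrow> (\<forall>n. \<forall>c\<in>carrier (A n). \<exists>j. transition t n j c = \<zero>\<^bsub>A (n + j)\<^esub>)"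
proof
  let ?r = "dirlim_rel A t" and ?U = "SIGMA n:UNIV. carrier (A n)"
  have transition_zero: "transition t n j \<zero>\<^bsub>A n\<^esub> = \<zero>\<^bsub>A (n + j)\<^esub>" for n j by (induction j) (simp_all add: t)
  {
    assume z: "zero_module (dirlim A t)"
    show "\<forall>n. \<forall>c\<in>carrier (A n). \<exists>j. transition t n j c = \<zero>\<^bsub>A (n + j)\<^esub>"
    proof (intro allI ballI)
      fix n c assume c: "c \<in> carrier (A n)"
      then have "?r `` {(n, c)} \<in> ?U // ?r" by (intro quotientI) simp
      then have "?r `` {(n, c)} = ?r `` {(0, \<zero>\<^bsub>A 0\<^esub>)}" using z by (simp add: zero_module_def dirlim_def)
      moreover have "((n, c), (n, c)) \<in> ?r" using c by (auto simp: dirlim_rel_def intro!: exI[of _ 0])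
      ultimately have "((0, \<zero>\<^bsub>A 0\<^esub>), (n, c)) \<in> ?r" by blast
      then obtain i j where "0 + i = n + j" "transition t 0 i \<zero>\<^bsub>A 0\<^esub> = transition t n j c" by (auto simp: dirlim_rel_def)
      then show "\<exists>j. transition t n j c = \<zero>\<^bsub>A (n + j)\<^esub>" using transition_zero[of 0 i] by auto
    qed
  next
    assume killed: "\<forall>n. \<forall>c\<in>carrier (A n). \<exists>j. transition t n j c = \<zero>\<^bsub>A (n + j)\<^esub>"
    have eventually: "\<exists>j. \<forall>i\<ge>j. transition t n i c = \<zero>\<^bsub>A (n + i)\<^esub>" if c: "c \<in> carrier (A n)" for n c
    proof -
      obtain j where "transition t n j c = \<zero>\<^bsub>A (n + j)\<^esub>" using killed c by blast
      then have "transition t n i c = \<zero>\<^bsub>A (n + i)\<^esub>" if "i \<ge> j" for i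
        using transition_add[of t n j "i - j" c] transition_zero[of "n + j" "i - j"] that by simp
      then show ?thesis by blast
    qed
    have "((n, c), (m, c')) \<in> ?r" if c: "c \<in> carrier (A n)" and c': "c' \<in> carrier (A m)" for n m c c'
    proof -
      obtain i where i: "\<And>j. j \<ge> i ==> transition t n j c = \<zero>\<^bsub>A (n + j)\<^esub>" using eventually[OF c] by blast
      obtain i' where i': "\<And>j. j \<ge> i' ==> transition t m j c' = \<zero>\<^bsub>A (m + j)\<^esub>" using eventually[OF c'] by blast
      have "transition t n (m + i + i') c = transition t m (n + i + i') c'"
        using i[of "m + i + i'"] i'[of "n + i + i'"] by (simp add: add.assoc add.left_commute)
      moreover have "n + (m + i + i') = m + (n + i + i')" by simp
      ultimately show ?thesis using c c' unfolding dirlim_rel_def by blast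
    qed
    then have "?r `` {(n, c)} = ?U" if "c \<in> carrier (A n)" for n c using that by (auto simp: dirlim_rel_def)
    then have "?U // ?r = {?r `` {(0, \<zero>\<^bsub>A 0\<^esub>)}}" using zero[of 0] by (auto simp: quotient_def)
    then show "zero_module (dirlim A t)" by (simp add: zero_module_def dirlim_def)
  }
qed

context
  fixes R :: "('a, 'r) ring_scheme" and X :: "('a, 'm, 's) module_scheme" (structure) and \<aa> :: "'a set" and k :: nat
  assumes X: "module R X" and \<aa>: "ideal \<aa> R" and ex: "\<And>n. \<exists>F. resolves R (ideal_power R \<aa> n) F"
begin

interpretation X: module R X by (rule X)

private abbreviation "F n \<equiv> free_resolution R (quot_power R \<aa> n)"
private abbreviation "proj n \<equiv> quot_proj (ring_as_module R) (ideal_power R \<aa> (Suc n)) (ideal_power R \<aa> n)"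
private abbreviation "lift \<equiv> iterated_lift (\<lambda>n. SOME \<phi>. is_chain_lift R (F (Suc n)) (F n) (proj n) \<phi>)"
private abbreviation "A n \<equiv> Ext_module R k (quot_power R \<aa> n) X"
private abbreviation "\<tau> n \<equiv> Ext_map R k (quot_power R \<aa> (Suc n)) (quot_power R \<aa> n) (proj n) X"
private abbreviation "coset n f \<equiv> coboundaries R (F n) X k +>\<^bsub>cochain_module R (F n) X k\<^esub> restrict f (chain_set R (F n) k)"
private abbreviation "cocycle n \<equiv> rel_cocycle R (F n) X (carrier X) {\<zero>} k"
private abbreviation "coboundary n \<equiv> rel_coboundary R (F n) X (carrier X) {\<zero>} k"

lemma free_resolution_tower:
  obtains e where "resolution_tower R \<aa> (\<lambda>n. with_aug (F n) (e n)) (\<lambda>m n. lift n (m - n))"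
proof -
  note R = X.is_cring and J = ideal_power_ideal[OF X.is_cring \<aa>]
  have "\<forall>n. \<exists>e. resolves R (ideal_power R \<aa> n) (with_aug (F n) e) \<and>
      (\<forall>x\<in>chain_set R (F n) 0. res_aug (F n) x = ideal_power R \<aa> n +>\<^bsub>ring_as_module R\<^esub> e x)"
    unfolding quot_power_def using free_resolution_quot_resolves[OF R J ex] by metis
  then obtain e where e: "\<And>n. resolves R (ideal_power R \<aa> n) (with_aug (F n) (e n))"
    "\<And>n x. x \<in> chain_set R (F n) 0 ==> res_aug (F n) x = ideal_power R \<aa> n +>\<^bsub>ring_as_module R\<^esub> e n x" by metis
  have "chain_lift R (with_aug (F (Suc n)) (e (Suc n))) (with_aug (F n) (e n)) (ideal_power R \<aa> n)
      (SOME \<phi>. is_chain_lift R (F (Suc n)) (F n) (proj n) \<phi>)" for n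
    by (rule quot_proj_chain_lift[OF R J J ideal_power_antimono[OF R \<aa>] e e]) simp_all
  from that[OF resolution_tower_iterated_lift[OF \<aa> e(1) this]] show ?thesis .
qed

private lemma chain_map_lift: "chain_map R (F (n + j)) (F n) (lift n j)"
proof -
  obtain e where "resolution_tower R \<aa> (\<lambda>n. with_aug (F n) (e n)) (\<lambda>m n. lift n (m - n))" by (rule free_resolution_tower)
  from chain_lift_chain_map[OF resolution_towerD(2)[OF this, of n "n + j"]] show ?thesis by simp
qed

private lemma resolves_aug_free_resolution: obtains e where "resolves R (ideal_power R \<aa> n) (with_aug (F n) e)"
  by (rule free_resolution_tower) (rule that, rule resolution_towerD(1))

lemma transition_Ext_coset:
  assumes f: "cocycle n f"
  shows "transition \<tau> n j (coset n f) = coset (n + j) (\<lambda>x. f (lift n j k x))"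
proof (induction j)
  case 0
  show ?case by simp
next
  case (Suc j)
  obtain e where e: "resolves R (ideal_power R \<aa> (n + j)) (with_aug (F (n + j)) e)" by (rule resolves_aug_free_resolution)
  obtain e' where e': "resolves R (ideal_power R \<aa> (Suc (n + j))) (with_aug (F (Suc (n + j))) e')" by (rule resolves_aug_free_resolution)
  let ?\<phi> = "SOME \<phi>. is_chain_lift R (F (Suc (n + j))) (F (n + j)) (proj (n + j)) \<phi>" and ?g = "\<lambda>x. f (lift n j k x)"
  let ?C = "chain_set R (F (n + j)) k" and ?C' = "chain_set R (F (Suc (n + j))) k"
  have \<phi>: "chain_map R (F (Suc (n + j))) (F (n + j)) ?\<phi>"
    using chain_map_lift[of "n + j" 1] by (simp add: iterated_lift.simps[abs_def])
  have g: "restrict ?g ?C \<in> cocycles R (F (n + j)) X k"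
    by (rule restrict_mem_cocycles[OF X e rel_cocycle_comp[OF f chain_map_lift]])
  have restrict: "(\<lambda>x\<in>?C'. restrict ?g ?C (?\<phi> k x)) = (\<lambda>x\<in>?C'. ?g (?\<phi> k x))"
    by (rule restrict_ext) (use linear_map_closed[OF chain_map_linear[OF \<phi>]] in simp)
  have "transition \<tau> n (Suc j) (coset n f) = \<tau> (n + j) (coset (n + j) ?g)" by (simp only: transition.simps Suc)
  also have "\<dots> = coset (Suc (n + j)) (\<lambda>x. ?g (?\<phi> k x))" unfolding Ext_map_coset[OF X e e' \<phi> g] restrict ..
  finally show ?case by (simp only: iterated_lift.simps add_Suc_right)
qed

lemma transition_Ext_coset_zero_iff:
  assumes f: "cocycle n f"
  shows "transition \<tau> n j (coset n f) = \<zero>\<^bsub>A (n + j)\<^esub> \<longleftrightarrow> coboundary (n + j) (\<lambda>x. f (lift n j k x))"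
proof -
  obtain e where e: "resolves R (ideal_power R \<aa> (n + j)) (with_aug (F (n + j)) e)" by (rule resolves_aug_free_resolution)
  let ?C = "chain_set R (F (n + j)) k" and ?g = "\<lambda>x. f (lift n j k x)"
  have "coboundary (n + j) (restrict ?g ?C) \<longleftrightarrow> coboundary (n + j) ?g" by (rule iffI; erule rel_coboundary_cong) simp_all
  then show ?thesis
    unfolding transition_Ext_coset[OF f] Ext_module_simps[OF X]
    using coboundaries_coset_eq_iff[OF X e restrict_mem_cocycles[OF X e rel_cocycle_comp[OF f chain_map_lift]]] by simp
qed

lemma Ext_module_cosets: "carrier (A n) = coset n ` {f. cocycle n f}"
proof -
  obtain e where e: "resolves R (ideal_power R \<aa> n) (with_aug (F n) e)" by (rule resolves_aug_free_resolution)
  have diff: "linear_map R (chain_mod R (F n) (Suc i)) (chain_mod R (F n) i) (res_diff (F n) i)" for i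
    using resolves_diff[OF e] by simp
  show ?thesis
  proof (intro equalityI subsetI)
    fix c assume "c \<in> carrier (A n)"
    then obtain f where f: "f \<in> cocycles R (F n) X k" "c = coboundaries R (F n) X k +>\<^bsub>cochain_module R (F n) X k\<^esub> f"
      unfolding Ext_module_simps[OF X] by blast
    have hom: "f \<in> module_homs R (chain_mod R (F n) k) X" and cocycle: "cocycle n f" using f(1) cocycles_iff[OF X diff] by auto
    have "restrict f (chain_set R (F n) k) = f" using hom by (auto simp: module_homs_def PiE_def intro: extensional_restrict)
    then show "c \<in> coset n ` {f. cocycle n f}" using cocycle f(2) by (intro image_eqI[of _ _ f]) simp_all
  next
    fix c assume "c \<in> coset n ` {f. cocycle n f}"
    then show "c \<in> carrier (A n)" unfolding Ext_module_simps[OF X] using restrict_mem_cocycles[OF X e] by blast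
  qed
qed

theorem zero_local_cohomology_iff: "zero_module (local_cohomology R \<aa> k X) \<longleftrightarrow> vanishes R \<aa> X (carrier X) {\<zero>} k"
proof -
  obtain e where tower: "resolution_tower R \<aa> (\<lambda>n. with_aug (F n) (e n)) (\<lambda>m n. lift n (m - n))" by (rule free_resolution_tower)
  note zero = rel_cocycle_zero[OF X X.carrier_is_submodule submodule_singleton_zero[OF X] resolution_towerD(1)[OF tower]]
    and zero' = rel_coboundary_zero[OF X X.carrier_is_submodule submodule_singleton_zero[OF X] resolution_towerD(1)[OF tower]]
  have coset_zero: "coset n (\<lambda>x. \<zero>) = \<zero>\<^bsub>A n\<^esub>" for n
    using transition_Ext_coset_zero_iff[of n "\<lambda>x. \<zero>" 0] zero zero' by simp
  have zero_mem: "\<zero>\<^bsub>A n\<^esub> \<in> carrier (A n)" for n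
    unfolding Ext_module_cosets by (rule image_eqI[of _ _ "\<lambda>x. \<zero>"]) (use coset_zero zero in simp_all)
  have map_zero: "\<tau> n \<zero>\<^bsub>A n\<^esub> = \<zero>\<^bsub>A (Suc n)\<^esub>" for n
    using transition_Ext_coset_zero_iff[of n "\<lambda>x. \<zero>" 1] zero zero' coset_zero by simp
  have "zero_module (local_cohomology R \<aa> k X) \<longleftrightarrow> (\<forall>n. \<forall>c\<in>carrier (A n). \<exists>j. transition \<tau> n j c = \<zero>\<^bsub>A (n + j)\<^esub>)"
    unfolding local_cohomology_def by (rule zero_module_dirlim_iff[of "\<lambda>n. A n" "\<lambda>n. \<tau> n", OF zero_mem map_zero])
  also have "\<dots> \<longleftrightarrow> (\<forall>n f. cocycle n f --> (\<exists>j. transition \<tau> n j (coset n f) = \<zero>\<^bsub>A (n + j)\<^esub>))"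
    by (simp only: Ext_module_cosets ball_simps)
  also have "\<dots> \<longleftrightarrow> (\<forall>n f. cocycle n f --> (\<exists>j. coboundary (n + j) (\<lambda>x. f (lift n j k x))))"
    by (simp only: transition_Ext_coset_zero_iff cong: imp_cong)
  also have "\<dots> \<longleftrightarrow> (\<forall>n f. cocycle n f --> (\<exists>m\<ge>n. coboundary m (\<lambda>x. f (lift n (m - n) k x))))"
  proof -
    have "(\<exists>j. P (n + j) j) \<longleftrightarrow> (\<exists>m\<ge>n. P m (m - n))" for n and P :: "nat => nat => bool"
      by (metis add_diff_cancel_left' le_add1 le_add_diff_inverse)
    from this[of "\<lambda>m j. coboundary m (\<lambda>x. _ (lift _ j k x))"] show ?thesis by (simp only:)
  qed
  also have "\<dots> \<longleftrightarrow> vanishes R \<aa> X (carrier X) {\<zero>} k"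
    unfolding vanishes_iff_tower[OF X X.carrier_is_submodule submodule_singleton_zero[OF X] \<aa> tower] by simp
  finally show ?thesis .
qed

end

lemma a_minus_carrier_update:
  assumes "module R X" "submodule N R X" "x \<in> N" "y \<in> N"
  shows "x \<ominus>\<^bsub>X\<lparr>carrier := N\<rparr>\<^esub> y = x \<ominus>\<^bsub>X\<^esub> y"
proof -
  interpret X: module R X by fact
  interpret N: module R "X\<lparr>carrier := N\<rparr>" by (rule submodule.submodule_is_module[OF assms(2,1)])
  have "\<ominus>\<^bsub>X\<^esub> y = \<ominus>\<^bsub>X\<lparr>carrier := N\<rparr>\<^esub> y"
    by (rule X.minus_equality) (use N.l_neg[of y] N.a_inv_closed[of y] assms submodule_mem_carrier[OF assms(2)] in auto)
  then show ?thesis by (simp add: a_minus_def)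
qed

lemma linear_map_carrier_update_iff:
  assumes X: "module R X" and N: "submodule N R X"
  shows "linear_map R A (X\<lparr>carrier := N\<rparr>) f \<longleftrightarrow> linear_map R A X f \<and> f ` carrier A \<subseteq> N"
  using X submodule.submodule_is_module[OF N X] submodule_mem_carrier[OF N] by (auto simp: linear_map_def)

lemma submodule_carrier_update:
  assumes "module R X" "submodule N R X" "submodule L R X" "L \<subseteq> N"
  shows "submodule L R (X\<lparr>carrier := N\<rparr>)"
  by (rule submoduleI_no_inverse[OF submodule.submodule_is_module[OF assms(2,1)]])
    (use assms submodule_zero_mem[OF assms(3)] submodule_add[OF assms(3)] submodule_smult[OF assms(3)] in auto)

lemma vanishes_carrier_update:
  assumes X: "module R X" and N: "submodule N R X" and L: "submodule L R X" and LN: "L \<subseteq> N"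
    and \<aa>: "ideal \<aa> R" and tower: "resolution_tower R \<aa> F \<phi>"
  shows "vanishes R \<aa> (X\<lparr>carrier := N\<rparr>) N L k \<longleftrightarrow> vanishes R \<aa> X N L k"
proof -
  let ?XN = "X\<lparr>carrier := N\<rparr>"
  note XN = submodule.submodule_is_module[OF N X] and F = resolution_towerD(1)[OF tower]
    and lin = linear_map_carrier_update_iff[OF X N] and \<phi> = chain_lift_linear[OF resolution_towerD(2)[OF tower]]
  have N': "submodule N R ?XN" using module.carrier_is_submodule[OF XN] by simp
  note L' = submodule_carrier_update[OF X N L LN]
  have cocycle: "rel_cocycle R (F n) ?XN N L k f \<longleftrightarrow> rel_cocycle R (F n) X N L k f" for n f
    unfolding rel_cocycle_def lin by blast
  have coboundary: "rel_coboundary R (F m) ?XN N L k f \<longleftrightarrow> rel_coboundary R (F m) X N L k f"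
    if f: "\<And>x. x \<in> chain_set R (F m) k ==> f x \<in> N" for m f
  proof (cases k)
    case 0
    then show ?thesis using f by (auto simp: rel_coboundary_0 lin)
  next
    case (Suc j)
    have minus: "f x \<ominus>\<^bsub>?XN\<^esub> g (res_diff (F m) j x) = f x \<ominus>\<^bsub>X\<^esub> g (res_diff (F m) j x)"
      if "x \<in> chain_set R (F m) (Suc j)" "\<forall>x\<in>chain_set R (F m) j. g x \<in> N" for g x
      using a_minus_carrier_update[OF X N f] linear_map_closed[OF resolves_diff[OF F]] that Suc by simp
    have minus_ball: "(\<forall>x\<in>chain_set R (F m) (Suc j). f x \<ominus>\<^bsub>?XN\<^esub> g (res_diff (F m) j x) \<in> L) \<longleftrightarrow>
        (\<forall>x\<in>chain_set R (F m) (Suc j). f x \<ominus>\<^bsub>X\<^esub> g (res_diff (F m) j x) \<in> L)"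
      if "\<forall>x\<in>chain_set R (F m) j. g x \<in> N" for g
      by (rule ball_cong[OF refl]) (simp only: minus[OF _ that])
    have "(linear_map R (chain_mod R (F m) j) ?XN g \<and> (\<forall>x\<in>chain_set R (F m) j. g x \<in> N) \<and>
          (\<forall>x\<in>chain_set R (F m) (Suc j). f x \<ominus>\<^bsub>?XN\<^esub> g (res_diff (F m) j x) \<in> L)) \<longleftrightarrow>
        (linear_map R (chain_mod R (F m) j) X g \<and> (\<forall>x\<in>chain_set R (F m) j. g x \<in> N) \<and>
          (\<forall>x\<in>chain_set R (F m) (Suc j). f x \<ominus>\<^bsub>X\<^esub> g (res_diff (F m) j x) \<in> L))" for g
      by (cases "\<forall>x\<in>chain_set R (F m) j. g x \<in> N", simp add: lin image_subset_iff minus_ball, blast)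
    moreover have "linear_map R (chain_mod R (F m) (Suc j)) ?XN f \<longleftrightarrow> linear_map R (chain_mod R (F m) (Suc j)) X f"
      unfolding lin using f Suc by blast
    ultimately show ?thesis unfolding rel_coboundary_def Suc nat.case by (simp only:)
  qed
  show ?thesis
    unfolding vanishes_iff_tower[OF XN N' L' \<aa> tower] vanishes_iff_tower[OF X N L \<aa> tower]
  proof (intro iff_allI imp_cong[OF cocycle] ex_cong1 conj_cong[OF refl])
    fix n f m assume f: "rel_cocycle R (F n) X N L k f" and m: "n \<le> m"
    show "rel_coboundary R (F m) ?XN N L k (\<lambda>x. f (\<phi> m n k x)) \<longleftrightarrow> rel_coboundary R (F m) X N L k (\<lambda>x. f (\<phi> m n k x))"
      by (rule coboundary) (rule rel_cocycle_mem[OF f linear_map_closed[OF \<phi>[OF m]]])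
  qed
qed

context
  fixes R :: "('a, 'r) ring_scheme" and X :: "('a, 'm, 's) module_scheme" and Y :: "('a, 'n, 't) module_scheme" (structure)
    and \<pi> :: "'m => 'n" and L :: "'m set"
  assumes \<pi>: "linear_map R X Y \<pi>" and surj: "carrier Y \<subseteq> \<pi> ` carrier X" and ker: "\<And>x. x \<in> carrier X ==> \<pi> x = \<zero> \<longleftrightarrow> x \<in> L"
begin

private lemmas X = linear_map_module(1)[OF \<pi>] and Y = linear_map_module(2)[OF \<pi>]

lemma linear_map_lift_surj:
  assumes f: "linear_map R (free_module R n) Y f"
  obtains g where "linear_map R (free_module R n) X g" "\<And>x. x \<in> carrier (free_module R n) ==> f x = \<pi> (g x)"
  by (rule linear_map_lift[OF \<pi> f _ that]) (use linear_map_closed[OF f] surj in blast)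

lemma rel_coboundary_reflect:
  assumes F: "resolves R J F" and f: "linear_map R (chain_mod R F k) X f"
    and \<pi>f: "rel_coboundary R F Y (carrier Y) {\<zero>} k (\<lambda>x. \<pi> (f x))"
  shows "rel_coboundary R F X (carrier X) L k f"
proof (cases k)
  case 0
  then show ?thesis using f \<pi>f ker linear_map_closed[OF f] by (simp add: rel_coboundary_0)
next
  case (Suc j)
  obtain h where h: "linear_map R (chain_mod R F j) Y h"
    "\<And>x. x \<in> chain_set R F (Suc j) ==> \<pi> (f x) \<ominus> h (res_diff F j x) \<in> {\<zero>}"
    using rel_coboundary_SucE[OF \<pi>f[unfolded Suc]] by blast
  obtain g where g: "linear_map R (chain_mod R F j) X g" "\<And>x. x \<in> chain_set R F j ==> h x = \<pi> (g x)"
    using linear_map_lift_surj[OF h(1)] by blast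
  show ?thesis unfolding Suc
  proof (rule rel_coboundary_SucI[OF f[unfolded Suc] g(1) linear_map_closed[OF g(1)]])
    fix x assume x: "x \<in> chain_set R F (Suc j)"
    note dx = linear_map_closed[OF resolves_diff[OF F] x] and fx = linear_map_closed[OF f[unfolded Suc] x]
    have "\<pi> (f x \<ominus>\<^bsub>X\<^esub> g (res_diff F j x)) = \<zero>"
      using linear_map_minus[OF \<pi> fx linear_map_closed[OF g(1) dx]] h(2)[OF x] g(2)[OF dx] by simp
    then show "f x \<ominus>\<^bsub>X\<^esub> g (res_diff F j x) \<in> L"
      using ker[OF submodule_minus[OF module.carrier_is_submodule[OF X] fx linear_map_closed[OF g(1) dx]]] by blast
  qed
qed

lemma vanishes_surj:
  assumes L: "submodule L R X" and \<aa>: "ideal \<aa> R" and tower: "resolution_tower R \<aa> F \<phi>"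
  shows "vanishes R \<aa> Y (carrier Y) {\<zero>} k \<longleftrightarrow> vanishes R \<aa> X (carrier X) L k"
proof -
  note F = resolution_towerD(1)[OF tower] and \<phi> = chain_lift_linear[OF resolution_towerD(2)[OF tower]]
  have image: "\<pi> ` carrier X \<subseteq> carrier Y" "\<pi> ` L \<subseteq> {\<zero>}" using linear_map_closed[OF \<pi>] ker submodule_mem_carrier[OF L] by auto
  show ?thesis
    unfolding vanishes_iff_tower[OF Y module.carrier_is_submodule[OF Y] submodule_singleton_zero[OF Y] \<aa> tower]
      vanishes_iff_tower[OF X module.carrier_is_submodule[OF X] L \<aa> tower]
  proof (intro iffI allI impI)
    fix n f
    assume vanish: "\<forall>n f. rel_cocycle R (F n) Y (carrier Y) {\<zero>} k f --> (\<exists>m\<ge>n. rel_coboundary R (F m) Y (carrier Y) {\<zero>} k (\<lambda>x. f (\<phi> m n k x)))"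
      and f: "rel_cocycle R (F n) X (carrier X) L k f"
    obtain m where m: "m \<ge> n" "rel_coboundary R (F m) Y (carrier Y) {\<zero>} k (\<lambda>x. \<pi> (f (\<phi> m n k x)))"
      using vanish rel_cocycle_map[OF f \<pi> image] by blast
    show "\<exists>m\<ge>n. rel_coboundary R (F m) X (carrier X) L k (\<lambda>x. f (\<phi> m n k x))"
      using m(1) rel_coboundary_reflect[OF F linear_map_comp[OF \<phi>[OF m(1)] rel_cocycle_linear[OF f]] m(2)] by blast
  next
    fix n f
    assume vanish: "\<forall>n f. rel_cocycle R (F n) X (carrier X) L k f --> (\<exists>m\<ge>n. rel_coboundary R (F m) X (carrier X) L k (\<lambda>x. f (\<phi> m n k x)))"
      and f: "rel_cocycle R (F n) Y (carrier Y) {\<zero>} k f"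
    obtain g where g: "linear_map R (chain_mod R (F n) k) X g" "\<And>x. x \<in> chain_set R (F n) k ==> f x = \<pi> (g x)"
      using linear_map_lift_surj[OF rel_cocycle_linear[OF f]] by blast
    have "g (res_diff (F n) k x) \<in> L" if x: "x \<in> chain_set R (F n) (Suc k)" for x
    proof -
      note dx = linear_map_closed[OF resolves_diff[OF F] x]
      have "\<pi> (g (res_diff (F n) k x)) = \<zero>" using rel_cocycle_diff[OF f x] g(2)[OF dx] by simp
      then show ?thesis using ker[OF linear_map_closed[OF g(1) dx]] by blast
    qed
    then have "rel_cocycle R (F n) X (carrier X) L k g" using g(1) linear_map_closed[OF g(1)] by (simp add: rel_cocycle_def)
    then obtain m where m: "m \<ge> n" "rel_coboundary R (F m) X (carrier X) L k (\<lambda>x. g (\<phi> m n k x))" using vanish by blast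
    have "rel_coboundary R (F m) Y (carrier Y) {\<zero>} k (\<lambda>x. f (\<phi> m n k x))"
      by (rule rel_coboundary_cong[OF rel_coboundary_map[OF m(2) F \<pi> image]]) (rule g(2)[OF linear_map_closed[OF \<phi>[OF m(1)]], symmetric])
    then show "\<exists>m\<ge>n. rel_coboundary R (F m) Y (carrier Y) {\<zero>} k (\<lambda>x. f (\<phi> m n k x))" using m(1) by blast
  qed
qed

end

context
  fixes R :: "('a, 'r) ring_scheme" and X :: "('a, 'm, 's) module_scheme" and \<aa> :: "'a set" and N :: "'m set"
  assumes X: "module R X" and \<aa>: "ideal \<aa> R" and ex: "\<And>n. \<exists>F. resolves R (ideal_power R \<aa> n) F" and N: "submodule N R X"
begin

private lemmas sub_module = submodule.submodule_is_module[OF N X]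

private lemma tower: obtains F \<phi> where "resolution_tower R \<aa> F \<phi>"
  by (rule resolution_tower_exists[OF module.axioms(1)[OF X] \<aa> ex])

lemma zero_local_cohomology_sub:
  "zero_module (local_cohomology R \<aa> k (X\<lparr>carrier := N\<rparr>)) \<longleftrightarrow> vanishes R \<aa> X N {\<zero>\<^bsub>X\<^esub>} k"
proof -
  obtain F \<phi> where F: "resolution_tower R \<aa> F \<phi>" by (rule tower)
  show ?thesis
    unfolding zero_local_cohomology_iff[OF sub_module \<aa> ex]
    using vanishes_carrier_update[OF X N submodule_singleton_zero[OF X] _ \<aa> F] submodule_zero_mem[OF N] by simp
qed

lemma zero_local_cohomology_quot:
  assumes L: "submodule L R X" and LN: "L \<subseteq> N"
  shows "zero_module (local_cohomology R \<aa> k (quot_module R (X\<lparr>carrier := N\<rparr>) L)) \<longleftrightarrow> vanishes R \<aa> X N L k"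
proof -
  obtain F \<phi> where F: "resolution_tower R \<aa> F \<phi>" by (rule tower)
  let ?XN = "X\<lparr>carrier := N\<rparr>"
  note L' = submodule_carrier_update[OF X N L LN]
  have "vanishes R \<aa> (quot_module R ?XN L) (carrier (quot_module R ?XN L)) {\<zero>\<^bsub>quot_module R ?XN L\<^esub>} k \<longleftrightarrow> vanishes R \<aa> ?XN (carrier ?XN) L k"
    by (rule vanishes_surj[OF linear_map_a_coset[OF sub_module L'] _ _ L' \<aa> F])
      (auto simp: quot_module_simps a_rcosets_iff a_coset_eq_self_iff[OF sub_module L'])
  then show ?thesis
    unfolding zero_local_cohomology_iff[OF module_quot_module[OF sub_module L'] \<aa> ex]
    using vanishes_carrier_update[OF X N L LN \<aa> F] by simp
qed

end

subsection \<open>The filtration of the completion\<close>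

lemma fin_gen_quot_module:
  assumes fg: "fin_gen_module R X" and T: "submodule T R X"
  shows "fin_gen_module R (quot_module R X T)"
proof -
  note X = fin_gen_moduleD[OF fg]
  note proj = linear_map_a_coset[OF X T]
  obtain k g where kg: "generates R X (carrier X) k g" using fg fin_gen_module_iff[OF X] by blast
  then have g: "\<And>i. i < k ==> g i \<in> carrier X" by (simp add: generates_def)
  have "y \<in> lincombs R (quot_module R X T) (\<lambda>i. T +>\<^bsub>X\<^esub> g i) k" if y: "y \<in> carrier (quot_module R X T)" for y
  proof -
    obtain x where x: "x \<in> carrier X" "y = T +>\<^bsub>X\<^esub> x" using y by (auto simp: quot_module_simps a_rcosets_iff)
    obtain c where c: "\<And>i. i < k ==> c i \<in> carrier R" "x = lincomb X g c k" using generatesE[OF kg x(1)] by blast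
    have "y = lincomb (quot_module R X T) (\<lambda>i. T +>\<^bsub>X\<^esub> g i) c k"
      unfolding x(2) c(2) by (rule linear_map_image_lincomb[OF proj g c(1)])
    then show ?thesis using c(1) unfolding lincombs_def by blast
  qed
  then have "generates R (quot_module R X T) (carrier (quot_module R X T)) k (\<lambda>i. T +>\<^bsub>X\<^esub> g i)"
    unfolding generates_def using linear_map_closed[OF proj g] by blast
  then show ?thesis using fin_gen_module_iff[OF module_quot_module[OF X T]] by blast
qed

lemma fin_gen_module_carrier_update:
  assumes X: "module R X" and N: "submodule N R X" and g: "generates R X N k g"
  shows "fin_gen_module R (X\<lparr>carrier := N\<rparr>)"
proof -
  have "lincomb (X\<lparr>carrier := N\<rparr>) g c m = lincomb X g c m" for c m by (induction m) simp_all
  then have "generates R (X\<lparr>carrier := N\<rparr>) N k g" using g by (simp add: generates_def lincombs_def)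
  then show ?thesis using fin_gen_module_iff[OF submodule.submodule_is_module[OF N X]] by auto
qed

lemma zero_quot_module_iff:
  assumes X: "module R X" and T: "submodule T R X"
  shows "zero_module (quot_module R X T) \<longleftrightarrow> carrier X = T"
proof -
  have "zero_module (quot_module R X T) \<longleftrightarrow> (\<forall>x\<in>carrier X. T +>\<^bsub>X\<^esub> x = T)"
  proof
    assume "zero_module (quot_module R X T)"
    then show "\<forall>x\<in>carrier X. T +>\<^bsub>X\<^esub> x = T" using a_rcosets_iff[of _ X T] by (auto simp: zero_module_def quot_module_simps)
  next
    assume eq: "\<forall>x\<in>carrier X. T +>\<^bsub>X\<^esub> x = T"
    have "T \<in> a_rcosets\<^bsub>X\<^esub> T"
      unfolding a_rcosets_iff using eq submodule_mem_carrier[OF T submodule_zero_mem[OF T]] by blast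
    then show "zero_module (quot_module R X T)" using eq by (auto simp: zero_module_def quot_module_simps a_rcosets_iff)
  qed
  then show ?thesis using a_coset_eq_self_iff[OF X T] submodule_mem_carrier[OF T] by blast
qed

lemma zero_subquotient_iff:
  assumes "module R X" "submodule N R X" "submodule L R X" "L \<subseteq> N"
  shows "zero_module (quot_module R (X\<lparr>carrier := N\<rparr>) L) \<longleftrightarrow> N = L"
  using zero_quot_module_iff[OF submodule.submodule_is_module[OF assms(2,1)] submodule_carrier_update[OF assms]] by simp

lemma cd_le_iff: "cd R \<aa> M \<le> ereal (real i) \<longleftrightarrow> (\<forall>k>i. zero_module (local_cohomology R \<aa> k M))"
  unfolding cd_def by (auto simp: SUP_le_iff) (meson leI)

lemma cd_cong:
  assumes "\<And>k. zero_module (local_cohomology R \<aa> k M) \<longleftrightarrow> zero_module (local_cohomology R' \<aa>' k M')"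
  shows "cd R \<aa> M = cd R' \<aa>' M'"
  using assms by (simp add: cd_def)

lemma zero_local_cohomology_bounded_imp_cd_attained:
  assumes "ereal (real i) \<le> cd R \<aa> M" and zero: "\<And>k. k > r ==> zero_module (local_cohomology R \<aa> k M)"
  obtains c where "cd R \<aa> M = ereal (real c)"
proof -
  let ?A = "{k. \<not> zero_module (local_cohomology R \<aa> k M)}"
  have fin: "finite ?A" using zero by (intro finite_subset[of ?A "{..r}"]) (auto simp: not_le[symmetric])
  have ne: "?A \<noteq> {}"
  proof
    assume "?A = {}"
    then have "cd R \<aa> M = -\<infinity>" unfolding cd_def by (simp only: image_empty Sup_empty bot_ereal_def)
    then show False using assms(1) by simp
  qed
  have "cd R \<aa> M = ereal (real (Max ?A))"
    unfolding cd_def by (rule antisym[OF SUP_least SUP_upper[OF Max_in[OF fin ne]]]) (simp add: Max_ge[OF fin])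
  then show ?thesis by (rule that)
qed

lemma relative_CM_degree:
  assumes "relative_CM R \<aa> N" "cd R \<aa> N = ereal (real i)" "k \<noteq> i"
  shows "zero_module (local_cohomology R \<aa> k N)"
proof -
  obtain j where j: "{i. \<not> zero_module (local_cohomology R \<aa> i N)} = {j}"
    using assms(1) unfolding relative_CM_def by blast
  then have "i = j" using assms(2) by (simp add: cd_def)
  then show ?thesis using j assms(3) by blast
qed

context adic
begin

abbreviation "\<bb> \<equiv> extended_ideal R \<aa>"

lemma resolution_exists_power: "\<exists>F. resolves R (J n) F"
  using resolution_exists[OF R NR ideal_J] by blast

lemma resolution_exists_extended_power: "\<exists>F. resolves S (ideal_power S \<bb> n) F"
  unfolding extended_ideal_power using resolution_exists[OF R NR ideal_J] resolves_completed_res by metis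

context
  fixes M :: "('a, 'm, 's) module_scheme"
  assumes fg: "fin_gen_module R M"
begin

private lemmas M_module = fin_gen_moduleD[OF fg]
private lemmas Mhat_module = module_completion[OF M_module]

lemma zero_local_cohomology_quot_adic_closure:
  assumes N: "submodule N R M" and L: "submodule L R M" and LN: "L \<subseteq> N"
  shows "zero_module (local_cohomology S \<bb> k (quot_module S ((Mhat M)\<lparr>carrier := adic_closure M N\<rparr>) (adic_closure M L))) \<longleftrightarrow>
    zero_module (local_cohomology R \<aa> k (quot_module R (M\<lparr>carrier := N\<rparr>) L))"
  unfolding zero_local_cohomology_quot[OF Mhat_module ideal_extended_ideal resolution_exists_extended_power
      submodule_adic_closure[OF M_module N] submodule_adic_closure[OF M_module L] adic_closure_mono[OF LN]]
    zero_local_cohomology_quot[OF M_module \<aa> resolution_exists_power N L LN]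
    vanishes_base_change[OF Mhat_module submodule_adic_closure[OF M_module N] submodule_adic_closure[OF M_module L]]
  by (rule vanishes_completion[OF fg N L LN, symmetric])

lemma cd_adic_closure:
  assumes N: "submodule N R M"
  shows "cd S \<bb> ((Mhat M)\<lparr>carrier := adic_closure M N\<rparr>) = cd R \<aa> (M\<lparr>carrier := N\<rparr>)"
proof (rule cd_cong)
  fix k
  note zero = submodule_singleton_zero[OF M_module] and zeroN = submodule_zero_mem[OF N]
  show "zero_module (local_cohomology S \<bb> k ((Mhat M)\<lparr>carrier := adic_closure M N\<rparr>)) \<longleftrightarrow>
      zero_module (local_cohomology R \<aa> k (M\<lparr>carrier := N\<rparr>))"
    unfolding zero_local_cohomology_sub[OF Mhat_module ideal_extended_ideal resolution_exists_extended_power submodule_adic_closure[OF M_module N]]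
      zero_local_cohomology_sub[OF M_module \<aa> resolution_exists_power N] adic_closure_zero[OF M_module, symmetric]
      vanishes_base_change[OF Mhat_module submodule_adic_closure[OF M_module N] submodule_adic_closure[OF M_module zero]]
    by (rule vanishes_completion[OF fg N zero, symmetric]) (use zeroN in simp)
qed

lemma cd_completion: "cd S \<bb> (Mhat M) = cd R \<aa> M"
  using cd_adic_closure[OF module.carrier_is_submodule[OF M_module]] by (simp add: adic_closure_carrier[OF M_module])

lemma fin_gen_adic_closure:
  assumes N: "submodule N R M"
  shows "fin_gen_module S ((Mhat M)\<lparr>carrier := adic_closure M N\<rparr>)"
proof -
  obtain k g where "generates R M N k g"
    using fin_gen_noetherian_module[OF R NR fg] N unfolding noetherian_module_def by blast
  from fin_gen_module_carrier_update[OF Mhat_module submodule_adic_closure[OF M_module N] adic_closure_generated[OF M_module fg N this]]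
  show ?thesis .
qed

lemma fin_gen_completion: "fin_gen_module S (Mhat M)"
  using fin_gen_adic_closure[OF module.carrier_is_submodule[OF M_module]] by (simp add: adic_closure_carrier[OF M_module])

lemma cd_attained:
  assumes "ereal (real i) \<le> cd R \<aa> M"
  obtains c where "cd R \<aa> M = ereal (real c)"
proof -
  obtain A where A: "finite A" "A \<subseteq> carrier R" "\<aa> = Idl\<^bsub>R\<^esub> A" using NR \<aa> by (auto simp: noetherian_ring_def noetherian_ring_axioms_def)
  note lifts = bounded_lifts_genideal[OF R NR A(1,2), folded A(3)]
  have "zero_module (local_cohomology R \<aa> k M)" if "k > card A" for k
    unfolding zero_local_cohomology_iff[OF M_module \<aa> resolution_exists_power]
    by (rule vanishes_above_lift_bound[OF NR \<aa> lifts M_module module.carrier_is_submodule[OF M_module] submodule_singleton_zero[OF M_module] that])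
  from zero_local_cohomology_bounded_imp_cd_attained[OF assms this] show ?thesis using that by blast
qed

context
  fixes F :: "nat => 'm set"
  assumes F: "is_cd_filtration R \<aa> M F"
    and subquotients: "\<And>i. i \<ge> 1 ==> ereal (real i) \<le> cd R \<aa> M ==>
      zero_module (quot_module R (M\<lparr>carrier := F i\<rparr>) (F (i - 1))) \<or>
      relative_CM R \<aa> (quot_module R (M\<lparr>carrier := F i\<rparr>) (F (i - 1))) \<and>
        cd R \<aa> (quot_module R (M\<lparr>carrier := F i\<rparr>) (F (i - 1))) = ereal (real i)"
begin

private lemma filtration:
  assumes "ereal (real i) \<le> cd R \<aa> M"
  shows "submodule (F i) R M" "cd R \<aa> (M\<lparr>carrier := F i\<rparr>) \<le> ereal (real i)"
    "\<And>N. submodule N R M ==> cd R \<aa> (M\<lparr>carrier := N\<rparr>) \<le> ereal (real i) ==> N \<subseteq> F i"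
  using F assms by (auto simp: is_cd_filtration_def)

private lemma filtration_pred:
  assumes "ereal (real i) \<le> cd R \<aa> M"
  shows "submodule (F (i - 1)) R M" "F (i - 1) \<subseteq> F i"
proof -
  have pred: "ereal (real (i - 1)) \<le> ereal (real i)" by simp
  then have pred_cd: "ereal (real (i - 1)) \<le> cd R \<aa> M" using assms by (rule order_trans)
  show sub: "submodule (F (i - 1)) R M" by (rule filtration(1)[OF pred_cd])
  show "F (i - 1) \<subseteq> F i" by (rule filtration(3)[OF assms sub order_trans[OF filtration(2)[OF pred_cd] pred]])
qed

private lemma filtration_subquotient:
  assumes i: "i \<ge> 1" "ereal (real i) \<le> cd R \<aa> M" and "F i \<noteq> F (i - 1)"
  shows "relative_CM R \<aa> (quot_module R (M\<lparr>carrier := F i\<rparr>) (F (i - 1)))"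
    "cd R \<aa> (quot_module R (M\<lparr>carrier := F i\<rparr>) (F (i - 1))) = ereal (real i)"
  using subquotients[OF i] zero_subquotient_iff[OF M_module filtration(1)[OF i(2)] filtration_pred[OF i(2)]] assms(3) by auto

text \<open>A submodule \<open>N\<close> of \<open>adic_closure M (F j)\<close> with \<open>cd(N) < j\<close> maps to zero in the separated module
  \<open>adic_closure M (F j) / adic_closure M (F (j - 1))\<close>, whose local cohomology is concentrated in degree \<open>j\<close>.\<close>

lemma subset_adic_closure_pred:
  assumes j: "ereal (real j) \<le> cd R \<aa> M" "i < j" and N: "submodule N S (Mhat M)"
    and above: "\<And>k. k > i ==> vanishes R \<aa> (rs (Mhat M)) N {\<zero>\<^bsub>Mhat M\<^esub>} k" and subset: "N \<subseteq> adic_closure M (F j)"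
  shows "N \<subseteq> adic_closure M (F (j - 1))"
proof (cases "F j = F (j - 1)")
  case True
  then show ?thesis using subset by simp
next
  case False
  have j1: "j \<ge> 1" using j(2) by simp
  let ?X = "rs (Mhat M)" and ?C = "adic_closure M (F j)" and ?C' = "adic_closure M (F (j - 1))"
  note Fj = filtration(1)[OF j(1)] and pred = filtration_pred[OF j(1)]
  note rs_closure = submodule_rs[OF Mhat_module submodule_adic_closure[OF M_module]]
  have below: "vanishes R \<aa> ?X ?C ?C' k" if "k \<le> i" for k
    using relative_CM_degree[OF filtration_subquotient[OF j1 j(1) False], of k] that j(2)
    unfolding zero_local_cohomology_quot[OF M_module \<aa> resolution_exists_power Fj pred] vanishes_completion[OF fg Fj pred]
    by simp
  have approx: "N \<subseteq> smult_span ?X (J n) ?C <+>\<^bsub>?X\<^esub> ?C'" for n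
    by (rule vanishes_imp_subset_smult_span_add[OF NR \<aa> module_rs[OF Mhat_module] submodule_rs[OF Mhat_module N]
          rs_closure[OF Fj] rs_closure[OF pred(1)] subset]) (use above below in auto)
  show ?thesis
  proof
    fix y assume y: "y \<in> N"
    show "y \<in> ?C'"
    proof (rule mem_adic_closure_if_approx[OF M_module pred(1) submodule_mem_carrier[OF N y]])
      fix n
      have "smult_span ?X (J n) ?C <+>\<^bsub>?X\<^esub> ?C' \<subseteq> smult_span ?X (J n) (carrier (Mhat M)) <+>\<^bsub>?X\<^esub> ?C'"
        by (rule set_add_mono[OF smult_span_mono[OF subset_refl] subset_refl]) (use adic_closure_closed in blast)
      from subsetD[OF this subsetD[OF approx y]]
      show "y \<in> smult_span ?X (J n) (carrier (Mhat M)) <+>\<^bsub>Mhat M\<^esub> ?C'" by (simp add: set_add_iff)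
    qed
  qed
qed

lemma subset_adic_closure_filtration:
  assumes i: "ereal (real i) \<le> cd R \<aa> M" and N: "submodule N S (Mhat M)"
    and N_cd: "cd S \<bb> ((Mhat M)\<lparr>carrier := N\<rparr>) \<le> ereal (real i)"
  shows "N \<subseteq> adic_closure M (F i)"
proof -
  obtain c where c: "cd R \<aa> M = ereal (real c)" using cd_attained[OF i] .
  have above: "vanishes R \<aa> (rs (Mhat M)) N {\<zero>\<^bsub>Mhat M\<^esub>} k" if "k > i" for k
    using N_cd that zero_local_cohomology_sub[OF Mhat_module ideal_extended_ideal resolution_exists_extended_power N]
      vanishes_base_change[OF Mhat_module N submodule_singleton_zero[OF Mhat_module]] unfolding cd_le_iff by blast
  have "i \<le> c" using i c by simp
  then show ?thesis
  proof (induction rule: inc_induct)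
    case base
    have "carrier M \<subseteq> F c"
      by (rule filtration(3)) (use c module.carrier_is_submodule[OF M_module] in auto)
    from adic_closure_mono[OF this, of M] show ?case
      using submodule_mem_carrier[OF N] unfolding adic_closure_carrier[OF M_module] by blast
  next
    case (step j)
    then have j: "ereal (real (Suc j)) \<le> cd R \<aa> M" "i < Suc j" using c by simp_all
    from subset_adic_closure_pred[OF j N above step.IH] show ?case by simp
  qed
qed

lemma is_cd_filtration_adic_closure: "is_cd_filtration S \<bb> (Mhat M) (\<lambda>i. adic_closure M (F i))"
  unfolding is_cd_filtration_def cd_completion
  using submodule_adic_closure[OF M_module filtration(1)] cd_adic_closure[OF filtration(1)] filtration(2) subset_adic_closure_filtration
  by auto

lemma adic_closure_subquotient:
  assumes i: "i \<ge> 1" "ereal (real i) \<le> cd R \<aa> M"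
  defines "Q \<equiv> quot_module S ((Mhat M)\<lparr>carrier := adic_closure M (F i)\<rparr>) (adic_closure M (F (i - 1)))"
  shows "zero_module Q \<or> relative_CM S \<bb> Q \<and> cd S \<bb> Q = ereal (real i)"
proof (cases "F i = F (i - 1)")
  note Fi = filtration(1)[OF i(2)] and pred = filtration_pred[OF i(2)]
  note C = submodule_adic_closure[OF M_module Fi] submodule_adic_closure[OF M_module pred(1)] adic_closure_mono[OF pred(2)]
  {
    case True
    then show ?thesis unfolding Q_def using zero_subquotient_iff[OF Mhat_module C] by simp
  next
    case False
    note rel_CM = filtration_subquotient[OF i False]
    note zero_iff = zero_local_cohomology_quot_adic_closure[OF Fi pred, folded Q_def]
    have "fin_gen_module S Q"
      unfolding Q_def by (rule fin_gen_quot_module[OF fin_gen_adic_closure[OF Fi] submodule_carrier_update[OF Mhat_module C]])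
    then have "relative_CM S \<bb> Q" using rel_CM(1) unfolding relative_CM_def zero_iff by blast
    then show ?thesis using rel_CM(2) cd_cong[OF zero_iff] by simp
  }
qed

lemma rcmf_completion: "rcmf S \<bb> (Mhat M)"
  unfolding rcmf_def Let_def
  using fin_gen_completion is_cd_filtration_adic_closure adic_closure_subquotient unfolding cd_completion[symmetric] by blast

end

end

end

theorem proposition2p26:
  fixes R :: "('a, 'r) ring_scheme"
    and \<aa> :: "'a set"
    and M :: "('a, 'm, 's) module_scheme"
  assumes "cring R"
    and "noetherian_ring R"
    and "ideal \<aa> R"
    and "\<aa> \<noteq> carrier R"
    and "rcmf R \<aa> M"
  shows "rcmf (completion_ring R \<aa>) (extended_ideal R \<aa>) (completion_module R \<aa> M)"
proof -
  interpret adic R \<aa> by (rule adic.intro) (rule assms)+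
  have "fin_gen_module R M" using assms(5) by (simp add: rcmf_def)
  moreover obtain F where "is_cd_filtration R \<aa> M F" "\<And>i. i \<ge> 1 ==> ereal (real i) \<le> cd R \<aa> M ==>
      zero_module (quot_module R (M\<lparr>carrier := F i\<rparr>) (F (i - 1))) \<or>
      relative_CM R \<aa> (quot_module R (M\<lparr>carrier := F i\<rparr>) (F (i - 1))) \<and>
        cd R \<aa> (quot_module R (M\<lparr>carrier := F i\<rparr>) (F (i - 1))) = ereal (real i)"
    using assms(5) unfolding rcmf_def Let_def by blast
  ultimately show ?thesis by (rule rcmf_completion)
qed

end
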